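(* Let $p$ be a prime and let $\mathcal{F}$ be a saturated fusion system on a finite $p$-group $P$. If $\mathcal{E}$ is a weakly normal subsystem of $\mathcal{F}$, on a subgroup $T$ of $P$, then there exist a normal subsystem $\mathcal{E}'$ of $\mathcal{F}$, also on $T$, and a $p'$-subgroup $H$ of $\mathrm{Aut}_{\mathcal{F}}(T)$ such that $\mathcal{E}$ is generated by $\mathcal{E}'$ and $H$.
   Context: Maps are written on the right and composed from left to right. A fusion system $\mathcal{F}$ on a finite $p$-group $P$ is a category whose objects are the subgroups of $P$ and whose morphism sets $\mathrm{Hom}_{\mathcal{F}}(Q,R)$ consist of injective group homomorphisms $Q\to R$, composed as maps, containing every conjugation map $c_g:x\mapsto g^{-1}xg$ with $g\in P$, $Q^g\le R$, and such that for each morphism $\phi:Q\to R$ in $\mathcal F$ the isomorphism $Q\to Q\phi$ and its inverse lie in $\mathcal{F}$. A subgroup $Q$ is fully $\mathcal F$-automized if $\mathrm{Aut}_P(Q)$ (the automorphisms of $Q$ induced by conjugation by elements of $N_P(Q)$) is a Sylow $p$-subgroup of $\mathrm{Aut}_{\mathcal{F}}(Q)$; $R$ is receptive if every isomorphism $\phi:S\to R$ in $\mathcal F$ extends to a morphism $N_\phi\to P$ in $\mathcal F$, where $N_\phi$ is the preimage in $N_P(S)$ of $\mathrm{Aut}_P(S)\cap \mathrm{Aut}_P(R)^{\phi^{-1}}$. $\mathcal{F}$ is saturated if every $\mathcal{F}$-conjugacy class of subgroups contains a fully automized, receptive member. A subsystem of $\mathcal F$ on $T\le P$ is a fusion system on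 $T$ all of whose morphisms lie in $\mathcal F$. The subsystem on $T$ generated by a collection of morphisms between subgroups of $T$ is the smallest fusion system on $T$ containing them. A subgroup $T\le P$ is strongly $\mathcal{F}$-closed if $Q\phi\le T$ for every $Q\le T$ and every morphism $\phi:Q\to P$ in $\mathcal{F}$. A subsystem $\mathcal{E}$ of $\mathcal{F}$ on a strongly $\mathcal{F}$-closed subgroup $T$ is $\mathcal{F}$-invariant if, whenever $Q\le R\le T$, $\phi:Q\to R$ is a morphism in $\mathcal{E}$ and $\psi:R\to T$ is a morphism in $\mathcal{F}$, the map $\psi^{-1}\phi\psi:Q\psi\to R\psi$ is in $\mathcal{E}$. $\mathcal{E}$ is weakly normal in $\mathcal{F}$ if it is saturated and $\mathcal{F}$-invariant. $\mathcal{E}$ is normal in $\mathcal{F}$ if it is weakly normal and, in addition, every $\phi\in\mathrm{Aut}_{\mathcal{E}}(T)$ extends to some $\bar\phi\in\mathrm{Aut}_{\mathcal{F}}(TC_P(T))$ with $[\bar\phi,C_P(T)]\le Z(T)$, where $[\bar\phi,C_P(T)]$ is generated by the elements $x^{-1}(x\bar\phi)$, $x\in C_P(T)$. *)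

theory Defs
  imports
    "HOL-Algebra.Group_Action"
    "HOL-Algebra.Generated_Groups"
    "HOL-Computational_Algebra.Primes"
begin

text \<open>
  All subgroups live in one ambient group \<open>G\<close>. A morphism with domain \<open>Q\<close> is a function that is
  \<^const>\<open>extensional\<close> on \<open>Q\<close>, so that equal morphisms are equal functions, and a family of
  morphisms is given by its Hom-sets: \<open>F Q R\<close> is the set of morphisms from \<open>Q\<close> to \<open>R\<close>. Maps are
  written on the left here; the convention \<open>x\<^sup>g = g\<^sup>-\<^sup>1 x g\<close> is kept.
\<close>

type_synonym 'a homs = "'a set \<Rightarrow> 'a set \<Rightarrow> ('a \<Rightarrow> 'a) set"

definition subgroup_of :: "('a, 'b) monoid_scheme \<Rightarrow> 'a set \<Rightarrow> 'a set \<Rightarrow> bool" where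
  "subgroup_of G S Q \<longleftrightarrow> subgroup Q G \<and> Q \<subseteq> S"

definition conj_map :: "('a, 'b) monoid_scheme \<Rightarrow> 'a set \<Rightarrow> 'a \<Rightarrow> 'a \<Rightarrow> 'a" where
  "conj_map G Q g = (\<lambda>x\<in>Q. inv\<^bsub>G\<^esub> g \<otimes>\<^bsub>G\<^esub> x \<otimes>\<^bsub>G\<^esub> g)"

text \<open>
  The first condition says that the objects are exactly the subgroups of \<open>S\<close>; it makes the Hom-sets
  empty elsewhere, so that two fusion systems on \<open>S\<close> with the same morphisms are equal. Identities
  and inclusions are the conjugation maps by \<open>\<one>\<close>.
\<close>

definition fusion_system :: "('a, 'b) monoid_scheme \<Rightarrow> 'a set \<Rightarrow> 'a homs \<Rightarrow> bool" where
  "fusion_system G S F \<longleftrightarrow>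
     subgroup S G \<and>
     (\<forall>Q R. F Q R \<noteq> {} \<longrightarrow> subgroup_of G S Q \<and> subgroup_of G S R) \<and>
     (\<forall>Q R. F Q R \<subseteq> mon (G\<lparr>carrier := Q\<rparr>) (G\<lparr>carrier := R\<rparr>) \<inter> extensional Q) \<and>
     (\<forall>Q R U. \<forall>\<phi>\<in>F Q R. \<forall>\<psi>\<in>F R U. compose Q \<psi> \<phi> \<in> F Q U) \<and>
     (\<forall>Q R. \<forall>g\<in>S. subgroup_of G S Q \<and> subgroup_of G S R \<and> conj_map G Q g ` Q \<subseteq> R
        \<longrightarrow> conj_map G Q g \<in> F Q R) \<and>
     (\<forall>Q R. \<forall>\<phi>\<in>F Q R.
        \<phi> \<in> F Q (\<phi> ` Q) \<and> restrict (inv_into Q \<phi>) (\<phi> ` Q) \<in> F (\<phi> ` Q) Q)"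

text \<open>
  The multiplication of \<^const>\<open>BijGroup\<close> composes from right to left. The group obtained by composing
  from left to right is its opposite, which has the same subgroups.
\<close>

definition Aut_homs :: "'a homs \<Rightarrow> 'a set \<Rightarrow> ('a \<Rightarrow> 'a) monoid" where
  "Aut_homs F Q = BijGroup Q\<lparr>carrier := F Q Q\<rparr>"

definition Aut_conj :: "('a, 'b) monoid_scheme \<Rightarrow> 'a set \<Rightarrow> 'a set \<Rightarrow> ('a \<Rightarrow> 'a) set" where
  "Aut_conj G S Q = conj_map G Q ` (normalizer G Q \<inter> S)"

definition sylow_subgroup :: "nat \<Rightarrow> ('a, 'b) monoid_scheme \<Rightarrow> 'a set \<Rightarrow> bool" where
  "sylow_subgroup p K H \<longleftrightarrow> subgroup H K \<and> card H = p ^ multiplicity p (order K)"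

definition fully_automized ::
    "nat \<Rightarrow> ('a, 'b) monoid_scheme \<Rightarrow> 'a set \<Rightarrow> 'a homs \<Rightarrow> 'a set \<Rightarrow> bool" where
  "fully_automized p G S F Q \<longleftrightarrow> sylow_subgroup p (Aut_homs F Q) (Aut_conj G S Q)"

definition iso_homs :: "'a homs \<Rightarrow> 'a set \<Rightarrow> 'a set \<Rightarrow> ('a \<Rightarrow> 'a) set" where
  "iso_homs F Q R = {\<phi> \<in> F Q R. \<phi> ` Q = R}"

text \<open>
  For an isomorphism \<open>\<phi>\<close> from \<open>Q\<close> to \<open>R\<close>, the second set in the intersection is
  \<open>Aut_S(R)\<close> conjugated by \<open>\<phi>\<^sup>-\<^sup>1\<close>, i.e. the maps \<open>x \<mapsto> \<phi>\<^sup>-\<^sup>1 (\<chi> (\<phi> x))\<close>.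
\<close>

definition extender :: "('a, 'b) monoid_scheme \<Rightarrow> 'a set \<Rightarrow> 'a set \<Rightarrow> 'a set \<Rightarrow> ('a \<Rightarrow> 'a) \<Rightarrow> 'a set"
  where "extender G S Q R \<phi> =
     {g \<in> normalizer G Q \<inter> S. conj_map G Q g \<in>
        Aut_conj G S Q \<inter> (\<lambda>\<chi>. \<lambda>x\<in>Q. inv_into Q \<phi> (\<chi> (\<phi> x))) ` Aut_conj G S R}"

definition receptive :: "('a, 'b) monoid_scheme \<Rightarrow> 'a set \<Rightarrow> 'a homs \<Rightarrow> 'a set \<Rightarrow> bool" where
  "receptive G S F R \<longleftrightarrow>
     (\<forall>Q. \<forall>\<phi>\<in>iso_homs F Q R. \<exists>\<psi>\<in>F (extender G S Q R \<phi>) S. \<forall>x\<in>Q. \<psi> x = \<phi> x)"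

definition saturated :: "nat \<Rightarrow> ('a, 'b) monoid_scheme \<Rightarrow> 'a set \<Rightarrow> 'a homs \<Rightarrow> bool" where
  "saturated p G S F \<longleftrightarrow>
     (\<forall>Q. subgroup_of G S Q \<longrightarrow>
        (\<exists>R. iso_homs F Q R \<noteq> {} \<and> fully_automized p G S F R \<and> receptive G S F R))"

text \<open>The order on \<^typ>\<open>'a homs\<close> is the pointwise one: inclusion of all Hom-sets.\<close>

definition subsystem ::
    "('a, 'b) monoid_scheme \<Rightarrow> 'a set \<Rightarrow> 'a homs \<Rightarrow> 'a set \<Rightarrow> 'a homs \<Rightarrow> bool" where
  "subsystem G S F T E \<longleftrightarrow> subgroup_of G S T \<and> fusion_system G T E \<and> E \<le> F"

definition generated_by ::
    "('a, 'b) monoid_scheme \<Rightarrow> 'a set \<Rightarrow> 'a homs \<Rightarrow> 'a homs \<Rightarrow> bool" where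
  "generated_by G T E X \<longleftrightarrow>
     fusion_system G T E \<and> X \<le> E \<and> (\<forall>D. fusion_system G T D \<and> X \<le> D \<longrightarrow> E \<le> D)"

definition strongly_closed :: "('a, 'b) monoid_scheme \<Rightarrow> 'a set \<Rightarrow> 'a homs \<Rightarrow> 'a set \<Rightarrow> bool" where
  "strongly_closed G S F T \<longleftrightarrow>
     subgroup_of G S T \<and> (\<forall>Q. subgroup_of G T Q \<longrightarrow> (\<forall>\<phi>\<in>F Q S. \<phi> ` Q \<subseteq> T))"

definition invariant_subsystem ::
    "('a, 'b) monoid_scheme \<Rightarrow> 'a set \<Rightarrow> 'a homs \<Rightarrow> 'a set \<Rightarrow> 'a homs \<Rightarrow> bool" where
  "invariant_subsystem G S F T E \<longleftrightarrow>
     subsystem G S F T E \<and> strongly_closed G S F T \<and>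
     (\<forall>Q R. Q \<subseteq> R \<longrightarrow> (\<forall>\<phi>\<in>E Q R. \<forall>\<psi>\<in>F R T.
        (\<lambda>y\<in>\<psi> ` Q. \<psi> (\<phi> (inv_into R \<psi> y))) \<in> E (\<psi> ` Q) (\<psi> ` R)))"

definition weakly_normal ::
    "nat \<Rightarrow> ('a, 'b) monoid_scheme \<Rightarrow> 'a set \<Rightarrow> 'a homs \<Rightarrow> 'a set \<Rightarrow> 'a homs \<Rightarrow> bool" where
  "weakly_normal p G S F T E \<longleftrightarrow> saturated p G T E \<and> invariant_subsystem G S F T E"

definition centralizer :: "('a, 'b) monoid_scheme \<Rightarrow> 'a set \<Rightarrow> 'a set \<Rightarrow> 'a set" where
  "centralizer G S T = {g \<in> S. \<forall>x\<in>T. g \<otimes>\<^bsub>G\<^esub> x = x \<otimes>\<^bsub>G\<^esub> g}"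

text \<open>\<open>centralizer G T T\<close> is the centre of \<open>T\<close>.\<close>

definition normal_subsystem ::
    "nat \<Rightarrow> ('a, 'b) monoid_scheme \<Rightarrow> 'a set \<Rightarrow> 'a homs \<Rightarrow> 'a set \<Rightarrow> 'a homs \<Rightarrow> bool" where
  "normal_subsystem p G S F T E \<longleftrightarrow>
     weakly_normal p G S F T E \<and>
     (let C = centralizer G S T in
        \<forall>\<phi>\<in>E T T. \<exists>\<phi>'\<in>F (T <#>\<^bsub>G\<^esub> C) (T <#>\<^bsub>G\<^esub> C).
          (\<forall>x\<in>T. \<phi>' x = \<phi> x) \<and>
          generate G ((\<lambda>x. inv\<^bsub>G\<^esub> x \<otimes>\<^bsub>G\<^esub> \<phi>' x) ` C) \<subseteq> centralizer G T T)"

end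

(*
  Let C = C_P(T). Call a subgroup Q of T centric if all its F-conjugates contain their centralizers
  in T, and call a morphism f of E on a centric Q good if it extends to a morphism of F on QC that
  is the identity on C modulo T. E' is generated by the restrictions of the good morphisms.

  - Automorphisms of p-power order of centric subgroups are good, so a Frattini argument gives
    E = Aut_E(T) E'. Hence every morphism of E has a type, a coset in Aut_E(T) / Aut_E'(T).
  - An automorphism of T that is good on a single centric subgroup is good on T: a p'-automorphism
    of QC that is trivial on Q extends, through normalizers, to TC with trivial restriction to T.
  - By downward induction on |R|, every E-receptive fully E-automized R is receptive for morphisms of
    each fixed type: the extension can be chosen of the same type. This gives the saturation of E'.
  - Good automorphisms of T extend to TC as the normality of E' requires. Finally H is a complement
    in Aut_E(T) to its normal Sylow p-subgroup Inn(T), given by the Schur-Zassenhaus theorem.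
*)

theory Submission
  imports Defs "HOL-Number_Theory.Cong" "HOL-Algebra.Multiplicative_Group" "HOL-Algebra.Sylow"
begin

section \<open>Finite groups\<close>

text \<open>The obstacle is that a morphism of E does not determine its type. On a non-centric R the
  identity may have several types, so receptivity of R in E extends a morphism of E' to a morphism
  of E whose type may be wrong. The error is a type of the identity of R, and the heart of the proof
  is to extend such an identity to N_T(R) without changing its type. On centric subgroups the
  ambiguity disappears, because goodness on one centric subgroup forces goodness on T. On a
  non-centric R the type is carried to R C_T(R), which is larger than R and is preserved by all
  extensions of automorphisms of R; from there it climbs to N_T(R) by an argument that keeps the
  type but not the map. Goodness asks for the identity on C only modulo T. Centricity sharpens this
  to the identity modulo the image of the subgroup, and so makes good morphisms composable. The
  calculus of types serves twice: for F over E, where it expresses the Frattini property, and for E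
  over E'. Morphisms are predicates on functions whose values off the domain are ignored; Hom-sets
  return only at the end.\<close>

lemma fixed_points_mod_prime:
  assumes "group_action G E \<phi>" "finite E" "prime p" "order G = p ^ a"
  shows "p dvd card {x \<in> E. \<exists>g\<in>carrier G. \<phi> g x \<noteq> x}"
proof -
  interpret group_action G E \<phi> by fact
  interpret group_hom G "BijGroup E" \<phi> by (rule group_hom)
  let ?C = "{orbit G \<phi> x |x. x \<in> E \<and> (\<exists>g\<in>carrier G. \<phi> g x \<noteq> x)}"
  have sub: "?C \<subseteq> orbits G E \<phi>" by (auto simp: orbits_def)
  have U: "\<Union>?C = {x \<in> E. \<exists>g\<in>carrier G. \<phi> g x \<noteq> x}"
  proof (intro equalityI subsetI)
    fix y assume "y \<in> \<Union>?C"
    then obtain x where x: "x \<in> E" "\<exists>g\<in>carrier G. \<phi> g x \<noteq> x" "y \<in> orbit G \<phi> x" by auto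
    have yE: "y \<in> E" using x element_image by (auto simp: orbit_def)
    have "\<exists>g\<in>carrier G. \<phi> g y \<noteq> y"
    proof (rule ccontr)
      assume c: "\<not> ?thesis"
      have "x \<in> orbit G \<phi> y" using orbit_sym x(1) yE x(3) by blast
      then have "x = y" using c by (auto simp: orbit_def)
      then show False using c x(2) by blast
    qed
    then show "y \<in> {x \<in> E. \<exists>g\<in>carrier G. \<phi> g x \<noteq> x}" using yE by auto
  next
    fix y assume "y \<in> {x \<in> E. \<exists>g\<in>carrier G. \<phi> g x \<noteq> x}"
    then show "y \<in> \<Union>?C" using orbit_refl by auto
  qed
  have "p dvd card (\<Union>?C)"
  proof (rule dvd_partition)
    show "finite (\<Union>?C)" unfolding U using assms(2) by simp
    show "\<forall>c1\<in>?C. \<forall>c2\<in>?C. c1 \<noteq> c2 \<longrightarrow> c1 \<inter> c2 = {}"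
      using sub disjoint_union by blast
    show "\<forall>c\<in>?C. p dvd card c"
    proof
      fix c assume "c \<in> ?C"
      then obtain x where x: "x \<in> E" "\<exists>g\<in>carrier G. \<phi> g x \<noteq> x" "c = orbit G \<phi> x" by auto
      have "card c dvd p ^ a"
        using orbit_stabilizer_theorem[OF x(1)] assms(4) x(3) by (metis dvd_triv_left)
      then obtain i where i: "card c = p ^ i" using assms(3) divides_primepow_nat by blast
      have "x \<in> c" using x orbit_refl by auto
      obtain g where g: "g \<in> carrier G" "\<phi> g x \<noteq> x" using x by auto
      have "\<phi> g x \<in> c" using g x by (auto simp: orbit_def)
      have "c \<subseteq> E" using x element_image by (auto simp: orbit_def)
      then have "finite c" using assms(2) finite_subset by blast
      then have "card c \<noteq> 1" using \<open>x \<in> c\<close> \<open>\<phi> g x \<in> c\<close> g(2) by (auto simp: card_1_singleton_iff)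
      then have "i \<noteq> 0" using i by (metis power_0)
      then show "p dvd card c" using i by simp
    qed
  qed
  then show ?thesis unfolding U .
qed

lemma (in group) inv_cancel:
  assumes "g \<in> carrier G" "x \<in> carrier G"
  shows "inv g \<otimes> (g \<otimes> x) = x" "g \<otimes> (inv g \<otimes> x) = x"
  using assms by (simp_all add: m_assoc[symmetric])

lemma (in group) pow_cong:
  assumes x: "x \<in> carrier G" and N: "x [^] (N :: nat) = \<one>" and "[a = b] (mod N)"
  shows "x [^] a = x [^] b"
proof -
  have "x [^] c = x [^] (c mod N)" for c
  proof -
    have "x [^] c = x [^] (c div N * N + c mod N)" by simp
    also have "\<dots> = x [^] (N * (c div N)) \<otimes> x [^] (c mod N)"
      using x by (simp only: nat_pow_mult[OF x, symmetric] mult.commute)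
    also have "x [^] (N * (c div N)) = \<one>"
      using x N by (simp add: nat_pow_pow[symmetric])
    finally show ?thesis using x by simp
  qed
  then show ?thesis using assms(3) by (metis cong_def)
qed

lemma (in group) card_subgroup_dvd:
  assumes A: "subgroup A G" and B: "subgroup B G" and sub: "A \<subseteq> B"
  shows "card A dvd card B"
proof -
  interpret B: group "G\<lparr>carrier := B\<rparr>" using B by (rule subgroup_imp_group)
  have "card (rcosets\<^bsub>G\<lparr>carrier := B\<rparr>\<^esub> A) * card A = card B"
    using B.lagrange[OF subgroup_incl[OF A B sub]] by (simp add: order_def)
  then show ?thesis by (metis dvd_triv_right)
qed

section \<open>Sylow conjugation and growth of normalizers, by counting fixed cosets\<close>

lemma (in group) right_mult_action:
  assumes S: "subgroup S G" and A: "subgroup A G"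
  shows "group_action (G\<lparr>carrier := A\<rparr>) (rcosets S) (\<lambda>a. \<lambda>C\<in>rcosets S. C #> inv a)"
proof -
  have As: "A \<subseteq> carrier G" and Ss: "S \<subseteq> carrier G" using S A subgroup.subset by auto
  have cl: "C #> b \<in> rcosets S" if "b \<in> carrier G" "C \<in> rcosets S" for C b
    using that Ss by (auto simp: RCOSETS_def coset_mult_assoc)
  have asc: "(C #> b) #> c = C #> (b \<otimes> c)" if "b \<in> carrier G" "c \<in> carrier G" "C \<in> rcosets S" for C b c
    using that S rcosets_subset_PowG by (intro coset_mult_assoc) auto
  have one: "C #> \<one> = C" if "C \<in> rcosets S" for C
    using that S rcosets_subset_PowG by (intro coset_mult_one) auto
  have bij: "(\<lambda>C\<in>rcosets S. C #> inv a) \<in> Bij (rcosets S)" if "a \<in> carrier G" for a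
  proof -
    have "bij_betw (\<lambda>C. C #> inv a) (rcosets S) (rcosets S)"
      by (rule bij_betw_byWitness[where f' = "\<lambda>C. C #> a"]) (auto simp: asc one that cl)
    then show ?thesis by (simp add: Bij_def)
  qed
  interpret A: group "G\<lparr>carrier := A\<rparr>" using A by (rule subgroup_imp_group)
  show ?thesis
    unfolding group_action_def group_hom_def group_hom_axioms_def
  proof (intro conjI A.is_group group_BijGroup)
    show "(\<lambda>a. \<lambda>C\<in>rcosets S. C #> inv a) \<in> hom (G\<lparr>carrier := A\<rparr>) (BijGroup (rcosets S))"
    proof (rule homI)
      fix a assume "a \<in> carrier (G\<lparr>carrier := A\<rparr>)"
      then show "(\<lambda>C\<in>rcosets S. C #> inv a) \<in> carrier (BijGroup (rcosets S))"
        using bij As by (auto simp: BijGroup_def)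
    next
      fix a b assume "a \<in> carrier (G\<lparr>carrier := A\<rparr>)" "b \<in> carrier (G\<lparr>carrier := A\<rparr>)"
      then have ab: "a \<in> carrier G" "b \<in> carrier G" using As by auto
      show "(\<lambda>C\<in>rcosets S. C #> inv (a \<otimes>\<^bsub>G\<lparr>carrier := A\<rparr>\<^esub> b)) =
         (\<lambda>C\<in>rcosets S. C #> inv a) \<otimes>\<^bsub>BijGroup (rcosets S)\<^esub> (\<lambda>C\<in>rcosets S. C #> inv b)"
        using ab bij by (auto simp: BijGroup_def compose_def asc cl inv_mult_group fun_eq_iff)
    qed
  qed
qed

lemma (in group) fixed_cosets:
  assumes fin: "finite (carrier G)" and p: "prime p" and S: "subgroup S G" and A: "subgroup A G"
    and cA: "card A = p ^ a"
  shows "p dvd card {C \<in> rcosets S. \<exists>a\<in>A. C #> inv a \<noteq> C}"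
proof -
  have "finite (rcosets S)"
    using fin S by (metis finite_Pow_iff finite_subset rcosets_subset_PowG)
  then have "p dvd card {C \<in> rcosets S. \<exists>a\<in>carrier (G\<lparr>carrier := A\<rparr>). (\<lambda>C\<in>rcosets S. C #> inv a) C \<noteq> C}"
    using fixed_points_mod_prime[OF right_mult_action[OF S A] _ p] cA by (simp add: order_def)
  also have "{C \<in> rcosets S. \<exists>a\<in>carrier (G\<lparr>carrier := A\<rparr>). (\<lambda>C\<in>rcosets S. C #> inv a) C \<noteq> C} =
     {C \<in> rcosets S. \<exists>a\<in>A. C #> inv a \<noteq> C}" by auto
  finally show ?thesis .
qed

lemma (in group) fixed_coset_conj:
  assumes S: "subgroup S G" and a: "a \<in> carrier G" "g \<in> carrier G" and "(S #> g) #> inv a = S #> g"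
  shows "g \<otimes> a \<otimes> inv g \<in> S"
proof -
  have Ss: "S \<subseteq> carrier G" using S subgroup.subset by auto
  have "S #> (g \<otimes> inv a) = S #> g" using assms Ss by (simp add: coset_mult_assoc)
  then have "S #> (g \<otimes> inv (g \<otimes> inv a)) = S"
    by (intro coset_mult_inv2) (use a Ss in auto)
  moreover have "g \<otimes> inv (g \<otimes> inv a) = g \<otimes> a \<otimes> inv g" using a by (simp add: inv_mult_group m_assoc)
  ultimately show ?thesis using coset_join1[OF _ _ S] a by simp
qed

text \<open>The number of cosets of \<open>S\<close> is prime to \<open>p\<close>, whereas the
  number of cosets moved by the \<open>p\<close>-group \<open>A\<close> is divisible by
  \<open>p\<close>. Hence \<open>A\<close> fixes a coset \<open>S g\<close>, and then
  \<open>g A g^-1\<close> lies in \<open>S\<close>.\<close>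

lemma (in group) sylow_conj:
  assumes fin: "finite (carrier G)" and p: "prime p" and S: "subgroup S G"
    and idx: "\<not> p dvd (order G div card S)" and A: "subgroup A G" and cA: "card A = p ^ a"
  obtains g where "g \<in> carrier G" "\<And>a. a \<in> A \<Longrightarrow> g \<otimes> a \<otimes> inv g \<in> S"
proof -
  have "card S > 0"
    using rev_finite_subset[OF fin subgroup.subset[OF S]] subgroup.one_closed[OF S] by (auto simp: card_gt_0_iff)
  then have idx': "\<not> p dvd card (rcosets S)" using idx lagrange[OF S]
    by (metis nonzero_mult_div_cancel_right less_irrefl)
  have "{C \<in> rcosets S. \<exists>a\<in>A. C #> inv a \<noteq> C} \<noteq> rcosets S"
    using idx' fixed_cosets[OF fin p S A cA] by metis
  then obtain C where C: "C \<in> rcosets S" "\<And>a. a \<in> A \<Longrightarrow> C #> inv a = C" by blast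
  then obtain g where g: "g \<in> carrier G" "C = S #> g" by (auto simp: RCOSETS_def)
  show ?thesis
    by (rule that[OF g(1)]) (use fixed_coset_conj[OF S _ g(1)] C g A subgroup.subset in blast)
qed

text \<open>The cosets of \<open>R\<close> in \<open>S\<close> fixed under right multiplication by
  \<open>R\<close> are those whose representatives normalize \<open>R\<close>. Their number is
  divisible by \<open>p\<close>, and \<open>R\<close> itself is one of them, so there is
  another.\<close>

lemma (in group) normalizer_grows:
  assumes fin: "finite (carrier G)" and p: "prime p" and R: "subgroup R G" and S: "subgroup S G"
    and cS: "card S = p ^ n" and RS: "R \<subset> S"
  obtains g where "g \<in> S" "g \<notin> R" "\<And>r. r \<in> R \<Longrightarrow> g \<otimes> r \<otimes> inv g \<in> R"
proof -
  let ?S = "G\<lparr>carrier := S\<rparr>"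
  interpret S: group ?S using S by (rule subgroup_imp_group)
  have finS: "finite (carrier ?S)" using rev_finite_subset[OF fin subgroup.subset[OF S]] by simp
  have RS': "subgroup R ?S" using R S RS by (metis subgroup_incl psubset_imp_subset)
  have "card R dvd p ^ n" using S.lagrange[OF RS'] cS by (simp add: order_def) (metis dvd_triv_right)
  then obtain j where j: "card R = p ^ j" using divides_primepow_nat[OF p] by blast
  have lt: "card R < card S" using RS finS by (simp add: psubset_card_mono)
  have ro: "card (rcosets\<^bsub>?S\<^esub> R) * p ^ j = p ^ n" using S.lagrange[OF RS'] cS j by (simp add: order_def)
  have "card (rcosets\<^bsub>?S\<^esub> R) dvd p ^ n" using ro by (metis dvd_triv_left)
  then obtain i where i: "card (rcosets\<^bsub>?S\<^esub> R) = p ^ i" using divides_primepow_nat[OF p] by blast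
  have "i \<noteq> 0" using i ro lt cS j by (cases i) auto
  then have pd: "p dvd card (rcosets\<^bsub>?S\<^esub> R)" using i by simp
  let ?M = "{C \<in> rcosets\<^bsub>?S\<^esub> R. \<exists>a\<in>R. C #>\<^bsub>?S\<^esub> inv\<^bsub>?S\<^esub> a \<noteq> C}"
  let ?F = "{C \<in> rcosets\<^bsub>?S\<^esub> R. \<forall>a\<in>R. C #>\<^bsub>?S\<^esub> inv\<^bsub>?S\<^esub> a = C}"
  have finc: "finite (rcosets\<^bsub>?S\<^esub> R)"
    using finS RS' by (metis finite_Pow_iff finite_subset S.rcosets_subset_PowG)
  have "?F = rcosets\<^bsub>?S\<^esub> R - ?M" by auto
  then have "card ?F = card (rcosets\<^bsub>?S\<^esub> R) - card ?M" using finc by (simp add: card_Diff_subset)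
  then have pF: "p dvd card ?F" using pd S.fixed_cosets[OF finS p RS' RS' j] by (simp add: dvd_diff_nat)
  have "R \<in> ?F"
  proof -
    have "R #>\<^bsub>?S\<^esub> x = R" if "x \<in> R" for x
      using S.coset_join2[of x R] that RS RS' by auto
    moreover have "R = R #>\<^bsub>?S\<^esub> \<one>\<^bsub>?S\<^esub>"
      using S.coset_mult_one[of R] RS by simp
    moreover have "inv\<^bsub>?S\<^esub> a \<in> R" if "a \<in> R" for a using RS' that by (simp add: subgroup.m_inv_closed)
    ultimately show ?thesis using S.one_closed unfolding RCOSETS_def by blast
  qed
  moreover have "finite ?F" using finc by simp
  moreover have "?F \<noteq> {R}"
  proof
    assume "?F = {R}"
    then have "card ?F = 1" by simp
    then show False using pF p by auto
  qed
  ultimately obtain C where C: "C \<in> ?F" "C \<noteq> R" by blast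
  then obtain g where g: "g \<in> S" "C = R #>\<^bsub>?S\<^esub> g" by (auto simp: RCOSETS_def)
  show ?thesis
  proof (rule that[OF g(1)])
    show "g \<notin> R" using C(2) g S.coset_join2[of g R] RS' by auto
    fix r assume r: "r \<in> R"
    have "g \<otimes>\<^bsub>?S\<^esub> r \<otimes>\<^bsub>?S\<^esub> inv\<^bsub>?S\<^esub> g \<in> R"
      by (rule S.fixed_coset_conj[OF RS']) (use C g r RS in auto)
    then show "g \<otimes> r \<otimes> inv g \<in> R" using S g by (simp add: m_inv_consistent)
  qed
qed

text \<open>Cauchy's theorem, read off from Sylow's: another prime divisor \<open>q\<close> of the
  order would give a subgroup of order \<open>q\<close>, whose elements have order dividing both
  \<open>q\<close> and a power of \<open>p\<close>.\<close>

lemma (in group) card_prime_power: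
  assumes fin: "finite (carrier G)" and p: "prime p" and el: "\<And>x. x \<in> carrier G \<Longrightarrow> \<exists>k. x [^] (p ^ k :: nat) = \<one>"
  shows "\<exists>a. order G = p ^ a"
proof -
  have pos: "order G \<noteq> 0" using fin order_gt_0_iff_finite by auto
  have "q = p" if q: "prime q" "q dvd order G" for q
  proof (rule ccontr)
    assume "q \<noteq> p"
    obtain m where "order G = q ^ 1 * m" using q by auto
    then obtain H where H: "subgroup H G" "card H = q" using sylow_thm[OF q(1) is_group _ fin, of 1 m] by auto
    have "H \<noteq> {\<one>}" using H q(1) by auto
    then obtain h where h: "h \<in> H" "h \<noteq> \<one>" using H(1) subgroup.one_closed by blast
    then have hc: "h \<in> carrier G" using H subgroup.subset by blast
    obtain k where k: "h [^] (p ^ k) = \<one>" using el hc by blast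
    interpret H: group "G\<lparr>carrier := H\<rparr>" using H(1) by (rule subgroup_imp_group)
    have "h [^]\<^bsub>G\<lparr>carrier := H\<rparr>\<^esub> order (G\<lparr>carrier := H\<rparr>) = \<one>" using H.pow_order_eq_1 h by simp
    then have "h [^] q = \<one>" using H by (simp add: order_def nat_pow_consistent[symmetric])
    then have "ord h dvd q" "ord h dvd p ^ k" using k hc pow_eq_id by auto
    moreover have "coprime q (p ^ k)" using \<open>q \<noteq> p\<close> p q(1) primes_coprime by auto
    ultimately have "ord h = 1" by (metis coprime_def nat_dvd_1_iff_1)
    then show False using h hc ord_eq_1 by blast
  qed
  note only_p = this
  obtain m where m: "order G = p ^ multiplicity p (order G) * m" "\<not> p dvd m"
    using multiplicity_decompose'[of "order G" p] pos p not_prime_unit by blast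
  have "m = 1"
  proof (rule ccontr)
    assume "m \<noteq> 1"
    then obtain q where "prime q" "q dvd m" using prime_factor_nat by blast
    then show False using only_p[of q] m by (metis dvd_mult)
  qed
  then show ?thesis using m(1) by auto
qed

subsection \<open>The Schur-Zassenhaus theorem for a normal Sylow subgroup\<close>

text \<open>Conjugation by \<open>g\<close> is an automorphism of the abelian normal subgroup
  \<open>N\<close>, so it passes through finite products. This evaluates one of the two factors when
  the crossed homomorphism below is applied to a product.\<close>

lemma (in group) finprod_conj:
  assumes "comm_group (G\<lparr>carrier := N\<rparr>)" "N \<lhd> G" "g \<in> carrier G" "finite E" "f \<in> E \<rightarrow> N"
  shows "finprod (G\<lparr>carrier := N\<rparr>) (\<lambda>c. g \<otimes> f c \<otimes> inv g) E = g \<otimes> finprod (G\<lparr>carrier := N\<rparr>) f E \<otimes> inv g"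
proof -
  interpret A: comm_group "G\<lparr>carrier := N\<rparr>" by fact
  interpret N: normal N G by fact
  show ?thesis using assms(4,5)
  proof (induction E rule: finite_induct)
    case empty
    then show ?case using assms(3) by simp
  next
    case (insert c E)
    have fN: "finprod (G\<lparr>carrier := N\<rparr>) f E \<in> N"
      using A.finprod_closed[of f E] insert.prems by auto
    have e: "(\<lambda>c. g \<otimes> f c \<otimes> inv g) \<in> E \<rightarrow> N" "g \<otimes> f c \<otimes> inv g \<in> N"
      using insert.prems assms(3) N.inv_op_closed2 by auto
    have "finprod (G\<lparr>carrier := N\<rparr>) (\<lambda>c. g \<otimes> f c \<otimes> inv g) (insert c E) =
      (g \<otimes> f c \<otimes> inv g) \<otimes> finprod (G\<lparr>carrier := N\<rparr>) (\<lambda>c. g \<otimes> f c \<otimes> inv g) E"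
      using A.finprod_insert[of E c "\<lambda>c. g \<otimes> f c \<otimes> inv g"] insert.hyps e by simp
    also have "\<dots> = (g \<otimes> f c \<otimes> inv g) \<otimes> (g \<otimes> finprod (G\<lparr>carrier := N\<rparr>) f E \<otimes> inv g)"
      using insert.IH insert.prems by auto
    also have "\<dots> = g \<otimes> (f c \<otimes> finprod (G\<lparr>carrier := N\<rparr>) f E) \<otimes> inv g"
    proof -
      have "f c \<in> carrier G" "finprod (G\<lparr>carrier := N\<rparr>) f E \<in> carrier G"
        using fN insert.prems N.subset by auto
      then show ?thesis using assms(3) by (simp add: m_assoc inv_cancel)
    qed
    also have "f c \<otimes> finprod (G\<lparr>carrier := N\<rparr>) f E = finprod (G\<lparr>carrier := N\<rparr>) f (insert c E)"
      using A.finprod_insert[of E c f] insert by auto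
    finally show ?case .
  qed
qed

text \<open>
  The complement is the kernel of the crossed homomorphism \<open>e g = \<Prod>c. g r(c) r(g c)\<^sup>-\<^sup>1\<close>, where
  \<open>r\<close> picks representatives of the cosets \<open>c\<close>; it restricts to \<open>x \<mapsto> x ^ |G : N|\<close> on \<open>N\<close>.
\<close>

lemma (in group) abelian_normal_complement:
  assumes fin: "finite (carrier G)" and N: "N \<lhd> G" and comm: "comm_group (G\<lparr>carrier := N\<rparr>)"
    and cop: "coprime (card (rcosets N)) (card N)"
  obtains H where "subgroup H G" "H \<inter> N = {\<one>}" "\<And>g. g \<in> carrier G \<Longrightarrow> \<exists>n\<in>N. n \<otimes> g \<in> H"
proof -
  interpret A: comm_group "G\<lparr>carrier := N\<rparr>" by fact
  interpret N: normal N G by fact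
  have sN: "subgroup N G" by (rule N.subgroup_axioms)
  have Nc: "x \<in> carrier G" if "x \<in> N" for x using that N.subset by auto
  define r where "r = (\<lambda>c :: 'a set. SOME x. x \<in> c)"
  define E where "E = rcosets N"
  have finE: "finite E" unfolding E_def
    using fin by (metis finite_Pow_iff finite_subset rcosets_subset_PowG sN)
  have r: "r c \<in> c" "r c \<in> carrier G" if "c \<in> E" for c
  proof -
    obtain x where x: "x \<in> carrier G" "c = N #> x" using \<open>c \<in> E\<close> by (auto simp: E_def RCOSETS_def)
    then show 1: "r c \<in> c" using rcos_self[OF x(1) sN] unfolding r_def by (metis someI)
    then show "r c \<in> carrier G" using x r_coset_subset_G[OF N.subset x(1)] by blast
  qed
  have rr: "c = N #> r c" if "c \<in> E" for c
  proof -
    obtain x where x: "x \<in> carrier G" "c = N #> x" using \<open>c \<in> E\<close> by (auto simp: E_def RCOSETS_def)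
    then show ?thesis using repr_independence[of "r c" N x] r(1)[OF that] sN by auto
  qed
  \<comment> \<open>Since \<open>N\<close> is normal, left multiplication permutes the right cosets.
    \<open>t\<close> is this action on \<open>E\<close>, and \<open>N\<close> acts
    trivially.\<close>
  define t where "t = (\<lambda>g c. N #> (g \<otimes> r c))"
  have tE: "t g c \<in> E" if "g \<in> carrier G" "c \<in> E" for g c
    unfolding t_def E_def using that r N.subset by (intro rcosetsI) auto
  have t_eq: "t g (N #> x) = N #> (g \<otimes> x)" if "g \<in> carrier G" "x \<in> carrier G" for g x
  proof -
    have c: "N #> x \<in> E" using that N.subset by (auto simp: E_def intro: rcosetsI)
    have "r (N #> x) \<in> N #> x" using r[OF c] by simp
    then obtain n where n: "n \<in> N" "r (N #> x) = n \<otimes> x" by (auto simp: r_coset_def)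
    have "g \<otimes> (n \<otimes> x) = (g \<otimes> n \<otimes> inv g) \<otimes> (g \<otimes> x)"
      using that n(1) Nc by (simp add: m_assoc inv_cancel)
    moreover have "g \<otimes> n \<otimes> inv g \<in> N" using N.inv_op_closed2 that n by simp
    ultimately have "g \<otimes> (n \<otimes> x) \<in> N #> (g \<otimes> x)" unfolding r_coset_def by auto
    then show ?thesis unfolding t_def n(2) using repr_independence[OF _ _ sN] that by auto
  qed
  have t_comp: "t g (t h c) = t (g \<otimes> h) c" if "g \<in> carrier G" "h \<in> carrier G" "c \<in> E" for g h c
    using t_eq[OF that(1), of "h \<otimes> r c"] that r(2)[OF that(3)] by (simp add: t_def m_assoc)
  have t_one: "t n c = c" if "n \<in> N" "c \<in> E" for n c
  proof -
    have "n \<otimes> r c \<in> N #> r c" using that by (auto simp: r_coset_def)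
    then show ?thesis unfolding t_def
      using repr_independence[of "n \<otimes> r c" N "r c"] sN r that rr by auto
  qed
  define f where "f = (\<lambda>g c. g \<otimes> r c \<otimes> inv (r (t g c)))"
  have fN: "f g c \<in> N" if "g \<in> carrier G" "c \<in> E" for g c
  proof -
    have c: "g \<otimes> r c \<in> carrier G" using that r by auto
    show ?thesis unfolding f_def
      by (rule diff_neutralizes[OF sN tE[OF that, unfolded E_def]])
        (use rcos_self[OF c sN] r(1)[OF tE[OF that]] in \<open>auto simp: t_def\<close>)
  qed
  define e where "e = (\<lambda>g. finprod (G\<lparr>carrier := N\<rparr>) (f g) E)"
  have eN: "e g \<in> N" if "g \<in> carrier G" for g
    unfolding e_def using A.finprod_closed[of "f g" E] fN that by auto
  have e_mult: "e (g \<otimes> h) = (g \<otimes> e h \<otimes> inv g) \<otimes> e g" if g: "g \<in> carrier G" and h: "h \<in> carrier G" for g h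
  proof -
    have 1: "f (g \<otimes> h) c = (g \<otimes> f h c \<otimes> inv g) \<otimes> f g (t h c)" if c: "c \<in> E" for c
    proof -
      have 2: "r c \<in> carrier G" "r (t h c) \<in> carrier G" "r (t g (t h c)) \<in> carrier G"
        using r(2) c tE g h by auto
      have 3: "(g \<otimes> f h c \<otimes> inv g) \<otimes> f g (t h c) =
        g \<otimes> (h \<otimes> (r c \<otimes> (inv r (t h c) \<otimes> (inv g \<otimes> (g \<otimes> (r (t h c) \<otimes> inv r (t g (t h c))))))))"
        unfolding f_def using 2 g h by (simp add: m_assoc)
      have 4: "inv g \<otimes> (g \<otimes> (r (t h c) \<otimes> inv r (t g (t h c)))) = r (t h c) \<otimes> inv r (t g (t h c))"
        using 2 g by (simp add: m_assoc[symmetric])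
      have 5: "inv r (t h c) \<otimes> (r (t h c) \<otimes> inv r (t g (t h c))) = inv r (t g (t h c))"
        using 2 g by (simp add: m_assoc[symmetric])
      show ?thesis unfolding 3 4 5 unfolding f_def t_comp[OF g h c] using 2 g h
        by (simp add: m_assoc t_comp[OF g h c])
    qed
    have b: "bij_betw (t h) E E"
    proof (rule bij_betw_byWitness[where f' = "t (inv h)"])
      show "\<forall>a\<in>E. t (inv h) (t h a) = a" "\<forall>a\<in>E. t h (t (inv h) a) = a"
        using t_comp[of "inv h" h] t_comp[of h "inv h"] h t_one[OF N.one_closed] by auto
    qed (use tE h in auto)
    have "e (g \<otimes> h) = finprod (G\<lparr>carrier := N\<rparr>) (\<lambda>c. (g \<otimes> f h c \<otimes> inv g) \<otimes> f g (t h c)) E"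
      unfolding e_def using 1 N.inv_op_closed2[OF g] fN g h tE
      by (intro A.finprod_cong') (auto intro!: N.m_closed)
    also have "\<dots> = finprod (G\<lparr>carrier := N\<rparr>) (\<lambda>c. g \<otimes> f h c \<otimes> inv g) E \<otimes>
        finprod (G\<lparr>carrier := N\<rparr>) (\<lambda>c. f g (t h c)) E"
      using A.finprod_multf[of "\<lambda>c. g \<otimes> f h c \<otimes> inv g" E "\<lambda>c. f g (t h c)"] N.inv_op_closed2[OF g] fN g h tE
      by auto
    also have "finprod (G\<lparr>carrier := N\<rparr>) (\<lambda>c. g \<otimes> f h c \<otimes> inv g) E = g \<otimes> e h \<otimes> inv g"
      unfolding e_def using fN h by (intro finprod_conj[OF comm N g finE]) auto
    also have "finprod (G\<lparr>carrier := N\<rparr>) (\<lambda>c. f g (t h c)) E = finprod (G\<lparr>carrier := N\<rparr>) (f g) (t h ` E)"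
      using A.finprod_reindex[of "f g" "t h" E] b fN g by (auto simp: bij_betw_def)
    also have "t h ` E = E" using b by (simp add: bij_betw_def)
    finally show ?thesis by (simp add: e_def)
  qed
  have e_N: "e n = n [^] card E" if n: "n \<in> N" for n
  proof -
    have "e n = finprod (G\<lparr>carrier := N\<rparr>) (\<lambda>c. n) E"
      unfolding e_def
    proof (rule A.finprod_cong')
      fix c assume c: "c \<in> E"
      show "f n c = n" unfolding f_def t_one[OF n c] using Nc[OF n] r(2)[OF c] by (simp add: m_assoc)
    qed (use n in auto)
    also have "\<dots> = n [^]\<^bsub>G\<lparr>carrier := N\<rparr>\<^esub> card E" using A.finprod_const[of n E] n by simp
    finally show ?thesis by (simp add: nat_pow_consistent[symmetric])
  qed
  have powN: "x [^] card N = \<one>" if "x \<in> N" for x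
    using A.pow_order_eq_1[of x] that by (simp add: order_def nat_pow_consistent[symmetric])
  \<comment> \<open>\<open>j\<close> inverts the index of \<open>N\<close> modulo the order of
    \<open>N\<close>, so that roots of exponent \<open>card E\<close> exist in \<open>N\<close> and
    are given by \<open>j\<close>-th powers.\<close>
  obtain j where j: "[card E * j = 1] (mod card N)"
    using cong_solve_coprime_nat[of "card E" "card N"] cop unfolding E_def by auto
  have inj0: "x = \<one>" if "x \<in> N" "x [^] card E = \<one>" for x
  proof -
    have "ord x dvd card E" "ord x dvd card N" using that powN pow_eq_id Nc by auto
    then have "ord x = 1" using cop unfolding E_def by (metis coprime_common_divisor_nat)
    then show ?thesis using ord_eq_1 Nc that by blast
  qed
  define H where "H = {g \<in> carrier G. e g = \<one>}"
  have e1: "e \<one> = \<one>" using e_N[OF N.one_closed] by simp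
  show ?thesis
  proof (rule that)
    show "subgroup H G"
    proof
      show "H \<subseteq> carrier G" "\<one> \<in> H" using e1 by (auto simp: H_def)
      show "x \<otimes> y \<in> H" if "x \<in> H" "y \<in> H" for x y
        using that e_mult[of x y] by (auto simp: H_def)
      show "inv x \<in> H" if "x \<in> H" for x
        using that e_mult[of "inv x" x] e1 eN[of "inv x"] Nc by (auto simp: H_def)
    qed
    show "H \<inter> N = {\<one>}" using inj0 e_N e1 N.one_closed by (auto simp: H_def)
    fix g assume g: "g \<in> carrier G"
    \<comment> \<open>Chosen with \<open>e n = inv (e g)\<close>. As \<open>N\<close> is abelian,
      \<open>e (n \<otimes> g)\<close> is the product of \<open>e g\<close> and \<open>e n\<close>,
      so \<open>n \<otimes> g\<close> falls into the kernel.\<close>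
    define n where "n = inv (e g) [^] j"
    have ie: "inv (e g) \<in> N" using eN[OF g] by simp
    have nN: "n \<in> N" unfolding n_def using ie N.one_closed
      by (induction j) (auto intro: N.m_closed)
    have "n [^] card E = inv (e g) [^] (card E * j)"
      unfolding n_def using ie Nc by (simp add: nat_pow_pow mult.commute)
    also have "\<dots> = inv (e g)"
    proof -
      have "inv (e g) [^] (card E * j) = inv (e g) [^] (1::nat)"
        using pow_cong[OF _ powN[OF ie] j] ie Nc by simp
      then show ?thesis using ie Nc by simp
    qed
    finally have np: "n [^] card E = inv (e g)" .
    have "n \<otimes> e g \<otimes> inv n = e g"
    proof -
      have "n \<otimes> e g = e g \<otimes> n" using A.m_comm[of n "e g"] nN eN[OF g] by simp
      then show ?thesis using nN eN[OF g] Nc by (simp add: m_assoc)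
    qed
    then have "e (n \<otimes> g) = e g \<otimes> inv (e g)"
      using e_mult[of n g] nN g Nc e_N[OF nN] np by simp
    then have "n \<otimes> g \<in> H" using nN g Nc eN[OF g] by (simp add: H_def)
    then show "\<exists>n\<in>N. n \<otimes> g \<in> H" using nN by blast
  qed
qed

section \<open>Nonabelian normal Sylow subgroups, by reduction to the abelian case\<close>

lemma (in group) finite_subgroupI:
  assumes "finite (carrier G)" "H \<subseteq> carrier G" "H \<noteq> {}"
    and cl: "\<And>x y. x \<in> H \<Longrightarrow> y \<in> H \<Longrightarrow> x \<otimes> y \<in> H"
  shows "subgroup H G"
proof -
  have pw: "x [^] Suc k \<in> H" if "x \<in> H" for x and k :: nat
  proof (induction k)
    case 0
    show ?case using that assms(2) by auto
  next
    case (Suc k)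
    then show ?case using cl[OF Suc that] by simp
  qed
  have pos: "order G > 0" using assms(1) order_gt_0_iff_finite by simp
  have pw': "x [^] k \<in> H" if "x \<in> H" "k > 0" for x and k :: nat
    using pw[OF that(1), of "k - 1"] that(2) by simp
  show ?thesis
  proof
    obtain x where x: "x \<in> H" using assms(3) by auto
    show "\<one> \<in> H" using pw'[OF x pos] pow_order_eq_1 x assms(2) by auto
    fix x assume x: "x \<in> H"
    then have xc: "x \<in> carrier G" using assms(2) by auto
    \<comment> \<open>The exponent \<open>order G - 1\<close> would be zero for the trivial group,
      while membership in \<open>H\<close> is available for positive powers. Doubling the order
      keeps the exponent positive.\<close>
    have "x [^] (2 * order G - 1) \<otimes> x = x [^] Suc (2 * order G - 1)" using xc by simp
    also have "Suc (2 * order G - 1) = order G * 2" using pos by simp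
    also have "x [^] (order G * 2) = \<one>" using xc pow_order_eq_1 by (simp add: nat_pow_pow[symmetric])
    finally have "inv x = x [^] (2 * order G - 1)" using xc inv_equality by simp
    then show "inv x \<in> H" using pw'[OF x, of "2 * order G - 1"] pos by simp
  qed (use assms in auto)
qed

text \<open>A proper subgroup \<open>X\<close> of largest order is normalized by some
  \<open>g\<close> outside it. The union of the cosets \<open>X g^i\<close> is then a subgroup,
  hence all of \<open>M\<close> by maximality. So \<open>M / X\<close> is cyclic, and commutators
  lie in \<open>X\<close>.\<close>

lemma (in group) p_group_derived_proper:
  assumes fin: "finite (carrier G)" and p: "prime p" and M: "subgroup M G" and cM: "card M = p ^ a"
    and ne: "M \<noteq> {\<one>}"
  shows "derived G M \<subset> M"
proof -
  have finM: "finite M" using rev_finite_subset[OF fin subgroup.subset[OF M]] .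
  define \<X> where "\<X> = {X. subgroup X G \<and> X \<subset> M}"
  have "{\<one>} \<in> \<X>" using ne subgroup.one_closed[OF M] triv_subgroup by (auto simp: \<X>_def)
  moreover have "\<forall>X. X \<in> \<X> \<longrightarrow> card X < Suc (card M)"
    using finM card_mono by (auto simp: \<X>_def less_Suc_eq_le)
  ultimately have "\<exists>X. X \<in> \<X> \<and> (\<forall>Y. Y \<in> \<X> \<longrightarrow> card Y \<le> card X)"
    by (rule Lattices_Big.ex_has_greatest_nat)
  then obtain X where X: "X \<in> \<X>" and maxX: "\<And>Y. Y \<in> \<X> \<Longrightarrow> card Y \<le> card X" by blast
  then have sX: "subgroup X G" and XM: "X \<subset> M" by (auto simp: \<X>_def)
  obtain g where g: "g \<in> M" "g \<notin> X" and gX: "\<And>r. r \<in> X \<Longrightarrow> g \<otimes> r \<otimes> inv g \<in> X"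
    using normalizer_grows[OF fin p sX M cM XM] by blast
  have Mc: "x \<in> carrier G" if "x \<in> M" for x using that subgroup.subset[OF M] by auto
  have gc: "g \<in> carrier G" and Xc: "\<And>x. x \<in> X \<Longrightarrow> x \<in> carrier G" using g XM Mc by auto
  have gpow: "g [^] i \<otimes> r \<in> X #> g [^] i" if "r \<in> X" for i :: nat and r
    using that
  proof (induction i arbitrary: r)
    case 0
    then show ?case using Xc by (auto simp: r_coset_def)
  next
    case (Suc i)
    have 1: "g \<otimes> r = (g \<otimes> r \<otimes> inv g) \<otimes> g" using gc Suc.prems Xc by (simp add: m_assoc)
    obtain y where y: "y \<in> X" "g [^] i \<otimes> (g \<otimes> r \<otimes> inv g) = y \<otimes> g [^] i"
      using Suc.IH[OF gX[OF Suc.prems]] by (auto simp: r_coset_def)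
    have c: "g \<otimes> r \<otimes> inv g \<in> carrier G" "y \<in> carrier G" using Suc.prems gX Xc y by auto
    have "g [^] Suc i \<otimes> r = g [^] i \<otimes> (g \<otimes> r)" using gc Suc.prems Xc by (simp add: m_assoc)
    also have "\<dots> = g [^] i \<otimes> (g \<otimes> r \<otimes> inv g) \<otimes> g" by (subst 1) (use gc c in \<open>simp add: m_assoc\<close>)
    also have "\<dots> = y \<otimes> g [^] Suc i" unfolding y(2) using gc c by (simp add: m_assoc)
    finally show ?case using y(1) by (auto simp: r_coset_def)
  qed
  have prod: "u \<otimes> v \<in> X #> g [^] (i + j)" if uv: "u \<in> X #> g [^] i" "v \<in> X #> g [^] j" for u v and i j :: nat
  proof -
    obtain x y where xy: "x \<in> X" "y \<in> X" "u = x \<otimes> g [^] i" "v = y \<otimes> g [^] j"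
      using uv by (auto simp: r_coset_def)
    obtain z where z: "z \<in> X" "g [^] i \<otimes> y = z \<otimes> g [^] i" using gpow[OF xy(2), of i] by (auto simp: r_coset_def)
    have "u \<otimes> v = x \<otimes> ((g [^] i \<otimes> y) \<otimes> g [^] j)" using xy gc Xc by (simp add: m_assoc)
    also have "\<dots> = (x \<otimes> z) \<otimes> g [^] (i + j)"
      unfolding z(2) using xy z gc Xc by (simp add: m_assoc nat_pow_mult)
    finally show ?thesis using subgroup.m_closed[OF sX xy(1) z(1)] by (auto simp: r_coset_def)
  qed
  define Y where "Y = (\<Union>i::nat. X #> g [^] i)"
  have YM: "Y \<subseteq> M"
  proof
    fix y assume "y \<in> Y"
    then obtain x i where "x \<in> X" "y = x \<otimes> g [^] (i::nat)" by (auto simp: Y_def r_coset_def)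
    moreover have "g [^] i \<in> M" for i :: nat
      using g M by (induction i) (auto intro: subgroup.m_closed subgroup.one_closed)
    ultimately show "y \<in> M" using XM subgroup.m_closed[OF M] by blast
  qed
  have sY: "subgroup Y G"
  proof (rule finite_subgroupI[OF fin])
    show "Y \<subseteq> carrier G" using YM Mc by auto
    show "Y \<noteq> {}" using subgroup.one_closed[OF sX] by (auto simp: Y_def r_coset_def)
    show "x \<otimes> y \<in> Y" if "x \<in> Y" "y \<in> Y" for x y
      using that prod unfolding Y_def by blast
  qed
  have "X #> g [^] (0::nat) \<subseteq> Y" "X #> g [^] (1::nat) \<subseteq> Y" unfolding Y_def by blast+
  moreover have "X #> g [^] (0::nat) = X" using subgroup.subset[OF sX] by simp
  moreover have "g \<in> X #> g [^] (1::nat)" using rcos_self[OF gc sX] gc by simp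
  ultimately have "X \<subset> Y" using g(2) by blast
  have "Y = M"
  proof (rule ccontr)
    assume "Y \<noteq> M"
    then have "Y \<in> \<X>" using sY YM by (auto simp: \<X>_def)
    then have "card Y \<le> card X" by (rule maxX)
    moreover have "card X < card Y" using \<open>X \<subset> Y\<close> YM finM by (meson finite_subset psubset_card_mono)
    ultimately show False by simp
  qed
  have "derived_set G M \<subseteq> X"
  proof
    fix x assume "x \<in> derived_set G M"
    then obtain u v where uv: "u \<in> M" "v \<in> M" "x = u \<otimes> v \<otimes> inv u \<otimes> inv v" by auto
    then obtain i j :: nat where ij: "u \<in> X #> g [^] i" "v \<in> X #> g [^] j" using \<open>Y = M\<close> by (auto simp: Y_def)
    have "u \<otimes> v \<in> X #> g [^] (i + j)" "v \<otimes> u \<in> X #> g [^] (i + j)"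
      using prod[OF ij] prod[OF ij(2,1)] by (simp_all add: add.commute)
    moreover have "X #> g [^] (i + j) \<in> rcosets X" using gc subgroup.subset[OF sX] by (intro rcosetsI) auto
    ultimately have "(u \<otimes> v) \<otimes> inv (v \<otimes> u) \<in> X" using diff_neutralizes[OF sX] by blast
    then show "x \<in> X" using uv Mc by (simp add: inv_mult_group m_assoc)
  qed
  then have "derived G M \<subseteq> X" unfolding derived_def using generate_subgroup_incl[OF _ sX] by simp
  then show ?thesis using XM by blast
qed

text \<open>Take a smallest subgroup \<open>B\<close> that supplements \<open>N\<close> and put
  \<open>M = B \<inter> N\<close>. If \<open>M\<close> were nontrivial, its derived subgroup
  \<open>D\<close> would be proper in it, and the abelian case in \<open>B / D\<close> would give a
  smaller supplement. Hence \<open>M\<close> is trivial and \<open>B\<close> is the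
  complement.\<close>

theorem (in group) normal_sylow_complement:
  assumes fin: "finite (carrier G)" and p: "prime p" and N: "N \<lhd> G" and cN: "card N = p ^ a"
    and idx: "\<not> p dvd order G div card N"
  obtains H where "subgroup H G" "coprime p (card H)" "\<And>g. g \<in> carrier G \<Longrightarrow> \<exists>n\<in>N. n \<otimes> g \<in> H"
proof -
  interpret N: normal N G by fact
  have sN: "subgroup N G" by (rule N.subgroup_axioms)
  \<comment> \<open>Every \<open>p\<close>-subgroup lies in the normal Sylow subgroup
    \<open>N\<close>, in particular a subgroup of \<open>B\<close> of order
    \<open>p^k\<close>.\<close>
  have p_part: "p ^ k dvd card (B \<inter> N)" if B: "subgroup B G" and k: "p ^ k dvd card B" for B k
  proof -
    interpret B: group "G\<lparr>carrier := B\<rparr>" using B by (rule subgroup_imp_group)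
    have finB: "finite B" using rev_finite_subset[OF fin subgroup.subset[OF B]] .
    obtain S where S: "subgroup S (G\<lparr>carrier := B\<rparr>)" "card S = p ^ k"
      using sylow_thm[OF p B.is_group, of k "card B div p ^ k"] k finB by (auto simp: order_def)
    have SG: "subgroup S G" using S(1) B incl_subgroup by blast
    have SB: "S \<subseteq> B" using subgroup.subset[OF S(1)] by simp
    obtain g where g: "g \<in> carrier G" "\<And>s. s \<in> S \<Longrightarrow> g \<otimes> s \<otimes> inv g \<in> N"
      using sylow_conj[OF fin p sN idx SG S(2)] by blast
    have "s \<in> N" if "s \<in> S" for s
    proof -
      have "s \<in> carrier G" using that subgroup.subset[OF SG] by auto
      then have "inv g \<otimes> (g \<otimes> s \<otimes> inv g) \<otimes> g = s" using g(1) by (simp add: m_assoc inv_cancel)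
      then show ?thesis using N.inv_op_closed1[OF g(1) g(2)[OF that]] by simp
    qed
    then have sub: "S \<subseteq> B \<inter> N" using SB by auto
    have BN: "subgroup (B \<inter> N) G" using subgroups_Inter_pair[OF B sN] .
    have "card S dvd card (B \<inter> N)" using card_subgroup_dvd[OF SG BN sub] .
    then show ?thesis using S(2) by simp
  qed
  define \<B> where "\<B> = {B. subgroup B G \<and> (\<forall>g\<in>carrier G. \<exists>n\<in>N. n \<otimes> g \<in> B)}"
  have "carrier G \<in> \<B>"
    unfolding \<B>_def by (intro CollectI conjI subgroup_self ballI bexI[OF _ N.one_closed]) simp
  then obtain B where B: "B \<in> \<B>" and minB: "\<And>C. C \<in> \<B> \<Longrightarrow> card B \<le> card C"
    using ex_has_least_nat[of "\<lambda>B. B \<in> \<B>" "carrier G" card] by blast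
  then have sB: "subgroup B G" and BN: "\<And>g. g \<in> carrier G \<Longrightarrow> \<exists>n\<in>N. n \<otimes> g \<in> B" by (auto simp: \<B>_def)
  define M where "M = B \<inter> N"
  have sM: "subgroup M G" unfolding M_def using subgroups_Inter_pair[OF sB sN] .
  have finB: "finite B" using rev_finite_subset[OF fin subgroup.subset[OF sB]] .
  have "M = {\<one>}"
  proof (rule ccontr)
    assume ne: "M \<noteq> {\<one>}"
    have Bc: "x \<in> carrier G" if "x \<in> B" for x using that subgroup.subset[OF sB] by auto
    have MB: "M \<subseteq> B" by (auto simp: M_def)
    have "card M dvd card N" using card_subgroup_dvd[OF sM sN] by (simp add: M_def)
    then obtain c where c: "card M = p ^ c" using cN divides_primepow_nat[OF p] by auto
    define GB where "GB = G\<lparr>carrier := B\<rparr>"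
    define D where "D = derived G M"
    have DM: "D \<subset> M" unfolding D_def by (rule p_group_derived_proper[OF fin p sM c ne])
    interpret GB: group GB unfolding GB_def using sB by (rule subgroup_imp_group)
    have Mn: "M \<lhd> GB"
    proof (rule GB.normal_invI)
      show sMB: "subgroup M GB" unfolding GB_def using subgroup_incl[OF sM sB MB] .
      fix x h assume "x \<in> carrier GB" "h \<in> M"
      then have xh: "x \<in> B" "h \<in> B" "h \<in> N" by (auto simp: GB_def M_def)
      have "x \<otimes> h \<otimes> inv x \<in> N" using xh Bc N.inv_op_closed2 by auto
      moreover have "x \<otimes> h \<otimes> inv x \<in> B" using xh sB by (simp add: subgroup.m_closed subgroup.m_inv_closed)
      moreover have "inv\<^bsub>GB\<^esub> x = inv x" unfolding GB_def using m_inv_consistent[OF sB xh(1)] .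
      ultimately show "x \<otimes>\<^bsub>GB\<^esub> h \<otimes>\<^bsub>GB\<^esub> inv\<^bsub>GB\<^esub> x \<in> M" by (simp add: GB_def M_def)
    qed
    have Dn: "D \<lhd> GB" using GB.derived_is_normal[OF Mn] derived_consistent[OF MB sB] by (simp add: D_def GB_def)
    interpret Mn: normal M GB by fact
    interpret D: normal D GB by fact
    define K where "K = GB Mod D"
    interpret K: group K unfolding K_def by (rule D.factorgroup_is_group)
    define \<pi> where "\<pi> = (\<lambda>b. D #>\<^bsub>GB\<^esub> b)"
    have \<pi>: "\<pi> \<in> hom GB K" unfolding \<pi>_def K_def by (rule D.r_coset_hom_Mod)
    have \<pi>m: "\<pi> (x \<otimes> y) = \<pi> x \<otimes>\<^bsub>K\<^esub> \<pi> y" if "x \<in> B" "y \<in> B" for x y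
      using hom_mult[OF \<pi>, of x y] that by (simp add: GB_def)
    have K_car: "carrier K = \<pi> ` B" by (auto simp: K_def carrier_FactGroup \<pi>_def GB_def)
    have \<pi>1: "\<pi> x = \<one>\<^bsub>K\<^esub> \<longleftrightarrow> x \<in> D" if "x \<in> B" for x
    proof -
      have "\<one>\<^bsub>K\<^esub> = D" by (simp add: K_def)
      moreover have "D #>\<^bsub>GB\<^esub> x = D \<longleftrightarrow> x \<in> D"
        using GB.coset_join1[OF _ _ D.subgroup_axioms] GB.coset_join2[OF _ D.subgroup_axioms] that
        by (auto simp: GB_def)
      ultimately show ?thesis by (simp add: \<pi>_def)
    qed
    have finK: "finite (carrier K)" unfolding K_car using finB by simp
    interpret gh: group_hom GB K \<pi> by unfold_locales (rule \<pi>)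
    have MKn: "\<pi> ` M \<lhd> K"
    proof (rule K.normal_invI)
      show "subgroup (\<pi> ` M) K" using gh.subgroup_img_is_subgroup[OF Mn.subgroup_axioms] .
      fix x h assume "x \<in> carrier K" "h \<in> \<pi> ` M"
      then obtain b m where bm: "b \<in> B" "m \<in> M" "x = \<pi> b" "h = \<pi> m" by (auto simp: K_car)
      have c: "b \<in> carrier GB" "m \<in> carrier GB" using bm MB by (auto simp: GB_def)
      have "x \<otimes>\<^bsub>K\<^esub> h \<otimes>\<^bsub>K\<^esub> inv\<^bsub>K\<^esub> x = \<pi> (b \<otimes>\<^bsub>GB\<^esub> m \<otimes>\<^bsub>GB\<^esub> inv\<^bsub>GB\<^esub> b)"
        using bm c by simp
      moreover have "b \<otimes>\<^bsub>GB\<^esub> m \<otimes>\<^bsub>GB\<^esub> inv\<^bsub>GB\<^esub> b \<in> M" using Mn.inv_op_closed2[of b m] bm by (simp add: GB_def)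
      ultimately show "x \<otimes>\<^bsub>K\<^esub> h \<otimes>\<^bsub>K\<^esub> inv\<^bsub>K\<^esub> x \<in> \<pi> ` M" by simp
    qed
    interpret MK: normal "\<pi> ` M" K by fact
    have MKg: "group (K\<lparr>carrier := \<pi> ` M\<rparr>)" using MK.subgroup_axioms by (rule K.subgroup_imp_group)
    have MKc: "comm_group (K\<lparr>carrier := \<pi> ` M\<rparr>)"
    proof (rule group.group_comm_groupI[OF MKg])
      fix x y assume "x \<in> carrier (K\<lparr>carrier := \<pi> ` M\<rparr>)" "y \<in> carrier (K\<lparr>carrier := \<pi> ` M\<rparr>)"
      then obtain u v where uv: "u \<in> M" "v \<in> M" "x = \<pi> u" "y = \<pi> v" by auto
      define d where "d = u \<otimes> v \<otimes> inv u \<otimes> inv v"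
      have "d \<in> derived_set G M" using uv by (auto simp: d_def)
      then have d: "d \<in> D" unfolding D_def derived_def by (rule generate.incl)
      have uvB: "u \<in> B" "v \<in> B" "d \<in> B" using uv MB d DM by auto
      then have uvc: "u \<in> carrier G" "v \<in> carrier G" using Bc by auto
      have "d \<otimes> (v \<otimes> u) = u \<otimes> v" using uvc by (simp add: d_def m_assoc inv_cancel)
      then have "\<pi> u \<otimes>\<^bsub>K\<^esub> \<pi> v = \<pi> d \<otimes>\<^bsub>K\<^esub> (\<pi> v \<otimes>\<^bsub>K\<^esub> \<pi> u)"
        using uvB sB by (simp add: \<pi>m[symmetric] subgroup.m_closed)
      also have "\<pi> d = \<one>\<^bsub>K\<^esub>" using \<pi>1 d uvB by simp
      finally show "x \<otimes>\<^bsub>K\<lparr>carrier := \<pi> ` M\<rparr>\<^esub> y = y \<otimes>\<^bsub>K\<lparr>carrier := \<pi> ` M\<rparr>\<^esub> x"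
        using uv uvB gh.hom_closed by (simp add: GB_def)
    qed
    have cMD: "card (\<pi> ` M) * card D = card M"
    proof -
      interpret GM: group "G\<lparr>carrier := M\<rparr>" using sM by (rule subgroup_imp_group)
      have "subgroup D G" using incl_subgroup[OF sB] D.subgroup_axioms by (simp add: GB_def)
      then have sD: "subgroup D (G\<lparr>carrier := M\<rparr>)" using subgroup_incl[OF _ sM] DM by blast
      have "rcosets\<^bsub>G\<lparr>carrier := M\<rparr>\<^esub> D = \<pi> ` M" by (auto simp: RCOSETS_def \<pi>_def GB_def)
      then show ?thesis using GM.lagrange[OF sD] by (simp add: order_def)
    qed
    have cM: "card (rcosets\<^bsub>K\<^esub> (\<pi> ` M)) * card M = card B"
    proof -
      have 1: "card (rcosets\<^bsub>K\<^esub> (\<pi> ` M)) * card (\<pi> ` M) = card (rcosets\<^bsub>GB\<^esub> D)"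
        using K.lagrange[OF MK.subgroup_axioms] by (simp add: order_def K_def FactGroup_def)
      have 2: "card (rcosets\<^bsub>GB\<^esub> D) * card D = card B"
        using GB.lagrange[OF D.subgroup_axioms] by (simp add: order_def GB_def)
      show ?thesis using 1 2 cMD by (metis mult.assoc)
    qed
    \<comment> \<open>The index of the image of \<open>M\<close> in \<open>K\<close> equals that of
      \<open>M\<close> in \<open>B\<close>. A factor \<open>p\<close> there would by
      \<open>p_part\<close> give a power of \<open>p\<close> above \<open>p^c\<close> dividing the
      order of \<open>M\<close>.\<close>
    have "\<not> p dvd card (rcosets\<^bsub>K\<^esub> (\<pi> ` M))"
    proof
      assume "p dvd card (rcosets\<^bsub>K\<^esub> (\<pi> ` M))"
      then have "p ^ Suc c dvd card B" unfolding cM[symmetric] c by (simp add: mult_dvd_mono)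
      from p_part[OF sB this] have "p ^ Suc c dvd p ^ c" using c by (simp add: M_def)
      then show False using p by (metis dvd_power_iff_le prime_ge_2_nat Suc_n_not_le_n)
    qed
    then have "coprime (card (rcosets\<^bsub>K\<^esub> (\<pi> ` M))) p" using p by (metis coprime_commute prime_imp_coprime_nat)
    moreover have "card (\<pi> ` M) dvd p ^ c" using cMD c by (metis dvd_triv_left)
    ultimately have "coprime (card (rcosets\<^bsub>K\<^esub> (\<pi> ` M))) (card (\<pi> ` M))"
      by (meson coprime_divisors coprime_power_right_iff dvd_refl)
    then obtain H where H: "subgroup H K" "H \<inter> \<pi> ` M = {\<one>\<^bsub>K\<^esub>}"
        "\<And>g. g \<in> carrier K \<Longrightarrow> \<exists>n\<in>\<pi> ` M. n \<otimes>\<^bsub>K\<^esub> g \<in> H"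
      using K.abelian_normal_complement[OF finK MKn MKc] by blast
    \<comment> \<open>The preimage of the complement still supplements \<open>N\<close>, but it
      misses the elements of \<open>M\<close> outside \<open>D\<close>.\<close>
    define C where "C = {b \<in> B. \<pi> b \<in> H}"
    have "C \<in> \<B>"
      unfolding \<B>_def
    proof (intro CollectI conjI ballI)
      show "subgroup C G"
      proof (rule finite_subgroupI[OF fin])
        show "C \<subseteq> carrier G" using Bc by (auto simp: C_def)
        show "C \<noteq> {}" using subgroup.one_closed[OF sB] subgroup.one_closed[OF H(1)] \<pi>1[of \<one>] D.one_closed
          by (auto simp: C_def GB_def)
        show "x \<otimes> y \<in> C" if "x \<in> C" "y \<in> C" for x y
          using that sB H(1) by (auto simp: C_def \<pi>m intro: subgroup.m_closed)
      qed
      fix g assume g: "g \<in> carrier G"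
      obtain n where n: "n \<in> N" "n \<otimes> g \<in> B" using BN[OF g] by blast
      then obtain m where m: "m \<in> M" "\<pi> m \<otimes>\<^bsub>K\<^esub> \<pi> (n \<otimes> g) \<in> H" using H(3)[of "\<pi> (n \<otimes> g)"] by (auto simp: K_car)
      have mB: "m \<in> B" "m \<in> N" using m by (auto simp: M_def)
      have "m \<otimes> (n \<otimes> g) \<in> C" using m n mB sB by (auto simp: C_def \<pi>m intro: subgroup.m_closed)
      moreover have "m \<otimes> (n \<otimes> g) = (m \<otimes> n) \<otimes> g" using mB n g Bc N.subset by (simp add: m_assoc subsetD)
      ultimately show "\<exists>n\<in>N. n \<otimes> g \<in> C" using mB n N.m_closed by metis
    qed
    then have "card B \<le> card C" by (rule minB)
    moreover have "C \<subset> B"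
    proof -
      obtain m where m: "m \<in> M" "m \<notin> D" using DM by blast
      have "m \<notin> C"
      proof
        assume "m \<in> C"
        then have "\<pi> m = \<one>\<^bsub>K\<^esub>" using H(2) m by (auto simp: C_def)
        then show False using \<pi>1 m MB by blast
      qed
      then show ?thesis using m MB by (auto simp: C_def)
    qed
    ultimately show False using finB psubset_card_mono by (metis leD)
  qed
  have "\<not> p dvd card B"
  proof
    assume "p dvd card B"
    then have "p ^ 1 dvd card (B \<inter> N)" using p_part[OF sB, of 1] by simp
    then show False using \<open>M = {\<one>}\<close> p by (simp add: M_def)
  qed
  then have "coprime p (card B)" using p prime_imp_coprime_nat by blast
  then show ?thesis using that[OF sB _ BN] by blast
qed

section \<open>Groups of bijections\<close>

lemma funpow_closed:
  assumes "f ` Q \<subseteq> Q" "x \<in> Q"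
  shows "(f ^^ k) x \<in> Q"
  using assms by (induction k) auto

lemma funpow_cong_on:
  assumes "f ` Q \<subseteq> Q" "\<And>x. x \<in> Q \<Longrightarrow> f x = g x" "x \<in> Q"
  shows "(f ^^ k) x = (g ^^ k) x"
proof (induction k)
  case (Suc k)
  have "(f ^^ Suc k) x = g ((f ^^ k) x)" using assms(2)[OF funpow_closed[OF assms(1,3)]] by simp
  then show ?case using Suc by simp
qed simp

lemma funpow_mult_id:
  assumes "f ` Q \<subseteq> Q" "\<And>x. x \<in> Q \<Longrightarrow> (f ^^ M) x = x" "x \<in> Q"
  shows "(f ^^ (M * k)) x = x"
proof (induction k)
  case (Suc k)
  have "(f ^^ (M * Suc k)) x = (f ^^ M) ((f ^^ (M * k)) x)" by (simp add: funpow_add)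
  then show ?case using Suc assms by simp
qed simp

lemma funpow_cong_mod:
  assumes "f ` Q \<subseteq> Q" "\<And>x. x \<in> Q \<Longrightarrow> (f ^^ M) x = x" "x \<in> Q" "[k = l] (mod M)"
  shows "(f ^^ k) x = (f ^^ l) x"
proof -
  have "(f ^^ k) x = (f ^^ (k mod M)) x" for k
  proof -
    have "(f ^^ k) x = (f ^^ (k mod M + M * (k div M))) x" by simp
    also have "\<dots> = (f ^^ (k mod M)) x"
      unfolding funpow_add using funpow_mult_id[OF assms(1-3)] by simp
    finally show ?thesis .
  qed
  then show ?thesis using assms(4) by (metis cong_def)
qed

lemma funpow_semiconj:
  assumes "a ` Q \<subseteq> Q" "\<And>x. x \<in> Q \<Longrightarrow> f (a x) = b (f x)" "x \<in> Q"
  shows "f ((a ^^ k) x) = (b ^^ k) (f x)"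
  by (induction k) (use assms funpow_closed[OF assms(1,3)] in auto)

lemma bij_betw_funpow: "bij_betw f Q Q \<Longrightarrow> bij_betw (f ^^ k) Q Q"
proof (induction k)
  case 0
  then show ?case by (simp add: id_def[symmetric])
next
  case (Suc k)
  then show ?case using bij_betw_trans[of "f ^^ k" Q Q f Q] by (simp add: o_def)
qed

lemma BijGroup_simps:
  "carrier (BijGroup Q) = Bij Q" "\<one>\<^bsub>BijGroup Q\<^esub> = (\<lambda>x\<in>Q. x)"
  "f \<in> Bij Q \<Longrightarrow> g \<in> Bij Q \<Longrightarrow> f \<otimes>\<^bsub>BijGroup Q\<^esub> g = compose Q f g"
  by (auto simp: BijGroup_def)

lemma finite_Bij: "finite Q \<Longrightarrow> finite (Bij Q)"
proof -
  assume f: "finite Q"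
  have "Bij Q \<subseteq> Q \<rightarrow>\<^sub>E Q" by (auto simp: Bij_def bij_betw_def PiE_def)
  then show ?thesis using finite_subset finite_PiE[OF f, of "\<lambda>_. Q"] f by blast
qed

lemma restrict_Bij: "bij_betw f Q Q \<Longrightarrow> restrict f Q \<in> Bij Q"
  by (simp add: Bij_def)

lemma BijGroup_pow:
  assumes "f \<in> Bij Q" "x \<in> Q"
  shows "(f [^]\<^bsub>BijGroup Q\<^esub> (k::nat)) x = (f ^^ k) x"
proof -
  interpret B: group "BijGroup Q" by (rule group_BijGroup)
  have f: "f ` Q \<subseteq> Q" using assms(1) by (auto simp: Bij_def bij_betw_def)
  have c: "f [^]\<^bsub>BijGroup Q\<^esub> k \<in> Bij Q" for k :: nat
    using B.nat_pow_closed[of f k] assms(1) by (simp add: BijGroup_simps)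
  show ?thesis using assms(2)
  proof (induction k arbitrary: x)
    case 0
    then show ?case by (simp add: BijGroup_simps)
  next
    case (Suc k)
    have "(f [^]\<^bsub>BijGroup Q\<^esub> Suc k) x = (f [^]\<^bsub>BijGroup Q\<^esub> k) (f x)"
      using c assms(1) Suc.prems by (simp add: BijGroup_simps compose_def)
    then show ?case using Suc.IH[of "f x"] f Suc.prems by (simp add: funpow_swap1 image_subset_iff)
  qed
qed

text \<open>Both parts are powers of \<open>f\<close>, found by the Chinese remainder theorem from
  the order of the symmetric group of \<open>Q\<close>. The congruence \<open>k = 1\<close> modulo
  \<open>M\<close> is a guarantee for restrictions: wherever the order of \<open>f\<close> divides
  \<open>M\<close>, the \<open>p'\<close>-part \<open>f ^^ k\<close> agrees with
  \<open>f\<close>.\<close>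

lemma p_decomposition:
  fixes p :: nat
  assumes fin: "finite Q" and f: "bij_betw f Q Q" and p: "prime p" and M: "coprime M p"
  shows "\<exists>k M' q j. [k = 1] (mod M) \<and> coprime M' p \<and> (\<forall>x\<in>Q. ((f ^^ k) ^^ M') x = x \<and>
    ((f ^^ q) ^^ (p ^ j)) x = x \<and> (f ^^ q) ((f ^^ k) x) = f x)"
proof -
  interpret B: group "BijGroup Q" by (rule group_BijGroup)
  have fQ: "f ` Q \<subseteq> Q" using f by (auto simp: bij_betw_def)
  define N where "N = order (BijGroup Q)"
  have N: "N \<noteq> 0" unfolding N_def using B.order_gt_0_iff_finite finite_Bij[OF fin] by (simp add: BijGroup_simps)
  have id: "(f ^^ N) x = x" if x: "x \<in> Q" for x
  proof -
    have rf: "restrict f Q \<in> Bij Q" using restrict_Bij f by blast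
    have "restrict f Q [^]\<^bsub>BijGroup Q\<^esub> N = (\<lambda>x\<in>Q. x)"
      unfolding N_def using B.pow_order_eq_1[of "restrict f Q"] rf by (simp add: BijGroup_simps)
    then have "(restrict f Q ^^ N) x = x" using BijGroup_pow[OF rf x, of N] x by simp
    moreover have "(restrict f Q ^^ N) x = (f ^^ N) x"
      by (rule funpow_cong_on[of _ Q]) (use fQ x in auto)
    ultimately show ?thesis by simp
  qed
  obtain M' where M': "N = p ^ multiplicity p N * M'" "\<not> p dvd M'"
    using multiplicity_decompose'[of N p] N p not_prime_unit by blast
  define j where "j = multiplicity p N"
  have M'p: "coprime (p ^ j) M'" using M'(2) p by (simp add: prime_imp_coprime_nat)
  have "coprime (p ^ j) (M * M')" using M M'p by (simp add: coprime_commute)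
  \<comment> \<open>The modulus \<open>M * M'\<close> lets one exponent \<open>p ^ j * l\<close>
    serve both purposes: it is 1 modulo \<open>M\<close>, and it is 1 modulo \<open>M'\<close> while
    divisible by \<open>p ^ j\<close>.\<close>
  then obtain l where l: "[p ^ j * l = 1] (mod (M * M'))"
    using cong_solve_coprime_nat[of "p ^ j" "M * M'"] by auto
  obtain r where r: "[M' * r = 1] (mod p ^ j)"
    using cong_solve_coprime_nat[of M' "p ^ j"] M'p by (auto simp: coprime_commute)
  have NM: "N = p ^ j * M'" using M'(1) by (simp add: j_def)
  show ?thesis
  proof (rule exI[of _ "p ^ j * l"], rule exI[of _ M'], rule exI[of _ "M' * r"], rule exI[of _ j],
      intro conjI ballI)
    show "[p ^ j * l = 1] (mod M)" using l cong_dvd_modulus_nat by (metis dvd_triv_left)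
    show "coprime M' p" using M'(2) p by (metis coprime_commute prime_imp_coprime_nat)
    fix x assume x: "x \<in> Q"
    have "(f ^^ (p ^ j * l * M')) x = (f ^^ (N * l)) x" by (simp add: NM mult_ac)
    then show "((f ^^ (p ^ j * l)) ^^ M') x = x"
      using funpow_mult_id[OF fQ id x] by (simp add: funpow_mult)
    have "(f ^^ (M' * r * p ^ j)) x = (f ^^ (N * r)) x" by (simp add: NM mult_ac)
    then show "((f ^^ (M' * r)) ^^ (p ^ j)) x = x"
      using funpow_mult_id[OF fQ id x] by (simp add: funpow_mult)
    have "[M' * r + p ^ j * l = 1 + 0] (mod p ^ j)" using r by (intro cong_add) (auto simp: cong_def)
    moreover have "[p ^ j * l = 1] (mod M')" using l cong_dvd_modulus_nat by (metis dvd_triv_right)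
    then have "[M' * r + p ^ j * l = 0 + 1] (mod M')" by (intro cong_add) (auto simp: cong_def)
    ultimately have "[M' * r + p ^ j * l = 1] (mod N)"
      unfolding NM using M'p by (simp add: coprime_cong_mult_nat)
    then have "(f ^^ (M' * r + p ^ j * l)) x = (f ^^ 1) x"
      using funpow_cong_mod[OF fQ id x] by blast
    then show "(f ^^ (M' * r)) ((f ^^ (p ^ j * l)) x) = f x" by (simp add: funpow_add)
  qed
qed

corollary p_prime_part:
  fixes p :: nat
  assumes "finite Q" "bij_betw f Q Q" "prime p" "coprime M p"
  shows "\<exists>k M'. [k = 1] (mod M) \<and> coprime M' p \<and> (\<forall>x\<in>Q. ((f ^^ k) ^^ M') x = x)"
  using p_decomposition[OF assms] by blast

text \<open>
  Groups of bijections of \<open>Q\<close> are given by predicates on functions that depend only on the values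
  on \<open>Q\<close>; closure under inverses is automatic since \<open>Q\<close> is finite.
\<close>

definition bij_group :: "'a set \<Rightarrow> (('a \<Rightarrow> 'a) \<Rightarrow> bool) \<Rightarrow> bool" where
  "bij_group Q \<beta> \<longleftrightarrow> (\<forall>f. \<beta> f \<longrightarrow> bij_betw f Q Q) \<and> \<beta> (\<lambda>x. x) \<and>
     (\<forall>f g. \<beta> f \<longrightarrow> \<beta> g \<longrightarrow> \<beta> (\<lambda>x. f (g x))) \<and>
     (\<forall>f g. \<beta> f \<longrightarrow> (\<forall>x\<in>Q. f x = g x) \<longrightarrow> \<beta> g)"

definition bij_set :: "'a set \<Rightarrow> (('a \<Rightarrow> 'a) \<Rightarrow> bool) \<Rightarrow> ('a \<Rightarrow> 'a) set" where
  "bij_set Q \<beta> = {f \<in> extensional Q. \<beta> f}"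

text \<open>Up to restriction to \<open>Q\<close>, a \<open>p\<close>-subgroup of the symmetric
  group of \<open>Q\<close>. Products need only agree on \<open>Q\<close>, so that conjugations,
  which are functions on the whole group, can be used as they stand.\<close>

definition p_family :: "nat \<Rightarrow> 'a set \<Rightarrow> ('a \<Rightarrow> 'a) set \<Rightarrow> bool" where
  "p_family p Q A \<longleftrightarrow> A \<noteq> {} \<and> (\<forall>a\<in>A. bij_betw a Q Q) \<and>
     (\<forall>a\<in>A. \<forall>b\<in>A. \<exists>c\<in>A. \<forall>x\<in>Q. c x = a (b x)) \<and>
     (\<forall>a\<in>A. \<exists>k. \<forall>x\<in>Q. (a ^^ (p ^ k)) x = x)"

text \<open>The inclusion of \<open>f A f^-1\<close> in \<open>J\<close>, written without inverses.
  \<open>f\<close> may lead to a different set, on which \<open>J\<close> acts.\<close>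

definition carries :: "'a set \<Rightarrow> ('a \<Rightarrow> 'a) \<Rightarrow> ('a \<Rightarrow> 'a) set \<Rightarrow> ('a \<Rightarrow> 'a) set \<Rightarrow> bool" where
  "carries Q f A J \<longleftrightarrow> (\<forall>a\<in>A. \<exists>j\<in>J. \<forall>x\<in>Q. f (a x) = j (f x))"

text \<open>Sylow's conjugacy property turned into a definition, the form in which arguments about
  extenders need it.\<close>

definition sylow_family :: "nat \<Rightarrow> 'a set \<Rightarrow> (('a \<Rightarrow> 'a) \<Rightarrow> bool) \<Rightarrow> ('a \<Rightarrow> 'a) set \<Rightarrow> bool" where
  "sylow_family p Q \<beta> J \<longleftrightarrow> p_family p Q J \<and> (\<forall>j\<in>J. \<beta> j) \<and>
     (\<forall>A. p_family p Q A \<longrightarrow> (\<forall>a\<in>A. \<beta> a) \<longrightarrow> (\<exists>b. \<beta> b \<and> carries Q b A J))"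

lemma bij_group_subgroup:
  assumes "finite Q" "bij_group Q \<beta>"
  shows "subgroup (bij_set Q \<beta>) (BijGroup Q)"
proof -
  interpret B: group "BijGroup Q" by (rule group_BijGroup)
  have c: "bij_set Q \<beta> \<subseteq> Bij Q" using assms(2) by (auto simp: bij_set_def Bij_def bij_group_def)
  show ?thesis
  proof (rule B.finite_subgroupI)
    show "finite (carrier (BijGroup Q))" using finite_Bij assms(1) by (simp add: BijGroup_simps)
    have "\<beta> (restrict (\<lambda>x. x) Q)" using assms(2) unfolding bij_group_def by (metis restrict_apply')
    then show "bij_set Q \<beta> \<noteq> {}" unfolding bij_set_def by blast
    fix f g assume fg: "f \<in> bij_set Q \<beta>" "g \<in> bij_set Q \<beta>"
    then have "\<beta> (\<lambda>x. f (g x))" using assms(2) by (simp add: bij_group_def bij_set_def)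
    then have "\<beta> (compose Q f g)" using assms(2) unfolding bij_group_def compose_def by (metis restrict_apply')
    then show "f \<otimes>\<^bsub>BijGroup Q\<^esub> g \<in> bij_set Q \<beta>" using fg c by (simp add: BijGroup_simps bij_set_def subset_iff)
  qed (use c in \<open>simp add: BijGroup_simps\<close>)
qed

lemma p_family_restrict:
  assumes "finite Q" "p_family p Q A" "prime p"
  shows "subgroup ((\<lambda>a. restrict a Q) ` A) (BijGroup Q)" "\<exists>k. card ((\<lambda>a. restrict a Q) ` A) = p ^ k"
proof -
  interpret B: group "BijGroup Q" by (rule group_BijGroup)
  let ?A = "(\<lambda>a. restrict a Q) ` A"
  have bij: "bij_betw a Q Q" if "a \<in> A" for a using that assms(2) by (simp add: p_family_def)
  then have c: "?A \<subseteq> Bij Q" using restrict_Bij by blast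
  show s: "subgroup ?A (BijGroup Q)"
  proof (rule B.finite_subgroupI)
    show "finite (carrier (BijGroup Q))" using finite_Bij assms(1) by (simp add: BijGroup_simps)
    show "?A \<noteq> {}" using assms(2) by (simp add: p_family_def)
    fix f g assume "f \<in> ?A" "g \<in> ?A"
    then obtain a b where ab: "a \<in> A" "b \<in> A" "f = restrict a Q" "g = restrict b Q" by auto
    then obtain d where d: "d \<in> A" "\<forall>x\<in>Q. d x = a (b x)" using assms(2) unfolding p_family_def by blast
    have "b x \<in> Q" if "x \<in> Q" for x using bij[OF ab(2)] that by (auto simp: bij_betw_def)
    then have "compose Q f g = restrict d Q" using ab d by (auto simp: compose_def)
    moreover have "f \<otimes>\<^bsub>BijGroup Q\<^esub> g = compose Q f g"
      by (rule BijGroup_simps(3)) (use ab bij restrict_Bij in auto)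
    ultimately show "f \<otimes>\<^bsub>BijGroup Q\<^esub> g \<in> ?A" using d(1) by auto
  qed (use c in \<open>simp add: BijGroup_simps\<close>)
  interpret A: group "BijGroup Q\<lparr>carrier := ?A\<rparr>" using s by (rule B.subgroup_imp_group)
  have "\<exists>k. order (BijGroup Q\<lparr>carrier := ?A\<rparr>) = p ^ k"
  proof (rule A.card_prime_power[OF _ assms(3)])
    show "finite (carrier (BijGroup Q\<lparr>carrier := ?A\<rparr>))"
      using finite_subset[OF c finite_Bij[OF assms(1)]] by simp
    fix f assume "f \<in> carrier (BijGroup Q\<lparr>carrier := ?A\<rparr>)"
    then obtain a where a: "a \<in> A" "f = restrict a Q" by auto
    then obtain k where k: "\<forall>x\<in>Q. (a ^^ (p ^ k)) x = x" using assms(2) unfolding p_family_def by blast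
    have fB: "f \<in> Bij Q" using a bij restrict_Bij by blast
    have "f [^]\<^bsub>BijGroup Q\<^esub> (p ^ k) = (\<lambda>x\<in>Q. x)"
    proof (rule extensionalityI[of _ Q])
      show "f [^]\<^bsub>BijGroup Q\<^esub> (p ^ k) \<in> extensional Q"
        using B.nat_pow_closed[of f "p ^ k"] fB by (simp add: BijGroup_simps Bij_def)
      fix x assume x: "x \<in> Q"
      have "(f [^]\<^bsub>BijGroup Q\<^esub> (p ^ k)) x = (f ^^ (p ^ k)) x" by (rule BijGroup_pow[OF fB x])
      also have "\<dots> = (a ^^ (p ^ k)) x"
        by (rule funpow_cong_on[of _ Q]) (use a x bij[OF a(1)] in \<open>auto simp: bij_betw_def\<close>)
      finally show "(f [^]\<^bsub>BijGroup Q\<^esub> (p ^ k)) x = (\<lambda>x\<in>Q. x) x" using k x by simp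
    qed auto
    then show "\<exists>k. f [^]\<^bsub>BijGroup Q\<lparr>carrier := ?A\<rparr>\<^esub> (p ^ k) = \<one>\<^bsub>BijGroup Q\<lparr>carrier := ?A\<rparr>\<^esub>"
      by (auto simp: BijGroup_simps B.nat_pow_consistent[symmetric] intro!: exI[of _ k])
  qed
  then show "\<exists>k. card ?A = p ^ k" by (simp add: order_def)
qed

lemma bij_set_sub:
  assumes "bij_group Q \<beta>" "\<forall>a\<in>A. \<beta> a"
  shows "(\<lambda>a. restrict a Q) ` A \<subseteq> bij_set Q \<beta>"
  using assms by (auto simp: bij_set_def bij_group_def)

lemma sylow_familyI:
  assumes fin: "finite Q" and p: "prime p" and \<beta>: "bij_group Q \<beta>"
    and J: "p_family p Q J" "\<forall>j\<in>J. \<beta> j"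
    and idx: "\<not> p dvd card (bij_set Q \<beta>) div card ((\<lambda>a. restrict a Q) ` J)"
  shows "sylow_family p Q \<beta> J"
  unfolding sylow_family_def
proof (intro conjI allI impI J)
  interpret B: group "BijGroup Q" by (rule group_BijGroup)
  let ?K = "BijGroup Q\<lparr>carrier := bij_set Q \<beta>\<rparr>"
  have sB: "subgroup (bij_set Q \<beta>) (BijGroup Q)" using bij_group_subgroup[OF fin \<beta>] .
  interpret K: group ?K using sB by (rule B.subgroup_imp_group)
  have c: "bij_set Q \<beta> \<subseteq> Bij Q" using \<beta> by (auto simp: bij_set_def Bij_def bij_group_def)
  have finK: "finite (carrier ?K)" using finite_subset[OF c finite_Bij[OF fin]] by simp
  fix A assume A: "p_family p Q A" "\<forall>a\<in>A. \<beta> a"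
  obtain k where k: "card ((\<lambda>a. restrict a Q) ` A) = p ^ k" using p_family_restrict[OF fin A(1) p] by blast
  have JK: "subgroup ((\<lambda>a. restrict a Q) ` J) ?K"
    using B.subgroup_incl[OF p_family_restrict(1)[OF fin J(1) p] sB bij_set_sub[OF \<beta> J(2)]] .
  have AK: "subgroup ((\<lambda>a. restrict a Q) ` A) ?K"
    using B.subgroup_incl[OF p_family_restrict(1)[OF fin A(1) p] sB bij_set_sub[OF \<beta> A(2)]] .
  obtain b where b: "b \<in> carrier ?K" "\<And>a. a \<in> (\<lambda>a. restrict a Q) ` A \<Longrightarrow>
      b \<otimes>\<^bsub>?K\<^esub> a \<otimes>\<^bsub>?K\<^esub> inv\<^bsub>?K\<^esub> b \<in> (\<lambda>a. restrict a Q) ` J"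
    by (rule K.sylow_conj[OF finK p JK _ AK k]) (use idx in \<open>auto simp: order_def\<close>)
  show "\<exists>b. \<beta> b \<and> carries Q b A J"
    unfolding carries_def
  proof (intro exI[of _ b] conjI ballI)
    show "\<beta> b" using b(1) by (simp add: bij_set_def)
    fix a assume a: "a \<in> A"
    obtain j where j: "j \<in> J" "b \<otimes>\<^bsub>?K\<^esub> restrict a Q \<otimes>\<^bsub>?K\<^esub> inv\<^bsub>?K\<^esub> b = restrict j Q"
      using b(2)[of "restrict a Q"] a by blast
    have ac: "restrict a Q \<in> carrier ?K" using subgroup.subset[OF AK] a by auto
    have "b \<otimes>\<^bsub>?K\<^esub> restrict a Q = restrict j Q \<otimes>\<^bsub>?K\<^esub> b"
      unfolding j(2)[symmetric] using ac b(1) by (simp only: K.m_assoc K.m_closed K.inv_closed K.l_inv K.r_one)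
    moreover have "restrict j Q \<in> Bij Q" "restrict a Q \<in> Bij Q" "b \<in> Bij Q"
      using J(2) j(1) c ac b(1) bij_set_sub[OF \<beta> J(2)] by auto
    ultimately have e: "compose Q b (restrict a Q) = compose Q (restrict j Q) b"
      by (simp add: BijGroup_simps)
    have "b (a x) = j (b x)" if x: "x \<in> Q" for x
    proof -
      have "b x \<in> Q" using \<open>b \<in> Bij Q\<close> x by (auto simp: Bij_def bij_betw_def)
      then show ?thesis using fun_cong[OF e, of x] x by (simp add: compose_def)
    qed
    then show "\<exists>j\<in>J. \<forall>x\<in>Q. b (a x) = j (b x)" using j(1) by blast
  qed
qed

lemma sylow_family_exists:
  assumes fin: "finite Q" and p: "prime p" and \<beta>: "bij_group Q \<beta>"
  obtains J where "sylow_family p Q \<beta> J"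
proof -
  interpret B: group "BijGroup Q" by (rule group_BijGroup)
  let ?K = "BijGroup Q\<lparr>carrier := bij_set Q \<beta>\<rparr>"
  have sB: "subgroup (bij_set Q \<beta>) (BijGroup Q)" using bij_group_subgroup[OF fin \<beta>] .
  interpret K: group ?K using sB by (rule B.subgroup_imp_group)
  have c: "bij_set Q \<beta> \<subseteq> Bij Q" using \<beta> by (auto simp: bij_set_def Bij_def bij_group_def)
  have finK: "finite (carrier ?K)" using finite_subset[OF c finite_Bij[OF fin]] by simp
  define N where "N = card (bij_set Q \<beta>)"
  have N0: "N \<noteq> 0" using K.order_gt_0_iff_finite finK by (simp add: N_def order_def del: card_eq_0_iff card_0_eq)
  obtain m where m: "N = p ^ multiplicity p N * m" "\<not> p dvd m"
    using multiplicity_decompose'[of N p] N0 p not_prime_unit by blast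
  obtain J where J: "subgroup J ?K" "card J = p ^ multiplicity p N"
    using sylow_thm[OF p K.is_group _ finK, of "multiplicity p N" m] m(1) by (auto simp: order_def N_def)
  have JB: "J \<subseteq> bij_set Q \<beta>" using subgroup.subset[OF J(1)] by simp
  have r: "restrict a Q = a" if "a \<in> J" for a using JB that by (auto simp: bij_set_def extensional_restrict)
  have rJ: "(\<lambda>a. restrict a Q) ` J = J" using r by force
  interpret J: group "?K\<lparr>carrier := J\<rparr>" using J(1) by (rule K.subgroup_imp_group)
  have pf: "p_family p Q J"
    unfolding p_family_def
  proof (intro conjI ballI)
    show "J \<noteq> {}" using subgroup.one_closed[OF J(1)] by auto
    show "bij_betw a Q Q" if "a \<in> J" for a using JB c that by (auto simp: Bij_def)
    fix a assume a: "a \<in> J"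
    have aB: "a \<in> Bij Q" using a JB c by auto
    have "a [^]\<^bsub>?K\<lparr>carrier := J\<rparr>\<^esub> order (?K\<lparr>carrier := J\<rparr>) = \<one>\<^bsub>?K\<lparr>carrier := J\<rparr>\<^esub>"
      by (rule J.pow_order_eq_1) (use a in simp)
    then have "a [^]\<^bsub>BijGroup Q\<^esub> (p ^ multiplicity p N) = (\<lambda>x\<in>Q. x)"
      using J(2) by (simp add: order_def K.nat_pow_consistent[symmetric] B.nat_pow_consistent[symmetric] BijGroup_simps)
    then have "\<forall>x\<in>Q. (a ^^ (p ^ multiplicity p N)) x = x" using BijGroup_pow[OF aB] by (metis restrict_apply')
    then show "\<exists>k. \<forall>x\<in>Q. (a ^^ (p ^ k)) x = x" by blast
    fix b assume b: "b \<in> J"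
    have "a \<otimes>\<^bsub>?K\<^esub> b \<in> J" using subgroup.m_closed[OF J(1) a b] .
    moreover have "a \<otimes>\<^bsub>?K\<^esub> b = compose Q a b" using a b JB c by (simp add: BijGroup_simps subset_iff)
    ultimately show "\<exists>c\<in>J. \<forall>x\<in>Q. c x = a (b x)" by (metis compose_eq)
  qed
  have pos: "p ^ multiplicity p N > 0" using p by (simp add: prime_gt_0_nat)
  have "sylow_family p Q \<beta> J"
  proof (rule sylow_familyI[OF fin p \<beta> pf])
    show "\<forall>j\<in>J. \<beta> j" using JB by (auto simp: bij_set_def)
    have "card (bij_set Q \<beta>) div card J = m" using m(1) J(2) pos by (metis N_def nonzero_mult_div_cancel_left less_irrefl)
    then show "\<not> p dvd card (bij_set Q \<beta>) div card ((\<lambda>a. restrict a Q) ` J)" using rJ m(2) by simp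
  qed
  then show ?thesis by (rule that)
qed

text \<open>A Sylow subgroup stays Sylow in every smaller group that contains it, because the new
  index divides the old one. This transfers full automization to good automorphisms and to the
  automorphisms of a subsystem.\<close>

lemma not_dvd_index_subgroup:
  assumes fin: "finite Q" and p: "prime p" and \<beta>: "bij_group Q \<beta>" and \<gamma>: "bij_group Q \<gamma>"
    and sub: "\<And>f. \<gamma> f \<Longrightarrow> \<beta> f" and J: "p_family p Q J" "\<forall>j\<in>J. \<gamma> j"
    and idx: "\<not> p dvd card (bij_set Q \<beta>) div card ((\<lambda>a. restrict a Q) ` J)"
  shows "\<not> p dvd card (bij_set Q \<gamma>) div card ((\<lambda>a. restrict a Q) ` J)"
proof -
  interpret B: group "BijGroup Q" by (rule group_BijGroup)
  let ?J = "(\<lambda>a. restrict a Q) ` J"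
  have 1: "card (bij_set Q \<gamma>) dvd card (bij_set Q \<beta>)"
    by (rule B.card_subgroup_dvd) (use bij_group_subgroup[OF fin] \<beta> \<gamma> sub in \<open>auto simp: bij_set_def\<close>)
  have 2: "card ?J dvd card (bij_set Q \<gamma>)"
    by (rule B.card_subgroup_dvd)
      (use bij_group_subgroup[OF fin \<gamma>] p_family_restrict(1)[OF fin J(1) p] bij_set_sub[OF \<gamma> J(2)] in auto)
  have "card (bij_set Q \<gamma>) div card ?J dvd card (bij_set Q \<beta>) div card ?J"
    using 1 2 dvd_trans[OF 2 1] by (simp add: div_dvd_div)
  then show ?thesis using idx dvd_trans by blast
qed

lemma carriesD: "carries Q f A J \<Longrightarrow> a \<in> A \<Longrightarrow> \<exists>j\<in>J. \<forall>x\<in>Q. f (a x) = j (f x)"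
  by (simp add: carries_def)

lemma carries_comp:
  assumes "carries Q f A B" "carries R g B C" "f ` Q \<subseteq> R"
  shows "carries Q (\<lambda>x. g (f x)) A C"
  using assms unfolding carries_def by (metis image_subset_iff)

definition conjugated :: "'a set \<Rightarrow> ('a \<Rightarrow> 'a) \<Rightarrow> ('a \<Rightarrow> 'a) \<Rightarrow> 'a \<Rightarrow> 'a" where
  "conjugated Q f a y = f (a (inv_into Q f y))"

lemma conjugated_apply: "inj_on f Q \<Longrightarrow> x \<in> Q \<Longrightarrow> conjugated Q f a (f x) = f (a x)"
  by (simp add: conjugated_def)

lemma p_family_conjugated:
  assumes A: "p_family p Q A" and f: "inj_on f Q"
  shows "p_family p (f ` Q) (conjugated Q f ` A)" "carries Q f A (conjugated Q f ` A)"
proof -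
  have bij: "bij_betw a Q Q" if "a \<in> A" for a using that A by (simp add: p_family_def)
  then have aQ: "a x \<in> Q" if "a \<in> A" "x \<in> Q" for a x using that by (auto simp: bij_betw_def)
  note ca = conjugated_apply[OF f]
  show "carries Q f A (conjugated Q f ` A)" by (auto simp: carries_def ca)
  show "p_family p (f ` Q) (conjugated Q f ` A)"
    unfolding p_family_def
  proof (intro conjI ballI)
    show "conjugated Q f ` A \<noteq> {}" using A by (simp add: p_family_def)
    fix a' assume "a' \<in> conjugated Q f ` A"
    then obtain a where a: "a \<in> A" "a' = conjugated Q f a" by auto
    have "bij_betw (f \<circ> (a \<circ> inv_into Q f)) (f ` Q) (f ` Q)"
      by (intro bij_betw_trans[of _ _ Q] bij_betw_trans[of "inv_into Q f" "f ` Q" Q a Q] bij[OF a(1)]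
          bij_betw_inv_into) (use f in \<open>auto simp: bij_betw_def\<close>)
    moreover have "f \<circ> (a \<circ> inv_into Q f) = a'" by (simp add: a conjugated_def fun_eq_iff)
    ultimately show "bij_betw a' (f ` Q) (f ` Q)" by simp
    obtain k where k: "\<forall>x\<in>Q. (a ^^ (p ^ k)) x = x" using A a(1) unfolding p_family_def by blast
    have "(a' ^^ (p ^ k)) (f x) = f x" if x: "x \<in> Q" for x
    proof -
      have "f ((a ^^ (p ^ k)) x) = (a' ^^ (p ^ k)) (f x)"
        by (rule funpow_semiconj[of a Q]) (use aQ[OF a(1)] ca a(2) x in auto)
      then show ?thesis using k x by simp
    qed
    then show "\<exists>k. \<forall>x\<in>f ` Q. (a' ^^ (p ^ k)) x = x" by blast
    fix b' assume "b' \<in> conjugated Q f ` A"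
    then obtain b where b: "b \<in> A" "b' = conjugated Q f b" by auto
    obtain c where c: "c \<in> A" "\<forall>x\<in>Q. c x = a (b x)" using A a(1) b(1) unfolding p_family_def by blast
    have "\<forall>x\<in>f ` Q. conjugated Q f c x = a' (b' x)" using a b c aQ by (auto simp: ca)
    then show "\<exists>c\<in>conjugated Q f ` A. \<forall>x\<in>f ` Q. c x = a' (b' x)" using c(1) by blast
  qed
qed

section \<open>Fusion systems as predicates\<close>

context group
begin

definition cj :: "'a \<Rightarrow> 'a \<Rightarrow> 'a" where
  "cj g x = inv g \<otimes> x \<otimes> g"

definition nrm :: "'a set \<Rightarrow> 'a set \<Rightarrow> 'a set" where
  "nrm S Q = {g \<in> S. cj g ` Q = Q}"

lemma cj_closed [simp]: "g \<in> carrier G \<Longrightarrow> x \<in> carrier G \<Longrightarrow> cj g x \<in> carrier G"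
  by (simp add: cj_def)

lemma cj_mult:
  "g \<in> carrier G \<Longrightarrow> x \<in> carrier G \<Longrightarrow> y \<in> carrier G \<Longrightarrow> cj g (x \<otimes> y) = cj g x \<otimes> cj g y"
  by (simp add: cj_def m_assoc inv_cancel)

lemma cj_cj:
  "g \<in> carrier G \<Longrightarrow> h \<in> carrier G \<Longrightarrow> x \<in> carrier G \<Longrightarrow> cj h (cj g x) = cj (g \<otimes> h) x"
  by (simp add: cj_def m_assoc inv_mult_group)

lemma cj_one [simp]: "x \<in> carrier G \<Longrightarrow> cj \<one> x = x"
  by (simp add: cj_def)

lemma cj_cancel:
  "g \<in> carrier G \<Longrightarrow> x \<in> carrier G \<Longrightarrow> cj g (cj (inv g) x) = x"
  "g \<in> carrier G \<Longrightarrow> x \<in> carrier G \<Longrightarrow> cj (inv g) (cj g x) = x"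
  by (simp_all add: cj_cj)

lemma cj_fixes_iff:
  "g \<in> carrier G \<Longrightarrow> x \<in> carrier G \<Longrightarrow> cj g x = x \<longleftrightarrow> g \<otimes> x = x \<otimes> g"
  by (metis cj_def inv_solve_left m_closed m_assoc inv_closed)

lemma cj_inj: "g \<in> carrier G \<Longrightarrow> Q \<subseteq> carrier G \<Longrightarrow> inj_on (cj g) Q"
  by (rule inj_on_inverseI[of _ "cj (inv g)"]) (auto simp: cj_cancel)

lemma cj_funpow: "g \<in> carrier G \<Longrightarrow> x \<in> carrier G \<Longrightarrow> (cj g ^^ k) x = cj (g [^] k) x"
proof (induction k)
  case (Suc k)
  then show ?case by (simp add: cj_cj)
qed simp

lemma nrm_subgroup:
  assumes S: "subgroup S G" and Q: "Q \<subseteq> carrier G"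
  shows "subgroup (nrm S Q) G"
proof
  have Sc: "g \<in> carrier G" if "g \<in> S" for g using that subgroup.subset[OF S] by auto
  show "nrm S Q \<subseteq> carrier G" using Sc by (auto simp: nrm_def)
  show "\<one> \<in> nrm S Q" using subgroup.one_closed[OF S] Q by (auto simp: nrm_def subset_iff image_def)
  fix g assume g: "g \<in> nrm S Q"
  then have gS: "g \<in> S" "cj g ` Q = Q" by (auto simp: nrm_def)
  have "cj (inv g) ` Q = cj (inv g) ` (cj g ` Q)" using gS by simp
  also have "\<dots> = Q" using Q Sc[OF gS(1)] by (force simp: cj_cancel image_image)
  finally show "inv g \<in> nrm S Q" using gS subgroup.m_inv_closed[OF S] by (auto simp: nrm_def)
  fix h assume h: "h \<in> nrm S Q"
  then have hS: "h \<in> S" "cj h ` Q = Q" by (auto simp: nrm_def)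
  have "cj (g \<otimes> h) ` Q = cj h ` (cj g ` Q)"
    using Q Sc[OF gS(1)] Sc[OF hS(1)] by (auto simp: cj_cj image_image subset_iff intro!: image_cong)
  then show "g \<otimes> h \<in> nrm S Q" using gS hS subgroup.m_closed[OF S] by (auto simp: nrm_def)
qed

lemma nrmI:
  assumes "finite Q" "Q \<subseteq> carrier G" "g \<in> S" "g \<in> carrier G" "\<And>x. x \<in> Q \<Longrightarrow> cj g x \<in> Q"
  shows "g \<in> nrm S Q"
proof -
  have "card (cj g ` Q) = card Q" using cj_inj assms card_image by blast
  then have "cj g ` Q = Q" using assms by (intro card_subset_eq) auto
  then show ?thesis using assms by (simp add: nrm_def)
qed

lemma nrmD: "g \<in> nrm S Q \<Longrightarrow> g \<in> S" "g \<in> nrm S Q \<Longrightarrow> x \<in> Q \<Longrightarrow> cj g x \<in> Q"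
  by (auto simp: nrm_def)

lemma nrm_self: "subgroup Q G \<Longrightarrow> finite Q \<Longrightarrow> Q \<subseteq> S \<Longrightarrow> Q \<subseteq> nrm S Q"
  by (auto intro!: nrmI simp: cj_def subgroup.m_closed subgroup.m_inv_closed dest: subgroup.mem_carrier)

end

locale finite_p_group = group G for G (structure) +
  fixes p n :: nat
  assumes p: "prime p" and fin: "finite (carrier G)" and order_G: "order G = p ^ n"
begin

lemma finS: "subgroup Q G \<Longrightarrow> finite Q"
  using rev_finite_subset[OF fin subgroup.subset] .

lemma subgroup_card: "subgroup Q G \<Longrightarrow> \<exists>k. card Q = p ^ k"
  using card_subgroup_dvd[OF _ subgroup_self subgroup.subset] divides_primepow_nat[OF p] order_G
  by (metis order_def)

lemma pow_pn: "x \<in> carrier G \<Longrightarrow> x [^] (p ^ n) = \<one>"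
  using pow_order_eq_1[of x] order_G by simp

lemma nrm_grows:
  assumes R: "subgroup R G" and S: "subgroup S G" and RS: "R \<subset> S"
  shows "R \<subset> nrm S R"
proof -
  obtain k where k: "card S = p ^ k" using subgroup_card S by blast
  obtain g where g: "g \<in> S" "g \<notin> R" and gR: "\<And>r. r \<in> R \<Longrightarrow> g \<otimes> r \<otimes> inv g \<in> R"
    using normalizer_grows[OF fin p R S k RS] by blast
  have gc: "g \<in> carrier G" using g S subgroup.subset by blast
  have "inv g \<in> nrm S R"
    by (rule nrmI) (use finS[OF R] subgroup.subset[OF R] gc gR g subgroup.m_inv_closed[OF S] in \<open>auto simp: cj_def\<close>)
  then have "g \<in> nrm S R"
    using subgroup.m_inv_closed[OF nrm_subgroup[OF S subgroup.subset[OF R]]] gc by fastforce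
  then show ?thesis using g nrm_self[OF R finS[OF R], of S] RS by blast
qed

lemma conj_family:
  assumes X: "subgroup X G" and Q: "Q \<subseteq> carrier G" and XQ: "\<And>g. g \<in> X \<Longrightarrow> cj g ` Q = Q"
  shows "p_family p Q (cj ` X)"
  unfolding p_family_def
proof (intro conjI ballI)
  have Xc: "g \<in> carrier G" if "g \<in> X" for g using that subgroup.subset[OF X] by auto
  show "cj ` X \<noteq> {}" using subgroup.one_closed[OF X] by auto
  fix a assume "a \<in> cj ` X"
  then obtain g where g: "g \<in> X" "a = cj g" by auto
  show "bij_betw a Q Q" using cj_inj[OF Xc Q] g XQ by (simp add: bij_betw_def)
  have "\<forall>x\<in>Q. (a ^^ (p ^ n)) x = x"
    using g Xc Q by (auto simp: cj_funpow pow_pn subset_iff)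
  then show "\<exists>k. \<forall>x\<in>Q. (a ^^ (p ^ k)) x = x" by blast
  fix b assume "b \<in> cj ` X"
  then obtain h where h: "h \<in> X" "b = cj h" by auto
  show "\<exists>c\<in>cj ` X. \<forall>x\<in>Q. c x = a (b x)"
    using g h Xc Q by (intro bexI[of _ "cj (h \<otimes> g)"]) (auto simp: cj_cj subset_iff subgroup.m_closed[OF X])
qed

lemma fixed_mod_funpow:
  assumes X: "subgroup X G" and R: "subgroup R G" and RX: "R \<subseteq> X"
    and d: "d ` X \<subseteq> X" "\<And>x y. x \<in> X \<Longrightarrow> y \<in> X \<Longrightarrow> d (x \<otimes> y) = d x \<otimes> d y"
    and fx: "\<And>r. r \<in> R \<Longrightarrow> d r = r" and x: "x \<in> X" and z: "z \<in> R" "d x = x \<otimes> z"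
  shows "(d ^^ k) x = x \<otimes> z [^] k"
proof (induction k)
  case (Suc k)
  have zc: "z \<in> carrier G" "x \<in> carrier G" using z x X R by (auto dest: subgroup.mem_carrier)
  have zk: "z [^] k \<in> R" using z R by (induction k) (auto simp: subgroup.one_closed subgroup.m_closed)
  have "(d ^^ Suc k) x = d (x \<otimes> z [^] k)" using Suc by simp
  also have "\<dots> = x \<otimes> z \<otimes> z [^] k" using d(2)[OF x, of "z [^] k"] zk RX fx z(2) by (simp add: subsetD)
  also have "\<dots> = x \<otimes> z [^] Suc k" using zc nat_pow_Suc2[of z k] by (simp add: m_assoc)
  finally show ?case .
qed (use x X in \<open>auto dest: subgroup.mem_carrier\<close>)

text \<open>Write \<open>d x = x z\<close> with \<open>z\<close> in \<open>R\<close>. As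
  \<open>d\<close> fixes \<open>R\<close> pointwise, \<open>d ^^ M\<close> multiplies
  \<open>x\<close> by \<open>z^M\<close>; so the order of \<open>z\<close> divides both
  \<open>M\<close> and a power of \<open>p\<close>.\<close>

lemma p'_automorphism_trivial:
  assumes X: "subgroup X G" and R: "subgroup R G" and RX: "R \<subseteq> X"
    and d: "d ` X \<subseteq> X" "\<And>x y. x \<in> X \<Longrightarrow> y \<in> X \<Longrightarrow> d (x \<otimes> y) = d x \<otimes> d y"
    and fx: "\<And>r. r \<in> R \<Longrightarrow> d r = r" and mod: "\<And>x. x \<in> X \<Longrightarrow> inv x \<otimes> d x \<in> R"
    and pow: "\<And>x. x \<in> X \<Longrightarrow> (d ^^ M) x = x" and M: "coprime M p" and x: "x \<in> X"
  shows "d x = x"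
proof -
  define z where "z = inv x \<otimes> d x"
  have zR: "z \<in> R" using mod x by (simp add: z_def)
  have zc: "z \<in> carrier G" "x \<in> carrier G" "d x \<in> carrier G"
    using zR x d X R by (auto dest: subgroup.mem_carrier)
  have dx: "d x = x \<otimes> z" using zc by (simp add: z_def m_assoc[symmetric])
  have "z [^] M = \<one>"
    using fixed_mod_funpow[OF X R RX d fx x zR dx, of M] pow[OF x] zc by (metis l_cancel_one nat_pow_closed)
  then have "ord z dvd M" using pow_eq_id zc by blast
  moreover have "ord z dvd p ^ n" using pow_eq_id zc pow_pn by blast
  moreover have "coprime M (p ^ n)" using M by simp
  ultimately have "ord z = 1" by (metis coprime_common_divisor_nat)
  then have "z = \<one>" using ord_eq_1 zc by blast
  then show ?thesis using dx zc by simp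
qed

end

text \<open>
  \<open>m Q f\<close> means that the restriction of \<open>f\<close> to \<open>Q\<close> is a morphism from \<open>Q\<close> to \<open>S\<close>; the values of
  \<open>f\<close> outside \<open>Q\<close> are irrelevant.
\<close>

locale fusion = finite_p_group +
  fixes S :: "'a set" and m :: "'a set \<Rightarrow> ('a \<Rightarrow> 'a) \<Rightarrow> bool"
  assumes S: "subgroup S G"
    and dom: "\<And>Q f. m Q f \<Longrightarrow> subgroup Q G" "\<And>Q f. m Q f \<Longrightarrow> Q \<subseteq> S"
    and img: "\<And>Q f. m Q f \<Longrightarrow> f ` Q \<subseteq> S"
    and inj: "\<And>Q f. m Q f \<Longrightarrow> inj_on f Q"
    and mult: "\<And>Q f x y. m Q f \<Longrightarrow> x \<in> Q \<Longrightarrow> y \<in> Q \<Longrightarrow> f (x \<otimes> y) = f x \<otimes> f y"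
    and cong: "\<And>Q f g. m Q f \<Longrightarrow> (\<And>x. x \<in> Q \<Longrightarrow> f x = g x) \<Longrightarrow> m Q g"
    and comp: "\<And>Q f g. m Q f \<Longrightarrow> m (f ` Q) g \<Longrightarrow> m Q (\<lambda>x. g (f x))"
    and restr: "\<And>Q Q' f. m Q f \<Longrightarrow> subgroup Q' G \<Longrightarrow> Q' \<subseteq> Q \<Longrightarrow> m Q' f"
    and inverse: "\<And>Q f. m Q f \<Longrightarrow> m (f ` Q) (inv_into Q f)"
    and conj_S: "\<And>g. g \<in> S \<Longrightarrow> m S (cj g)"
begin

lemma Sc: "x \<in> S \<Longrightarrow> x \<in> carrier G"
  using subgroup.subset[OF S] by auto

lemma subS: "Q \<subseteq> S \<Longrightarrow> Q \<subseteq> carrier G"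
  using subgroup.subset[OF S] by auto

lemma car: "m Q f \<Longrightarrow> x \<in> Q \<Longrightarrow> x \<in> carrier G" "m Q f \<Longrightarrow> x \<in> Q \<Longrightarrow> f x \<in> carrier G"
  using dom img Sc by blast+

lemma finQ: "m Q f \<Longrightarrow> finite Q"
  using finS dom by blast

lemma conj: "g \<in> S \<Longrightarrow> subgroup Q G \<Longrightarrow> Q \<subseteq> S \<Longrightarrow> m Q (cj g)"
  using restr conj_S by blast

lemma ident: "subgroup Q G \<Longrightarrow> Q \<subseteq> S \<Longrightarrow> m Q (\<lambda>x. x)"
  by (rule cong[OF conj[OF subgroup.one_closed[OF S]]]) (use Sc in auto)

lemma cardQ: "m Q f \<Longrightarrow> card (f ` Q) = card Q"
  using inj card_image by blast

lemma one: "m Q f \<Longrightarrow> f \<one> = \<one>"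
  using mult[of Q f \<one> \<one>] dom(1)[of Q f] car[of Q f \<one>] subgroup.one_closed by (metis l_cancel_one one_closed r_one)

lemma inv: "m Q f \<Longrightarrow> x \<in> Q \<Longrightarrow> f (inv x) = inv (f x)"
proof -
  assume a: "m Q f" "x \<in> Q"
  have i: "inv x \<in> Q" using a dom subgroup.m_inv_closed by metis
  have "f (inv x) \<otimes> f x = \<one>" using mult[OF a(1) i a(2)] one[OF a(1)] car[OF a] by simp
  then show ?thesis using inv_equality car a i by metis
qed

lemma image: "m Q f \<Longrightarrow> subgroup (f ` Q) G"
  using inverse dom by blast

lemma image_sub:
  assumes "m Q f" "subgroup U G" "U \<subseteq> Q"
  shows "subgroup (f ` U) G"
  using image[OF restr[OF assms]] .

lemma m_cj: "m Q f \<Longrightarrow> g \<in> Q \<Longrightarrow> x \<in> Q \<Longrightarrow> f (cj g x) = cj (f g) (f x)"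
  unfolding cj_def using mult inv dom(1)
  by (metis subgroup.m_closed subgroup.m_inv_closed)

lemma inv_f: "m Q f \<Longrightarrow> x \<in> Q \<Longrightarrow> inv_into Q f (f x) = x"
  using inj by simp

lemma comp': "m Q f \<Longrightarrow> m R g \<Longrightarrow> f ` Q \<subseteq> R \<Longrightarrow> m Q (\<lambda>x. g (f x))"
  using comp restr image by metis

text \<open>The composite \<open>h = g \<circ> f\<^sup>-\<^sup>1\<close>, without mentioning the inverse.\<close>

lemma comp_inv:
  assumes "m Q f" "m Q g" "\<And>x. x \<in> Q \<Longrightarrow> h (f x) = g x"
  shows "m (f ` Q) h"
proof -
  have "inv_into Q f ` f ` Q = Q" using inv_f[OF assms(1)] by (force simp: image_image)
  then have "m (f ` Q) (\<lambda>y. g (inv_into Q f y))" using comp[OF inverse[OF assms(1)]] assms(2) by simp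
  then show ?thesis by (rule cong) (use inv_f[OF assms(1)] assms(3) in auto)
qed

lemma endo: "m Q f \<Longrightarrow> f ` Q \<subseteq> Q \<Longrightarrow> f ` Q = Q"
  using card_subset_eq[OF finQ _ cardQ] by blast

lemma power:
  assumes "m Q f" "f ` Q = Q"
  shows "m Q (f ^^ k)" "(f ^^ k) ` Q = Q"
proof -
  have "m Q (f ^^ k) \<and> (f ^^ k) ` Q = Q"
  proof (induction k)
    case 0
    have "m Q (\<lambda>x. x)" using ident dom[OF assms(1)] by blast
    then show ?case by (simp add: id_def)
  next
    case (Suc k)
    then have "m Q (\<lambda>x. f ((f ^^ k) x))" using comp[of Q "f ^^ k" f] assms by simp
    moreover have "(\<lambda>x. f ((f ^^ k) x)) = f ^^ Suc k" by auto
    moreover have "(f ^^ Suc k) ` Q = Q" using Suc assms by (metis funpow.simps(2) image_comp)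
    ultimately show ?case by simp
  qed
  then show "m Q (f ^^ k)" "(f ^^ k) ` Q = Q" by auto
qed

lemma bij: "m Q f \<Longrightarrow> f ` Q = R \<Longrightarrow> bij_betw f Q R"
  using inj by (simp add: bij_betw_def)

definition aut :: "'a set \<Rightarrow> ('a \<Rightarrow> 'a) \<Rightarrow> bool" where
  "aut Q f \<longleftrightarrow> m Q f \<and> f ` Q = Q"

lemma aut_group: "subgroup Q G \<Longrightarrow> Q \<subseteq> S \<Longrightarrow> bij_group Q (aut Q)"
  unfolding bij_group_def aut_def
  using ident bij comp cong
  by (auto simp: image_image[symmetric] cong: image_cong)

lemma nrm_aut: "g \<in> nrm S Q \<Longrightarrow> subgroup Q G \<Longrightarrow> Q \<subseteq> S \<Longrightarrow> aut Q (cj g)"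
  unfolding aut_def using conj by (auto simp: nrm_def)

lemma nrm_family: "subgroup Q G \<Longrightarrow> Q \<subseteq> S \<Longrightarrow> p_family p Q (cj ` nrm S Q)"
  by (rule conj_family[OF nrm_subgroup[OF S]]) (auto simp: nrm_def dest: subS)

text \<open>The extender \<open>N_f\<close> of an isomorphism \<open>f\<close> from \<open>Q\<close>
  to \<open>R\<close>, with the conjugation by \<open>f\<close> cleared of inverses.\<close>

definition ext :: "'a set \<Rightarrow> 'a set \<Rightarrow> ('a \<Rightarrow> 'a) \<Rightarrow> 'a set" where
  "ext Q R f = {g \<in> nrm S Q. \<exists>h\<in>nrm S R. \<forall>x\<in>Q. f (cj g x) = cj h (f x)}"

definition recp :: "'a set \<Rightarrow> bool" where
  "recp R \<longleftrightarrow> (\<forall>Q f. m Q f \<longrightarrow> f ` Q = R \<longrightarrow> (\<exists>h. m (ext Q R f) h \<and> (\<forall>x\<in>Q. h x = f x)))"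

text \<open>\<open>Aut_S(R)\<close> is a \<open>p\<close>-group, so it is Sylow exactly if its index
  is prime to \<open>p\<close>. Conjugations are restricted to \<open>R\<close> before they are
  counted, as different elements may induce the same automorphism.\<close>

definition fau :: "'a set \<Rightarrow> bool" where
  "fau R \<longleftrightarrow> \<not> p dvd card (bij_set R (aut R)) div card ((\<lambda>a. restrict a R) ` cj ` nrm S R)"

definition sat :: bool where
  "sat \<longleftrightarrow> (\<forall>Q. subgroup Q G \<longrightarrow> Q \<subseteq> S \<longrightarrow> (\<exists>f. m Q f \<and> fau (f ` Q) \<and> recp (f ` Q)))"

lemma satD:
  assumes sat "subgroup Q G" "Q \<subseteq> S"
  obtains f where "m Q f" "fau (f ` Q)" "recp (f ` Q)"
  using assms unfolding sat_def by blast

lemma recpD: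
  assumes "recp R" "m Q f" "f ` Q = R"
  obtains h where "m (ext Q R f) h" "\<And>x. x \<in> Q \<Longrightarrow> h x = f x"
  using assms unfolding recp_def by blast

text \<open>\<open>\<gamma>\<close> ranges over the groups between \<open>Aut_S(R)\<close> and the
  full automorphism group of \<open>R\<close>. The generality serves the group of good
  automorphisms.\<close>

lemma fau_sylow:
  assumes "fau R" "subgroup R G" "R \<subseteq> S"
    and "bij_group R \<gamma>" "\<And>f. \<gamma> f \<Longrightarrow> aut R f" "\<And>g. g \<in> nrm S R \<Longrightarrow> \<gamma> (cj g)"
  shows "sylow_family p R \<gamma> (cj ` nrm S R)"
proof (rule sylow_familyI[OF finS[OF assms(2)] p assms(4) nrm_family[OF assms(2,3)]])
  show "\<not> p dvd card (bij_set R \<gamma>) div card ((\<lambda>a. restrict a R) ` cj ` nrm S R)"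
    by (rule not_dvd_index_subgroup[OF _ p aut_group[OF assms(2,3)] assms(4) assms(5)])
      (use assms finS nrm_family in \<open>auto simp: fau_def\<close>)
qed (use assms(6) in blast)

text \<open>The standard correction: after composition with some \<open>\<rho>\<close> of
  \<open>\<gamma>\<close>, the \<open>p\<close>-group \<open>A\<close> acts on \<open>R\<close>
  through \<open>N_S(R)\<close>. If \<open>A\<close> is induced by a subgroup of
  \<open>N_S(Q)\<close>, this subgroup lies in the extender of the corrected map.\<close>

lemma fau_carries:
  assumes R: "fau R" "subgroup R G" "R \<subseteq> S"
    and \<gamma>: "bij_group R \<gamma>" "\<And>f. \<gamma> f \<Longrightarrow> aut R f" "\<And>g. g \<in> nrm S R \<Longrightarrow> \<gamma> (cj g)"
    and f: "inj_on f Q" "f ` Q = R" and A: "p_family p Q A"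
    and fA: "\<And>a. a \<in> A \<Longrightarrow> \<gamma> (conjugated Q f a)"
  obtains \<rho> where "\<gamma> \<rho>" "carries Q (\<lambda>x. \<rho> (f x)) A (cj ` nrm S R)"
proof -
  have "sylow_family p R \<gamma> (cj ` nrm S R)" by (rule fau_sylow[OF R \<gamma>])
  moreover have "p_family p R (conjugated Q f ` A)" using p_family_conjugated(1)[OF A f(1)] f(2) by simp
  ultimately obtain \<rho> where \<rho>: "\<gamma> \<rho>" "carries R \<rho> (conjugated Q f ` A) (cj ` nrm S R)"
    using fA unfolding sylow_family_def by blast
  show ?thesis
    by (rule that[OF \<rho>(1)]) (use carries_comp[OF p_family_conjugated(2)[OF A f(1)] \<rho>(2)] f(2) in simp)
qed

lemma fau_carries_aut:
  assumes R: "fau R" and f: "m Q f" "f ` Q = R" and A: "p_family p Q A" "\<And>a. a \<in> A \<Longrightarrow> aut Q a"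
  obtains \<rho> where "aut R \<rho>" "carries Q (\<lambda>x. \<rho> (f x)) A (cj ` nrm S R)"
proof (rule fau_carries[OF R _ _ _ _ _ inj[OF f(1)] f(2) A(1)])
  show sR: "subgroup R G" "R \<subseteq> S" using image img f by blast+
  show "bij_group R (aut R)" by (rule aut_group[OF sR])
  show "g \<in> nrm S R \<Longrightarrow> aut R (cj g)" for g using nrm_aut sR by blast
  fix a assume "a \<in> A"
  then have a: "m Q a" "a ` Q = Q" using A(2) unfolding aut_def by auto
  have "m (f ` Q) (conjugated Q f a)"
    by (rule comp_inv[OF f(1) comp[OF a(1)]]) (use a f conjugated_apply[OF inj[OF f(1)]] in auto)
  moreover have "conjugated Q f a ` f ` Q = f ` Q"
    using a(2) conjugated_apply[OF inj[OF f(1)]] by (auto simp: image_image) (metis image_eqI image_iff)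
  ultimately show "aut R (conjugated Q f a)" using f(2) by (simp add: aut_def)
qed

lemma nrm_ext:
  assumes "carries Q f (cj ` X) (cj ` nrm S R)" "X \<subseteq> nrm S Q"
  shows "X \<subseteq> ext Q R f"
  using assms unfolding ext_def carries_def by blast

lemma ext_self:
  assumes "m Q f" "f ` Q = R"
  shows "Q \<subseteq> ext Q R f"
proof
  fix g assume g: "g \<in> Q"
  have R: "subgroup R G" "R \<subseteq> S" using image img assms by blast+
  have "g \<in> nrm S Q" "f g \<in> nrm S R"
    using nrm_self[OF dom(1)[OF assms(1)] finQ[OF assms(1)] dom(2)[OF assms(1)]]
      nrm_self[OF R(1) finS[OF R(1)] R(2)] assms g by auto
  then show "g \<in> ext Q R f" using m_cj[OF assms(1) g] by (auto simp: ext_def)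
qed

text \<open>An element centralizing \<open>Q\<close> induces the identity on it, which is matched by
  \<open>\<one>\<close> on the side of \<open>R\<close>.\<close>

lemma ext_centralizer:
  assumes "subgroup Q G" "Q \<subseteq> S" "subgroup R G" "R \<subseteq> S" "c \<in> S" "\<And>x. x \<in> Q \<Longrightarrow> c \<otimes> x = x \<otimes> c" "f ` Q \<subseteq> R"
  shows "c \<in> ext Q R f"
proof -
  have c: "cj c x = x" if "x \<in> Q" for x using cj_fixes_iff[of c x] that assms Sc by blast
  have "c \<in> nrm S Q" using c assms(5) by (auto simp: nrm_def)
  moreover have "\<one> \<in> nrm S R" using subgroup.one_closed[OF nrm_subgroup[OF S subS]] assms by simp
  ultimately show ?thesis using c assms Sc by (auto simp: ext_def image_subset_iff intro!: bexI[of _ \<one>])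
qed

lemma ext_sub: "ext Q R f \<subseteq> nrm S Q" "ext Q R f \<subseteq> S"
  by (auto simp: ext_def nrm_def)

end

lemma (in fusion) extend_carries:
  assumes R: "recp R" and f: "m Q f" "f ` Q = R" and c: "carries Q f (cj ` X) (cj ` nrm S R)"
    and X: "subgroup X G" "X \<subseteq> nrm S Q"
  obtains h where "m X h" "\<And>x. x \<in> Q \<Longrightarrow> h x = f x"
proof -
  obtain h where h: "m (ext Q R f) h" "\<And>x. x \<in> Q \<Longrightarrow> h x = f x" using recpD[OF R f] by blast
  show ?thesis by (rule that[OF restr[OF h(1) X(1) nrm_ext[OF c X(2)]] h(2)])
qed

section \<open>Invariant subsystems and types of morphisms\<close>

text \<open>Invariance is asked under automorphisms of \<open>T\<close> alone. This is what the
  calculus of types uses, and it is available both for F over E and for E over the good subsystem,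
  where \<open>S\<close> is \<open>T\<close> itself.\<close>

locale normal_pair = finite_p_group G p n + big: fusion G p n S M + small: fusion G p n T m
  for G (structure) and p n :: nat and S M T m +
  assumes m_M: "\<And>Q f. m Q f \<Longrightarrow> M Q f"
    and closed: "\<And>Q f. M Q f \<Longrightarrow> Q \<subseteq> T \<Longrightarrow> f ` Q \<subseteq> T"
    and TS: "T \<subseteq> S"
    and aut_inv: "\<And>a Q f h. M T a \<Longrightarrow> m Q f \<Longrightarrow> (\<And>x. x \<in> Q \<Longrightarrow> h (a x) = a (f x)) \<Longrightarrow> m (a ` Q) h"
begin

lemma autT: "M T a \<Longrightarrow> a ` T = T"
  using big.endo closed by blast

lemma autT_inv:
  assumes "M T a"
  shows "M T (inv_into T a)" "x \<in> T \<Longrightarrow> a (inv_into T a x) = x" "x \<in> T \<Longrightarrow> inv_into T a (a x) = x"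
    "x \<in> T \<Longrightarrow> inv_into T a x \<in> T" "x \<in> T \<Longrightarrow> a x \<in> T"
  using big.inverse[OF assms] autT[OF assms] big.inv_f[OF assms]
  by (auto simp: f_inv_into_f inv_into_into)

lemma autT_comp: "M T a \<Longrightarrow> M T b \<Longrightarrow> M T (\<lambda>x. b (a x))"
  using big.comp autT by metis

lemma autT_id: "M T (\<lambda>x. x)"
  using big.ident small.S TS by blast

text \<open>The type of a morphism \<open>a \<circ> e\<close>, with \<open>e\<close> in \<open>m\<close>, is the coset of \<open>a\<close> in \<open>Aut\<^sub>M(T) / Aut\<^sub>m(T)\<close>.\<close>

definition ty :: "('a \<Rightarrow> 'a) \<Rightarrow> 'a set \<Rightarrow> ('a \<Rightarrow> 'a) \<Rightarrow> bool" where
  "ty a Q f \<longleftrightarrow> M T a \<and> (\<exists>e. m Q e \<and> (\<forall>x\<in>Q. f x = a (e x)))"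

lemma tyE:
  assumes "ty a Q f"
  obtains e where "M T a" "m Q e" "\<And>x. x \<in> Q \<Longrightarrow> f x = a (e x)"
  using assms unfolding ty_def by blast

lemma ty_M: "ty a Q f \<Longrightarrow> M Q f"
proof -
  assume "ty a Q f"
  then obtain e where e: "M T a" "m Q e" "\<And>x. x \<in> Q \<Longrightarrow> f x = a (e x)" using tyE by metis
  have "M Q (\<lambda>x. a (e x))" using big.comp'[OF m_M[OF e(2)] e(1) small.img[OF e(2)]] .
  then show ?thesis by (rule big.cong) (use e in auto)
qed

lemma ty_cong: "ty a Q f \<Longrightarrow> (\<And>x. x \<in> Q \<Longrightarrow> f x = g x) \<Longrightarrow> ty a Q g"
  unfolding ty_def by auto

lemma ty_cong_aut: "ty a Q f \<Longrightarrow> (\<And>x. x \<in> T \<Longrightarrow> a x = b x) \<Longrightarrow> ty b Q f"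
proof -
  assume a: "ty a Q f" "\<And>x. x \<in> T \<Longrightarrow> a x = b x"
  then obtain e where e: "M T a" "m Q e" "\<And>x. x \<in> Q \<Longrightarrow> f x = a (e x)" using tyE by metis
  have "e x \<in> T" if "x \<in> Q" for x using small.img[OF e(2)] that by auto
  then show ?thesis unfolding ty_def using a(2) e big.cong[OF e(1) a(2)] by auto
qed

lemma ty_restr: "ty a Q f \<Longrightarrow> subgroup U G \<Longrightarrow> U \<subseteq> Q \<Longrightarrow> ty a U f"
  unfolding ty_def using small.restr by blast

lemma ty_id: "m Q f \<Longrightarrow> ty (\<lambda>x. x) Q f"
  unfolding ty_def using autT_id by auto

lemma ty_idD: "ty (\<lambda>x. x) Q f \<Longrightarrow> m Q f"
  unfolding ty_def by (metis small.cong)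

lemma ty_aut: "M T a \<Longrightarrow> subgroup Q G \<Longrightarrow> Q \<subseteq> T \<Longrightarrow> ty a Q a"
  unfolding ty_def using small.ident by blast

text \<open>\<open>b d a e = (b a) (a^-1 d a) e\<close>, and \<open>a^-1 d a\<close> is in
  \<open>m\<close> by invariance: types multiply like cosets of a normal subgroup.\<close>

lemma ty_comp:
  assumes f: "ty a Q f" and g: "ty b (f ` Q) g"
  shows "ty (\<lambda>x. b (a x)) Q (\<lambda>x. g (f x))"
proof -
  obtain e where e: "M T a" "m Q e" "\<And>x. x \<in> Q \<Longrightarrow> f x = a (e x)" using tyE[OF f] by metis
  obtain d where d: "M T b" "m (f ` Q) d" "\<And>x. x \<in> f ` Q \<Longrightarrow> g x = b (d x)" using tyE[OF g] by metis
  let ?i = "inv_into T a"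
  have eT: "e x \<in> T" if "x \<in> Q" for x using small.img[OF e(2)] that by auto
  have dT: "d (f x) \<in> T" if "x \<in> Q" for x using small.img[OF d(2)] that by auto
  have fQ: "f ` Q = a ` e ` Q" using e(3) by (auto simp: image_image)
  have ifQ: "?i ` f ` Q = e ` Q" using autT_inv[OF e(1)] eT by (force simp: fQ image_image)
  have "m (?i ` f ` Q) (\<lambda>y. ?i (d (a y)))"
    by (rule aut_inv[OF autT_inv(1)[OF e(1)] d(2)]) (use autT_inv[OF e(1)] eT e(3) in auto)
  then have "m Q (\<lambda>x. ?i (d (a (e x))))" using small.comp[OF e(2), of "\<lambda>y. ?i (d (a y))"] ifQ by simp
  moreover have "g (f x) = b (a (?i (d (a (e x)))))" if "x \<in> Q" for x
    using that d(3) e(3) autT_inv(2)[OF e(1) dT[OF that]] by simp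
  ultimately show ?thesis unfolding ty_def using autT_comp[OF e(1) d(1)] by blast
qed

lemma ty_comp':
  assumes f: "ty a Q f" and g: "ty b R g" and "f ` Q \<subseteq> R"
  shows "ty (\<lambda>x. b (a x)) Q (\<lambda>x. g (f x))"
  using ty_comp[OF f ty_restr[OF g big.image[OF ty_M[OF f]]]] assms(3) by simp

lemma ty_comp_small: "ty a Q f \<Longrightarrow> m (f ` Q) g \<Longrightarrow> ty a Q (\<lambda>x. g (f x))"
  using ty_comp[OF _ ty_id] by fastforce

lemma ty_small_comp: "m Q f \<Longrightarrow> ty a (f ` Q) g \<Longrightarrow> ty a Q (\<lambda>x. g (f x))"
  using ty_comp[OF ty_id] by fastforce

text \<open>The inverse of \<open>a e\<close> is \<open>a^-1 (a e^-1 a^-1)\<close>, and the second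
  factor is in \<open>m\<close> by invariance.\<close>

lemma ty_inv:
  assumes f: "ty a Q f" and g: "\<And>x. x \<in> Q \<Longrightarrow> g (f x) = x"
  shows "ty (inv_into T a) (f ` Q) g"
proof -
  obtain e where e: "M T a" "m Q e" "\<And>x. x \<in> Q \<Longrightarrow> f x = a (e x)" using tyE[OF f] by metis
  have eT: "e x \<in> T" if "x \<in> Q" for x using small.img[OF e(2)] that by auto
  have QT: "x \<in> T" if "x \<in> Q" for x using small.dom[OF e(2)] that by auto
  have fQ: "f ` Q = a ` e ` Q" using e(3) by (auto simp: image_image)
  have "m (a ` e ` Q) (\<lambda>y. a (g y))"
    by (rule aut_inv[OF e(1) small.inverse[OF e(2)]]) (use small.inv_f[OF e(2)] e(3) g in auto)
  then have "m (f ` Q) (\<lambda>y. a (g y))" by (simp add: fQ)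
  then show ?thesis unfolding ty_def using autT_inv[OF e(1)] g QT by (auto intro!: exI[of _ "\<lambda>y. a (g y)"])
qed

definition fac :: "'a set \<Rightarrow> ('a \<Rightarrow> 'a) \<Rightarrow> bool" where
  "fac Q f \<longleftrightarrow> (\<exists>a. ty a Q f)"

lemma fac_comp: "fac Q f \<Longrightarrow> fac (f ` Q) g \<Longrightarrow> fac Q (\<lambda>x. g (f x))"
  unfolding fac_def using ty_comp by blast

lemma fac_inv: "fac Q f \<Longrightarrow> (\<And>x. x \<in> Q \<Longrightarrow> g (f x) = x) \<Longrightarrow> fac (f ` Q) g"
  unfolding fac_def using ty_inv by blast

lemma fac_m: "m Q f \<Longrightarrow> fac Q f"
  unfolding fac_def using ty_id by blast

lemma fac_restr: "fac Q f \<Longrightarrow> subgroup U G \<Longrightarrow> U \<subseteq> Q \<Longrightarrow> fac U f"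
  unfolding fac_def using ty_restr by blast

lemma fac_cong: "fac Q f \<Longrightarrow> (\<And>x. x \<in> Q \<Longrightarrow> f x = g x) \<Longrightarrow> fac Q g"
  unfolding fac_def using ty_cong by blast

text \<open>Allows a map to be improved on the left by factorizable maps until the composite extends
  to a larger subgroup.\<close>

lemma fac_cancel:
  assumes "fac Q (\<lambda>x. g (f x))" "fac (f ` Q) g"
  shows "fac Q f"
proof -
  have "M (f ` Q) g" using assms(2) ty_M unfolding fac_def by blast
  then have i: "inj_on g (f ` Q)" using big.inj by blast
  have "fac (g ` f ` Q) (inv_into (f ` Q) g)" by (rule fac_inv[OF assms(2)]) (use i in simp)
  then have "fac ((\<lambda>x. g (f x)) ` Q) (inv_into (f ` Q) g)" by (simp add: image_image)
  from fac_comp[OF assms(1) this] show ?thesis by (rule fac_cong) (use i in simp)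
qed

end

section \<open>Weakly normal subsystems\<close>

locale weakly_normal_pair = normal_pair G p n "carrier G" mF T mE
  for G (structure) and p n mF T mE +
  assumes F_sat: "big.sat" and E_sat: "small.sat"
    and invar: "\<And>Q f R g h. mE Q f \<Longrightarrow> mF R g \<Longrightarrow> R \<subseteq> T \<Longrightarrow> Q \<subseteq> R \<Longrightarrow> f ` Q \<subseteq> R \<Longrightarrow>
      (\<And>x. x \<in> Q \<Longrightarrow> h (g x) = g (f x)) \<Longrightarrow> mE (g ` Q) h"
begin

lemmas T = small.S

lemma Tc: "x \<in> T \<Longrightarrow> x \<in> carrier G"
  using small.Sc .

lemma finT: "finite T"
  using finS T .

lemma T_normal: "g \<in> carrier G \<Longrightarrow> x \<in> T \<Longrightarrow> cj g x \<in> T"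
  using closed[OF big.conj[OF _ T]] TS by blast

lemma card_less_T: "subgroup Q G \<Longrightarrow> Q \<subseteq> T \<Longrightarrow> Q \<noteq> T \<Longrightarrow> card Q < card T"
  using psubset_card_mono[OF finT] by auto

lemma nrm_grows_card:
  assumes "subgroup Q G" "Q \<subseteq> T" "Q \<noteq> T"
  shows "card Q < card (nrm T Q)" "subgroup (nrm T Q) G" "nrm T Q \<subseteq> T" "Q \<subset> nrm T Q"
proof -
  show s: "subgroup (nrm T Q) G" using nrm_subgroup[OF T] assms Tc by blast
  show 1: "Q \<subset> nrm T Q" using nrm_grows[OF assms(1) T] assms by blast
  show "card Q < card (nrm T Q)" using psubset_card_mono[OF finS[OF s] 1] .
  show "nrm T Q \<subseteq> T" by (auto simp: nrm_def)
qed

lemma invar_conj: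
  assumes a: "small.aut Q a" and f: "mF Q f" and Q: "Q \<subseteq> T"
  shows "small.aut (f ` Q) (conjugated Q f a)"
  unfolding small.aut_def
proof
  have a': "mE Q a" "a ` Q = Q" using a by (auto simp: small.aut_def)
  show "mE (f ` Q) (conjugated Q f a)"
    by (rule invar[OF a'(1) f Q]) (use a' conjugated_apply[OF big.inj[OF f]] in auto)
  show "conjugated Q f a ` f ` Q = f ` Q"
    using a'(2) conjugated_apply[OF big.inj[OF f]] by (auto simp: image_image) (metis image_eqI image_iff)
qed

text \<open>Induction on the index of \<open>Q\<close> in \<open>T\<close>. Both
  \<open>\<chi>\<close> on \<open>R\<close> and \<open>\<chi> f2\<close> on \<open>Q\<close> end at
  an F-receptive subgroup and extend to the normalizers in \<open>T\<close>, where they factor by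
  induction. Cancelling \<open>\<chi>\<close> leaves \<open>f2\<close>, which differs from
  \<open>f\<close> by morphisms of E. Invariance is what permits the Sylow correction
  \<open>\<epsilon>\<close> inside E: \<open>f1\<close> conjugates \<open>Aut_T(Q)\<close> into
  \<open>Aut_E(R)\<close>.\<close>

theorem frattini:
  assumes "mF Q f" "Q \<subseteq> T"
  shows "fac Q f"
  using assms
proof (induction "card T - card Q" arbitrary: Q f rule: less_induct)
  case less
  note f = \<open>mF Q f\<close> and QT = \<open>Q \<subseteq> T\<close>
  have sQ: "subgroup Q G" using big.dom f by blast
  show ?case
  proof (cases "Q = T")
    case True
    then show ?thesis using ty_aut[of f T] f T unfolding fac_def by blast
  next
    case False
    have IH: "fac U g" if "mF U g" "U \<subseteq> T" "card Q < card U" for U g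
      by (rule less.hyps) (use that card_less_T[OF sQ QT False] in auto)
    have sf: "subgroup (f ` Q) G" "f ` Q \<subseteq> T" using big.image[OF f] closed[OF f QT] by auto
    obtain e where e: "mE (f ` Q) e" "small.fau (e ` f ` Q)" "small.recp (e ` f ` Q)"
      using small.satD[OF E_sat sf] by metis
    define f1 where "f1 = (\<lambda>x. e (f x))"
    define R where "R = f1 ` Q"
    have f1: "mF Q f1" unfolding f1_def using big.comp[OF f m_M[OF e(1)]] .
    have Re: "R = e ` f ` Q" by (auto simp: R_def f1_def)
    have sR: "subgroup R G" "R \<subseteq> T" using big.image[OF f1] closed[OF f1 QT] by (auto simp: R_def)
    have cR: "card R = card Q" unfolding R_def by (rule big.cardQ[OF f1])
    have RnT: "R \<noteq> T" using cR card_less_T[OF sQ QT False] by auto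
    note NQ = nrm_grows_card[OF sQ QT False] and NR = nrm_grows_card[OF sR RnT]
    obtain \<chi>0 where \<chi>0: "mF R \<chi>0" "big.fau (\<chi>0 ` R)" "big.recp (\<chi>0 ` R)"
      using big.satD[OF F_sat sR(1) subset_trans[OF sR(2) TS]] by blast
    have fR: "p_family p R (cj ` nrm T R)" using small.nrm_family sR by blast
    obtain \<rho> where \<rho>: "big.aut (\<chi>0 ` R) \<rho>"
        "carries R (\<lambda>x. \<rho> (\<chi>0 x)) (cj ` nrm T R) (cj ` nrm (carrier G) (\<chi>0 ` R))"
    proof (rule big.fau_carries_aut[OF \<chi>0(2,1) refl fR])
      show "big.aut R a" if "a \<in> cj ` nrm T R" for a
        using that big.nrm_aut[of _ R] sR TS by (auto simp: nrm_def)
    qed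
    define \<chi> where "\<chi> = (\<lambda>x. \<rho> (\<chi>0 x))"
    have \<chi>: "mF R \<chi>" "\<chi> ` R = \<chi>0 ` R"
      using \<rho>(1) big.comp[OF \<chi>0(1)] by (auto simp: big.aut_def \<chi>_def image_image[symmetric])
    obtain \<epsilon> where \<epsilon>: "small.aut R \<epsilon>"
        "carries Q (\<lambda>x. \<epsilon> (f1 x)) (cj ` nrm T Q) (cj ` nrm T R)"
    proof (rule small.fau_carries[of R "small.aut R" f1 Q "cj ` nrm T Q"])
      show "small.fau R" using e(2) Re by simp
      show "bij_group R (small.aut R)" by (rule small.aut_group[OF sR])
      show "small.aut R (cj g)" if "g \<in> nrm T R" for g using small.nrm_aut that sR by blast
      show "p_family p Q (cj ` nrm T Q)" using small.nrm_family sQ QT by blast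
      show "small.aut R (conjugated Q f1 a)" if "a \<in> cj ` nrm T Q" for a
        unfolding R_def using invar_conj[OF _ f1 QT] small.nrm_aut sQ QT that by blast
    qed (use sR R_def big.inj[OF f1] in auto)
    define f2 where "f2 = (\<lambda>x. \<epsilon> (f1 x))"
    have \<epsilon>': "mE R \<epsilon>" "\<epsilon> ` R = R" using \<epsilon>(1) by (auto simp: small.aut_def)
    have f2: "mF Q f2" "f2 ` Q = R"
      using big.comp[OF f1, of \<epsilon>] m_M[OF \<epsilon>'(1)] \<epsilon>'(2)
      by (auto simp: f2_def R_def[symmetric] image_image[symmetric])
    have c\<chi>: "carries R \<chi> (cj ` nrm T R) (cj ` nrm (carrier G) (\<chi>0 ` R))"
      using \<rho>(2) by (simp add: \<chi>_def)
    have subN: "nrm T U \<subseteq> nrm (carrier G) U" for U using Tc by (auto simp: nrm_def)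
    have "fac R \<chi>"
    proof -
      obtain h where h: "mF (nrm T R) h" "\<And>x. x \<in> R \<Longrightarrow> h x = \<chi> x"
        using big.extend_carries[OF \<chi>0(3) \<chi> c\<chi> NR(2) subN] by blast
      have "fac (nrm T R) h" by (rule IH[OF h(1) NR(3)]) (use NR(1) cR in simp)
      then have "fac R h" by (rule fac_restr[OF _ sR(1)]) (use NR(4) in blast)
      then show ?thesis by (rule fac_cong) (use h(2) in auto)
    qed
    moreover have "fac Q (\<lambda>x. \<chi> (f2 x))"
    proof -
      have c: "carries Q (\<lambda>x. \<chi> (f2 x)) (cj ` nrm T Q) (cj ` nrm (carrier G) (\<chi>0 ` R))"
        by (rule carries_comp[OF _ c\<chi>]) (use \<epsilon>(2) f2(2) in \<open>auto simp: f2_def\<close>)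
      have mc: "mF Q (\<lambda>x. \<chi> (f2 x))" "(\<lambda>x. \<chi> (f2 x)) ` Q = \<chi>0 ` R"
        using big.comp[OF f2(1), of \<chi>] f2(2) \<chi> by (auto simp: image_image[symmetric])
      obtain h where h: "mF (nrm T Q) h" "\<And>x. x \<in> Q \<Longrightarrow> h x = \<chi> (f2 x)"
        using big.extend_carries[OF \<chi>0(3) mc c NQ(2) subN] by blast
      have "fac (nrm T Q) h" by (rule IH[OF h(1) NQ(3,1)])
      then have "fac Q h" by (rule fac_restr[OF _ sQ]) (use NQ(4) in blast)
      then show ?thesis by (rule fac_cong) (use h(2) in auto)
    qed
    ultimately have "fac Q f2" using fac_cancel[of Q \<chi> f2] f2(2) by simp
    then have "fac Q f1" unfolding f2_def
      by (rule fac_cancel) (use fac_m[OF \<epsilon>'(1)] R_def in simp)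
    then show ?thesis unfolding f1_def
      by (rule fac_cancel) (rule fac_m[OF e(1)])
  qed
qed

end

text \<open>The powers of \<open>b\<close> form a \<open>p\<close>-group, so at a fully automized
  conjugate of \<open>Q\<close> they can be moved into the automorphisms induced by
  \<open>S\<close>.\<close>

lemma (in fusion) p_element_conj:
  assumes sat and b: "aut Q b" and pow: "\<And>x. x \<in> Q \<Longrightarrow> (b ^^ (p ^ k)) x = x"
  obtains e t where "m Q e" "t \<in> nrm S (e ` Q)" "\<And>x. x \<in> Q \<Longrightarrow> e (b x) = cj t (e x)"
proof -
  have b': "m Q b" "b ` Q = Q" using b by (auto simp: aut_def)
  note sQ = dom[OF b'(1)]
  define A where "A = {b ^^ i |i. True}"
  have A: "p_family p Q A"
    unfolding p_family_def
  proof (intro conjI ballI)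
    show "A \<noteq> {}" by (auto simp: A_def)
    fix a assume "a \<in> A"
    then obtain i where i: "a = b ^^ i" by (auto simp: A_def)
    show "bij_betw a Q Q" unfolding i using bij_betw_funpow[OF bij[OF b']] .
    have "\<forall>x\<in>Q. (a ^^ (p ^ k)) x = x"
    proof
      fix x assume x: "x \<in> Q"
      have "(a ^^ (p ^ k)) x = (b ^^ (p ^ k * i)) x" unfolding i funpow_mult by (simp add: mult.commute)
      then show "(a ^^ (p ^ k)) x = x" using funpow_mult_id[of b Q "p ^ k" x i] b' pow x by simp
    qed
    then show "\<exists>k. \<forall>x\<in>Q. (a ^^ (p ^ k)) x = x" by blast
    fix c assume "c \<in> A"
    then obtain j where j: "c = b ^^ j" by (auto simp: A_def)
    show "\<exists>d\<in>A. \<forall>x\<in>Q. d x = a (c x)"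
      by (rule bexI[of _ "b ^^ (i + j)"]) (simp add: i j funpow_add, unfold A_def, blast)
  qed
  have aA: "aut Q a" if "a \<in> A" for a
    using that power[OF b'] by (auto simp: A_def aut_def)
  have "b \<in> A" unfolding A_def by (auto intro!: exI[of _ 1])
  obtain e where e: "m Q e" "fau (e ` Q)" "recp (e ` Q)"
    using satD[OF \<open>sat\<close> sQ] by blast
  define R where "R = e ` Q"
  obtain \<rho> where \<rho>: "aut R \<rho>" "carries Q (\<lambda>x. \<rho> (e x)) A (cj ` nrm S R)"
    using fau_carries_aut[OF e(2,1) refl A aA] by (auto simp: R_def)
  define e1 where "e1 = (\<lambda>x. \<rho> (e x))"
  have e1: "m Q e1" "e1 ` Q = R"
    using \<rho>(1) comp[OF e(1), of \<rho>] by (auto simp: aut_def e1_def R_def image_image[symmetric])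
  obtain t where t: "t \<in> nrm S R" "\<And>x. x \<in> Q \<Longrightarrow> e1 (b x) = cj t (e1 x)"
    using \<rho>(2) \<open>b \<in> A\<close> unfolding carries_def e1_def by blast
  show ?thesis by (rule that[OF e1(1) t(1)[folded e1(2)] t(2)])
qed

section \<open>Centric subgroups and good morphisms\<close>

context weakly_normal_pair
begin

definition C :: "'a set" where
  "C = centralizer G (carrier G) T"

definition TC :: "'a set \<Rightarrow> 'a set" where
  "TC Q = Q <#> C"

lemma C_iff: "c \<in> C \<longleftrightarrow> c \<in> carrier G \<and> (\<forall>x\<in>T. c \<otimes> x = x \<otimes> c)"
  by (simp add: C_def centralizer_def)

lemma Cc: "c \<in> C \<Longrightarrow> c \<in> carrier G"
  by (simp add: C_iff)

lemma C_comm: "c \<in> C \<Longrightarrow> x \<in> T \<Longrightarrow> c \<otimes> x = x \<otimes> c"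
  by (simp add: C_iff)

lemma C_subgroup: "subgroup C G"
proof (rule finite_subgroupI[OF fin])
  show "C \<subseteq> carrier G" using Cc by auto
  have "\<one> \<in> C" using Tc by (simp add: C_iff)
  then show "C \<noteq> {}" by blast
  fix c d assume cd: "c \<in> C" "d \<in> C"
  have "c \<otimes> d \<otimes> x = x \<otimes> (c \<otimes> d)" if x: "x \<in> T" for x
    using C_comm[OF cd(1) x] C_comm[OF cd(2) x] Cc cd Tc[OF x] by (metis m_assoc)
  then show "c \<otimes> d \<in> C" using cd Cc by (simp add: C_iff)
qed

lemma TC_mem: "x \<in> TC Q \<longleftrightarrow> (\<exists>q\<in>Q. \<exists>c\<in>C. x = q \<otimes> c)"
  by (auto simp: TC_def set_mult_def)

lemma TC_subgroup: "subgroup Q G \<Longrightarrow> Q \<subseteq> T \<Longrightarrow> subgroup (TC Q) G"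
proof -
  assume Q: "subgroup Q G" "Q \<subseteq> T"
  show ?thesis
  proof (rule finite_subgroupI[OF fin])
    show "TC Q \<subseteq> carrier G" using Q Tc Cc by (auto simp: TC_mem subset_iff)
    show "TC Q \<noteq> {}" using subgroup.one_closed[OF Q(1)] subgroup.one_closed[OF C_subgroup]
      unfolding TC_def set_mult_def by blast
    fix x y assume "x \<in> TC Q" "y \<in> TC Q"
    then obtain q c r d where *: "q \<in> Q" "c \<in> C" "r \<in> Q" "d \<in> C" "x = q \<otimes> c" "y = r \<otimes> d"
      by (auto simp: TC_mem)
    have "x \<otimes> y = (q \<otimes> r) \<otimes> (c \<otimes> d)"
    proof -
      have "c \<otimes> r = r \<otimes> c" using * C_comm Q by auto
      then have "q \<otimes> ((c \<otimes> r) \<otimes> d) = q \<otimes> ((r \<otimes> c) \<otimes> d)" by simp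
      then show ?thesis using * Cc Tc Q by (simp add: m_assoc subset_iff)
    qed
    then show "x \<otimes> y \<in> TC Q"
      using * subgroup.m_closed[OF Q(1)] subgroup.m_closed[OF C_subgroup] unfolding TC_mem by blast
  qed
qed

lemma Q_TC: "Q \<subseteq> T \<Longrightarrow> Q \<subseteq> TC Q"
  using subgroup.one_closed[OF C_subgroup] Tc by (force simp: TC_mem)

lemma C_TC: "subgroup Q G \<Longrightarrow> C \<subseteq> TC Q"
  using subgroup.one_closed Cc by (force simp: TC_mem)

lemma TC_mono: "U \<subseteq> Q \<Longrightarrow> TC U \<subseteq> TC Q"
  by (fastforce simp: TC_mem)

lemma TC_c: "subgroup Q G \<Longrightarrow> Q \<subseteq> T \<Longrightarrow> TC Q \<subseteq> carrier G"
  using subgroup.subset[OF TC_subgroup] .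

definition cen :: "'a set \<Rightarrow> bool" where
  "cen Q \<longleftrightarrow> subgroup Q G \<and> Q \<subseteq> T \<and>
     (\<forall>f t. mF Q f \<longrightarrow> t \<in> T \<longrightarrow> (\<forall>x\<in>Q. t \<otimes> f x = f x \<otimes> t) \<longrightarrow> t \<in> f ` Q)"

lemma cen_sub: "cen Q \<Longrightarrow> subgroup Q G" "cen Q \<Longrightarrow> Q \<subseteq> T"
  by (auto simp: cen_def)

lemma cenD: "cen Q \<Longrightarrow> mF Q f \<Longrightarrow> t \<in> T \<Longrightarrow> (\<And>x. x \<in> Q \<Longrightarrow> t \<otimes> f x = f x \<otimes> t) \<Longrightarrow> t \<in> f ` Q"
  by (auto simp: cen_def)

lemma cenD0:
  assumes "cen Q" "t \<in> T" "\<And>x. x \<in> Q \<Longrightarrow> t \<otimes> x = x \<otimes> t"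
  shows "t \<in> Q"
proof -
  have "mF Q (\<lambda>x. x)" using big.ident cen_sub[OF assms(1)] TS by blast
  then show ?thesis using cenD[OF assms(1) _ assms(2)] assms(3) by fastforce
qed

lemma cen_up:
  assumes "cen Q" "subgroup U G" "Q \<subseteq> U" "U \<subseteq> T"
  shows "cen U"
  unfolding cen_def
proof (intro conjI allI impI assms)
  fix f t assume "mF U f" "t \<in> T" "\<forall>x\<in>U. t \<otimes> f x = f x \<otimes> t"
  then have "t \<in> f ` Q" using cenD[OF assms(1) big.restr[OF _ cen_sub(1)[OF assms(1)] assms(3)]] assms(3) by blast
  then show "t \<in> f ` U" using assms(3) by blast
qed

lemma cen_image:
  assumes "cen Q" "mF Q f"
  shows "cen (f ` Q)"
  unfolding cen_def
proof (intro conjI allI impI)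
  show "subgroup (f ` Q) G" "f ` Q \<subseteq> T" using big.image closed assms cen_sub by auto
  fix g t assume g: "mF (f ` Q) g" "t \<in> T" "\<forall>x\<in>f ` Q. t \<otimes> g x = g x \<otimes> t"
  have "t \<in> (\<lambda>x. g (f x)) ` Q"
    by (rule cenD[OF assms(1) big.comp[OF assms(2) g(1)] g(2)]) (use g(3) in auto)
  then show "t \<in> g ` f ` Q" by auto
qed

lemma cen_T: "cen T"
  unfolding cen_def using T autT by blast

definition good :: "'a set \<Rightarrow> ('a \<Rightarrow> 'a) \<Rightarrow> bool" where
  "good Q f \<longleftrightarrow> cen Q \<and> mE Q f \<and>
     (\<exists>h. mF (TC Q) h \<and> (\<forall>x\<in>Q. h x = f x) \<and> (\<forall>c\<in>C. inv c \<otimes> h c \<in> T))"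

lemma good_mE: "good Q f \<Longrightarrow> mE Q f" and good_cen: "good Q f \<Longrightarrow> cen Q"
  by (auto simp: good_def)

text \<open>Let \<open>h c = c t\<close> with \<open>t\<close> in \<open>T\<close>. Both
  \<open>h c\<close> and \<open>c\<close> centralize the image of \<open>Q\<close>, hence so does
  \<open>t\<close>, and centricity places \<open>t\<close> in that image. So \<open>h\<close> maps
  \<open>Q C\<close> onto \<open>f(Q) C\<close>, and extensions of good morphisms can be
  composed.\<close>

lemma goodE:
  assumes "good Q f"
  obtains h where "mF (TC Q) h" "\<And>x. x \<in> Q \<Longrightarrow> h x = f x"
    "\<And>c. c \<in> C \<Longrightarrow> \<exists>r\<in>f ` Q. h c = c \<otimes> r" "h ` TC Q = TC (f ` Q)"
proof -
  obtain h where h: "mF (TC Q) h" "\<And>x. x \<in> Q \<Longrightarrow> h x = f x" "\<And>c. c \<in> C \<Longrightarrow> inv c \<otimes> h c \<in> T"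
    using assms by (auto simp: good_def)
  note cQ = good_cen[OF assms]
  note sQ = cen_sub[OF cQ]
  have f: "mE Q f" using assms good_mE by blast
  have fT: "f x \<in> T" if "x \<in> Q" for x using small.img[OF f] that by auto
  have QT: "x \<in> TC Q" if "x \<in> Q" for x using Q_TC sQ that by blast
  have CT: "c \<in> TC Q" if "c \<in> C" for c using C_TC sQ that by blast
  have hc: "\<exists>r\<in>f ` Q. h c = c \<otimes> r" if c: "c \<in> C" for c
  proof
    define t where "t = inv c \<otimes> h c"
    have hcc: "h c \<in> carrier G" using big.car(2)[OF h(1) CT[OF c]] .
    have "t \<otimes> f x = f x \<otimes> t" if x: "x \<in> Q" for x
    proof -
      have "h (c \<otimes> x) = h (x \<otimes> c)" using C_comm[OF c] sQ x by auto
      then have 1: "h c \<otimes> f x = f x \<otimes> h c" using big.mult[OF h(1)] QT[OF x] CT[OF c] h(2)[OF x] by simp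
      have 2: "inv c \<otimes> f x = f x \<otimes> inv c"
        using C_comm[OF subgroup.m_inv_closed[OF C_subgroup c] fT[OF x]] .
      have "t \<otimes> f x = inv c \<otimes> (f x \<otimes> h c)" unfolding t_def 1[symmetric]
        using hcc Cc[OF c] Tc[OF fT[OF x]] by (simp add: m_assoc)
      also have "\<dots> = (inv c \<otimes> f x) \<otimes> h c"
        using hcc Cc[OF c] Tc[OF fT[OF x]] by (simp add: m_assoc)
      also have "\<dots> = f x \<otimes> t" unfolding 2 t_def
        using hcc Cc[OF c] Tc[OF fT[OF x]] by (simp add: m_assoc)
      finally show ?thesis .
    qed
    then show "t \<in> f ` Q" using cenD[OF cQ m_M[OF f] h(3)[OF c]] by (simp add: t_def)
    show "h c = c \<otimes> t" using hcc Cc[OF c] by (simp add: t_def inv_cancel)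
  qed
  have "h ` TC Q = TC (f ` Q)"
  proof (intro equalityI subsetI)
    fix y assume "y \<in> h ` TC Q"
    then obtain q c where qc: "q \<in> Q" "c \<in> C" "y = h (q \<otimes> c)" by (auto simp: TC_mem)
    obtain r where r: "r \<in> Q" "h c = c \<otimes> f r" using hc[OF qc(2)] by auto
    have "y = f q \<otimes> (c \<otimes> f r)" using qc r big.mult[OF h(1) QT CT] h(2) by simp
    also have "c \<otimes> f r = f r \<otimes> c" using C_comm[OF qc(2) fT[OF r(1)]] .
    also have "f q \<otimes> (f r \<otimes> c) = f (q \<otimes> r) \<otimes> c"
      using small.mult[OF f qc(1) r(1)] Tc[OF fT] qc r Cc by (simp add: m_assoc)
    finally show "y \<in> TC (f ` Q)" using qc r subgroup.m_closed[OF sQ(1)] unfolding TC_mem by blast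
  next
    fix y assume "y \<in> TC (f ` Q)"
    then obtain q c where qc: "q \<in> Q" "c \<in> C" "y = f q \<otimes> c" by (auto simp: TC_mem)
    obtain r where r: "r \<in> Q" "h c = c \<otimes> f r" using hc[OF qc(2)] by auto
    have ir: "inv r \<in> Q" "q \<otimes> inv r \<in> Q" using qc r sQ by (auto simp: subgroup.m_closed subgroup.m_inv_closed)
    have "h ((q \<otimes> inv r) \<otimes> c) = f (q \<otimes> inv r) \<otimes> (c \<otimes> f r)"
      using big.mult[OF h(1) QT[OF ir(2)] CT[OF qc(2)]] h(2)[OF ir(2)] r by simp
    also have "c \<otimes> f r = f r \<otimes> c" using C_comm[OF qc(2) fT[OF r(1)]] .
    also have "f (q \<otimes> inv r) = f q \<otimes> inv (f r)"
      using small.mult[OF f qc(1) ir(1)] small.inv[OF f r(1)] by simp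
    also have "(f q \<otimes> inv (f r)) \<otimes> (f r \<otimes> c) = y"
      using qc r Tc[OF fT] Cc by (simp add: m_assoc inv_cancel)
    finally show "y \<in> h ` TC Q" using ir qc unfolding TC_mem by (metis TC_mem image_eqI)
  qed
  then show ?thesis using that h hc by blast
qed

lemma goodI:
  assumes "cen Q" "mE Q f" "mF (TC Q) h" "\<And>x. x \<in> Q \<Longrightarrow> h x = f x" "\<And>c. c \<in> C \<Longrightarrow> inv c \<otimes> h c \<in> T"
  shows "good Q f"
  using assms unfolding good_def by blast

lemma goodI':
  assumes "cen Q" "mE Q f" "mF (TC Q) h" "\<And>x. x \<in> Q \<Longrightarrow> h x = f x"
    "\<And>c. c \<in> C \<Longrightarrow> \<exists>t\<in>T. h c = c \<otimes> t"
  shows "good Q f"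
proof (rule goodI[OF assms(1-4)])
  fix c assume c: "c \<in> C"
  then obtain t where "t \<in> T" "h c = c \<otimes> t" using assms(5) by blast
  then show "inv c \<otimes> h c \<in> T" using Cc[OF c] Tc by (simp add: inv_cancel)
qed

lemma good_cong: "good Q f \<Longrightarrow> (\<And>x. x \<in> Q \<Longrightarrow> f x = g x) \<Longrightarrow> good Q g"
  unfolding good_def using small.cong[of Q f g] by auto

lemma good_comp:
  assumes f: "good Q f" and g: "good (f ` Q) g"
  shows "good Q (\<lambda>x. g (f x))"
proof -
  obtain h where h: "mF (TC Q) h" "\<And>x. x \<in> Q \<Longrightarrow> h x = f x"
    "\<And>c. c \<in> C \<Longrightarrow> \<exists>r\<in>f ` Q. h c = c \<otimes> r" "h ` TC Q = TC (f ` Q)" using goodE[OF f] by metis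
  obtain k where k: "mF (TC (f ` Q)) k" "\<And>x. x \<in> f ` Q \<Longrightarrow> k x = g x"
    "\<And>c. c \<in> C \<Longrightarrow> \<exists>r\<in>g ` f ` Q. k c = c \<otimes> r" using goodE[OF g] by metis
  show ?thesis
  proof (rule goodI'[OF good_cen[OF f] small.comp[OF good_mE[OF f] good_mE[OF g]]])
    show "mF (TC Q) (\<lambda>x. k (h x))" using big.comp[OF h(1)] h(4) k(1) by simp
    show "k (h x) = g (f x)" if "x \<in> Q" for x using that h(2) k(2) by simp
    fix c assume c: "c \<in> C"
    obtain r where r: "r \<in> f ` Q" "h c = c \<otimes> r" using h(3)[OF c] by blast
    obtain s where s: "s \<in> g ` f ` Q" "k c = c \<otimes> s" using k(3)[OF c] by blast
    note sfQ = cen_sub[OF good_cen[OF g]]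
    have "k (h c) = (c \<otimes> s) \<otimes> g r"
      unfolding r(2) using big.mult[OF k(1), of c r] r c C_TC[OF sfQ(1)] Q_TC[OF sfQ(2)] k(2) s(2) by auto
    moreover have "s \<in> T" "g r \<in> T" using small.img[OF good_mE[OF g]] s r by auto
    ultimately show "\<exists>t\<in>T. k (h c) = c \<otimes> t"
      using Cc[OF c] Tc subgroup.m_closed[OF T] by (intro bexI[of _ "s \<otimes> g r"]) (auto simp: m_assoc)
  qed
qed

lemma good_inv:
  assumes f: "good Q f" and g: "\<And>x. x \<in> Q \<Longrightarrow> g (f x) = x"
  shows "good (f ` Q) g"
proof -
  obtain h where h: "mF (TC Q) h" "\<And>x. x \<in> Q \<Longrightarrow> h x = f x"
    "\<And>c. c \<in> C \<Longrightarrow> \<exists>r\<in>f ` Q. h c = c \<otimes> r" "h ` TC Q = TC (f ` Q)" using goodE[OF f] by metis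
  note sQ = cen_sub[OF good_cen[OF f]]
  have mf: "mE Q f" using f good_mE by blast
  have QTC: "Q \<subseteq> TC Q" and CTC: "C \<subseteq> TC Q" using Q_TC C_TC sQ by auto
  let ?k = "inv_into (TC Q) h"
  show ?thesis
  proof (rule goodI')
    show "cen (f ` Q)" using cen_image[OF good_cen[OF f] m_M[OF mf]] .
    show "mE (f ` Q) g" by (rule small.cong[OF small.inverse[OF mf]]) (use g small.inv_f[OF mf] in auto)
    show "mF (TC (f ` Q)) ?k" using big.inverse[OF h(1)] h(4) by simp
    show "?k y = g y" if y: "y \<in> f ` Q" for y
    proof -
      obtain x where x: "x \<in> Q" "y = f x" using y by auto
      then show ?thesis using big.inv_f[OF h(1), of x] QTC g[OF x(1)] h(2)[OF x(1)] by auto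
    qed
    fix c assume c: "c \<in> C"
    obtain x where x: "x \<in> Q" "h c = c \<otimes> f x" using h(3)[OF c] by auto
    have ix: "inv x \<in> Q" using x subgroup.m_inv_closed[OF sQ(1)] by blast
    have cx: "c \<otimes> inv x \<in> TC Q" using subgroup.m_closed[OF TC_subgroup[OF sQ]] c ix QTC CTC by blast
    have fx: "f x \<in> carrier G" using small.car(2)[OF mf x(1)] .
    have "h (c \<otimes> inv x) = (c \<otimes> f x) \<otimes> inv (f x)"
      using big.mult[OF h(1), of c "inv x"] c ix QTC CTC x h(2)[OF ix] small.inv[OF mf x(1)] by auto
    also have "\<dots> = c" using fx Cc[OF c] by (simp add: m_assoc)
    finally have "?k c = c \<otimes> inv x" using big.inv_f[OF h(1) cx] by simp
    then show "\<exists>t\<in>T. ?k c = c \<otimes> t" using ix sQ by blast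
  qed
qed

lemma good_restr:
  assumes f: "good Q f" and U: "cen U" "U \<subseteq> Q"
  shows "good U f"
proof -
  obtain h where h: "mF (TC Q) h" "\<And>x. x \<in> Q \<Longrightarrow> h x = f x" "\<And>c. c \<in> C \<Longrightarrow> inv c \<otimes> h c \<in> T"
    using f by (auto simp: good_def)
  show ?thesis
  proof (rule goodI[OF U(1)])
    show "mE U f" using small.restr[OF good_mE[OF f] cen_sub(1)[OF U(1)] U(2)] .
    show "mF (TC U) h" using big.restr[OF h(1) TC_subgroup[OF cen_sub[OF U(1)]] TC_mono[OF U(2)]] .
  qed (use h U in auto)
qed

lemma good_cj:
  assumes t: "t \<in> T" and Q: "cen Q"
  shows "good Q (cj t)"
proof (rule goodI'[OF Q])
  note sQ = cen_sub[OF Q]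
  show "mE Q (cj t)" using small.conj[OF t] sQ by blast
  show "mF (TC Q) (cj t)" using big.conj[OF Tc[OF t]] TC_subgroup[OF sQ] TC_c[OF sQ] by blast
  fix c assume c: "c \<in> C"
  have "cj t c = c" using cj_fixes_iff[OF Tc[OF t] Cc[OF c]] C_comm[OF c t] by simp
  then show "\<exists>s\<in>T. cj t c = c \<otimes> s" using subgroup.one_closed[OF T] Cc[OF c] by (intro bexI[of _ \<one>]) auto
qed simp

text \<open>\<open>T\<close> is strongly closed, so it is its only conjugate and therefore
  receptive. The extender of an automorphism of \<open>T\<close> contains \<open>T\<close> and its
  centralizer \<open>C\<close>, and the extension maps \<open>C\<close> to itself because it
  preserves \<open>T\<close>.\<close>

lemma autF_extends:
  assumes a: "mF T a"
  obtains h where "mF (TC T) h" "\<And>x. x \<in> T \<Longrightarrow> h x = a x" "h ` C = C" "h ` TC T = TC T"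
proof -
  obtain e where e: "mF T e" "big.fau (e ` T)" "big.recp (e ` T)" using big.satD[OF F_sat T TS] by blast
  then have R: "big.recp T" using autT by simp
  obtain h where h: "mF (big.ext T T a) h" "\<And>x. x \<in> T \<Longrightarrow> h x = a x"
    using big.recpD[OF R a autT[OF a]] by blast
  have sX: "subgroup (big.ext T T a) G" using big.dom[OF h(1)] by blast
  have 1: "T \<subseteq> big.ext T T a" using big.ext_self[OF a autT[OF a]] .
  have 2: "C \<subseteq> big.ext T T a"
    using big.ext_centralizer[OF T TS T TS] C_iff autT[OF a] by auto
  have "TC T \<subseteq> big.ext T T a" using 1 2 subgroup.m_closed[OF sX] by (fastforce simp: TC_mem)
  then have h': "mF (TC T) h" using big.restr[OF h(1) TC_subgroup[OF T order_refl]] by blast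
  have TT: "T \<subseteq> TC T" "C \<subseteq> TC T" using Q_TC C_TC T by auto
  have hC: "h c \<in> C" if c: "c \<in> C" for c
  proof -
    have "h c \<otimes> y = y \<otimes> h c" if y: "y \<in> T" for y
    proof -
      obtain x where x: "x \<in> T" "y = h x" using y autT[OF a] h(2) by (metis imageE)
      have "h (c \<otimes> x) = h (x \<otimes> c)" using C_comm[OF c x(1)] by simp
      then show ?thesis using big.mult[OF h'] TT c x by (simp add: subsetD)
    qed
    moreover have "h c \<in> carrier G" using big.car(2)[OF h'] TT c by blast
    ultimately show ?thesis by (simp add: C_iff)
  qed
  have CC: "h ` C = C" using big.endo[OF big.restr[OF h' C_subgroup TT(2)]] hC by blast
  have "h ` TC T \<subseteq> TC T"
  proof
    fix y assume "y \<in> h ` TC T"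
    then obtain t c where tc: "t \<in> T" "c \<in> C" "y = h (t \<otimes> c)" by (auto simp: TC_mem)
    have "y = a t \<otimes> h c" using tc big.mult[OF h', of t c] TT h(2) by auto
    moreover have "a t \<in> T" using autT[OF a] tc by auto
    ultimately show "y \<in> TC T" using hC tc unfolding TC_mem by blast
  qed
  then have "h ` TC T = TC T" by (rule big.endo[OF h'])
  then show ?thesis using that h' h(2) CC by blast
qed

text \<open>Conjugate the extension of \<open>f\<close> by an extension \<open>A\<close> of
  \<open>a\<close> to \<open>T C\<close>. Since \<open>A\<close> preserves both \<open>C\<close> and
  \<open>T\<close>, the result is still the identity on \<open>C\<close> modulo
  \<open>T\<close>.\<close>

lemma good_autF:
  assumes a: "mF T a" and f: "good Q f" and h: "\<And>x. x \<in> Q \<Longrightarrow> h (a x) = a (f x)"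
  shows "good (a ` Q) h"
proof -
  note sQ = cen_sub[OF good_cen[OF f]]
  obtain A where A: "mF (TC T) A" "\<And>x. x \<in> T \<Longrightarrow> A x = a x" "A ` C = C" "A ` TC T = TC T"
    using autF_extends[OF a] by metis
  obtain k where k: "mF (TC Q) k" "\<And>x. x \<in> Q \<Longrightarrow> k x = f x"
    "\<And>c. c \<in> C \<Longrightarrow> \<exists>r\<in>f ` Q. k c = c \<otimes> r" "k ` TC Q = TC (f ` Q)" using goodE[OF f] by metis
  have mf: "mE Q f" using good_mE[OF f] .
  have QT: "TC Q \<subseteq> TC T" using TC_mono sQ by auto
  have fQT: "f ` Q \<subseteq> T" using small.img[OF mf] .
  have fQTC: "TC (f ` Q) \<subseteq> TC T" using TC_mono[OF fQT] .
  have maQ: "mF Q a" using big.restr[OF a sQ] .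
  have ATC: "A ` TC Q = TC (a ` Q)"
  proof -
    have TT: "x \<in> TC T" if "x \<in> T \<or> x \<in> C" for x using that Q_TC C_TC T by auto
    have e: "A (q \<otimes> c) = a q \<otimes> A c" if "q \<in> Q" "c \<in> C" for q c
      using big.mult[OF A(1) TT TT, of q c] that sQ A(2) by auto
    show ?thesis
    proof (intro equalityI subsetI)
      fix y assume "y \<in> A ` TC Q"
      then obtain q c where qc: "q \<in> Q" "c \<in> C" "y = A (q \<otimes> c)" by (auto simp: TC_mem)
      then have "y = a q \<otimes> A c" "A c \<in> C" using e A(3) by auto
      then show "y \<in> TC (a ` Q)" unfolding TC_mem using qc(1) by blast
    next
      fix y assume "y \<in> TC (a ` Q)"
      then obtain q d where qd: "q \<in> Q" "d \<in> C" "y = a q \<otimes> d" by (auto simp: TC_mem)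
      then obtain c where c: "c \<in> C" "d = A c" using A(3) by auto
      have "y = A (q \<otimes> c)" using e qd c by simp
      moreover have "q \<otimes> c \<in> TC Q" unfolding TC_mem using qd(1) c(1) by blast
      ultimately show "y \<in> A ` TC Q" by blast
    qed
  qed
  define K where "K = (\<lambda>y. A (k (inv_into (TC T) A y)))"
  have iA: "inv_into (TC T) A (A x) = x" if "x \<in> TC T" for x using big.inv_f[OF A(1) that] .
  have mK: "mF (A ` TC Q) K"
  proof (rule big.comp_inv[OF big.restr[OF A(1) TC_subgroup[OF sQ] QT]])
    show "mF (TC Q) (\<lambda>x. A (k x))" by (rule big.comp'[OF k(1) A(1)]) (use k(4) fQTC in simp)
    show "K (A x) = A (k x)" if "x \<in> TC Q" for x using iA that QT by (auto simp: K_def)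
  qed
  show ?thesis
  proof (rule goodI')
    show "cen (a ` Q)" using cen_image[OF good_cen[OF f] maQ] .
    show "mE (a ` Q) h" using aut_inv[OF a mf h] .
    show "mF (TC (a ` Q)) K" using mK ATC by simp
    show "K y = h y" if y: "y \<in> a ` Q" for y
    proof -
      obtain x where x: "x \<in> Q" "y = a x" using y by auto
      have xT: "x \<in> T" "f x \<in> T" using x sQ fQT by auto
      have "y = A x" using A(2)[OF xT(1)] x by simp
      then have "K y = A (k x)" using iA[of x] xT Q_TC[of T] by (auto simp: K_def)
      then show ?thesis using k(2)[OF x(1)] A(2)[OF xT(2)] h[OF x(1)] x(2) by simp
    qed
    fix c assume c: "c \<in> C"
    then obtain d where d: "d \<in> C" "c = A d" using A(3) by auto
    obtain r where r: "r \<in> f ` Q" "k d = d \<otimes> r" using k(3)[OF d(1)] by blast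
    have rT: "r \<in> T" using r fQT by auto
    have "K c = A (d \<otimes> r)" using iA[of d] C_TC[OF T] d r by (auto simp: K_def)
    also have "\<dots> = c \<otimes> a r"
      using big.mult[OF A(1), of d r] C_TC[OF T] Q_TC[of T] d rT A(2) by auto
    finally have "K c = c \<otimes> a r" .
    then show "\<exists>t\<in>T. K c = c \<otimes> t" using autT[OF a] rT by blast
  qed
qed

text \<open>
  An element of \<open>p\<close>-power order becomes conjugation by some \<open>t \<in> T\<close> at an \<open>mF\<close>-receptive conjugate
  \<open>R\<close>. There \<open>[t, C(R)] \<le> C(R) \<inter> T \<le> R\<close>, so \<open>t\<close> normalizes every subgroup between \<open>R\<close> and
  \<open>R C(R)\<close>, in particular the image of \<open>TC Q\<close>.
\<close>

lemma good_p_element: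
  assumes Q: "cen Q" and b: "small.aut Q b" and pow: "\<And>x. x \<in> Q \<Longrightarrow> (b ^^ (p ^ k)) x = x"
  shows "good Q b"
proof -
  note sQ = cen_sub[OF Q]
  have b': "mE Q b" "b ` Q = Q" using b by (auto simp: small.aut_def)
  obtain e1 t where e1': "mE Q e1" and t: "t \<in> nrm T (e1 ` Q)" "\<And>x. x \<in> Q \<Longrightarrow> e1 (b x) = cj t (e1 x)"
    using small.p_element_conj[OF E_sat b pow] by blast
  define R where "R = e1 ` Q"
  have e1: "mE Q e1" "e1 ` Q = R" using e1' by (auto simp: R_def)
  note t = t[folded R_def]
  have sR: "subgroup R G" "R \<subseteq> T" using small.image[OF e1(1)] small.img[OF e1(1)] by (auto simp: R_def)
  obtain u where u: "mF R u" "big.fau (u ` R)" "big.recp (u ` R)"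
    using big.satD[OF F_sat sR(1) subset_trans[OF sR(2) TS]] by blast
  define W where "W = u ` R"
  obtain \<sigma> where \<sigma>: "big.aut W \<sigma>"
      "carries R (\<lambda>x. \<sigma> (u x)) (cj ` nrm T R) (cj ` nrm (carrier G) W)"
  proof (rule big.fau_carries_aut[of W R u "cj ` nrm T R"])
    show "p_family p R (cj ` nrm T R)" using small.nrm_family sR by blast
    show "big.aut R a" if "a \<in> cj ` nrm T R" for a
      using that big.nrm_aut[of _ R] sR TS by (auto simp: nrm_def)
  qed (use u W_def in auto)
  define u1 where "u1 = (\<lambda>x. \<sigma> (u x))"
  have u1: "mF R u1" "u1 ` R = W"
    using \<sigma>(1) big.comp[OF u(1), of \<sigma>] by (auto simp: big.aut_def u1_def W_def image_image[symmetric])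
  have sN: "subgroup (nrm T R) G" using nrm_subgroup[OF T] sR Tc by blast
  have RN: "R \<subseteq> nrm T R" using nrm_self[OF sR(1) finS[OF sR(1)] sR(2)] .
  have NT: "nrm T R \<subseteq> T" by (auto simp: nrm_def)
  obtain h where h: "mF (nrm T R) h" "\<And>x. x \<in> R \<Longrightarrow> h x = u1 x"
    by (rule big.extend_carries[OF u(3)[folded W_def] u1 _ sN])
      (use \<sigma>(2) Tc in \<open>auto simp: u1_def nrm_def\<close>)
  \<comment> \<open>On \<open>W\<close> the map \<open>b\<close> becomes conjugation by
    \<open>s\<close>. Obtaining \<open>s\<close> as the image of \<open>t\<close> under the
    extension \<open>h\<close> shows that it lies in \<open>T\<close>, by strong closure.\<close>
  define s where "s = h t"
  have sT: "s \<in> T" using closed[OF h(1) NT] t(1) by (auto simp: s_def)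
  define \<chi> where "\<chi> = (\<lambda>x. u1 (e1 x))"
  have \<chi>: "mF Q \<chi>" "\<chi> ` Q = W"
    using big.comp[OF m_M[OF e1(1)], of u1] e1(2) u1 by (auto simp: \<chi>_def image_image[symmetric])
  have \<chi>b: "\<chi> (b x) = cj s (\<chi> x)" if x: "x \<in> Q" for x
  proof -
    have "e1 x \<in> R" "cj t (e1 x) \<in> R" using e1(2) x nrmD[OF t(1)] by auto
    then show ?thesis using t(2)[OF x] big.m_cj[OF h(1) t(1), of "e1 x"] RN h(2)
      by (auto simp: \<chi>_def s_def)
  qed
  obtain H0 where H0: "mF (big.ext Q W \<chi>) H0" "\<And>x. x \<in> Q \<Longrightarrow> H0 x = \<chi> x"
    using big.recpD[OF u(3)[folded W_def] \<chi>] by blast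
  have WT: "W \<subseteq> T" "subgroup W G" using closed[OF \<chi>(1) sQ(2)] big.image[OF \<chi>(1)] \<chi>(2) by auto
  have sub: "TC Q \<subseteq> big.ext Q W \<chi>"
  proof -
    have "Q \<subseteq> big.ext Q W \<chi>" using big.ext_self[OF \<chi>] .
    moreover have "C \<subseteq> big.ext Q W \<chi>"
      using big.ext_centralizer[of Q W _ \<chi>] sQ WT TS \<chi>(2) Cc C_comm by blast
    ultimately show ?thesis
      using subgroup.m_closed[OF big.dom(1)[OF H0(1)]] by (fastforce simp: TC_mem)
  qed
  have H: "mF (TC Q) H0" using big.restr[OF H0(1) TC_subgroup[OF sQ] sub] .
  have QTC: "Q \<subseteq> TC Q" and CTC: "C \<subseteq> TC Q" using Q_TC C_TC sQ by auto
  define I where "I = H0 ` TC Q"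
  have sI: "subgroup I G" "I \<subseteq> carrier G" using big.image[OF H] big.img[OF H] by (auto simp: I_def)
  have WI: "W \<subseteq> I" using \<chi>(2) H0(2) QTC by (force simp: I_def)
  have sc: "s \<in> carrier G" using sT Tc by blast
  have sW: "cj s x \<in> W" if "x \<in> W" for x
    using that \<chi>b b'(2) \<chi>(2) by (metis imageE image_eqI)
  have cenW: "cen W" using cen_image[OF Q \<chi>(1)] \<chi>(2) by simp
  have Hc: "\<exists>w\<in>W. cj s (H0 c) = H0 c \<otimes> w" if c: "c \<in> C" for c
  proof
    define w where "w = inv (H0 c) \<otimes> cj s (H0 c)"
    have hc: "H0 c \<in> carrier G" using big.car(2)[OF H] CTC c by auto
    have comm: "H0 c \<otimes> y = y \<otimes> H0 c" if y: "y \<in> W" for y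
    proof -
      obtain x where x: "x \<in> Q" "y = H0 x" using y \<chi>(2) H0(2) by (metis imageE)
      have "H0 (c \<otimes> x) = H0 (x \<otimes> c)" using C_comm[OF c] x sQ by auto
      then show ?thesis using big.mult[OF H] CTC QTC c x by (simp add: subsetD)
    qed
    have comm2: "cj s (H0 c) \<otimes> y = y \<otimes> cj s (H0 c)" if y: "y \<in> W" for y
    proof -
      have "s \<in> nrm (carrier G) W"
        by (rule nrmI) (use finS[OF WT(2)] WT Tc sc sW in auto)
      then obtain z where z: "z \<in> W" "y = cj s z" using y by (auto simp: nrm_def)
      have zc: "z \<in> carrier G" using z WT Tc by auto
      show ?thesis unfolding z(2) using comm[OF z(1)] cj_mult[OF sc hc zc] cj_mult[OF sc zc hc] by simp
    qed
    have wT: "w \<in> T"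
    proof -
      have "w = cj (H0 c) (inv s) \<otimes> s"
        using hc sc by (simp add: w_def cj_def m_assoc)
      then show ?thesis using T_normal[OF hc subgroup.m_inv_closed[OF T sT]] subgroup.m_closed[OF T _ sT] by simp
    qed
    show "w \<in> W"
    proof (rule cenD0[OF cenW wT])
      fix y assume y: "y \<in> W"
      have yc: "y \<in> carrier G" using y WT Tc by auto
      have cc: "cj s (H0 c) \<in> carrier G" using sc hc by simp
      have i: "inv (H0 c) \<otimes> y = y \<otimes> inv (H0 c)"
        using comm[OF y] hc yc by (metis inv_solve_left inv_solve_right m_assoc inv_closed m_closed)
      have "w \<otimes> y = inv (H0 c) \<otimes> (y \<otimes> cj s (H0 c))"
        unfolding w_def comm2[OF y, symmetric] using hc yc cc by (simp add: m_assoc)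
      also have "\<dots> = (inv (H0 c) \<otimes> y) \<otimes> cj s (H0 c)" using hc yc cc by (simp add: m_assoc)
      also have "\<dots> = y \<otimes> w" unfolding i w_def using hc yc cc by (simp add: m_assoc)
      finally show "w \<otimes> y = y \<otimes> w" .
    qed
    show "cj s (H0 c) = H0 c \<otimes> w" using hc sc by (simp add: w_def inv_cancel)
  qed
  have sIc: "cj s y \<in> I" if "y \<in> I" for y
  proof -
    obtain q c where qc: "q \<in> Q" "c \<in> C" "y = H0 (q \<otimes> c)" using \<open>y \<in> I\<close> by (auto simp: I_def TC_mem)
    have mem: "H0 q \<in> I" "H0 c \<in> I" using qc QTC CTC unfolding I_def by blast+
    have memW: "H0 q \<in> W" using qc \<chi>(2) H0(2) by auto
    have y: "y = H0 q \<otimes> H0 c" using qc big.mult[OF H, of q c] QTC CTC by auto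
    obtain w where w: "w \<in> W" "cj s (H0 c) = H0 c \<otimes> w" using Hc[OF qc(2)] by blast
    have "cj s y = cj s (H0 q) \<otimes> (H0 c \<otimes> w)"
      unfolding y w(2)[symmetric] using mem sI sc by (intro cj_mult) auto
    moreover have "cj s (H0 q) \<in> I" "w \<in> I" using sW[OF memW] WI w by auto
    ultimately show ?thesis using mem subgroup.m_closed[OF sI(1)] by simp
  qed
  have mI: "mF I (cj s)" using big.conj[OF sc sI] .
  have sII: "cj s ` I = I" by (rule big.endo[OF mI]) (use sIc in auto)
  define k where "k = (\<lambda>x. inv_into (TC Q) H0 (cj s (H0 x)))"
  have mk: "mF (TC Q) k"
  proof -
    have "mF (TC Q) (\<lambda>x. cj s (H0 x))" using big.comp[OF H, of "cj s"] mI by (simp add: I_def)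
    moreover have "(\<lambda>x. cj s (H0 x)) ` TC Q = H0 ` TC Q" using sII by (simp add: I_def image_image)
    ultimately show ?thesis unfolding k_def using big.comp[of "TC Q" _ "inv_into (TC Q) H0"] big.inverse[OF H] by simp
  qed
  show ?thesis
  proof (rule goodI'[OF Q b'(1) mk])
    fix x assume x: "x \<in> Q"
    have bx: "b x \<in> Q" using b'(2) x by auto
    have "cj s (H0 x) = H0 (b x)" using \<chi>b[OF x] H0(2)[OF x] H0(2)[OF bx] by simp
    then show "k x = b x" using big.inv_f[OF H] QTC bx by (auto simp: k_def)
  next
    fix c assume c: "c \<in> C"
    obtain q where q: "q \<in> Q" "cj s (H0 c) = H0 c \<otimes> H0 q" using Hc[OF c] \<chi>(2) H0(2) by (metis imageE)
    have "H0 (c \<otimes> q) = cj s (H0 c)" using big.mult[OF H, of c q] c q QTC CTC by auto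
    moreover have "c \<otimes> q \<in> TC Q" using subgroup.m_closed[OF TC_subgroup[OF sQ]] c q QTC CTC by auto
    ultimately have "k c = c \<otimes> q" using big.inv_f[OF H] by (metis k_def)
    then show "\<exists>t\<in>T. k c = c \<otimes> t" using q sQ by auto
  qed
qed

section \<open>The subsystem generated by good morphisms\<close>

text \<open>Closure under restriction and composition suffices: inverses follow because inverses of
  good morphisms are good. Agreement on \<open>Q\<close> is built into both rules, so that the
  predicate ignores values outside \<open>Q\<close>.\<close>

inductive mE' :: "'a set \<Rightarrow> ('a \<Rightarrow> 'a) \<Rightarrow> bool" where
  base: "good U f \<Longrightarrow> subgroup Q G \<Longrightarrow> Q \<subseteq> U \<Longrightarrow> (\<And>x. x \<in> Q \<Longrightarrow> f x = g x) \<Longrightarrow> mE' Q g"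
| step: "mE' Q f \<Longrightarrow> mE' (f ` Q) g \<Longrightarrow> (\<And>x. x \<in> Q \<Longrightarrow> h x = g (f x)) \<Longrightarrow> mE' Q h"

lemma mE'_mE: "mE' Q f \<Longrightarrow> mE Q f"
proof (induction rule: mE'.induct)
  case (base U f Q g)
  then show ?case using small.cong[OF small.restr[OF good_mE]] by blast
next
  case (step Q f g h)
  show ?case by (rule small.cong[OF small.comp[OF step.IH]]) (use step.hyps in auto)
qed

text \<open>On centric subgroups generation adds nothing: restrictions of good morphisms to centric
  subgroups and composites of good morphisms are good, and images of centric subgroups are
  centric.\<close>

lemma mE'_good: "mE' Q f \<Longrightarrow> cen Q \<Longrightarrow> good Q f"
proof (induction rule: mE'.induct)
  case (base U f Q g)
  then show ?case using good_cong[OF good_restr] by blast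
next
  case (step Q f g h)
  have "cen (f ` Q)" using cen_image[OF step.prems m_M[OF mE'_mE[OF step.hyps(1)]]] .
  then show ?case using good_cong[OF good_comp[of Q f g]] step by auto
qed

lemma good_mE': "good Q f \<Longrightarrow> mE' Q f"
  using mE'.base[of Q f Q f] cen_sub good_cen by blast

lemma mE'_cong: "mE' Q f \<Longrightarrow> (\<And>x. x \<in> Q \<Longrightarrow> f x = g x) \<Longrightarrow> mE' Q g"
proof (induction arbitrary: g rule: mE'.induct)
  case (base U f Q f')
  then show ?case by (intro mE'.base[OF base.hyps(1-3)]) auto
next
  case (step Q f g' h)
  then show ?case by (intro mE'.step[OF step.hyps(1,2)]) auto
qed

lemma mE'_restr: "mE' Q f \<Longrightarrow> subgroup U G \<Longrightarrow> U \<subseteq> Q \<Longrightarrow> mE' U f"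
proof (induction arbitrary: U rule: mE'.induct)
  case (base V f Q g)
  then show ?case by (intro mE'.base[OF base.hyps(1), of U]) auto
next
  case (step Q f g h)
  have "mE' U f" using step by blast
  moreover have "mE' (f ` U) g"
    using step.IH(2)[of "f ` U"] small.image[OF mE'_mE[OF \<open>mE' U f\<close>]] step.prems by blast
  ultimately show ?case by (rule mE'.step) (use step in auto)
qed

lemma mE'_inv: "mE' Q f \<Longrightarrow> (\<And>x. x \<in> Q \<Longrightarrow> g (f x) = x) \<Longrightarrow> mE' (f ` Q) g"
proof (induction arbitrary: g rule: mE'.induct)
  case (base U f Q f')
  have fQ: "f' ` Q = f ` Q" using base.hyps(4) by auto
  have i: "inj_on f U" using small.inj[OF good_mE[OF base.hyps(1)]] .
  show ?case
  proof (rule mE'.base)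
    show "good (f ` U) (inv_into U f)" by (rule good_inv[OF base.hyps(1)]) (use i in simp)
    show "subgroup (f' ` Q) G" unfolding fQ
      using small.image[OF small.restr[OF good_mE[OF base.hyps(1)] base.hyps(2,3)]] .
    show "f' ` Q \<subseteq> f ` U" unfolding fQ using base.hyps(3) by auto
    show "inv_into U f y = g y" if "y \<in> f' ` Q" for y
    proof -
      obtain x where x: "x \<in> Q" "y = f' x" using \<open>y \<in> f' ` Q\<close> by auto
      then have "inv_into U f (f x) = x" using i base.hyps(3) by auto
      then show ?thesis using x base.hyps(4)[OF x(1)] base.prems[OF x(1)] by simp
    qed
  qed
next
  case (step Q f g h k)
  have hQ: "h ` Q = g ` f ` Q" using step.hyps(3) by (auto simp: image_image)
  have if': "inv_into Q f (f x) = x" if "x \<in> Q" for x using small.inv_f[OF mE'_mE[OF step.hyps(1)] that] .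
  have ig: "inv_into (f ` Q) g (g y) = y" if "y \<in> f ` Q" for y using small.inv_f[OF mE'_mE[OF step.hyps(2)] that] .
  have 1: "mE' (f ` Q) (inv_into Q f)" by (rule step.IH(1)) (use if' in simp)
  have 2: "mE' (g ` f ` Q) (inv_into (f ` Q) g)" by (rule step.IH(2)) (use ig in simp)
  have 3: "inv_into (f ` Q) g ` g ` f ` Q = f ` Q" using ig by (force simp: image_image)
  have "mE' (h ` Q) k" unfolding hQ
    by (rule mE'.step[OF 2, of "inv_into Q f"]) (use 1 3 ig if' step in auto)
  then show ?case .
qed

lemma mE'_cj: "g \<in> T \<Longrightarrow> mE' T (cj g)"
  using good_mE'[OF good_cj[OF _ cen_T]] .

sublocale sub: fusion G p n T mE'
proof (intro fusion.intro fusion_axioms.intro finite_p_group_axioms)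
  show "subgroup T G" by (rule T)
  show "subgroup Q G" if "mE' Q f" for Q f using small.dom(1)[OF mE'_mE[OF that]] .
  show "Q \<subseteq> T" if "mE' Q f" for Q f using small.dom(2)[OF mE'_mE[OF that]] .
  show "f ` Q \<subseteq> T" if "mE' Q f" for Q f using small.img[OF mE'_mE[OF that]] .
  show "inj_on f Q" if "mE' Q f" for Q f using small.inj[OF mE'_mE[OF that]] .
  show "f (x \<otimes> y) = f x \<otimes> f y" if "mE' Q f" "x \<in> Q" "y \<in> Q" for Q f x y
    using small.mult[OF mE'_mE[OF that(1)] that(2,3)] .
  show "mE' Q g" if "mE' Q f" "\<And>x. x \<in> Q \<Longrightarrow> f x = g x" for Q f g using mE'_cong that .
  show "mE' Q (\<lambda>x. g (f x))" if "mE' Q f" "mE' (f ` Q) g" for Q f g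
    by (rule mE'.step[OF that]) simp
  show "mE' U f" if "mE' Q f" "subgroup U G" "U \<subseteq> Q" for Q U f using mE'_restr that .
  show "mE' (f ` Q) (inv_into Q f)" if "mE' Q f" for Q f
    by (rule mE'_inv[OF that]) (use small.inv_f[OF mE'_mE[OF that]] in simp)
  show "mE' T (cj g)" if "g \<in> T" for g using mE'_cj that .
qed

lemma mE'_autF: "mE' Q f \<Longrightarrow> mF T a \<Longrightarrow> (\<And>x. x \<in> Q \<Longrightarrow> h (a x) = a (f x)) \<Longrightarrow> mE' (a ` Q) h"
proof (induction arbitrary: h rule: mE'.induct)
  case (base U f Q g)
  note UT = cen_sub[OF good_cen[OF base.hyps(1)]]
  have sa: "subgroup (a ` Q) G" using big.image_sub[OF base.prems(1) base.hyps(2)] base.hyps(3) UT by blast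
  have ia: "inv_into T a (a x) = x" if "x \<in> U" for x using autT_inv(3)[OF base.prems(1)] that UT by blast
  show ?case
  proof (rule mE'.base)
    show "good (a ` U) (\<lambda>y. a (f (inv_into T a y)))"
      by (rule good_autF[OF base.prems(1) base.hyps(1)]) (use ia in simp)
  qed (use sa base ia in auto)
next
  case (step Q f g h h')
  have fT: "f x \<in> T" if "x \<in> Q" for x using sub.img[OF step.hyps(1)] that by auto
  have QT: "x \<in> T" if "x \<in> Q" for x using sub.dom[OF step.hyps(1)] that by auto
  note ia = autT_inv(3)[OF step.prems(1)]
  have 1: "mE' (a ` Q) (\<lambda>y. a (f (inv_into T a y)))"
    by (rule step.IH(1)[OF step.prems(1)]) (use ia QT in simp)
  have 2: "mE' (a ` f ` Q) (\<lambda>y. a (g (inv_into T a y)))"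
    by (rule step.IH(2)[OF step.prems(1)]) (use ia fT in auto)
  have 3: "(\<lambda>y. a (f (inv_into T a y))) ` a ` Q = a ` f ` Q"
    using ia QT by (auto simp: image_image)
  show ?case
    by (rule mE'.step[OF 1, of "\<lambda>y. a (g (inv_into T a y))"]) (use 2 3 ia QT fT step in auto)
qed

text \<open>Types once more, one level down: \<open>E'.ty\<close> and \<open>E'.fac\<close> compare
  \<open>mE\<close> with \<open>mE'\<close>, whereas the unqualified \<open>ty\<close> and
  \<open>fac\<close> compare \<open>mF\<close> with \<open>mE\<close>.\<close>

sublocale E': normal_pair G p n T mE T mE'
proof (intro normal_pair.intro normal_pair_axioms.intro finite_p_group_axioms
    small.fusion_axioms sub.fusion_axioms)
  show "mE Q f" if "mE' Q f" for Q f using mE'_mE that .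
  show "f ` Q \<subseteq> T" if "mE Q f" for Q f using small.img that .
  show "mE' (a ` Q) h" if "mE T a" "mE' Q f" "\<And>x. x \<in> Q \<Longrightarrow> h (a x) = a (f x)" for a Q f h
    using mE'_autF[OF that(2) m_M[OF that(1)]] that(3) by blast
qed simp

section \<open>Factorization through the good subsystem\<close>

text \<open>Some F-conjugate of \<open>R\<close> misses an element of its centralizer in
  \<open>T\<close>. By the Frattini factorization so does an E-conjugate, and receptivity carries
  the missing element over to \<open>R\<close> itself.\<close>

lemma non_centric_centralizer:
  assumes R: "subgroup R G" "R \<subseteq> T" and nc: "\<not> cen R" and rec: "small.recp R"
  obtains t where "t \<in> T" "t \<notin> R" "\<And>x. x \<in> R \<Longrightarrow> t \<otimes> x = x \<otimes> t"
proof -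
  obtain f t where f: "mF R f" and t: "t \<in> T" "\<And>x. x \<in> R \<Longrightarrow> t \<otimes> f x = f x \<otimes> t" "t \<notin> f ` R"
    using nc R unfolding cen_def by blast
  obtain a e where ae: "mF T a" "mE R e" "\<And>x. x \<in> R \<Longrightarrow> f x = a (e x)"
    using frattini[OF f R(2)] unfolding fac_def ty_def by blast
  define s where "s = inv_into T a t"
  have s: "s \<in> T" "a s = t" using autT_inv[OF ae(1)] t(1) by (auto simp: s_def)
  have eT: "e x \<in> T" if "x \<in> R" for x using small.img[OF ae(2)] that by auto
  have s_comm: "s \<otimes> e x = e x \<otimes> s" if x: "x \<in> R" for x
  proof -
    have "a (s \<otimes> e x) = a (e x \<otimes> s)"
      using big.mult[OF ae(1)] s eT[OF x] ae(3)[OF x] t(2)[OF x] by simp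
    then show ?thesis
      using inj_onD[OF big.inj[OF ae(1)]] s eT[OF x] subgroup.m_closed[OF T] by blast
  qed
  have s_not: "s \<notin> e ` R"
  proof
    assume "s \<in> e ` R"
    then have "t \<in> f ` R" using s(2) ae(3) by auto
    then show False using t(3) by simp
  qed
  define \<chi> where "\<chi> = inv_into R e"
  have \<chi>: "mE (e ` R) \<chi>" "\<chi> ` e ` R = R"
    using small.inverse[OF ae(2)] small.inv_f[OF ae(2)] by (force simp: \<chi>_def image_image)+
  obtain h where h: "mE (small.ext (e ` R) R \<chi>) h" "\<And>x. x \<in> e ` R \<Longrightarrow> h x = \<chi> x"
    using small.recpD[OF rec \<chi>] by blast
  have eR: "subgroup (e ` R) G" "e ` R \<subseteq> T" using small.image[OF ae(2)] small.img[OF ae(2)] by auto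
  have s_ext: "s \<in> small.ext (e ` R) R \<chi>"
    by (rule small.ext_centralizer[OF eR R s(1)]) (use s_comm \<chi>(2) in auto)
  have e_ext: "e x \<in> small.ext (e ` R) R \<chi>" if "x \<in> R" for x
    using small.ext_self[OF \<chi>] that by auto
  have he: "h (e x) = x" if "x \<in> R" for x using h(2) small.inv_f[OF ae(2)] that by (auto simp: \<chi>_def)
  show ?thesis
  proof (rule that)
    show "h s \<in> T" using small.img[OF h(1)] s_ext by auto
    show "h s \<notin> R"
    proof
      assume "h s \<in> R"
      then have "h s = h (e (h s))" using he by simp
      then have "s = e (h s)" using inj_onD[OF small.inj[OF h(1)]] s_ext e_ext \<open>h s \<in> R\<close> by blast
      then show False using s_not \<open>h s \<in> R\<close> by blast
    qed
    fix x assume x: "x \<in> R"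
    have "h (s \<otimes> e x) = h (e x \<otimes> s)" using s_comm[OF x] by simp
    then show "h s \<otimes> x = x \<otimes> h s" using small.mult[OF h(1)] s_ext e_ext[OF x] he[OF x] by simp
  qed
qed

lemma good_aut_group:
  assumes R: "cen R"
  shows "bij_group R (\<lambda>f. good R f \<and> f ` R = R)"
  unfolding bij_group_def
proof (intro conjI allI impI)
  show "good R (\<lambda>x. x)"
    by (rule good_cong[OF good_cj[OF subgroup.one_closed[OF T] R]]) (use cen_sub[OF R] Tc in auto)
  fix f g assume f: "good R f \<and> f ` R = R"
  show "bij_betw f R R" using small.bij good_mE f by blast
  {
    assume g: "good R g \<and> g ` R = R"
    show "good R (\<lambda>x. f (g x))" using good_comp[of R g f] f g by simp
    show "(\<lambda>x. f (g x)) ` R = R" using f g by (metis image_image)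
  }
  assume "\<forall>x\<in>R. f x = g x"
  then show "good R g" "g ` R = R" using good_cong f by (auto simp: image_def)
qed simp

lemma small_aut_p_family_conjugated:
  assumes A: "p_family p Q A" "\<And>a. a \<in> A \<Longrightarrow> small.aut Q a" and f: "mE Q f" and a: "a \<in> A"
  shows "small.aut (f ` Q) (conjugated Q f a)"
    and "\<exists>k. \<forall>y\<in>f ` Q. (conjugated Q f a ^^ (p ^ k)) y = y"
proof -
  show "small.aut (f ` Q) (conjugated Q f a)"
    using invar_conj[OF A(2)[OF a] m_M[OF f] small.dom(2)[OF f]] .
  show "\<exists>k. \<forall>y\<in>f ` Q. (conjugated Q f a ^^ (p ^ k)) y = y"
    using p_family_conjugated(1)[OF A(1) small.inj[OF f]] a unfolding p_family_def by blast
qed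

text \<open>The Frattini argument again, but the Sylow correction \<open>\<rho>\<close> must itself
  factor. At a centric \<open>R\<close> the \<open>p\<close>-elements of \<open>Aut_E(R)\<close> are
  good, so \<open>\<rho>\<close> can be taken among the good automorphisms. At a non-centric
  \<open>R\<close> the extender of any automorphism contains centralizing elements outside
  \<open>R\<close>, so \<open>\<rho>\<close> extends to a larger subgroup and factors by
  induction.\<close>

theorem E'_fac: "mE Q f \<Longrightarrow> E'.fac Q f"
proof (induction "card T - card Q" arbitrary: Q f rule: less_induct)
  case less
  have sQ: "subgroup Q G" "Q \<subseteq> T" using small.dom less.prems by auto
  show ?case
  proof (cases "Q = T")
    case True
    then show ?thesis using E'.ty_aut[OF _ T] less.prems unfolding E'.fac_def by blast
  next
    case False
    have IH: "E'.fac U g" if "mE U g" "card Q < card U" for U g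
      by (rule less.hyps) (use that card_less_T[OF sQ False] in auto)
    \<comment> \<open>Only maps onto a fully automized receptive subgroup are treated directly. The
      given map \<open>f\<close> is recovered by cancelling \<open>e\<close> from
      \<open>e f\<close>.\<close>
    have claim: "E'.fac V \<chi>" if \<chi>: "mE V \<chi>" and cV: "card V = card Q"
      and nice: "small.fau (\<chi> ` V)" "small.recp (\<chi> ` V)" for V \<chi>
    proof -
      have sV: "subgroup V G" "V \<subseteq> T" using small.dom \<chi> by auto
      have VT: "V \<noteq> T" using cV card_less_T[OF sQ False] by auto
      define R where "R = \<chi> ` V"
      have sR: "subgroup R G" "R \<subseteq> T" using small.image[OF \<chi>] small.img[OF \<chi>] by (auto simp: R_def)
      have cR: "card R = card Q" using small.cardQ[OF \<chi>] cV by (simp add: R_def)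
      note NV = nrm_grows_card[OF sV VT]
      have fV: "p_family p V (cj ` nrm T V)" using small.nrm_family sV by blast
      have aV: "small.aut V a" if "a \<in> cj ` nrm T V" for a using small.nrm_aut sV that by blast
      have "\<exists>\<rho>. small.aut R \<rho> \<and> E'.fac R \<rho> \<and> carries V (\<lambda>x. \<rho> (\<chi> x)) (cj ` nrm T V) (cj ` nrm T R)"
      proof (cases "cen R")
        case True
        obtain \<rho> where \<rho>: "good R \<rho> \<and> \<rho> ` R = R"
          "carries V (\<lambda>x. \<rho> (\<chi> x)) (cj ` nrm T V) (cj ` nrm T R)"
        proof (rule small.fau_carries[of R "\<lambda>f. good R f \<and> f ` R = R" \<chi> V "cj ` nrm T V"])
          show "bij_group R (\<lambda>f. good R f \<and> f ` R = R)" using good_aut_group[OF True] .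
          show "small.aut R f" if "good R f \<and> f ` R = R" for f
            using good_mE that by (auto simp: small.aut_def)
          show "good R (cj g) \<and> cj g ` R = R" if "g \<in> nrm T R" for g
            using that good_cj True by (auto simp: nrm_def)
          fix a assume a: "a \<in> cj ` nrm T V"
          note c = small_aut_p_family_conjugated[OF fV aV \<chi> a, folded R_def]
          obtain k where "\<And>y. y \<in> R \<Longrightarrow> (conjugated V \<chi> a ^^ (p ^ k)) y = y" using c(2) by blast
          then have "good R (conjugated V \<chi> a)" using good_p_element[OF True c(1)] by blast
          then show "good R (conjugated V \<chi> a) \<and> conjugated V \<chi> a ` R = R"
            using c(1) by (simp add: small.aut_def)
        qed (use nice sR fV small.inj[OF \<chi>] in \<open>auto simp: R_def\<close>)
        have "E'.fac R \<rho>" using good_mE' \<rho>(1) by (intro E'.fac_m) blast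
        moreover have "small.aut R \<rho>" using \<rho>(1) good_mE by (auto simp: small.aut_def)
        ultimately show ?thesis using \<rho>(2) by blast
      next
        case nc: False
        obtain \<rho> where \<rho>: "small.aut R \<rho>" "carries V (\<lambda>x. \<rho> (\<chi> x)) (cj ` nrm T V) (cj ` nrm T R)"
          using small.fau_carries_aut[OF nice(1)[folded R_def] \<chi> R_def[symmetric] fV aV] by blast
        have \<rho>': "mE R \<rho>" "\<rho> ` R = R" using \<rho>(1) by (auto simp: small.aut_def)
        obtain h where h: "mE (small.ext R R \<rho>) h" "\<And>x. x \<in> R \<Longrightarrow> h x = \<rho> x"
          using small.recpD[OF nice(2)[folded R_def] \<rho>'] by blast
        obtain t where t: "t \<in> T" "t \<notin> R" "\<And>x. x \<in> R \<Longrightarrow> t \<otimes> x = x \<otimes> t"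
          using non_centric_centralizer[OF sR nc nice(2)[folded R_def]] by blast
        have "t \<in> small.ext R R \<rho>" by (rule small.ext_centralizer) (use sR t \<rho>' in auto)
        then have "R \<subset> small.ext R R \<rho>" using small.ext_self[OF \<rho>'] t(2) by blast
        then have "card R < card (small.ext R R \<rho>)"
          using psubset_card_mono[OF small.finQ[OF h(1)]] by blast
        then have "E'.fac (small.ext R R \<rho>) h" using IH[OF h(1)] cR by simp
        then have "E'.fac R h" by (rule E'.fac_restr[OF _ sR(1) small.ext_self[OF \<rho>']])
        then have "E'.fac R \<rho>" by (rule E'.fac_cong) (use h(2) in auto)
        then show ?thesis using \<rho> by blast
      qed
      then obtain \<rho> where \<rho>: "mE R \<rho>" "\<rho> ` R = R" "E'.fac R \<rho>"
        "carries V (\<lambda>x. \<rho> (\<chi> x)) (cj ` nrm T V) (cj ` nrm T R)" by (auto simp: small.aut_def)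
      have m: "mE V (\<lambda>x. \<rho> (\<chi> x))" "(\<lambda>x. \<rho> (\<chi> x)) ` V = R"
        using small.comp[OF \<chi>, of \<rho>] \<rho> R_def by (auto simp: image_image[symmetric])
      obtain h where h: "mE (nrm T V) h" "\<And>x. x \<in> V \<Longrightarrow> h x = \<rho> (\<chi> x)"
        using small.extend_carries[OF nice(2)[folded R_def] m \<rho>(4) NV(2)] by blast
      have "E'.fac (nrm T V) h" using IH[OF h(1)] NV(1) cV by simp
      then have "E'.fac V h" by (rule E'.fac_restr[OF _ sV(1)]) (use NV(4) in blast)
      then have "E'.fac V (\<lambda>x. \<rho> (\<chi> x))" by (rule E'.fac_cong) (use h(2) in auto)
      then show ?thesis by (rule E'.fac_cancel) (use \<rho>(3) R_def in simp)
    qed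
    have f: "mE Q f" by (rule less.prems)
    obtain e where e: "mE (f ` Q) e" "small.fau (e ` f ` Q)" "small.recp (e ` f ` Q)"
      using small.satD[OF E_sat small.image[OF f] small.img[OF f]] by metis
    have "E'.fac (f ` Q) e" using claim[OF e(1) small.cardQ[OF f] e(2,3)] .
    moreover have "E'.fac Q (\<lambda>x. e (f x))"
      by (rule claim[OF small.comp[OF f e(1)] refl]) (use e(2,3) in \<open>simp_all add: image_image\<close>)
    ultimately show ?thesis using E'.fac_cancel by blast
  qed
qed

text \<open>Write \<open>g = a b d\<close> with \<open>d\<close> in the subsystem and
  \<open>a b\<close> an automorphism of \<open>T\<close> in F. Conjugation by \<open>d\<close> is
  internal, and conjugation by \<open>a b\<close> preserves goodness.\<close>

lemma E'_invar:
  assumes f: "mE' Q f" and g: "mF R g" and RT: "R \<subseteq> T" and QR: "Q \<subseteq> R" "f ` Q \<subseteq> R"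
    and h: "\<And>x. x \<in> Q \<Longrightarrow> h (g x) = g (f x)"
  shows "mE' (g ` Q) h"
proof -
  obtain a e where ae: "mF T a" "mE R e" "\<And>x. x \<in> R \<Longrightarrow> g x = a (e x)"
    using frattini[OF g RT] unfolding fac_def ty_def by blast
  obtain b d where bd: "mE T b" "mE' R d" "\<And>x. x \<in> R \<Longrightarrow> e x = b (d x)"
    using E'_fac[OF ae(2)] unfolding E'.fac_def E'.ty_def by blast
  define A where "A = (\<lambda>x. a (b x))"
  have A: "mF T A" unfolding A_def using autT_comp[OF m_M[OF bd(1)] ae(1)] .
  have gA: "g x = A (d x)" if "x \<in> R" for x using ae(3) bd(3) that by (simp add: A_def)
  have dQ: "mE' Q d" using sub.restr[OF bd(2) sub.dom(1)[OF f] QR(1)] .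
  have 1: "mE' (d ` Q) (conjugated Q d f)"
    by (rule sub.comp_inv[OF dQ sub.comp'[OF f bd(2) QR(2)]]) (use conjugated_apply[OF sub.inj[OF dQ]] in auto)
  have "mE' (A ` d ` Q) h"
    by (rule mE'_autF[OF 1 A])
      (use h gA QR conjugated_apply[OF sub.inj[OF dQ]] in \<open>auto simp: image_subset_iff subset_iff\<close>)
  moreover have "A ` d ` Q = g ` Q" using gA QR(1) by (force simp: image_image)
  ultimately show ?thesis by simp
qed

section \<open>Extending \<open>p'\<close>-automorphisms\<close>

lemma TC_inter_T:
  assumes R: "cen R" and x: "x \<in> TC R" "x \<in> T"
  shows "x \<in> R"
proof -
  note sR = cen_sub[OF R]
  obtain q c where qc: "q \<in> R" "c \<in> C" "x = q \<otimes> c" using x by (auto simp: TC_mem)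
  have "c = inv q \<otimes> x" using qc Cc Tc sR by (simp add: inv_cancel subset_iff)
  moreover have "inv q \<otimes> x \<in> T" using qc(1) sR x by (intro subgroup.m_closed[OF T] subgroup.m_inv_closed[OF T]) auto
  ultimately have "c \<in> T" by simp
  then have "c \<in> R" using cenD0[OF R _ C_comm[OF qc(2)]] sR by blast
  then show ?thesis using qc subgroup.m_closed[OF sR(1)] by simp
qed

text \<open>Automorphisms of \<open>R C\<close> that act on \<open>R\<close> as an element of
  \<open>N_T(R)\<close> and modulo \<open>R\<close> as an inner automorphism. They form a
  \<open>p\<close>-group that contains the inner automorphisms and the action of
  \<open>N_T(R)\<close> and is normalized by every automorphism trivial on \<open>R\<close>. The
  elements \<open>t\<close> and \<open>u\<close> are parameters so that powers can be
  followed.\<close>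

definition tame :: "'a set \<Rightarrow> 'a \<Rightarrow> 'a \<Rightarrow> ('a \<Rightarrow> 'a) \<Rightarrow> bool" where
  "tame R t u l \<longleftrightarrow> big.aut (TC R) l \<and> t \<in> nrm T R \<and> u \<in> TC R \<and> (\<forall>x\<in>R. l x = cj t x) \<and>
     (\<forall>x\<in>TC R. \<exists>r\<in>R. l x = cj u x \<otimes> r)"

lemma tame_mult:
  assumes R: "cen R" and l: "tame R t u l" and l': "tame R t' u' l'"
  shows "tame R (t' \<otimes> t) (u' \<otimes> u) (\<lambda>x. l (l' x))"
proof -
  note sR = cen_sub[OF R]
  have sM: "subgroup (TC R) G" "TC R \<subseteq> carrier G" using TC_subgroup[OF sR] TC_c[OF sR] .
  have tc: "t \<in> carrier G" "t' \<in> carrier G" "u \<in> carrier G" "u' \<in> carrier G"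
    using l l' Tc sM by (auto simp: tame_def nrm_def)
  have uR: "cj u r \<in> R" if r: "r \<in> R" for r
  proof -
    obtain q c where qc: "q \<in> R" "c \<in> C" "u = q \<otimes> c" using l by (auto simp: tame_def TC_mem)
    have y: "cj q r \<in> R" using qc r sR by (simp add: cj_def subgroup.m_closed subgroup.m_inv_closed)
    have "cj u r = cj c (cj q r)" using qc r sR Tc Cc by (simp add: cj_cj subset_iff)
    also have "\<dots> = cj q r" using cj_fixes_iff[of c "cj q r"] C_comm[OF qc(2)] y sR Tc Cc[OF qc(2)] by blast
    finally show ?thesis using y by simp
  qed
  show ?thesis
    unfolding tame_def
  proof (intro conjI ballI)
    show "big.aut (TC R) (\<lambda>x. l (l' x))"
      using l l' big.comp[of "TC R" l' l] unfolding tame_def big.aut_def by (metis image_image)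
    show "t' \<otimes> t \<in> nrm T R"
      using l l' subgroup.m_closed[OF nrm_subgroup[OF T]] sR Tc by (auto simp: tame_def subset_iff)
    show "u' \<otimes> u \<in> TC R" using l l' subgroup.m_closed[OF sM(1)] by (simp add: tame_def)
    show "l (l' x) = cj (t' \<otimes> t) x" if x: "x \<in> R" for x
      using x l l' nrmD(2)[of t' T R x] tc sR Tc by (simp add: tame_def cj_cj subset_iff)
    fix x assume x: "x \<in> TC R"
    have xc: "x \<in> carrier G" using x sM by auto
    obtain r where r: "r \<in> R" "l' x = cj u' x \<otimes> r" using l' x by (auto simp: tame_def)
    have l'x: "l' x \<in> TC R" using l' x by (auto simp: tame_def big.aut_def)
    obtain r' where r': "r' \<in> R" "l (l' x) = cj u (l' x) \<otimes> r'" using l l'x by (auto simp: tame_def)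
    have rc: "r \<in> carrier G" "r' \<in> carrier G" using r r' sR Tc by auto
    have "l (l' x) = cj u (cj u' x \<otimes> r) \<otimes> r'" using r'(2) r(2) by simp
    also have "\<dots> = cj (u' \<otimes> u) x \<otimes> (cj u r \<otimes> r')"
      using tc xc rc by (simp add: cj_mult cj_cj m_assoc)
    finally have "l (l' x) = cj (u' \<otimes> u) x \<otimes> (cj u r \<otimes> r')" .
    then show "\<exists>r\<in>R. l (l' x) = cj (u' \<otimes> u) x \<otimes> r"
      using subgroup.m_closed[OF sR(1) uR[OF r(1)] r'(1)] by blast
  qed
qed

text \<open>Conjugation by \<open>t\<close> fixes \<open>C\<close> pointwise, so it changes
  \<open>q c\<close> only by an element of \<open>R\<close>; therefore the inner part is
  trivial.\<close>

lemma tame_cj: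
  assumes R: "cen R" and t: "t \<in> nrm T R"
  shows "tame R t \<one> (cj t)"
proof -
  note sR = cen_sub[OF R]
  have sM: "subgroup (TC R) G" "TC R \<subseteq> carrier G" using TC_subgroup[OF sR] TC_c[OF sR] .
  have tT: "t \<in> T" "t \<in> carrier G" using t Tc by (auto simp: nrm_def)
  have e: "cj t (q \<otimes> c) = cj t q \<otimes> c" if "q \<in> R" "c \<in> C" for q c
  proof -
    have "cj t c = c" using cj_fixes_iff[OF tT(2) Cc[OF that(2)]] C_comm[OF that(2) tT(1)] by simp
    then show ?thesis using cj_mult[OF tT(2)] that sR Tc Cc by auto
  qed
  have "cj t ` TC R \<subseteq> TC R"
  proof
    fix y assume "y \<in> cj t ` TC R"
    then obtain q c where qc: "q \<in> R" "c \<in> C" "y = cj t (q \<otimes> c)" by (auto simp: TC_mem)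
    then have "y = cj t q \<otimes> c" "cj t q \<in> R" using e nrmD(2)[OF t] by auto
    then show "y \<in> TC R" using qc(2) unfolding TC_mem by blast
  qed
  then have a: "big.aut (TC R) (cj t)"
    unfolding big.aut_def using big.conj[OF tT(2) sM] big.endo by blast
  show ?thesis
    unfolding tame_def
  proof (intro conjI ballI a t)
    show "\<one> \<in> TC R" using subgroup.one_closed[OF sM(1)] .
    fix x assume "x \<in> TC R"
    then obtain q c where qc: "q \<in> R" "c \<in> C" "x = q \<otimes> c" by (auto simp: TC_mem)
    have k: "inv q \<otimes> cj t q \<in> R" using qc nrmD(2)[OF t] sR by (simp add: subgroup.m_closed subgroup.m_inv_closed)
    have kT: "inv q \<otimes> cj t q \<in> T" using k sR by auto
    have car: "q \<in> carrier G" "c \<in> carrier G" "cj t q \<in> carrier G" using qc sR Tc Cc tT by auto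
    have "x \<otimes> (inv q \<otimes> cj t q) = q \<otimes> ((inv q \<otimes> cj t q) \<otimes> c)"
      unfolding qc(3) C_comm[OF qc(2) kT, symmetric] using car by (simp add: m_assoc)
    also have "\<dots> = cj t x" using car e qc by (simp add: m_assoc inv_cancel)
    finally show "\<exists>r\<in>R. cj t x = cj \<one> x \<otimes> r" using k car qc by (metis cj_one m_closed)
  qed simp
qed

lemma tame_inner:
  assumes R: "cen R" and u: "u \<in> TC R"
  shows "\<exists>t. tame R t u (cj u)"
proof -
  note sR = cen_sub[OF R]
  have sM: "subgroup (TC R) G" "TC R \<subseteq> carrier G" using TC_subgroup[OF sR] TC_c[OF sR] .
  obtain q c where qc: "q \<in> R" "c \<in> C" "u = q \<otimes> c" using u by (auto simp: TC_mem)
  have uc: "u \<in> carrier G" using u sM by auto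
  have "cj u ` TC R \<subseteq> TC R"
    using u by (auto simp: cj_def intro!: subgroup.m_closed[OF sM(1)] subgroup.m_inv_closed[OF sM(1)])
  then have a: "big.aut (TC R) (cj u)" unfolding big.aut_def using big.conj[OF uc sM] big.endo by blast
  have "tame R q u (cj u)"
    unfolding tame_def
  proof (intro conjI ballI a u)
    show "q \<in> nrm T R" using nrm_self[OF sR(1) finS[OF sR(1)] sR(2)] qc by auto
    show "cj u x = cj q x" if x: "x \<in> R" for x
    proof -
      have y: "cj q x \<in> T" using T_normal x sR qc Tc by auto
      have "cj u x = cj c (cj q x)" using qc x sR Tc Cc by (simp add: cj_cj subset_iff)
      also have "\<dots> = cj q x" using cj_fixes_iff[of c "cj q x"] C_comm[OF qc(2) y] y Tc Cc[OF qc(2)] by blast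
      finally show ?thesis .
    qed
    show "\<exists>r\<in>R. cj u x = cj u x \<otimes> r" if "x \<in> TC R" for x
      using that sM uc subgroup.one_closed[OF sR(1)] by (intro bexI[of _ \<one>]) auto
  qed
  then show ?thesis by blast
qed

text \<open>As \<open>d\<close> fixes \<open>R\<close> pointwise, conjugation by it keeps the action
  on \<open>R\<close> and transports the inner part.\<close>

lemma tame_conj:
  assumes R: "cen R" and l: "tame R t u l" and d: "big.aut (TC R) d" "\<And>r. r \<in> R \<Longrightarrow> d r = r"
  shows "tame R t (d u) (conjugated (TC R) d l)"
proof -
  note sR = cen_sub[OF R]
  have sM: "subgroup (TC R) G" "TC R \<subseteq> carrier G" using TC_subgroup[OF sR] TC_c[OF sR] .
  have md: "mF (TC R) d" "d ` TC R = TC R" using d(1) by (auto simp: big.aut_def)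
  have ml: "mF (TC R) l" "l ` TC R = TC R" using l by (auto simp: tame_def big.aut_def)
  have RM: "R \<subseteq> TC R" using Q_TC sR by blast
  have cj': "conjugated (TC R) d l (d x) = d (l x)" if "x \<in> TC R" for x
    using conjugated_apply[OF big.inj[OF md(1)] that] .
  have m: "mF (d ` TC R) (conjugated (TC R) d l)"
    by (rule big.comp_inv[OF md(1) big.comp[OF ml(1)]]) (use cj' ml md in auto)
  have im: "conjugated (TC R) d l ` TC R = TC R"
  proof -
    have "conjugated (TC R) d l ` d ` TC R = d ` l ` TC R" using cj' by (force simp: image_image)
    then show ?thesis using md ml by simp
  qed
  have u: "u \<in> TC R" using l by (simp add: tame_def)
  show ?thesis
    unfolding tame_def
  proof (intro conjI ballI)
    show "big.aut (TC R) (conjugated (TC R) d l)" using m md(2) im by (simp add: big.aut_def)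
    show t: "t \<in> nrm T R" using l by (simp add: tame_def)
    show "d u \<in> TC R" using u md(2) by auto
    show "conjugated (TC R) d l x = cj t x" if x: "x \<in> R" for x
    proof -
      have "conjugated (TC R) d l x = d (l x)" using cj'[of x] d(2)[OF x] RM x by auto
      also have "\<dots> = cj t x" using l x d(2) nrmD(2)[OF t x] by (simp add: tame_def)
      finally show ?thesis .
    qed
    fix y assume "y \<in> TC R"
    then obtain x where x: "x \<in> TC R" "y = d x" using md(2) by auto
    obtain r where r: "r \<in> R" "l x = cj u x \<otimes> r" using l x by (auto simp: tame_def)
    have cu: "cj u x \<in> TC R" using u x by (simp add: cj_def subgroup.m_closed[OF sM(1)] subgroup.m_inv_closed[OF sM(1)])
    have "conjugated (TC R) d l y = d (cj u x) \<otimes> d r"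
      unfolding x(2) cj'[OF x(1)] r(2) using big.mult[OF md(1) cu] r RM by auto
    also have "\<dots> = cj (d u) y \<otimes> r" using big.m_cj[OF md(1) u x(1)] d(2)[OF r(1)] x by simp
    finally show "\<exists>r\<in>R. conjugated (TC R) d l y = cj (d u) y \<otimes> r" using r(1) by blast
  qed
qed

text \<open>The power \<open>l ^^ (p ^ n)\<close> is tame with \<open>t\<close> and \<open>u\<close>
  trivial, so it fixes \<open>R\<close> and multiplies each \<open>x\<close> by an element of
  \<open>R\<close>. A second power with exponent \<open>p ^ n\<close> removes that factor, which
  explains the exponent \<open>n + n\<close>.\<close>

lemma tame_family:
  assumes R: "cen R"
  shows "p_family p (TC R) {l. \<exists>t u. tame R t u l}"
  unfolding p_family_def
proof (intro conjI ballI)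
  note sR = cen_sub[OF R]
  have sM: "subgroup (TC R) G" "TC R \<subseteq> carrier G" using TC_subgroup[OF sR] TC_c[OF sR] .
  have oneN: "\<one> \<in> nrm T R" using subgroup.one_closed[OF nrm_subgroup[OF T]] sR Tc by auto
  show "{l. \<exists>t u. tame R t u l} \<noteq> {}" using tame_cj[OF R oneN] by blast
  fix l assume "l \<in> {l. \<exists>t u. tame R t u l}"
  then obtain t u where l: "tame R t u l" by blast
  have ml: "mF (TC R) l" "l ` TC R = TC R" using l by (auto simp: tame_def big.aut_def)
  show "bij_betw l (TC R) (TC R)" using big.bij[OF ml] .
  show "\<exists>c\<in>{l. \<exists>t u. tame R t u l}. \<forall>x\<in>TC R. c x = l (l' x)" if "l' \<in> {l. \<exists>t u. tame R t u l}" for l'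
  proof -
    obtain t' u' where "tame R t' u' l'" using \<open>l' \<in> _\<close> by blast
    then have "(\<lambda>x. l (l' x)) \<in> {l. \<exists>t u. tame R t u l}" using tame_mult[OF R l] by blast
    then show ?thesis by (rule bexI[rotated]) simp
  qed
  have tc: "t \<in> carrier G" "u \<in> carrier G" using l Tc sM by (auto simp: tame_def nrm_def)
  have it: "\<exists>t' u'. t' = t [^] k \<and> u' = u [^] k \<and> tame R t' u' (l ^^ k)" for k
  proof (induction k)
    case 0
    have "tame R \<one> \<one> (cj \<one>)" by (rule tame_cj[OF R oneN])
    moreover have "(\<lambda>x. cj \<one> x) x = x" if "x \<in> TC R" for x using that sM by auto
    ultimately have "tame R \<one> \<one> (\<lambda>x. x)"
      unfolding tame_def big.aut_def using big.cong[of "TC R" "cj \<one>" "\<lambda>x. x"] Q_TC[OF sR(2)] by auto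
    then show ?case by (simp add: id_def)
  next
    case (Suc k)
    have "tame R (t [^] k \<otimes> t) (u [^] k \<otimes> u) (\<lambda>x. l ((l ^^ k) x))" using tame_mult[OF R l] Suc by blast
    moreover have "(\<lambda>x. l ((l ^^ k) x)) = l ^^ Suc k" by auto
    ultimately show ?case using tc by simp
  qed
  define l2 where "l2 = l ^^ (p ^ n)"
  have l2: "tame R \<one> \<one> l2" using it[of "p ^ n"] pow_pn tc by (simp add: l2_def)
  have ml2: "mF (TC R) l2" "l2 ` TC R = TC R" using l2 by (auto simp: tame_def big.aut_def)
  have "\<forall>x\<in>TC R. (l ^^ (p ^ (n + n))) x = x"
  proof
    fix x assume x: "x \<in> TC R"
    obtain r where r: "r \<in> R" "l2 x = x \<otimes> r" using l2 x sM by (auto simp: tame_def subset_iff)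
    have "(l2 ^^ (p ^ n)) x = x \<otimes> r [^] (p ^ n)"
      by (rule fixed_mod_funpow[OF sM(1) sR(1) Q_TC[OF sR(2)]])
        (use ml2 big.mult[OF ml2(1)] l2 x r sR Tc in \<open>auto simp: tame_def subset_iff\<close>)
    then show "(l ^^ (p ^ (n + n))) x = x"
      using r sR Tc x sM pow_pn by (simp add: l2_def funpow_mult power_add subset_iff)
  qed
  then show "\<exists>k. \<forall>x\<in>TC R. (l ^^ (p ^ k)) x = x" by blast
qed

text \<open>
  Move \<open>TC R\<close> by \<open>\<chi>\<close> to a receptive subgroup \<open>W\<close> where the tame automorphisms are conjugations by
  elements of a subgroup \<open>N'\<close>. Since \<open>d\<close> normalizes the tame automorphisms, it extends to \<open>N'\<close>, and a
  \<open>p'\<close>-part of the extension is trivial on \<open>N' \<inter> T\<close>.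
\<close>

lemma p'_extension_step:
  assumes R: "cen R" "R \<noteq> T" and d: "big.aut (TC R) d" "\<And>r. r \<in> R \<Longrightarrow> d r = r"
    and pow: "\<And>x. x \<in> TC R \<Longrightarrow> (d ^^ M) x = x" and M: "coprime M p"
  obtains d1 M1 where "big.aut (TC (nrm T R)) d1" "\<And>r. r \<in> nrm T R \<Longrightarrow> d1 r = r"
    "\<And>x. x \<in> TC (nrm T R) \<Longrightarrow> (d1 ^^ M1) x = x" "coprime M1 p" "\<And>x. x \<in> TC R \<Longrightarrow> d1 x = d x"
proof -
  note sR = cen_sub[OF R(1)]
  have sM: "subgroup (TC R) G" "TC R \<subseteq> carrier G" using TC_subgroup[OF sR] TC_c[OF sR] .
  note N = nrm_grows_card[OF sR R(2)]
  let ?N = "nrm T R"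
  have sN: "subgroup (TC ?N) G" using TC_subgroup[OF N(2,3)] .
  have RM: "R \<subseteq> TC R" using Q_TC sR by blast
  have md: "mF (TC R) d" "d ` TC R = TC R" using d(1) by (auto simp: big.aut_def)
  define L where "L = {l. \<exists>t u. tame R t u l}"
  have L: "p_family p (TC R) L" unfolding L_def by (rule tame_family[OF R(1)])
  have La: "big.aut (TC R) l" if "l \<in> L" for l using that by (auto simp: L_def tame_def)
  obtain \<chi>0 where \<chi>0: "mF (TC R) \<chi>0" "big.fau (\<chi>0 ` TC R)" "big.recp (\<chi>0 ` TC R)"
    using big.satD[OF F_sat sM] by blast
  define W where "W = \<chi>0 ` TC R"
  obtain \<rho> where \<rho>: "big.aut W \<rho>" "carries (TC R) (\<lambda>x. \<rho> (\<chi>0 x)) L (cj ` nrm (carrier G) W)"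
    using big.fau_carries_aut[OF \<chi>0(2,1) refl L La] by (auto simp: W_def)
  define \<chi> where "\<chi> = (\<lambda>x. \<rho> (\<chi>0 x))"
  have \<chi>: "mF (TC R) \<chi>" "\<chi> ` TC R = W"
    using \<rho>(1) big.comp[OF \<chi>0(1)] by (auto simp: big.aut_def \<chi>_def W_def image_image[symmetric])
  have recW: "big.recp W" using \<chi>0(3) by (simp add: W_def)
  have sW: "subgroup W G" "W \<subseteq> carrier G" using big.image[OF \<chi>(1)] big.img[OF \<chi>(1)] \<chi>(2) by auto
  have finW: "finite W" using finS[OF sW(1)] .
  have \<chi>W: "\<chi> x \<in> W" if "x \<in> TC R" for x using \<chi>(2) that by blast
  have dM: "d x \<in> TC R" if "x \<in> TC R" for x using md(2) that by blast
  have LM: "l x \<in> TC R" if "l \<in> L" "x \<in> TC R" for l x using La[OF that(1)] that(2) by (auto simp: big.aut_def)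
  have Lcj: "\<exists>h\<in>nrm (carrier G) W. \<forall>x\<in>TC R. \<chi> (l x) = cj h (\<chi> x)" if "l \<in> L" for l
    using \<rho>(2) that unfolding carries_def \<chi>_def by blast
  have Lconj: "conjugated (TC R) d l \<in> L" if "l \<in> L" for l
    using that tame_conj[OF R(1) _ d] unfolding L_def by blast
  have Lconj_apply: "conjugated (TC R) d l (d x) = d (l x)" if "x \<in> TC R" for l x
    using conjugated_apply[OF big.inj[OF md(1)] that] .
  define N' where "N' = {g \<in> nrm (carrier G) W. \<exists>l\<in>L. \<forall>x\<in>TC R. \<chi> (l x) = cj g (\<chi> x)}"
  have N'I: "g \<in> N'" if g: "g \<in> carrier G" and l: "l \<in> L" and gl: "\<And>x. x \<in> TC R \<Longrightarrow> \<chi> (l x) = cj g (\<chi> x)" for g l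
  proof -
    have "cj g y \<in> W" if y: "y \<in> W" for y
    proof -
      obtain x where x: "x \<in> TC R" "y = \<chi> x" using \<chi>(2) y by blast
      then show ?thesis using gl[OF x(1)] \<chi>W[OF LM[OF l x(1)]] by simp
    qed
    then have "g \<in> nrm (carrier G) W" by (rule nrmI[OF finW sW(2) g g])
    then show ?thesis using l gl unfolding N'_def by blast
  qed
  have N'c: "g \<in> carrier G" if "g \<in> N'" for g using that by (auto simp: N'_def nrm_def)
  have sN': "subgroup N' G"
  proof (rule finite_subgroupI[OF fin])
    show "N' \<subseteq> carrier G" using N'c by blast
    obtain l where l: "l \<in> L" using L unfolding p_family_def by blast
    then show "N' \<noteq> {}" using Lcj[OF l] unfolding N'_def by blast
    fix g h assume g: "g \<in> N'" and h: "h \<in> N'"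
    obtain l where l: "l \<in> L" "\<And>x. x \<in> TC R \<Longrightarrow> \<chi> (l x) = cj g (\<chi> x)" using g unfolding N'_def by blast
    obtain k where k: "k \<in> L" "\<And>x. x \<in> TC R \<Longrightarrow> \<chi> (k x) = cj h (\<chi> x)" using h unfolding N'_def by blast
    have kl: "(\<lambda>x. k (l x)) \<in> L" using tame_mult[OF R(1)] k(1) l(1) unfolding L_def by blast
    show "g \<otimes> h \<in> N'"
    proof (rule N'I[OF _ kl])
      show "g \<otimes> h \<in> carrier G" using N'c g h by blast
      fix x assume x: "x \<in> TC R"
      have "\<chi> x \<in> carrier G" using \<chi>W[OF x] sW by blast
      then show "\<chi> (k (l x)) = cj (g \<otimes> h) (\<chi> x)"
        using k(2)[OF LM[OF l(1) x]] l(2)[OF x] N'c g h by (simp add: cj_cj)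
    qed
  qed
  have WN': "W \<subseteq> N'"
  proof
    fix w assume w: "w \<in> W"
    obtain u where u: "u \<in> TC R" "w = \<chi> u" using w \<chi>(2) by blast
    have "cj u \<in> L" using tame_inner[OF R(1) u(1)] by (auto simp: L_def)
    then show "w \<in> N'" by (rule N'I[rotated]) (use big.m_cj[OF \<chi>(1) u(1)] u w sW in auto)
  qed
  define d' where "d' = conjugated (TC R) \<chi> d"
  have d'_apply: "d' (\<chi> x) = \<chi> (d x)" if "x \<in> TC R" for x
    unfolding d'_def using conjugated_apply[OF big.inj[OF \<chi>(1)] that] .
  have md': "mF W d'"
    using big.comp_inv[OF \<chi>(1) big.comp[OF md(1), of \<chi>], of d'] md(2) \<chi> d'_apply by simp
  have d'W: "d' ` W = W"
  proof -
    have "d' ` \<chi> ` TC R = \<chi> ` d ` TC R" using d'_apply by (force simp: image_image)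
    then show ?thesis using md(2) \<chi>(2) by simp
  qed
  obtain d2 where d2: "mF (big.ext W W d') d2" "\<And>y. y \<in> W \<Longrightarrow> d2 y = d' y"
    using big.recpD[OF recW md' d'W] by blast
  have W_ext: "W \<subseteq> big.ext W W d'" using big.ext_self[OF md' d'W] .
  have conj_d: "\<exists>l'\<in>L. \<forall>x\<in>TC R. d' (cj g (\<chi> x)) = \<chi> (l' (d x))" if g: "g \<in> N'" for g
  proof -
    obtain l where l: "l \<in> L" "\<And>x. x \<in> TC R \<Longrightarrow> \<chi> (l x) = cj g (\<chi> x)" using g unfolding N'_def by blast
    have "d' (cj g (\<chi> x)) = \<chi> (conjugated (TC R) d l (d x))" if x: "x \<in> TC R" for x
      using l(2)[OF x] d'_apply[OF LM[OF l(1) x]] Lconj_apply[OF x] by simp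
    then show ?thesis using Lconj[OF l(1)] by blast
  qed
  \<comment> \<open>Conjugated by \<open>d'\<close>, the action of \<open>g\<close> is again tame,
    hence again induced by an element normalizing \<open>W\<close>. This is membership in the
    extender of \<open>d'\<close>.\<close>
  have N'_ext: "N' \<subseteq> big.ext W W d'"
  proof
    fix g assume g: "g \<in> N'"
    obtain l' where l': "l' \<in> L" "\<And>x. x \<in> TC R \<Longrightarrow> d' (cj g (\<chi> x)) = \<chi> (l' (d x))" using conj_d[OF g] by blast
    obtain h where h: "h \<in> nrm (carrier G) W" "\<And>x. x \<in> TC R \<Longrightarrow> \<chi> (l' x) = cj h (\<chi> x)" using Lcj[OF l'(1)] by blast
    have "d' (cj g y) = cj h (d' y)" if y: "y \<in> W" for y
    proof -
      obtain x where x: "x \<in> TC R" "y = \<chi> x" using \<chi>(2) y by blast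
      then show ?thesis using l'(2)[OF x(1)] h(2)[OF dM[OF x(1)]] d'_apply[OF x(1)] by simp
    qed
    then show "g \<in> big.ext W W d'" using g h(1) unfolding big.ext_def N'_def by blast
  qed
  have md2: "mF N' d2" using big.restr[OF d2(1) sN' N'_ext] .
  have "d2 ` N' \<subseteq> N'"
  proof (rule image_subsetI)
    fix g assume g: "g \<in> N'"
    obtain l' where l': "l' \<in> L" "\<And>x. x \<in> TC R \<Longrightarrow> d' (cj g (\<chi> x)) = \<chi> (l' (d x))" using conj_d[OF g] by blast
    have gW: "g \<in> nrm (carrier G) W" using g by (auto simp: N'_def)
    show "d2 g \<in> N'"
    proof (rule N'I[OF _ l'(1)])
      show "d2 g \<in> carrier G" using big.car(2)[OF md2 g] .
      fix y assume "y \<in> TC R"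
      then obtain x where x: "x \<in> TC R" "y = d x" using md(2) by blast
      have "d2 (cj g (\<chi> x)) = cj (d2 g) (d2 (\<chi> x))"
        using big.m_cj[OF d2(1)] N'_ext g W_ext \<chi>W[OF x(1)] by blast
      moreover have "cj g (\<chi> x) \<in> W" using nrmD(2)[OF gW \<chi>W[OF x(1)]] .
      ultimately show "\<chi> (l' y) = cj (d2 g) (\<chi> y)"
        using d2(2) \<chi>W[OF x(1)] l'(2)[OF x(1)] d'_apply[OF x(1)] x(2) by simp
    qed
  qed
  then have d2N': "d2 ` N' = N'" by (rule big.endo[OF md2])
  \<comment> \<open>Since \<open>k\<close> is 1 modulo \<open>M\<close>, passing to the
    \<open>p'\<close>-part of \<open>d2\<close> does not disturb its values on
    \<open>W\<close>.\<close>
  obtain k M1 where k: "[k = 1] (mod M)" "coprime M1 p" "\<And>y. y \<in> N' \<Longrightarrow> ((d2 ^^ k) ^^ M1) y = y"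
    using p_prime_part[OF finS[OF sN'] big.bij[OF md2 d2N'] p M] by blast
  define e where "e = d2 ^^ k"
  have me: "mF N' e" "e ` N' = N'" unfolding e_def using big.power[OF md2 d2N'] by auto
  have e\<chi>: "e (\<chi> x) = \<chi> (d x)" if x: "x \<in> TC R" for x
  proof -
    have "\<chi> ((d ^^ k) x) = (d2 ^^ k) (\<chi> x)"
      by (rule funpow_semiconj[of d "TC R"]) (use md(2) x d2(2) \<chi>W d'_apply in auto)
    moreover have "(d ^^ k) x = (d ^^ 1) x"
      by (rule funpow_cong_mod[OF _ pow x k(1)]) (use md(2) in auto)
    ultimately show ?thesis by (simp add: e_def)
  qed
  define R' where "R' = \<chi> ` R"
  have sR': "subgroup R' G" unfolding R'_def by (rule big.image_sub[OF \<chi>(1) sR(1) RM])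
  have mR\<chi>: "mF R \<chi>" using big.restr[OF \<chi>(1) sR(1) RM] .
  have R'T: "R' \<subseteq> T" unfolding R'_def using closed[OF mR\<chi> sR(2)] .
  have R'W: "R' \<subseteq> W" unfolding R'_def using RM \<chi>W by blast
  have cenR': "cen R'" unfolding R'_def by (rule cen_image[OF R(1) mR\<chi>])
  have eR': "e r = r" if "r \<in> R'" for r using that e\<chi> d(2) RM by (auto simp: R'_def)
  have W_T: "y \<in> R'" if y: "y \<in> W" "y \<in> T" for y
  proof -
    obtain x where x: "x \<in> TC R" "y = \<chi> x" using \<chi>(2) y(1) by blast
    have sWT: "subgroup (W \<inter> T) G" by (rule subgroups_Inter_pair[OF sW(1) T])
    have "mF W (inv_into (TC R) \<chi>)" using big.inverse[OF \<chi>(1)] \<chi>(2) by simp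
    then have "mF (W \<inter> T) (inv_into (TC R) \<chi>)" using big.restr[OF _ sWT] by blast
    then have "inv_into (TC R) \<chi> y \<in> T" using closed y by blast
    then have "x \<in> T" using x big.inv_f[OF \<chi>(1) x(1)] by simp
    then show ?thesis using TC_inter_T[OF R(1) x(1)] x(2) by (auto simp: R'_def)
  qed
  define T' where "T' = N' \<inter> T"
  have sT': "subgroup T' G" unfolding T'_def by (rule subgroups_Inter_pair[OF sN' T])
  have R'T': "R' \<subseteq> T'" using R'T R'W WN' by (auto simp: T'_def)
  have eT': "e ` T' \<subseteq> T'"
    using closed[OF big.restr[OF me(1) sT'], of] me(2) unfolding T'_def by blast
  \<comment> \<open>\<open>e\<close> fixes \<open>R'\<close>, so \<open>e x\<close> and
    \<open>x\<close> act alike on \<open>R'\<close>, and \<open>e x x^-1\<close> centralizes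
    \<open>R'\<close>. By centricity it lies in \<open>R'\<close>. Thus \<open>e\<close> is a
    \<open>p'\<close>-automorphism of \<open>T'\<close> that is trivial on \<open>R'\<close> and
    modulo \<open>R'\<close>.\<close>
  have e_triv: "e x = x" if x: "x \<in> T'" for x
  proof (rule p'_automorphism_trivial[OF sT' sR' R'T' eT' _ eR' _ _ k(2) x])
    show "e (x \<otimes> y) = e x \<otimes> e y" if "x \<in> T'" "y \<in> T'" for x y
      using big.mult[OF me(1)] that by (simp add: T'_def)
    show "(e ^^ M1) x = x" if "x \<in> T'" for x using k(3) that by (simp add: e_def T'_def)
    fix x assume x: "x \<in> T'"
    have ex: "e x \<in> T'" using eT' x by blast
    have c: "x \<in> carrier G" "e x \<in> carrier G" using x ex Tc by (auto simp: T'_def)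
    have xR': "cj x r \<in> R'" if r: "r \<in> R'" for r
    proof (rule W_T)
      have "x \<in> nrm (carrier G) W" using x by (auto simp: T'_def N'_def)
      then show "cj x r \<in> W" using nrmD(2) r R'W by blast
      show "cj x r \<in> T" using T_normal[OF c(1)] r R'T by blast
    qed
    have "e x \<otimes> inv x \<in> R'"
    proof (rule cenD0[OF cenR'])
      show "e x \<otimes> inv x \<in> T"
        using x ex subgroup.m_closed[OF T] subgroup.m_inv_closed[OF T] by (simp add: T'_def)
      fix r assume r: "r \<in> R'"
      have rc: "r \<in> carrier G" using r R'T Tc by blast
      have "e (cj x r) = cj (e x) (e r)" using big.m_cj[OF me(1)] x r R'T' by (auto simp: T'_def)
      then have "cj x r = cj (e x) r" using eR' xR' r by simp
      then have "cj (inv x) (cj (e x) r) = r" using c rc cj_cancel by metis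
      then have "cj (e x \<otimes> inv x) r = r" using c rc by (simp add: cj_cj)
      then show "(e x \<otimes> inv x) \<otimes> r = r \<otimes> (e x \<otimes> inv x)" using cj_fixes_iff c rc by simp
    qed
    then have "cj x (e x \<otimes> inv x) \<in> R'" using xR' by blast
    then show "inv x \<otimes> e x \<in> R'" using c by (simp add: cj_def m_assoc)
  qed
  \<comment> \<open>Conjugation by elements of \<open>N_T(R)\<close> is tame and so is induced on
    \<open>W\<close>; \<open>C\<close> lies in \<open>R C\<close>, which belongs to the extender
    anyway.\<close>
  have ext_sub: "TC ?N \<subseteq> big.ext (TC R) W \<chi>"
  proof -
    obtain h0 where h0: "mF (big.ext (TC R) W \<chi>) h0" using big.recpD[OF recW \<chi>] by blast
    have "?N \<subseteq> big.ext (TC R) W \<chi>"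
    proof (rule big.nrm_ext)
      have "cj ` ?N \<subseteq> L" using tame_cj[OF R(1)] by (auto simp: L_def)
      then show "carries (TC R) \<chi> (cj ` ?N) (cj ` nrm (carrier G) W)"
        using \<rho>(2) unfolding carries_def \<chi>_def by blast
      show "?N \<subseteq> nrm (carrier G) (TC R)"
        using tame_cj[OF R(1)] Tc by (auto simp: tame_def big.aut_def nrm_def)
    qed
    moreover have "C \<subseteq> big.ext (TC R) W \<chi>" using big.ext_self[OF \<chi>] C_TC[OF sR(1)] by blast
    ultimately show ?thesis using subgroup.m_closed[OF big.dom(1)[OF h0]] by (fastforce simp: TC_mem)
  qed
  obtain \<chi>2 where \<chi>2: "mF (TC ?N) \<chi>2" "\<And>x. x \<in> TC R \<Longrightarrow> \<chi>2 x = \<chi> x"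
    using big.recpD[OF recW \<chi>] big.restr[OF _ sN ext_sub] by metis
  have RN: "TC R \<subseteq> TC ?N" using TC_mono N(4) by blast
  have NTC: "?N \<subseteq> TC ?N" "C \<subseteq> TC ?N" using Q_TC[OF N(3)] C_TC[OF N(2)] by auto
  have \<chi>2N: "\<chi>2 t \<in> T'" if t: "t \<in> ?N" for t
  proof -
    have "cj t \<in> L" using tame_cj[OF R(1) t] by (auto simp: L_def)
    then have "\<chi>2 t \<in> N'"
    proof (rule N'I[rotated])
      have tTC: "t \<in> TC ?N" using NTC t by blast
      then show "\<chi>2 t \<in> carrier G" using big.car(2)[OF \<chi>2(1)] by blast
      fix x assume x: "x \<in> TC R"
      have "cj t x \<in> TC R" using LM[OF \<open>cj t \<in> L\<close> x] .
      then show "\<chi> (cj t x) = cj (\<chi>2 t) (\<chi> x)"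
        using big.m_cj[OF \<chi>2(1) tTC, of x] RN x \<chi>2(2) by auto
    qed
    moreover have "\<chi>2 t \<in> T" using closed[OF big.restr[OF \<chi>2(1) N(2) NTC(1)] N(3)] t by blast
    ultimately show ?thesis by (simp add: T'_def)
  qed
  define I where "I = \<chi>2 ` TC ?N"
  have e\<chi>2: "e (\<chi>2 (t \<otimes> c)) = \<chi>2 (t \<otimes> d c)" and \<chi>2N': "\<chi>2 (t \<otimes> c) \<in> N'"
    and dc: "t \<otimes> d c \<in> TC ?N" if t: "t \<in> ?N" and c: "c \<in> C" for t c
  proof -
    have cM: "c \<in> TC R" using C_TC[OF sR(1)] c by blast
    have dcM: "d c \<in> TC R" using dM[OF cM] .
    have tT': "\<chi>2 t \<in> N'" "e (\<chi>2 t) = \<chi>2 t" using \<chi>2N[OF t] e_triv by (auto simp: T'_def)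
    have cN': "\<chi>2 c \<in> N'" using \<chi>2(2)[OF cM] \<chi>W[OF cM] WN' by auto
    have tN: "t \<in> TC ?N" "c \<in> TC ?N" "d c \<in> TC ?N" using NTC t c RN dcM by auto
    have m: "\<chi>2 (t \<otimes> c) = \<chi>2 t \<otimes> \<chi>2 c" using big.mult[OF \<chi>2(1) tN(1,2)] .
    show "\<chi>2 (t \<otimes> c) \<in> N'" unfolding m using subgroup.m_closed[OF sN' tT'(1) cN'] .
    have "e (\<chi>2 (t \<otimes> c)) = \<chi>2 t \<otimes> e (\<chi> c)"
      unfolding m using big.mult[OF me(1) tT'(1) cN'] tT'(2) \<chi>2(2)[OF cM] by simp
    also have "\<dots> = \<chi>2 t \<otimes> \<chi>2 (d c)" using e\<chi>[OF cM] \<chi>2(2)[OF dcM] by simp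
    also have "\<dots> = \<chi>2 (t \<otimes> d c)" using big.mult[OF \<chi>2(1) tN(1,3)] by simp
    finally show "e (\<chi>2 (t \<otimes> c)) = \<chi>2 (t \<otimes> d c)" .
    show "t \<otimes> d c \<in> TC ?N" using subgroup.m_closed[OF sN tN(1,3)] .
  qed
  have eI: "e (\<chi>2 x) \<in> I" if "x \<in> TC ?N" for x
    using that e\<chi>2 dc by (auto simp: I_def TC_mem)
  have IN': "I \<subseteq> N'" using \<chi>2N' by (auto simp: I_def TC_mem)
  have mI: "mF I e" using big.restr[OF me(1) _ IN'] big.image[OF \<chi>2(1)] by (simp add: I_def)
  have eII: "e ` I = I" by (rule big.endo[OF mI]) (use eI in \<open>auto simp: I_def\<close>)
  \<comment> \<open>\<open>\<chi>2\<close> sends \<open>N_T(R)\<close> into \<open>T'\<close>, where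
    \<open>e\<close> is trivial. Pulling \<open>e\<close> back through \<open>\<chi>2\<close>
    therefore fixes \<open>N_T(R)\<close> pointwise.\<close>
  define d1 where "d1 = (\<lambda>x. inv_into (TC ?N) \<chi>2 (e (\<chi>2 x)))"
  have \<chi>2d1: "\<chi>2 (d1 x) = e (\<chi>2 x)" and d1M: "d1 x \<in> TC ?N" if "x \<in> TC ?N" for x
    using eI[OF that] by (auto simp: d1_def I_def f_inv_into_f inv_into_into)
  have inj2: "x = y" if "\<chi>2 x = \<chi>2 y" "x \<in> TC ?N" "y \<in> TC ?N" for x y
    using inj_onD[OF big.inj[OF \<chi>2(1)]] that by blast
  have md1: "mF (TC ?N) d1"
  proof -
    have "mF (TC ?N) (\<lambda>x. e (\<chi>2 x))" using big.comp[OF \<chi>2(1)] mI by (simp add: I_def)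
    moreover have "(\<lambda>x. e (\<chi>2 x)) ` TC ?N = \<chi>2 ` TC ?N" using eII by (simp add: I_def image_image)
    ultimately show ?thesis unfolding d1_def
      using big.comp[of "TC ?N" _ "inv_into (TC ?N) \<chi>2"] big.inverse[OF \<chi>2(1)] by simp
  qed
  have d1N: "d1 ` TC ?N = TC ?N" by (rule big.endo[OF md1]) (use d1M in auto)
  show ?thesis
  proof (rule that[OF _ _ _ k(2)])
    show "big.aut (TC ?N) d1" using md1 d1N by (simp add: big.aut_def)
    show "d1 t = t" if t: "t \<in> ?N" for t
    proof (rule inj2)
      show tN: "t \<in> TC ?N" "d1 t \<in> TC ?N" using NTC t d1M by auto
      show "\<chi>2 (d1 t) = \<chi>2 t" using \<chi>2d1[OF tN(1)] e_triv[OF \<chi>2N[OF t]] by simp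
    qed
    show "d1 x = d x" if x: "x \<in> TC R" for x
    proof (rule inj2)
      show "d1 x \<in> TC ?N" "d x \<in> TC ?N" using d1M dM RN x by auto
      show "\<chi>2 (d1 x) = \<chi>2 (d x)" using \<chi>2d1[of x] RN x \<chi>2(2) e\<chi>[OF x] dM[OF x] by auto
    qed
    fix x assume x: "x \<in> TC ?N"
    show "(d1 ^^ M1) x = x"
    proof (rule inj2[OF _ _ x])
      show "(d1 ^^ M1) x \<in> TC ?N" by (rule funpow_closed) (use d1N x in auto)
      have "\<chi>2 ((d1 ^^ M1) x) = (e ^^ M1) (\<chi>2 x)"
        by (rule funpow_semiconj[of d1 "TC ?N"]) (use d1N \<chi>2d1 x in auto)
      also have "\<dots> = \<chi>2 x" using k(3) IN' x by (auto simp: e_def I_def)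
      finally show "\<chi>2 ((d1 ^^ M1) x) = \<chi>2 x" .
    qed
  qed
qed

text \<open>Climb the chain of iterated normalizers of \<open>R\<close> in \<open>T\<close>. The
  exponent \<open>M\<close> may change at each step but stays prime to \<open>p\<close>.\<close>

lemma p'_extension:
  assumes "cen R" "big.aut (TC R) d" "\<And>r. r \<in> R \<Longrightarrow> d r = r"
    and "\<And>x. x \<in> TC R \<Longrightarrow> (d ^^ M) x = x" "coprime M p"
  obtains D where "mF (TC T) D" "\<And>r. r \<in> T \<Longrightarrow> D r = r" "\<And>x. x \<in> TC R \<Longrightarrow> D x = d x"
proof -
  have "\<exists>D. mF (TC T) D \<and> (\<forall>r\<in>T. D r = r) \<and> (\<forall>x\<in>TC R. D x = d x)"
    using assms
  proof (induction "card T - card R" arbitrary: R d M rule: less_induct)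
    case less
    show ?case
    proof (cases "R = T")
      case True
      then show ?thesis using less.prems by (auto simp: big.aut_def)
    next
      case False
      note sR = cen_sub[OF less.prems(1)]
      note N = nrm_grows_card[OF sR False]
      obtain d1 M1 where d1: "big.aut (TC (nrm T R)) d1" "\<And>r. r \<in> nrm T R \<Longrightarrow> d1 r = r"
        "\<And>x. x \<in> TC (nrm T R) \<Longrightarrow> (d1 ^^ M1) x = x" "coprime M1 p" "\<And>x. x \<in> TC R \<Longrightarrow> d1 x = d x"
        using p'_extension_step[OF less.prems(1) False less.prems(2-5)] by metis
      have "\<exists>D. mF (TC T) D \<and> (\<forall>r\<in>T. D r = r) \<and> (\<forall>x\<in>TC (nrm T R). D x = d1 x)"
      proof (rule less.hyps)
        show "card T - card (nrm T R) < card T - card R" using N(1) card_less_T[OF sR False] by simp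
        show "cen (nrm T R)" using cen_up[OF less.prems(1) N(2) _ N(3)] N(4) by blast
      qed (use d1 in auto)
      moreover have "TC R \<subseteq> TC (nrm T R)" using TC_mono N(4) by blast
      ultimately show ?thesis using d1(5) by (metis subsetD)
    qed
  qed
  then show ?thesis using that by blast
qed

lemma good_p'_aut_extends:
  assumes h: "mE T h" and Q: "good Q h" and pow: "\<And>x. x \<in> T \<Longrightarrow> (h ^^ M0) x = x" and M0: "coprime M0 p"
  shows "good T h"
proof -
  note cQ = good_cen[OF Q]
  note sQ = cen_sub[OF cQ]
  have hT: "h ` T = T" using E'.autT[OF h] .
  have mh: "mF T h" using m_M[OF h] .
  have sTC: "subgroup (TC T) G" "TC T \<subseteq> carrier G" using TC_subgroup[OF T order_refl] TC_c[OF T order_refl] .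
  have TT: "T \<subseteq> TC T" "C \<subseteq> TC T" using Q_TC[of T] C_TC[OF T] by auto
  obtain A0 where A0: "mF (TC T) A0" "\<And>x. x \<in> T \<Longrightarrow> A0 x = h x" "A0 ` C = C" "A0 ` TC T = TC T"
    using autF_extends[OF mh] by blast
  \<comment> \<open>Because \<open>k1\<close> is 1 modulo \<open>M0\<close>, the
    \<open>p'\<close>-part of the extension still restricts to \<open>h\<close> on
    \<open>T\<close>.\<close>
  obtain k1 M1 where k1: "[k1 = 1] (mod M0)" "coprime M1 p" "\<And>x. x \<in> TC T \<Longrightarrow> ((A0 ^^ k1) ^^ M1) x = x"
    using p_prime_part[OF finS[OF sTC(1)] big.bij[OF A0(1,4)] p M0] by blast
  define A where "A = A0 ^^ k1"
  have A: "mF (TC T) A" "A ` TC T = TC T" unfolding A_def using big.power[OF A0(1,4)] by auto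
  have AC: "A ` C = C" unfolding A_def
    using big.power(2)[OF big.restr[OF A0(1) C_subgroup TT(2)] A0(3)] .
  have Ah: "A x = h x" if x: "x \<in> T" for x
  proof -
    have "(A0 ^^ k1) x = (h ^^ k1) x" by (rule funpow_cong_on[of _ T]) (use hT A0(2) x in auto)
    also have "\<dots> = (h ^^ 1) x" by (rule funpow_cong_mod[OF _ pow x k1(1)]) (use hT in auto)
    finally show ?thesis by (simp add: A_def)
  qed
  have "M1 \<noteq> 0" using k1(2) p by (metis coprime_0_left_iff not_prime_unit)
  then obtain M1' where M1': "M1 = Suc M1'" using not0_implies_Suc by blast
  have powA: "(A ^^ M1) x = x" if "x \<in> TC T" for x using k1(3) that by (simp add: A_def)
  \<comment> \<open>The inverse of \<open>A\<close>, written as a power so that it inherits what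
    holds for iterates of \<open>A\<close>.\<close>
  define B where "B = A ^^ M1'"
  have B: "mF (TC T) B" "B ` TC T = TC T" unfolding B_def using big.power[OF A] by auto
  have BA: "B (A x) = x" if "x \<in> TC T" for x
    using powA[OF that] unfolding B_def M1' by (simp add: funpow_swap1)
  have BC: "B c \<in> C" if c: "c \<in> C" for c
    unfolding B_def by (rule funpow_closed) (use AC c in auto)
  have AT: "A ` T = T" using Ah hT by (force simp: image_def)
  have BT: "B t \<in> T" if t: "t \<in> T" for t
    unfolding B_def by (rule funpow_closed) (use AT t in auto)
  have powB: "(B ^^ M1) x = x" if x: "x \<in> TC T" for x
    unfolding B_def funpow_mult using funpow_mult_id[of A "TC T" M1 x M1'] A(2) powA x
    by (simp add: mult.commute)
  obtain \<gamma> where \<gamma>: "mF (TC Q) \<gamma>" "\<And>x. x \<in> Q \<Longrightarrow> \<gamma> x = h x"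
    "\<And>c. c \<in> C \<Longrightarrow> \<exists>r\<in>h ` Q. \<gamma> c = c \<otimes> r" "\<gamma> ` TC Q = TC (h ` Q)" using goodE[OF Q] by metis
  define R where "R = h ` Q"
  have cR: "cen R" unfolding R_def by (rule cen_image[OF cQ big.restr[OF mh sQ]])
  note sR = cen_sub[OF cR]
  have sM: "subgroup (TC R) G" "TC R \<subseteq> TC T" using TC_subgroup[OF sR] TC_mono[OF sR(2)] .
  have QTC: "Q \<subseteq> TC Q" "C \<subseteq> TC Q" using Q_TC C_TC sQ by auto
  define \<delta> where "\<delta> = (\<lambda>x. \<gamma> (B x))"
  have Bx: "\<exists>q\<in>Q. \<exists>c\<in>C. B x = q \<otimes> c" if "x \<in> TC R" for x
  proof -
    obtain q c where qc: "q \<in> Q" "c \<in> C" "x = h q \<otimes> c"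
      using \<open>x \<in> TC R\<close> by (auto simp: TC_mem R_def)
    have qT: "q \<in> T" "h q \<in> T" using qc sQ hT by auto
    have "B x = B (h q) \<otimes> B c" unfolding qc(3) using big.mult[OF B(1)] qT qc TT by auto
    also have "B (h q) = q" using BA[of q] Ah[OF qT(1)] TT qT by auto
    finally show ?thesis using qc BC by blast
  qed
  have BR: "B ` TC R \<subseteq> TC Q" using Bx by (auto simp: TC_mem)
  have m\<delta>: "mF (TC R) \<delta>" unfolding \<delta>_def
    by (rule big.comp'[OF big.restr[OF B(1) sM] \<gamma>(1) BR])
  have \<delta>R: "\<delta> ` TC R = TC R"
    by (rule big.endo[OF m\<delta>]) (use BR \<gamma>(4) in \<open>auto simp: \<delta>_def R_def\<close>)
  have \<delta>r: "\<delta> r = r" if "r \<in> R" for r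
  proof -
    obtain q where q: "q \<in> Q" "r = h q" using \<open>r \<in> R\<close> by (auto simp: R_def)
    have qT: "q \<in> T" using q sQ by auto
    have "B r = q" using BA[of q] Ah[OF qT] TT qT q by auto
    then show ?thesis using \<gamma>(2)[OF q(1)] q by (simp add: \<delta>_def)
  qed
  have step: "\<exists>t\<in>T. \<delta> x = B x \<otimes> t" if "x \<in> TC R" for x
  proof -
    obtain q c where qc: "q \<in> Q" "c \<in> C" "B x = q \<otimes> c" using Bx[OF \<open>x \<in> TC R\<close>] by blast
    obtain r where r: "r \<in> R" "\<gamma> c = c \<otimes> r" using \<gamma>(3)[OF qc(2)] by (auto simp: R_def)
    have T3: "q \<in> T" "h q \<in> T" "r \<in> T" using qc sQ hT r sR by auto
    have iT: "inv q \<otimes> h q \<in> T" using T3 by (intro subgroup.m_closed[OF T] subgroup.m_inv_closed[OF T]) auto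
    have car: "q \<in> carrier G" "h q \<in> carrier G" "r \<in> carrier G" "c \<in> carrier G" using T3 Tc qc Cc by auto
    have "\<delta> x = h q \<otimes> (c \<otimes> r)"
      unfolding \<delta>_def qc(3) using big.mult[OF \<gamma>(1), of q c] QTC qc \<gamma>(2) r(2) by auto
    also have "\<dots> = q \<otimes> ((inv q \<otimes> h q) \<otimes> c) \<otimes> r" using car by (simp add: m_assoc inv_cancel)
    also have "\<dots> = (q \<otimes> c) \<otimes> ((inv q \<otimes> h q) \<otimes> r)"
      unfolding C_comm[OF qc(2) iT, symmetric] using car by (simp add: m_assoc)
    finally show ?thesis unfolding qc(3) using subgroup.m_closed[OF T iT T3(3)] by blast
  qed
  have \<delta>M: "(\<delta> ^^ k) x \<in> TC R" if "x \<in> TC R" for x k by (rule funpow_closed) (use \<delta>R that in auto)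
  have BM: "(B ^^ k) x \<in> TC T" if "x \<in> TC T" for x k by (rule funpow_closed) (use B that in auto)
  have iter: "\<exists>t\<in>T. (\<delta> ^^ k) x = (B ^^ k) x \<otimes> t" if x: "x \<in> TC R" for x k
  proof (induction k)
    case 0
    show ?case using x sM sTC subgroup.one_closed[OF T] by (intro bexI[of _ \<one>]) auto
  next
    case (Suc k)
    define z where "z = (B ^^ k) x"
    have z: "z \<in> TC T" unfolding z_def using BM x sM by blast
    obtain t where t: "t \<in> T" "(\<delta> ^^ k) x = z \<otimes> t" using Suc by (auto simp: z_def)
    obtain t' where t': "t' \<in> T" "\<delta> ((\<delta> ^^ k) x) = B ((\<delta> ^^ k) x) \<otimes> t'" using step[OF \<delta>M[OF x]] by blast
    have "B ((\<delta> ^^ k) x) = B z \<otimes> B t" unfolding t(2) using big.mult[OF B(1) z] TT t(1) by auto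
    then have "(\<delta> ^^ Suc k) x = (B ^^ Suc k) x \<otimes> (B t \<otimes> t')"
      using t' Tc BT[OF t(1)] big.car(2)[OF B(1) z] by (simp add: z_def m_assoc)
    then show ?case using subgroup.m_closed[OF T BT[OF t(1)] t'(1)] by blast
  qed
  \<comment> \<open>\<open>M1\<close> is an exponent of \<open>B\<close>, and \<open>k2\<close> is 1
    modulo \<open>M1\<close>. So the \<open>p'\<close>-part of \<open>\<delta>\<close> still agrees
    with \<open>B\<close> modulo \<open>T\<close>, and composing with \<open>A\<close> cancels
    \<open>B\<close>.\<close>
  obtain k2 M2 where k2: "[k2 = 1] (mod M1)" "coprime M2 p" "\<And>x. x \<in> TC R \<Longrightarrow> ((\<delta> ^^ k2) ^^ M2) x = x"
    using p_prime_part[OF finS[OF sM(1)] big.bij[OF m\<delta> \<delta>R] p k1(2)] by blast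
  have auts: "big.aut (TC R) (\<delta> ^^ k2)" unfolding big.aut_def using big.power[OF m\<delta> \<delta>R] by blast
  have fxd: "(\<delta> ^^ k2) r = r" if r: "r \<in> R" for r
    by (induction k2) (use \<delta>r r in auto)
  obtain D where D: "mF (TC T) D" "\<And>r. r \<in> T \<Longrightarrow> D r = r" "\<And>x. x \<in> TC R \<Longrightarrow> D x = (\<delta> ^^ k2) x"
    using p'_extension[OF cR auts fxd k2(3,2)] by blast
  show ?thesis
  proof (rule goodI'[OF cen_T h])
    show "mF (TC T) (\<lambda>x. D (A x))" using big.comp[OF A(1), of D] A(2) D(1) by simp
    show "D (A x) = h x" if "x \<in> T" for x using D(2) Ah[OF that] hT that by auto
    fix c assume c: "c \<in> C"
    have Ac: "A c \<in> C" using AC c by blast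
    then have AcR: "A c \<in> TC R" using C_TC[OF sR(1)] by blast
    obtain t where t: "t \<in> T" "(\<delta> ^^ k2) (A c) = (B ^^ k2) (A c) \<otimes> t" using iter[OF AcR] by blast
    have AcT: "A c \<in> TC T" using AcR sM by blast
    have "(B ^^ k2) (A c) = (B ^^ 1) (A c)"
      by (rule funpow_cong_mod[OF _ powB AcT k2(1)]) (use B in auto)
    also have "\<dots> = c" using BA[of c] TT c by auto
    finally show "\<exists>t\<in>T. D (A c) = c \<otimes> t" using D(3)[OF AcR] t by auto
  qed
qed

text \<open>\<open>T\<close> is its own only conjugate, so a \<open>p\<close>-element of
  \<open>Aut_E(T)\<close> is conjugate to an inner automorphism. Inner automorphisms form a normal
  subgroup, hence it is inner itself.\<close>

lemma p_aut_inner: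
  assumes b: "mE T b" and pow: "\<And>x. x \<in> T \<Longrightarrow> (b ^^ (p ^ k)) x = x"
  obtains s where "s \<in> T" "\<And>x. x \<in> T \<Longrightarrow> b x = cj s x"
proof -
  have bT: "small.aut T b" using b E'.autT by (simp add: small.aut_def)
  obtain e t where e: "mE T e" "t \<in> nrm T (e ` T)" "\<And>x. x \<in> T \<Longrightarrow> e (b x) = cj t (e x)"
    using small.p_element_conj[OF E_sat bT pow] by blast
  have t: "t \<in> T" using e(2) by (auto simp: nrm_def)
  note i = E'.autT_inv[OF e(1)]
  define s where "s = inv_into T e t"
  have s: "s \<in> T" "e s = t" using i t by (auto simp: s_def)
  show ?thesis
  proof (rule that[OF s(1)])
    fix x assume x: "x \<in> T"
    have "e (b x) = e (cj s x)" using e(3)[OF x] small.m_cj[OF e(1) s(1) x] s(2) by simp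
    moreover have "b x \<in> T" "cj s x \<in> T" using E'.autT[OF b] x T_normal[OF Tc[OF s(1)] x] by auto
    ultimately show "b x = cj s x" using inj_onD[OF small.inj[OF e(1)]] by blast
  qed
qed

text \<open>
  After removing an inner automorphism, \<open>a\<close> has an extension \<open>A\<close> to \<open>TC T\<close> of \<open>p'\<close>-order. If \<open>\<gamma>\<close> is the good
  extension of \<open>a\<close> on \<open>Q\<close>, then \<open>\<gamma> A\<^sup>-\<^sup>1\<close> fixes \<open>R = a Q\<close> pointwise and acts as \<open>A\<^sup>-\<^sup>1\<close> modulo \<open>T\<close>, so a
  \<open>p'\<close>-part \<open>D\<close> of it can be extended to \<open>TC T\<close> and \<open>D A\<close> is the required extension.
\<close>

theorem good_aut_extends:
  assumes a: "mE T a" and Q: "good Q a"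
  shows "good T a"
proof -
  note sQ = cen_sub[OF good_cen[OF Q]]
  have aT: "a ` T = T" using E'.autT[OF a] .
  obtain k M q j where k: "coprime M p" "\<And>x. x \<in> T \<Longrightarrow> ((a ^^ k) ^^ M) x = x"
    "\<And>x. x \<in> T \<Longrightarrow> ((a ^^ q) ^^ (p ^ j)) x = x" "\<And>x. x \<in> T \<Longrightarrow> (a ^^ q) ((a ^^ k) x) = a x"
    using p_decomposition[OF finT small.bij[OF a aT] p coprime_1_left] by blast
  have m: "mE T (a ^^ i)" "(a ^^ i) ` T = T" for i using small.power[OF a aT] by auto
  obtain s where s: "s \<in> T" "\<And>x. x \<in> T \<Longrightarrow> (a ^^ q) x = cj s x"
    using p_aut_inner[OF m(1) k(3)] by blast
  have as: "a x = cj s ((a ^^ k) x)" if "x \<in> T" for x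
    using k(4)[OF that] s(2)[of "(a ^^ k) x"] m(2)[of k] that by auto
  have "good Q (\<lambda>x. cj (inv s) (a x))"
    by (rule good_comp[OF Q good_cj[OF subgroup.m_inv_closed[OF T s(1)] cen_image[OF good_cen[OF Q]]]])
      (use m_M[OF good_mE[OF Q]] in blast)
  then have "good Q (a ^^ k)"
  proof (rule good_cong)
    fix x assume "x \<in> Q"
    then have x: "x \<in> T" using sQ by auto
    have "(a ^^ k) x \<in> T" using m(2)[of k] x by blast
    then show "cj (inv s) (a x) = (a ^^ k) x" using as[OF x] cj_cancel(2) Tc s(1) by simp
  qed
  then have g: "good T (a ^^ k)" using good_p'_aut_extends[OF m(1) _ k(2,1)] by blast
  have "good T (\<lambda>x. cj s ((a ^^ k) x))"
    by (rule good_comp[OF g]) (use good_cj[OF s(1) cen_T] m(2) in simp)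
  then show ?thesis by (rule good_cong) (use as in simp)
qed

section \<open>Extending morphisms together with their types\<close>

text \<open>For the trivial type this says that extensions can be chosen in the subsystem. All types
  are needed because the receptive subgroups of E are reached by morphisms of arbitrary
  type.\<close>

definition typed_recp :: "'a set \<Rightarrow> bool" where
  "typed_recp R \<longleftrightarrow> (\<forall>Q f a. E'.ty a Q f \<longrightarrow> f ` Q = R \<longrightarrow>
     (\<exists>h. E'.ty a (small.ext Q R f) h \<and> (\<forall>x\<in>Q. h x = f x)))"

lemma extension_nrm:
  assumes h: "mE X h" and Q: "Q \<subseteq> X" and X: "X \<subseteq> nrm T Q"
  shows "h ` X \<subseteq> nrm T (h ` Q)"
proof (rule image_subsetI)
  fix g assume g: "g \<in> X"
  have hg: "h g \<in> T" using small.img[OF h] g by blast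
  have e: "cj (h g) (h x) = h (cj g x)" if "x \<in> Q" for x
    using small.m_cj[OF h g, of x] that Q by auto
  have "cj g ` Q = Q" using g X by (auto simp: nrm_def)
  then have "cj (h g) ` h ` Q = h ` Q" using e by (force simp: image_image)
  then show "h g \<in> nrm T (h ` Q)" using hg by (simp add: nrm_def)
qed

text \<open>An untyped extension has some type \<open>b\<close> instead of \<open>a\<close>, and the
  discrepancy \<open>a b^-1\<close> is a type of the identity of \<open>R\<close>. Extending that
  identity to \<open>N_T(R)\<close> with its type and composing repairs the extension, since
  extensions map extenders into \<open>N_T(R)\<close>.\<close>

lemma typed_recpI:
  assumes rec: "small.recp R"
    and id: "\<And>a. E'.ty a R (\<lambda>x. x) \<Longrightarrow> \<exists>h. E'.ty a (nrm T R) h \<and> (\<forall>x\<in>R. h x = x)"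
  shows "typed_recp R"
  unfolding typed_recp_def
proof (intro allI impI)
  fix Q f a assume f: "E'.ty a Q f" and fQ: "f ` Q = R"
  have mf: "mE Q f" using E'.ty_M[OF f] .
  let ?X = "small.ext Q R f"
  obtain h0 where h0: "mE ?X h0" "\<And>x. x \<in> Q \<Longrightarrow> h0 x = f x" using small.recpD[OF rec mf fQ] by blast
  obtain b where b: "E'.ty b ?X h0" using E'_fac[OF h0(1)] unfolding E'.fac_def by blast
  have QX: "Q \<subseteq> ?X" using small.ext_self[OF mf fQ] .
  have sQ: "subgroup Q G" using small.dom[OF mf] by blast
  have bQ: "E'.ty b Q f" by (rule E'.ty_cong[OF E'.ty_restr[OF b sQ QX]]) (rule h0(2))
  have a: "mE T a" and bT: "mE T b" using f b by (auto simp: E'.ty_def)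
  have i: "E'.ty (inv_into T b) R (inv_into Q f)"
    unfolding fQ[symmetric] by (rule E'.ty_inv[OF bQ]) (use small.inv_f[OF mf] in simp)
  have iR: "inv_into Q f ` R = Q" unfolding fQ[symmetric] using small.inv_f[OF mf] by (force simp: image_image)
  have "E'.ty (\<lambda>x. a (inv_into T b x)) R (\<lambda>x. f (inv_into Q f x))"
    by (rule E'.ty_comp[OF i]) (use f iR in simp)
  then have "E'.ty (\<lambda>x. a (inv_into T b x)) R (\<lambda>x. x)"
    by (rule E'.ty_cong) (use fQ in \<open>auto simp: f_inv_into_f\<close>)
  then obtain \<delta> where \<delta>: "E'.ty (\<lambda>x. a (inv_into T b x)) (nrm T R) \<delta>" "\<And>x. x \<in> R \<Longrightarrow> \<delta> x = x"
    using id by blast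
  have "h0 ` Q = R" using h0(2) fQ by (force simp: image_def)
  then have "h0 ` ?X \<subseteq> nrm T R" using extension_nrm[OF h0(1) QX small.ext_sub(1)] by simp
  from E'.ty_comp'[OF b \<delta>(1) this] have "E'.ty a ?X (\<lambda>x. \<delta> (h0 x))"
    by (rule E'.ty_cong_aut) (use E'.autT_inv[OF bT] in simp)
  moreover have "\<delta> (h0 x) = f x" if "x \<in> Q" for x using h0(2)[OF that] \<delta>(2) fQ that by auto
  ultimately show "\<exists>h. E'.ty a ?X h \<and> (\<forall>x\<in>Q. h x = f x)" by blast
qed

text \<open>On \<open>R\<close> the inverse of \<open>a\<close> agrees with a morphism of the
  subsystem, so it is good on the centric \<open>R\<close> and hence good on \<open>T\<close>. Thus
  \<open>a\<close> has trivial type, and no ambiguity of types exists on centric subgroups.\<close>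

lemma ty_id_cen:
  assumes a: "E'.ty a R (\<lambda>x. x)" and R: "cen R"
  shows "E'.ty a T (\<lambda>x. x)"
proof -
  obtain e where e: "mE T a" "mE' R e" "\<And>x. x \<in> R \<Longrightarrow> x = a (e x)" using E'.tyE[OF a] by blast
  note i = E'.autT_inv[OF e(1)]
  have eT: "e x \<in> T" if "x \<in> R" for x using sub.img[OF e(2)] that by blast
  have "good R (inv_into T a)"
  proof (rule good_cong[OF mE'_good[OF e(2) R]])
    fix x assume x: "x \<in> R"
    have "inv_into T a (a (e x)) = e x" using i(3)[OF eT[OF x]] .
    then show "e x = inv_into T a x" using e(3)[OF x] by simp
  qed
  then have "mE' T (inv_into T a)" using good_aut_extends[OF i(1)] good_mE' by blast
  then show ?thesis unfolding E'.ty_def using e(1) i(2) by (intro conjI exI[of _ "inv_into T a"]) auto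
qed

lemma typed_recp_cen:
  assumes "cen R" "small.recp R"
  shows "typed_recp R"
proof (rule typed_recpI[OF assms(2)])
  fix a assume "E'.ty a R (\<lambda>x. x)"
  then have "E'.ty a T (\<lambda>x. x)" using ty_id_cen assms(1) by blast
  moreover have "subgroup (nrm T R) G" using nrm_subgroup[OF T] cen_sub[OF assms(1)] Tc by blast
  ultimately have "E'.ty a (nrm T R) (\<lambda>x. x)" using E'.ty_restr by (auto simp: nrm_def)
  then show "\<exists>h. E'.ty a (nrm T R) h \<and> (\<forall>x\<in>R. h x = x)" by blast
qed

section \<open>Types on subgroups between a fixed \<open>R\<close> and its normalizer in
  \<open>T\<close>\<close>

context
  fixes R
  assumes R: "subgroup R G" "R \<subseteq> T" "R \<noteq> T" and R_recp: "small.recp R" and R_fau: "small.fau R"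
    and IH: "\<And>U. subgroup U G \<Longrightarrow> U \<subseteq> T \<Longrightarrow> card R < card U \<Longrightarrow> small.fau U \<Longrightarrow> small.recp U \<Longrightarrow> typed_recp U"
begin

definition Y where "Y = nrm T R"

lemma Y: "subgroup Y G" "Y \<subseteq> T" "R \<subseteq> Y"
  using nrm_grows_card[OF R] unfolding Y_def by auto

lemma Yc: "y \<in> Y \<Longrightarrow> y \<in> carrier G"
  using Y Tc by blast

lemma Rc: "x \<in> R \<Longrightarrow> x \<in> carrier G"
  using R Tc by blast

lemma Y_cj: "y \<in> Y \<Longrightarrow> x \<in> R \<Longrightarrow> cj y x \<in> R"
  unfolding Y_def using nrmD(2) .

lemma YI: "g \<in> T \<Longrightarrow> (\<And>x. x \<in> R \<Longrightarrow> cj g x \<in> R) \<Longrightarrow> g \<in> Y"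
  unfolding Y_def by (rule nrmI) (use finS[OF R(1)] Rc Tc in auto)

text \<open>Maps acting on \<open>R\<close> as elements of \<open>N_T(R)\<close>, as in the
  \<open>K\<close>-normalizer of \<open>R\<close> for \<open>K = Aut_T(R)\<close>. Allowing these,
  and not only maps trivial on \<open>R\<close>, keeps all conjugations by elements of
  \<open>Y\<close> available for Sylow arguments.\<close>

definition inner where "inner f \<longleftrightarrow> (\<exists>y\<in>Y. \<forall>x\<in>R. f x = cj y x)"

lemma innerD: "inner f \<Longrightarrow> x \<in> R \<Longrightarrow> f x \<in> R"
  unfolding inner_def using Y_cj by auto

lemma inner_id: "(\<And>x. x \<in> R \<Longrightarrow> f x = x) \<Longrightarrow> inner f"
  unfolding inner_def using subgroup.one_closed[OF Y(1)] Rc by (intro bexI[of _ \<one>]) auto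

lemma inner_cj: "y \<in> Y \<Longrightarrow> inner (cj y)"
  unfolding inner_def by blast

lemma inner_cong: "inner f \<Longrightarrow> (\<And>x. x \<in> R \<Longrightarrow> f x = g x) \<Longrightarrow> inner g"
  unfolding inner_def by auto

lemma inner_comp: "inner f \<Longrightarrow> inner g \<Longrightarrow> inner (\<lambda>x. g (f x))"
proof -
  assume "inner f" "inner g"
  then obtain y z where yz: "y \<in> Y" "z \<in> Y" "\<And>x. x \<in> R \<Longrightarrow> f x = cj y x" "\<And>x. x \<in> R \<Longrightarrow> g x = cj z x"
    unfolding inner_def by blast
  have "g (f x) = cj (y \<otimes> z) x" if "x \<in> R" for x
    using yz Y_cj[OF yz(1) that] that by (simp add: cj_cj Yc Rc)
  then show ?thesis unfolding inner_def using subgroup.m_closed[OF Y(1) yz(1,2)] by blast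
qed

lemma inner_inv: "inner f \<Longrightarrow> (\<And>x. x \<in> R \<Longrightarrow> g (f x) = x) \<Longrightarrow> inner g"
proof -
  assume "inner f" and g: "\<And>x. x \<in> R \<Longrightarrow> g (f x) = x"
  then obtain y where y: "y \<in> Y" "\<And>x. x \<in> R \<Longrightarrow> f x = cj y x" unfolding inner_def by blast
  have iy: "inv y \<in> Y" using subgroup.m_inv_closed[OF Y(1) y(1)] .
  have "g x = cj (inv y) x" if x: "x \<in> R" for x
  proof -
    have r: "cj (inv y) x \<in> R" using Y_cj[OF iy x] .
    have "f (cj (inv y) x) = x" using y(2)[OF r] cj_cancel(1) Yc[OF y(1)] Rc[OF x] by simp
    then show ?thesis using g[OF r] by simp
  qed
  then show ?thesis unfolding inner_def using iy by blast
qed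

lemma inner_image: "inner f \<Longrightarrow> inj_on f R \<Longrightarrow> f ` R = R"
  using innerD endo_inj_surj[OF finS[OF R(1)]] by blast

text \<open>An element \<open>u\<close> of \<open>Y\<close> normalizes \<open>R\<close>, so
  \<open>f u\<close> normalizes the image of \<open>R\<close>, which is \<open>R\<close>
  again.\<close>

lemma inner_Y: "mE U f \<Longrightarrow> inner f \<Longrightarrow> R \<subseteq> U \<Longrightarrow> U \<subseteq> Y \<Longrightarrow> f ` U \<subseteq> Y"
proof (rule image_subsetI, rule YI)
  fix u x assume a: "mE U f" "inner f" "R \<subseteq> U" "U \<subseteq> Y" "u \<in> U"
  show "f u \<in> T" using small.img[OF a(1)] a(5) by blast
  assume x: "x \<in> R"
  have "f ` R = R" by (rule inner_image[OF a(2)]) (use small.inj[OF a(1)] a(3) inj_on_subset in blast)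
  then obtain r where r: "r \<in> R" "x = f r" using x by blast
  have "cj (f u) x = f (cj u r)" unfolding r(2) using small.m_cj[OF a(1,5)] a(3) r(1) by auto
  moreover have "cj u r \<in> R" using Y_cj a(4,5) r(1) by blast
  ultimately show "cj (f u) x \<in> R" using innerD[OF a(2)] by simp
qed

definition inner_aut where "inner_aut U f \<longleftrightarrow> sub.aut U f \<and> inner f"

lemma inner_aut_group:
  assumes "subgroup U G" "U \<subseteq> Y" "R \<subseteq> U"
  shows "bij_group U (inner_aut U)"
proof -
  have g: "bij_group U (sub.aut U)" using sub.aut_group assms Y by blast
  have "inner_aut U h" if "inner_aut U f" "\<forall>x\<in>U. f x = h x" for f h
    using that g inner_cong[of f h] assms(3) unfolding inner_aut_def bij_group_def by blast
  moreover have "inner_aut U (\<lambda>x. f (h x))" if "inner_aut U f" "inner_aut U h" for f h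
    using that g inner_comp[of h f] unfolding inner_aut_def bij_group_def by simp
  moreover have "inner_aut U (\<lambda>x. x)" using g inner_id unfolding inner_aut_def bij_group_def by simp
  moreover have "bij_betw f U U" if "inner_aut U f" for f
    using that g unfolding inner_aut_def bij_group_def by blast
  ultimately show ?thesis unfolding bij_group_def by blast
qed

lemma conj_aut:
  assumes a: "sub.aut U a" and f: "mE U f"
  shows "sub.aut (f ` U) (conjugated U f a)"
  unfolding sub.aut_def
proof
  have a': "mE' U a" "a ` U = U" using a by (auto simp: sub.aut_def)
  have UT: "U \<subseteq> T" using small.dom f by blast
  show "mE' (f ` U) (conjugated U f a)"
    by (rule E'_invar[OF a'(1) m_M[OF f] UT]) (use a' conjugated_apply[OF small.inj[OF f]] in auto)
  show "conjugated U f a ` f ` U = f ` U"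
    using a'(2) conjugated_apply[OF small.inj[OF f]] by (auto simp: image_image) (metis image_eqI image_iff)
qed

lemma inner_conjugated:
  assumes a: "inner a" and f: "mE U f" "R \<subseteq> U" "inner f"
  shows "inner (conjugated U f a)"
proof -
  have i: "inner (inv_into U f)"
    by (rule inner_inv[OF f(3)]) (use small.inv_f[OF f(1)] f(2) in blast)
  show ?thesis unfolding conjugated_def using inner_comp[OF inner_comp[OF i a] f(3)] by simp
qed

lemma inner_aut_conj:
  assumes "inner_aut U a" "mE U f" "R \<subseteq> U" "inner f"
  shows "inner_aut (f ` U) (conjugated U f a)"
  using assms conj_aut inner_conjugated by (simp add: inner_aut_def)

lemma nrm_inner_aut:
  assumes "subgroup U G" "U \<subseteq> Y" "y \<in> nrm Y U"
  shows "inner_aut U (cj y)"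
  using assms Y(2) sub.nrm_aut[of y U] inner_cj by (auto simp: inner_aut_def nrm_def)

lemma nrm_Y_family:
  assumes "subgroup U G" "U \<subseteq> Y"
  shows "p_family p U (cj ` nrm Y U)"
  by (rule conj_family[OF nrm_subgroup[OF Y(1)]]) (use assms Y Yc in \<open>auto simp: nrm_def\<close>)

text \<open>
  Within the morphisms acting on \<open>R\<close> as elements of \<open>Y\<close>, every \<open>U\<close> has a conjugate that behaves like a
  fully automized and receptive subgroup. It is obtained from such a conjugate \<open>H\<close> of \<open>U\<close> in \<open>mE\<close>, whose
  copy of \<open>R\<close> is moved back to \<open>R\<close> by \<open>\<tau>\<close>.
\<close>

lemma nice_conjugate:
  assumes U: "subgroup U G" "R \<subset> U" "U \<subseteq> Y"
  obtains \<omega> where "mE U \<omega>" "\<And>x. x \<in> R \<Longrightarrow> \<omega> x = x"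
    "\<And>A. p_family p (\<omega> ` U) A \<Longrightarrow> (\<And>a. a \<in> A \<Longrightarrow> inner_aut (\<omega> ` U) a) \<Longrightarrow>
       \<exists>b. inner_aut (\<omega> ` U) b \<and> carries (\<omega> ` U) b A (cj ` nrm Y (\<omega> ` U))"
    "\<And>V \<kappa> g. E'.ty g V \<kappa> \<Longrightarrow> \<kappa> ` V = \<omega> ` U \<Longrightarrow> R \<subseteq> V \<Longrightarrow> V \<subseteq> Y \<Longrightarrow> inner \<kappa> \<Longrightarrow>
       carries V \<kappa> (cj ` nrm Y V) (cj ` nrm Y (\<omega> ` U)) \<Longrightarrow>
       \<exists>\<kappa>'. E'.ty g (nrm Y V) \<kappa>' \<and> (\<forall>x\<in>V. \<kappa>' x = \<kappa> x)"
proof -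
  have UT: "U \<subseteq> T" "R \<subseteq> U" using U Y by auto
  have finU: "finite U" using finS[OF U(1)] .
  have bg: "bij_group U (inner_aut U)" using inner_aut_group[OF U(1,3) UT(2)] .
  \<comment> \<open>A Sylow subgroup of \<open>inner_aut U\<close>. The construction arranges that
    it becomes the group induced by \<open>Y\<close> on a conjugate of \<open>U\<close>.\<close>
  obtain J where "sylow_family p U (inner_aut U) J" using sylow_family_exists[OF finU p bg] by blast
  then have Jp: "p_family p U J" and JI: "\<And>j. j \<in> J \<Longrightarrow> inner_aut U j"
    and Js: "\<And>A. p_family p U A \<Longrightarrow> (\<And>a. a \<in> A \<Longrightarrow> inner_aut U a) \<Longrightarrow> \<exists>b. inner_aut U b \<and> carries U b A J"
    unfolding sylow_family_def by blast+
  have Ja: "small.aut U j" if "j \<in> J" for j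
    using JI[OF that] mE'_mE by (auto simp: inner_aut_def sub.aut_def small.aut_def)
  have JU: "j x \<in> U" if "j \<in> J" "x \<in> U" for j x using Ja[OF that(1)] that(2) by (auto simp: small.aut_def)
  obtain e where e: "mE U e" "small.fau (e ` U)" "small.recp (e ` U)" using small.satD[OF E_sat U(1) UT(1)] by blast
  define H where "H = e ` U"
  obtain \<rho> where \<rho>: "small.aut H \<rho>" "carries U (\<lambda>x. \<rho> (e x)) J (cj ` nrm T H)"
    using small.fau_carries_aut[OF e(2,1) refl Jp Ja] by (auto simp: H_def)
  define \<chi> where "\<chi> = (\<lambda>x. \<rho> (e x))"
  have \<chi>: "mE U \<chi>" "\<chi> ` U = H"
    using \<rho>(1) small.comp[OF e(1), of \<rho>] by (auto simp: small.aut_def \<chi>_def H_def image_image[symmetric])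
  have sH: "subgroup H G" "H \<subseteq> T" using small.image[OF \<chi>(1)] small.img[OF \<chi>(1)] \<chi>(2) by auto
  have "card R < card U" using psubset_card_mono[OF finU U(2)] .
  then have "card R < card H" using small.cardQ[OF \<chi>(1)] \<chi>(2) by simp
  then have recH: "typed_recp H" using IH[OF sH] e(2,3) by (simp add: H_def)
  have \<chi>J: "\<exists>g\<in>nrm T H. \<forall>x\<in>U. \<chi> (j x) = cj g (\<chi> x)" if "j \<in> J" for j
    using \<rho>(2) that unfolding carries_def \<chi>_def by blast
  define R0 where "R0 = \<chi> ` R"
  define \<tau>0 where "\<tau>0 = inv_into R \<chi>"
  have \<chi>R: "mE R \<chi>" using small.restr[OF \<chi>(1) R(1) UT(2)] .
  have \<tau>0: "mE R0 \<tau>0" "\<tau>0 ` R0 = R"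
    using small.inverse[OF \<chi>R] small.inv_f[OF \<chi>R] by (force simp: R0_def \<tau>0_def image_image)+
  have \<tau>0\<chi>: "\<tau>0 (\<chi> r) = r" if "r \<in> R" for r using small.inv_f[OF \<chi>R that] by (simp add: \<tau>0_def)
  let ?X = "small.ext R0 R \<tau>0"
  obtain \<tau> where \<tau>: "mE ?X \<tau>" "\<And>x. x \<in> R0 \<Longrightarrow> \<tau> x = \<tau>0 x" using small.recpD[OF R_recp \<tau>0] by blast
  obtain t where t: "E'.ty t ?X \<tau>" using E'_fac[OF \<tau>(1)] unfolding E'.fac_def by blast
  have tT: "mE T t" using t by (simp add: E'.ty_def)
  have finR0: "finite R0" using finS[OF R(1)] by (simp add: R0_def)
  have R0c: "R0 \<subseteq> carrier G" using small.img[OF \<chi>R] Tc by (auto simp: R0_def)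
  \<comment> \<open>A sufficient condition for the extender of \<open>\<tau>0\<close>: the element
    acts on \<open>R0\<close> as some \<open>w\<close> of \<open>Y\<close> acts on \<open>R\<close>.
    It puts both \<open>H\<close> and the elements realizing \<open>J\<close> into the domain of
    \<open>\<tau>\<close>.\<close>
  have XI: "g \<in> ?X" if g: "g \<in> T" and w: "w \<in> Y" and gw: "\<And>r. r \<in> R \<Longrightarrow> cj g (\<chi> r) = \<chi> (cj w r)" for g w
  proof -
    have "g \<in> nrm T R0"
      by (rule nrmI[OF finR0 R0c g Tc[OF g]]) (use gw Y_cj[OF w] in \<open>auto simp: R0_def\<close>)
    moreover have "\<tau>0 (cj g y) = cj w (\<tau>0 y)" if "y \<in> R0" for y
      using that gw \<tau>0\<chi> Y_cj[OF w] by (auto simp: R0_def)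
    ultimately show ?thesis using w unfolding small.ext_def Y_def by blast
  qed
  have HX: "\<chi> u \<in> ?X" if u: "u \<in> U" for u
  proof (rule XI)
    show "\<chi> u \<in> T" using small.img[OF \<chi>(1)] u by blast
    show "u \<in> Y" using u U by blast
    show "cj (\<chi> u) (\<chi> r) = \<chi> (cj u r)" if "r \<in> R" for r using small.m_cj[OF \<chi>(1) u] UT that by auto
  qed
  define \<omega> where "\<omega> = (\<lambda>x. \<tau> (\<chi> x))"
  have \<omega>: "mE U \<omega>" unfolding \<omega>_def by (rule small.comp'[OF \<chi>(1) \<tau>(1)]) (use HX in auto)
  have \<omega>R: "\<omega> x = x" if "x \<in> R" for x using \<tau>(2)[of "\<chi> x"] \<tau>0\<chi>[OF that] that by (simp add: \<omega>_def R0_def)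
  have inner\<omega>: "inner \<omega>" using inner_id \<omega>R by blast
  define U1 where "U1 = \<omega> ` U"
  have U1: "U1 \<subseteq> Y" "subgroup U1 G" unfolding U1_def
    using inner_Y[OF \<omega> inner\<omega> UT(2) U(3)] small.image[OF \<omega>] by auto
  have RU1: "R \<subseteq> U1" using \<omega>R UT(2) unfolding U1_def by force
  have J1: "\<exists>s\<in>nrm Y U1. \<forall>x\<in>U. \<omega> (j x) = cj s (\<omega> x)" if j: "j \<in> J" for j
  proof -
    obtain g where g: "g \<in> nrm T H" "\<And>x. x \<in> U \<Longrightarrow> \<chi> (j x) = cj g (\<chi> x)" using \<chi>J[OF j] by blast
    obtain w where w: "w \<in> Y" "\<And>r. r \<in> R \<Longrightarrow> j r = cj w r" using JI[OF j] unfolding inner_aut_def inner_def by blast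
    have gX: "g \<in> ?X"
    proof (rule XI[OF _ w(1)])
      show "g \<in> T" using g(1) by (simp add: nrm_def)
      show "cj g (\<chi> r) = \<chi> (cj w r)" if "r \<in> R" for r using g(2)[of r] w(2)[OF that] UT(2) that by auto
    qed
    have e: "\<omega> (j x) = cj (\<tau> g) (\<omega> x)" if x: "x \<in> U" for x
      unfolding \<omega>_def g(2)[OF x] using small.m_cj[OF \<tau>(1) gX HX[OF x]] .
    have tgT: "\<tau> g \<in> T" using small.img[OF \<tau>(1)] gX by blast
    have "\<tau> g \<in> Y"
    proof (rule YI[OF tgT])
      fix r assume r: "r \<in> R"
      have "cj (\<tau> g) r = \<omega> (j r)" using e[of r] \<omega>R[OF r] r UT by auto
      moreover have "j r \<in> R" using w r Y_cj by simp
      ultimately show "cj (\<tau> g) r \<in> R" using \<omega>R by simp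
    qed
    then have "\<tau> g \<in> nrm Y U1"
      by (intro nrmI) (use finS[OF U1(2)] U1 Yc e[symmetric] JU[OF j] in \<open>auto simp: U1_def\<close>)
    then show ?thesis using e by blast
  qed
  define i where "i = inv_into U \<omega>"
  have i\<omega>: "i (\<omega> x) = x" if "x \<in> U" for x using small.inv_f[OF \<omega> that] by (simp add: i_def)
  have mi: "mE U1 i" "i ` U1 = U" using small.inverse[OF \<omega>] i\<omega> by (force simp: i_def U1_def image_image)+
  have iR: "i x = x" if "x \<in> R" for x using i\<omega>[of x] \<omega>R[OF that] UT that by auto
  have inner_i: "inner i" using inner_id iR by blast
  have \<omega>i: "\<omega> (i y) = y" if "y \<in> U1" for y using that i\<omega> by (auto simp: U1_def)
  \<comment> \<open>The group induced by \<open>N_Y(U1)\<close>, moved back to \<open>U\<close>, is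
    a \<open>p\<close>-group containing \<open>J\<close>. As \<open>J\<close> is Sylow, comparing
    orders gives equality, so every element of \<open>N_Y(U1)\<close> comes from
    \<open>J\<close>.\<close>
  have J2: "\<exists>j\<in>J. \<forall>x\<in>U. \<omega> (j x) = cj s (\<omega> x)" if s: "s \<in> nrm Y U1" for s
  proof -
    define A where "A = conjugated U1 i ` cj ` nrm Y U1"
    have ca: "conjugated U1 i a x = i (a (\<omega> x))" if "x \<in> U" for a x
      using conjugated_apply[OF small.inj[OF mi(1)], of "\<omega> x" a] i\<omega>[OF that] that by (auto simp: U1_def)
    have A: "p_family p U A"
      unfolding A_def using p_family_conjugated(1)[OF nrm_Y_family[OF U1(2,1)] small.inj[OF mi(1)]] mi(2) by simp
    have AI: "inner_aut U a" if "a \<in> A" for a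
      using that inner_aut_conj[OF nrm_inner_aut[OF U1(2,1)] mi(1) RU1 inner_i] mi(2) by (auto simp: A_def)
    obtain b where b: "inner_aut U b" "carries U b A J" using Js[OF A AI] by blast
    have bU: "inj_on b U" "b ` U = U" using b(1) sub.inj by (auto simp: inner_aut_def sub.aut_def)
    let ?rA = "(\<lambda>a. restrict a U) ` A" and ?rJ = "(\<lambda>a. restrict a U) ` J"
    have fin: "finite ?rA" "finite ?rJ"
    proof -
      have "?rA \<subseteq> Bij U" "?rJ \<subseteq> Bij U" using A Jp restrict_Bij unfolding p_family_def by blast+
      then show "finite ?rA" "finite ?rJ" using finite_Bij[OF finU] finite_subset by blast+
    qed
    have "?rJ \<subseteq> ?rA"
    proof
      fix f assume "f \<in> ?rJ"
      then obtain j where j: "j \<in> J" "f = restrict j U" by auto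
      obtain s where s: "s \<in> nrm Y U1" "\<And>x. x \<in> U \<Longrightarrow> \<omega> (j x) = cj s (\<omega> x)" using J1[OF j(1)] by blast
      have "f = restrict (conjugated U1 i (cj s)) U"
        unfolding j(2) by (rule restrict_ext) (use ca s(2)[symmetric] i\<omega> JU[OF j(1)] in simp)
      then show "f \<in> ?rA" using s(1) unfolding A_def by blast
    qed
    moreover have "card ?rA \<le> card ?rJ"
    proof (rule card_inj_on_le[OF _ _ fin(2)])
      let ?\<Phi> = "\<lambda>f. restrict (conjugated U b f) U"
      have cb: "conjugated U b f (b x) = b (f x)" if "x \<in> U" for f x using conjugated_apply[OF bU(1) that] .
      show "?\<Phi> ` ?rA \<subseteq> ?rJ"
      proof (rule image_subsetI)
        fix f assume "f \<in> ?rA"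
        then obtain a where a: "a \<in> A" "f = restrict a U" by blast
        obtain j where j: "j \<in> J" "\<And>x. x \<in> U \<Longrightarrow> b (a x) = j (b x)" using carriesD[OF b(2) a(1)] by blast
        have "conjugated U b (restrict a U) y = j y" if y: "y \<in> U" for y
        proof -
          obtain x where "x \<in> U" "y = b x" using bU(2) y by blast
          then show ?thesis using cb j(2) by simp
        qed
        then have "?\<Phi> (restrict a U) = restrict j U" by (intro restrict_ext) auto
        then show "?\<Phi> f \<in> ?rJ" unfolding a(2) using j(1) by blast
      qed
      show "inj_on ?\<Phi> ?rA"
      proof (rule inj_onI)
        fix f g assume fg: "f \<in> ?rA" "g \<in> ?rA" "?\<Phi> f = ?\<Phi> g"
        have "f x = g x" if x: "x \<in> U" for x
        proof -
          have bx: "b x \<in> U" using bU(2) x by blast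
          have "conjugated U b f (b x) = conjugated U b g (b x)" using fun_cong[OF fg(3), of "b x"] bx by simp
          then have "b (f x) = b (g x)" using cb[OF x] by simp
          moreover have "a x \<in> U" if "a \<in> A" for a using AI[OF that] x by (auto simp: inner_aut_def sub.aut_def)
          then have "f x \<in> U" "g x \<in> U" using fg(1,2) x by auto
          ultimately show ?thesis using inj_onD[OF bU(1)] by blast
        qed
        then show "f = g" using fg(1,2) by (auto intro!: extensionalityI[of _ U])
      qed
    qed
    ultimately have "?rJ = ?rA" using card_seteq[OF fin(1)] by blast
    moreover have "restrict (conjugated U1 i (cj s)) U \<in> ?rA" using s unfolding A_def by blast
    ultimately obtain j where j: "j \<in> J" "restrict (conjugated U1 i (cj s)) U = restrict j U" by blast
    have "\<omega> (j x) = cj s (\<omega> x)" if x: "x \<in> U" for x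
    proof -
      have "j x = i (cj s (\<omega> x))" using fun_cong[OF j(2), of x] x ca by simp
      moreover have "cj s (\<omega> x) \<in> U1" using nrmD(2)[OF s] x by (simp add: U1_def)
      ultimately show ?thesis using \<omega>i by simp
    qed
    then show ?thesis using j(1) by blast
  qed
  show ?thesis
  proof (rule that[OF \<omega> \<omega>R])
    fix A assume A: "p_family p (\<omega> ` U) A" and AI: "\<And>a. a \<in> A \<Longrightarrow> inner_aut (\<omega> ` U) a"
    note A = A[folded U1_def] and AI = AI[folded U1_def]
    have A': "p_family p U (conjugated U1 i ` A)"
      using p_family_conjugated(1)[OF A small.inj[OF mi(1)]] mi(2) by simp
    have A'I: "inner_aut U a" if "a \<in> conjugated U1 i ` A" for a
      using that inner_aut_conj[OF AI mi(1) RU1 inner_i] mi(2) by auto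
    obtain b where b: "inner_aut U b" "carries U b (conjugated U1 i ` A) J" using Js[OF A' A'I] by blast
    define b1 where "b1 = conjugated U \<omega> b"
    have "inner_aut U1 b1" unfolding b1_def U1_def by (rule inner_aut_conj[OF b(1) \<omega> UT(2) inner\<omega>])
    moreover have "carries U1 b1 A (cj ` nrm Y U1)"
      unfolding carries_def
    proof
      fix a assume a: "a \<in> A"
      obtain j where j: "j \<in> J" "\<And>x. x \<in> U \<Longrightarrow> b (conjugated U1 i a x) = j (b x)"
        using carriesD[OF b(2), of "conjugated U1 i a"] a by blast
      obtain s where s: "s \<in> nrm Y U1" "\<And>x. x \<in> U \<Longrightarrow> \<omega> (j x) = cj s (\<omega> x)" using J1[OF j(1)] by blast
      have "b1 (a y) = cj s (b1 y)" if y: "y \<in> U1" for y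
      proof -
        have iy: "i y \<in> U" "a y \<in> U1" using mi(2) y AI[OF a] by (auto simp: inner_aut_def sub.aut_def)
        have iay: "i (a y) \<in> U" using mi(2) iy by blast
        have bU: "b (i y) \<in> U" using b(1) iy by (auto simp: inner_aut_def sub.aut_def)
        have "b1 (a y) = \<omega> (b (i (a y)))" by (simp add: b1_def conjugated_def i_def)
        also have "i (a y) = conjugated U1 i a (i y)" using conjugated_apply[OF small.inj[OF mi(1)] y] by simp
        also have "\<omega> (b (conjugated U1 i a (i y))) = cj s (\<omega> (b (i y)))" using j(2)[OF iy(1)] s(2)[OF bU] by simp
        also have "\<omega> (b (i y)) = b1 y" by (simp add: b1_def conjugated_def i_def)
        finally show ?thesis .
      qed
      then show "\<exists>j\<in>cj ` nrm Y U1. \<forall>x\<in>U1. b1 (a x) = j (b1 x)" using s(1) by blast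
    qed
    ultimately show "\<exists>b. inner_aut (\<omega> ` U) b \<and> carries (\<omega> ` U) b A (cj ` nrm Y (\<omega> ` U))"
      unfolding U1_def by blast
  next
    fix V \<kappa> g assume \<kappa>: "E'.ty g V \<kappa>" and \<kappa>V: "\<kappa> ` V = \<omega> ` U" and RV: "R \<subseteq> V" and VY: "V \<subseteq> Y"
      and inn: "inner \<kappa>" and car: "carries V \<kappa> (cj ` nrm Y V) (cj ` nrm Y (\<omega> ` U))"
    note \<kappa>V = \<kappa>V[folded U1_def] and car = car[folded U1_def]
    have m\<kappa>: "mE V \<kappa>" using E'.ty_M[OF \<kappa>] .
    have sV: "subgroup V G" using small.dom[OF m\<kappa>] by blast
    have gT: "mE T g" using \<kappa> by (simp add: E'.ty_def)
    have HsubX: "H \<subseteq> ?X" using HX \<chi>(2) by blast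
    have \<tau>H: "\<tau> ` H = U1" unfolding U1_def \<omega>_def \<chi>(2)[symmetric] by (simp add: image_image)
    have ti: "E'.ty (inv_into T t) U1 (\<lambda>y. \<chi> (i y))"
      unfolding \<tau>H[symmetric]
    proof (rule E'.ty_inv[OF E'.ty_restr[OF t sH(1) HsubX]])
      fix x assume "x \<in> H"
      then obtain u where u: "u \<in> U" "x = \<chi> u" using \<chi>(2) by blast
      then show "\<chi> (i (\<tau> x)) = x" using i\<omega>[OF u(1)] by (simp add: \<omega>_def)
    qed
    \<comment> \<open>Return from \<open>U1\<close> to \<open>H\<close>, where typed receptivity
      holds by induction. This changes the type by the inverse of \<open>t\<close>, and applying
      \<open>\<tau>\<close> after the extension restores it.\<close>
    define \<mu>0 where "\<mu>0 = (\<lambda>x. \<chi> (i (\<kappa> x)))"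
    have \<mu>0: "E'.ty (\<lambda>x. inv_into T t (g x)) V \<mu>0"
      unfolding \<mu>0_def using E'.ty_comp[OF \<kappa>] ti \<kappa>V by simp
    have \<mu>0V: "\<mu>0 ` V = H"
    proof -
      have "\<mu>0 ` V = \<chi> ` i ` \<kappa> ` V" by (simp add: \<mu>0_def image_image)
      then show ?thesis using \<kappa>V mi(2) \<chi>(2) by simp
    qed
    obtain \<mu> where \<mu>: "E'.ty (\<lambda>x. inv_into T t (g x)) (small.ext V H \<mu>0) \<mu>" "\<And>x. x \<in> V \<Longrightarrow> \<mu> x = \<mu>0 x"
      using recH \<mu>0 \<mu>0V unfolding typed_recp_def by blast
    have sN: "subgroup (nrm Y V) G" using nrm_subgroup[OF Y(1)] VY Yc by blast
    have VN: "V \<subseteq> nrm Y V" using nrm_self[OF sV finS[OF sV] VY] .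
    have Nsub: "nrm Y V \<subseteq> small.ext V H \<mu>0"
    proof
      fix y assume y: "y \<in> nrm Y V"
      obtain s where s: "s \<in> nrm Y U1" "\<And>x. x \<in> V \<Longrightarrow> \<kappa> (cj y x) = cj s (\<kappa> x)"
        using carriesD[OF car, of "cj y"] y by blast
      obtain j where j: "j \<in> J" "\<And>x. x \<in> U \<Longrightarrow> \<omega> (j x) = cj s (\<omega> x)" using J2[OF s(1)] by blast
      obtain h where h: "h \<in> nrm T H" "\<And>x. x \<in> U \<Longrightarrow> \<chi> (j x) = cj h (\<chi> x)" using \<chi>J[OF j(1)] by blast
      have "\<mu>0 (cj y x) = cj h (\<mu>0 x)" if x: "x \<in> V" for x
      proof -
        have kx: "\<kappa> x \<in> U1" using \<kappa>V x by blast
        have z: "i (\<kappa> x) \<in> U" using mi(2) kx by blast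
        have "\<kappa> (cj y x) = \<omega> (j (i (\<kappa> x)))" using s(2)[OF x] j(2)[OF z] \<omega>i[OF kx] by simp
        then have "i (\<kappa> (cj y x)) = j (i (\<kappa> x))" using i\<omega> JU[OF j(1) z] by simp
        then show ?thesis using h(2)[OF z] by (simp add: \<mu>0_def)
      qed
      moreover have "y \<in> nrm T V" using y Y(2) by (auto simp: nrm_def)
      ultimately show "y \<in> small.ext V H \<mu>0" using h(1) unfolding small.ext_def by blast
    qed
    have \<mu>N: "E'.ty (\<lambda>x. inv_into T t (g x)) (nrm Y V) \<mu>" using E'.ty_restr[OF \<mu>(1) sN Nsub] .
    have m\<mu>: "mE (nrm Y V) \<mu>" using E'.ty_M[OF \<mu>N] .
    obtain w where w: "w \<in> Y" "\<And>x. x \<in> R \<Longrightarrow> \<kappa> x = cj w x" using inn unfolding inner_def by blast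
    have \<mu>R: "\<mu> x = \<chi> (\<kappa> x)" if x: "x \<in> R" for x
      using \<mu>(2)[of x] iR[OF innerD[OF inn x]] RV x by (auto simp: \<mu>0_def)
    have \<mu>X: "\<mu> ` nrm Y V \<subseteq> ?X"
    proof (rule image_subsetI)
      fix y assume y: "y \<in> nrm Y V"
      have yY: "y \<in> Y" using y by (simp add: nrm_def)
      have wc: "w \<in> carrier G" "y \<in> carrier G" using w yY Yc by auto
      define v where "v = inv w \<otimes> y \<otimes> w"
      show "\<mu> y \<in> ?X"
      proof (rule XI)
        show "\<mu> y \<in> T" using small.img[OF m\<mu>] y by blast
        show "v \<in> Y" unfolding v_def
          using w yY subgroup.m_closed[OF Y(1)] subgroup.m_inv_closed[OF Y(1)] by simp
        fix r assume r: "r \<in> R"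
        have "\<kappa> ` R = R" by (rule inner_image[OF inn]) (use small.inj[OF m\<kappa>] RV inj_on_subset in blast)
        then obtain x where x: "x \<in> R" "r = \<kappa> x" using r by blast
        have xN: "x \<in> nrm Y V" using VN RV x by blast
        have cyx: "cj y x \<in> R" using Y_cj[OF yY x(1)] .
        have "cj (\<mu> y) (\<chi> r) = \<mu> (cj y x)"
          unfolding x(2) \<mu>R[OF x(1), symmetric] using small.m_cj[OF m\<mu> y xN] by simp
        also have "\<dots> = \<chi> (\<kappa> (cj y x))" using \<mu>R[OF cyx] .
        also have "\<kappa> (cj y x) = cj v r"
          unfolding x(2) w(2)[OF cyx] w(2)[OF x(1)] v_def
          using wc Rc[OF x(1)] by (simp add: cj_cj m_assoc inv_cancel)
        finally show "cj (\<mu> y) (\<chi> r) = \<chi> (cj v r)" .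
      qed
    qed
    from E'.ty_comp'[OF \<mu>N t this] have "E'.ty g (nrm Y V) (\<lambda>x. \<tau> (\<mu> x))"
      by (rule E'.ty_cong_aut) (use E'.autT_inv[OF tT] E'.autT_inv[OF gT] in simp)
    moreover have "\<tau> (\<mu> x) = \<kappa> x" if x: "x \<in> V" for x
    proof -
      have kx: "\<kappa> x \<in> U1" using \<kappa>V x by blast
      have "\<tau> (\<mu> x) = \<omega> (i (\<kappa> x))" using \<mu>(2)[OF x] by (simp add: \<mu>0_def \<omega>_def)
      then show ?thesis using \<omega>i[OF kx] by simp
    qed
    ultimately show "\<exists>\<kappa>'. E'.ty g (nrm Y V) \<kappa>' \<and> (\<forall>x\<in>V. \<kappa>' x = \<kappa> x)" by blast
  qed
qed

text \<open>The map on \<open>Y\<close> need not extend \<open>\<kappa>\<close>; only the type is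
  kept. Both \<open>\<omega>\<close> on \<open>U\<close> and \<open>\<omega> \<kappa>^-1\<close> on
  the image of \<open>\<kappa>\<close> end at a nice conjugate, so they can be corrected and
  extended to normalizers in \<open>Y\<close>. Induction yields \<open>\<delta>1\<close> and
  \<open>\<delta>2\<close> on \<open>Y\<close> of types \<open>g1\<close> and
  \<open>g1 g^-1\<close>, and \<open>\<delta>2^-1 \<delta>1\<close> has type
  \<open>g\<close>.\<close>

lemma typed_extension:
  assumes "subgroup U G" "R \<subset> U" "U \<subseteq> Y" "E'.ty g U \<kappa>" "inner \<kappa>"
  shows "\<exists>\<delta>. E'.ty g Y \<delta> \<and> inner \<delta>"
  using assms
proof (induction "card Y - card U" arbitrary: U g \<kappa> rule: less_induct)
  case less
  note U = less.prems(1-3) and \<kappa> = less.prems(4) and inn = less.prems(5)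
  show ?case
  proof (cases "U = Y")
    case True
    then show ?thesis using \<kappa> inn by blast
  next
    case False
    have RU: "R \<subseteq> U" using U by blast
    have finY: "finite Y" using finS[OF Y(1)] .
    have cUY: "card U < card Y" using psubset_card_mono[OF finY] U(3) False by blast
    have grow: "\<exists>\<delta>. E'.ty h Y \<delta> \<and> inner \<delta>"
      if V: "subgroup V G" "R \<subseteq> V" "V \<subseteq> Y" "card V = card U"
        and f: "E'.ty h (nrm Y V) f" "inner f" for V h f
    proof (rule less.hyps[OF _ _ _ _ f])
      have VY: "V \<subset> Y" using V cUY by auto
      have g: "V \<subset> nrm Y V" using nrm_grows[OF V(1) Y(1) VY] .
      show s: "subgroup (nrm Y V) G" using nrm_subgroup[OF Y(1)] V(3) Yc by blast
      have "card V < card (nrm Y V)" using psubset_card_mono[OF finS[OF s] g] .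
      then show "card Y - card (nrm Y V) < card Y - card U" using V(4) cUY by simp
      show "R \<subset> nrm Y V" using V(2) g by blast
      show "nrm Y V \<subseteq> Y" by (auto simp: nrm_def)
    qed
    obtain \<omega> where \<omega>: "mE U \<omega>" "\<And>x. x \<in> R \<Longrightarrow> \<omega> x = x"
      and syl: "\<And>A. p_family p (\<omega> ` U) A \<Longrightarrow> (\<And>a. a \<in> A \<Longrightarrow> inner_aut (\<omega> ` U) a) \<Longrightarrow>
         \<exists>b. inner_aut (\<omega> ` U) b \<and> carries (\<omega> ` U) b A (cj ` nrm Y (\<omega> ` U))"
      and rec: "\<And>V \<kappa> g. E'.ty g V \<kappa> \<Longrightarrow> \<kappa> ` V = \<omega> ` U \<Longrightarrow> R \<subseteq> V \<Longrightarrow> V \<subseteq> Y \<Longrightarrow> inner \<kappa> \<Longrightarrow>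
         carries V \<kappa> (cj ` nrm Y V) (cj ` nrm Y (\<omega> ` U)) \<Longrightarrow>
         \<exists>\<kappa>'. E'.ty g (nrm Y V) \<kappa>' \<and> (\<forall>x\<in>V. \<kappa>' x = \<kappa> x)"
      using nice_conjugate[OF U] by metis
    \<comment> \<open>The correction \<open>b\<close> lies in the subsystem and leaves the type
      unchanged. The corrected map extends to \<open>N_Y(V)\<close>, which brings the induction
      forward.\<close>
    have extend: "\<exists>\<delta>. E'.ty h Y \<delta> \<and> inner \<delta>"
      if f: "E'.ty h V f" "f ` V = \<omega> ` U" and V: "R \<subseteq> V" "V \<subseteq> Y" and i: "inner f" for V h f
    proof -
      have mf: "mE V f" using E'.ty_M[OF f(1)] .
      have sV: "subgroup V G" using small.dom[OF mf] by blast
      have cV: "card V = card U" using small.cardQ[OF mf] small.cardQ[OF \<omega>(1)] f(2) by simp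
      have A: "p_family p (\<omega> ` U) (conjugated V f ` cj ` nrm Y V)"
        using p_family_conjugated(1)[OF nrm_Y_family[OF sV V(2)] small.inj[OF mf]] f(2) by simp
      have AI: "inner_aut (\<omega> ` U) a" if "a \<in> conjugated V f ` cj ` nrm Y V" for a
        using that inner_aut_conj[OF nrm_inner_aut[OF sV V(2)] mf V(1) i] f(2) by auto
      obtain b where b: "inner_aut (\<omega> ` U) b"
        "carries (\<omega> ` U) b (conjugated V f ` cj ` nrm Y V) (cj ` nrm Y (\<omega> ` U))"
        using syl[OF A AI] by blast
      have b': "mE' (f ` V) b" "b ` f ` V = \<omega> ` U" "inner b"
        using b(1) f(2) by (auto simp: inner_aut_def sub.aut_def)
      have c: "carries V (\<lambda>x. b (f x)) (cj ` nrm Y V) (cj ` nrm Y (\<omega> ` U))"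
        by (rule carries_comp[OF p_family_conjugated(2)[OF nrm_Y_family[OF sV V(2)] small.inj[OF mf]] b(2)])
          (use f(2) in simp)
      have t: "E'.ty h V (\<lambda>x. b (f x))" by (rule E'.ty_comp_small[OF f(1) b'(1)])
      have ib: "inner (\<lambda>x. b (f x))" using inner_comp[OF i b'(3)] .
      obtain f2 where f2: "E'.ty h (nrm Y V) f2" "\<And>x. x \<in> V \<Longrightarrow> f2 x = b (f x)"
        using rec[OF t _ V ib c] b'(2) by (auto simp: image_image)
      have "inner f2" by (rule inner_cong[OF ib]) (use f2(2) V(1) in auto)
      then show ?thesis using grow[OF sV V cV f2(1)] by blast
    qed
    obtain g1 where g1: "E'.ty g1 U \<omega>" using E'_fac[OF \<omega>(1)] unfolding E'.fac_def by blast
    obtain \<delta>1 where \<delta>1: "E'.ty g1 Y \<delta>1" "inner \<delta>1"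
      using extend[OF g1 refl RU U(3) inner_id[OF \<omega>(2)]] by blast
    have m\<kappa>: "mE U \<kappa>" using E'.ty_M[OF \<kappa>] .
    define i where "i = inv_into U \<kappa>"
    have i\<kappa>: "i (\<kappa> x) = x" if "x \<in> U" for x using small.inv_f[OF m\<kappa> that] by (simp add: i_def)
    have ti: "E'.ty (inv_into T g) (\<kappa> ` U) i" by (rule E'.ty_inv[OF \<kappa>]) (rule i\<kappa>)
    have iU: "i ` \<kappa> ` U = U" using i\<kappa> by (force simp: image_image)
    have ii: "inner i" by (rule inner_inv[OF inn]) (use i\<kappa> RU in blast)
    have t2: "E'.ty (\<lambda>x. g1 (inv_into T g x)) (\<kappa> ` U) (\<lambda>x. \<omega> (i x))"
      by (rule E'.ty_comp[OF ti]) (use g1 iU in simp)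
    have R\<kappa>: "R \<subseteq> \<kappa> ` U"
      using inner_image[OF inn inj_on_subset[OF small.inj[OF m\<kappa>] RU]] RU by blast
    have im: "(\<lambda>x. \<omega> (i x)) ` \<kappa> ` U = \<omega> ` U" using iU by (metis image_image)
    obtain \<delta>2 where \<delta>2: "E'.ty (\<lambda>x. g1 (inv_into T g x)) Y \<delta>2" "inner \<delta>2"
      using extend[OF t2 im R\<kappa> inner_Y[OF m\<kappa> inn RU U(3)] inner_comp[OF ii inner_id[OF \<omega>(2)]]] by blast
    have m\<delta>: "mE Y \<delta>1" "mE Y \<delta>2" using E'.ty_M \<delta>1 \<delta>2 by blast+
    have \<delta>Y: "\<delta>1 ` Y = Y" "\<delta>2 ` Y = Y"
      using small.endo[OF m\<delta>(1) inner_Y[OF m\<delta>(1) \<delta>1(2) Y(3)]] small.endo[OF m\<delta>(2) inner_Y[OF m\<delta>(2) \<delta>2(2) Y(3)]] by auto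
    define j where "j = inv_into Y \<delta>2"
    have j: "j (\<delta>2 x) = x" if "x \<in> Y" for x using small.inv_f[OF m\<delta>(2) that] by (simp add: j_def)
    let ?a = "\<lambda>x. g1 (inv_into T g x)"
    have tj: "E'.ty (inv_into T ?a) Y j" using E'.ty_inv[OF \<delta>2(1) j] \<delta>Y by simp
    have aT: "mE T ?a" "mE T g1" "mE T g" using \<delta>2(1) g1 \<kappa> by (simp_all add: E'.ty_def)
    have "E'.ty (\<lambda>x. inv_into T ?a (g1 x)) Y (\<lambda>x. j (\<delta>1 x))"
      by (rule E'.ty_comp[OF \<delta>1(1)]) (use tj \<delta>Y in simp)
    then have "E'.ty g Y (\<lambda>x. j (\<delta>1 x))"
    proof (rule E'.ty_cong_aut)
      fix x assume x: "x \<in> T"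
      have gx: "g x \<in> T" using E'.autT_inv(5)[OF aT(3) x] .
      have "?a (g x) = g1 x" using E'.autT_inv(3)[OF aT(3) x] by simp
      then show "inv_into T ?a (g1 x) = g x" using E'.autT_inv(3)[OF aT(1) gx] by simp
    qed
    moreover have "inner (\<lambda>x. j (\<delta>1 x))"
      by (rule inner_comp[OF \<delta>1(2) inner_inv[OF \<delta>2(2)]]) (use j Y(3) in blast)
    ultimately show ?thesis by blast
  qed
qed

text \<open>The inner map found on \<open>Y\<close> acts on \<open>R\<close> as some
  \<open>z\<close>. Conjugation by \<open>z^-1\<close> belongs to the subsystem, so composing with
  it does not affect the type.\<close>

lemma typed_extension_id:
  assumes U: "subgroup U G" "R \<subset> U" "U \<subseteq> Y" and \<kappa>: "E'.ty g U \<kappa>" "\<And>x. x \<in> R \<Longrightarrow> \<kappa> x = x"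
  obtains \<delta> where "E'.ty g Y \<delta>" "\<And>x. x \<in> R \<Longrightarrow> \<delta> x = x"
proof -
  obtain \<delta> where \<delta>: "E'.ty g Y \<delta>" "inner \<delta>" using typed_extension[OF U \<kappa>(1) inner_id[OF \<kappa>(2)]] by blast
  obtain z where z: "z \<in> Y" "\<And>x. x \<in> R \<Longrightarrow> \<delta> x = cj z x" using \<delta>(2) unfolding inner_def by blast
  have iz: "inv z \<in> Y" using subgroup.m_inv_closed[OF Y(1) z(1)] .
  have mz: "mE' Y (cj (inv z))" using sub.conj[OF _ Y(1,2)] iz Y(2) by blast
  have "inv z \<in> nrm Y Y" using nrm_self[OF Y(1) finS[OF Y(1)] order_refl] iz by blast
  then have zY: "cj (inv z) ` Y = Y" by (simp add: nrm_def)
  show ?thesis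
  proof (rule that)
    show "E'.ty g Y (\<lambda>x. \<delta> (cj (inv z) x))" by (rule E'.ty_small_comp[OF mz]) (use \<delta>(1) zY in simp)
    show "\<delta> (cj (inv z) x) = x" if "x \<in> R" for x
      using z(2)[OF Y_cj[OF iz that]] cj_cancel(1)[OF Yc[OF z(1)] Rc[OF that]] by simp
  qed
qed

text \<open>\<open>R C_T(R)\<close> lies in the extender of every automorphism of \<open>R\<close>
  in E, and the extensions map it to itself. Extensions to it can therefore be composed, unlike
  extensions to subgroups that depend on the map.\<close>

definition RC where "RC = {r \<otimes> c |r c. r \<in> R \<and> c \<in> T \<and> (\<forall>x\<in>R. c \<otimes> x = x \<otimes> c)}"

lemma RC: "subgroup RC G" "R \<subseteq> RC" "RC \<subseteq> Y"
  and RC_sub: "subgroup X G \<Longrightarrow> R \<subseteq> X \<Longrightarrow>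
    (\<And>c. c \<in> T \<Longrightarrow> (\<And>x. x \<in> R \<Longrightarrow> c \<otimes> x = x \<otimes> c) \<Longrightarrow> c \<in> X) \<Longrightarrow> RC \<subseteq> X"
proof -
  show sub: "RC \<subseteq> X" if X: "subgroup X G" "R \<subseteq> X"
    "\<And>c. c \<in> T \<Longrightarrow> (\<And>x. x \<in> R \<Longrightarrow> c \<otimes> x = x \<otimes> c) \<Longrightarrow> c \<in> X" for X
    using subgroup.m_closed[OF X(1)] X(2,3) by (auto simp: RC_def)
  have cR: "cj c x = x" if "c \<in> T" "\<forall>x\<in>R. c \<otimes> x = x \<otimes> c" "x \<in> R" for c x
    using that cj_fixes_iff Tc Rc by simp
  show "RC \<subseteq> Y" by (rule sub[OF Y(1,3)]) (rule YI, use cR in auto)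
  have "r = r \<otimes> \<one>" if "r \<in> R" for r using Rc[OF that] by simp
  then show R_RC: "R \<subseteq> RC"
    using subgroup.one_closed[OF T] Rc unfolding RC_def by fastforce
  show "subgroup RC G"
  proof (rule finite_subgroupI[OF fin])
    show "RC \<subseteq> carrier G" using \<open>RC \<subseteq> Y\<close> Yc by blast
    show "RC \<noteq> {}" using R_RC subgroup.one_closed[OF R(1)] by blast
    fix u v assume "u \<in> RC" "v \<in> RC"
    then obtain r c s d where *: "r \<in> R" "c \<in> T" "\<forall>x\<in>R. c \<otimes> x = x \<otimes> c" "u = r \<otimes> c"
      "s \<in> R" "d \<in> T" "\<forall>x\<in>R. d \<otimes> x = x \<otimes> d" "v = s \<otimes> d" by (auto simp: RC_def)
    have car: "r \<in> carrier G" "c \<in> carrier G" "s \<in> carrier G" "d \<in> carrier G" using * Rc Tc by auto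
    have "u \<otimes> v = r \<otimes> ((c \<otimes> s) \<otimes> d)" unfolding *(4,8) using car by (simp add: m_assoc)
    also have "c \<otimes> s = s \<otimes> c" using * by simp
    finally have uv: "u \<otimes> v = (r \<otimes> s) \<otimes> (c \<otimes> d)" using car by (simp add: m_assoc)
    have "(c \<otimes> d) \<otimes> x = x \<otimes> (c \<otimes> d)" if "x \<in> R" for x
    proof -
      have "(c \<otimes> d) \<otimes> x = c \<otimes> (x \<otimes> d)" using *(7) that car Rc[OF that] by (simp add: m_assoc)
      also have "\<dots> = (x \<otimes> c) \<otimes> d" using *(3) that car Rc[OF that] by (simp add: m_assoc[symmetric])
      finally show ?thesis using car Rc[OF that] by (simp add: m_assoc)
    qed
    then show "u \<otimes> v \<in> RC"
      unfolding uv RC_def using subgroup.m_closed[OF R(1) *(1,5)] subgroup.m_closed[OF T *(2,6)] by blast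
  qed
qed

lemma RC_ext: "mE R f \<Longrightarrow> f ` R = R \<Longrightarrow> RC \<subseteq> small.ext R R f"
proof (rule RC_sub)
  assume f: "mE R f" "f ` R = R"
  obtain h where "mE (small.ext R R f) h" using small.recpD[OF R_recp f] by blast
  then show "subgroup (small.ext R R f) G" using small.dom by blast
  show "R \<subseteq> small.ext R R f" using small.ext_self[OF f] .
  show "c \<in> small.ext R R f" if "c \<in> T" "\<And>x. x \<in> R \<Longrightarrow> c \<otimes> x = x \<otimes> c" for c
    by (rule small.ext_centralizer) (use R f that in auto)
qed

lemma RC_image:
  assumes f: "mE RC f" and fR: "f ` R = R"
  shows "f ` RC = RC"
proof (rule small.endo[OF f], rule image_subsetI)
  fix u assume "u \<in> RC"
  then obtain r c where u: "r \<in> R" "c \<in> T" "\<forall>x\<in>R. c \<otimes> x = x \<otimes> c" "u = r \<otimes> c" by (auto simp: RC_def)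
  have mem: "r \<in> RC" "c \<in> RC"
  proof -
    show "r \<in> RC" using u RC(2) by blast
    have "c = \<one> \<otimes> c" using u Tc by simp
    then show "c \<in> RC" unfolding RC_def using u subgroup.one_closed[OF R(1)] by blast
  qed
  have "f c \<otimes> y = y \<otimes> f c" if y: "y \<in> R" for y
  proof -
    obtain x where x: "x \<in> R" "y = f x" using fR y by blast
    have xRC: "x \<in> RC" using x RC(2) by blast
    have "f (c \<otimes> x) = f (x \<otimes> c)" using u(3) x(1) by simp
    then show ?thesis using small.mult[OF f mem(2) xRC] small.mult[OF f xRC mem(2)] x(2) by simp
  qed
  moreover have "f c \<in> T" using small.img[OF f] mem(2) by blast
  moreover have "f u = f r \<otimes> f c" unfolding u(4) using small.mult[OF f mem] .
  moreover have "f r \<in> R" using fR u(1) by blast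
  ultimately show "f u \<in> RC" unfolding RC_def by blast
qed

text \<open>
  Extend \<open>\<theta>|\<^sub>R\<^sup>-\<^sup>1\<close> to \<open>\<psi>\<close>; then \<open>\<psi> \<theta>\<close> fixes \<open>R\<close> pointwise, so its type is also realized on \<open>Y\<close>.
\<close>

lemma typed_centralizer_extension:
  assumes U: "subgroup U G" "R \<subset> U" "U \<subseteq> Y" and \<theta>: "E'.ty g U \<theta>" "\<theta> ` R = R"
  obtains \<mu> where "E'.ty g RC \<mu>" "\<And>x. x \<in> R \<Longrightarrow> \<mu> x = \<theta> x"
proof -
  have m\<theta>: "mE U \<theta>" using E'.ty_M[OF \<theta>(1)] .
  have RU: "R \<subseteq> U" using U by blast
  have \<theta>R: "mE R \<theta>" using small.restr[OF m\<theta> R(1) RU] .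
  define i where "i = inv_into R \<theta>"
  have i\<theta>: "i (\<theta> x) = x" if "x \<in> R" for x using small.inv_f[OF \<theta>R that] by (simp add: i_def)
  have "i ` \<theta> ` R = R" using i\<theta> by (force simp: image_image)
  then have mi: "mE R i" "i ` R = R" using small.inverse[OF \<theta>R] \<theta>(2) by (simp_all add: i_def)
  obtain \<psi> where \<psi>: "mE (small.ext R R i) \<psi>" "\<And>x. x \<in> R \<Longrightarrow> \<psi> x = i x" using small.recpD[OF R_recp mi] by blast
  obtain b where b: "E'.ty b (small.ext R R i) \<psi>" using E'_fac[OF \<psi>(1)] unfolding E'.fac_def by blast
  have bT: "mE T b" "mE T g" using b \<theta> by (simp_all add: E'.ty_def)
  have sub: "\<theta> ` U \<subseteq> small.ext R R i"
  proof (rule image_subsetI)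
    fix u assume u: "u \<in> U"
    have uY: "u \<in> Y" using u U by blast
    have e: "cj (\<theta> u) (\<theta> r) = \<theta> (cj u r)" if "r \<in> R" for r using small.m_cj[OF m\<theta> u, of r] that RU by auto
    have luY: "\<theta> u \<in> Y"
    proof (rule YI)
      show "\<theta> u \<in> T" using small.img[OF m\<theta>] u by blast
      fix x assume "x \<in> R"
      then obtain r where r: "r \<in> R" "x = \<theta> r" using \<theta>(2) by blast
      show "cj (\<theta> u) x \<in> R" unfolding r(2) e[OF r(1)] using \<theta>(2) Y_cj[OF uY r(1)] by blast
    qed
    have "i (cj (\<theta> u) y) = cj u (i y)" if "y \<in> R" for y
    proof -
      obtain r where r: "r \<in> R" "y = \<theta> r" using \<theta>(2) \<open>y \<in> R\<close> by blast
      show ?thesis unfolding r(2) e[OF r(1)] using i\<theta> Y_cj[OF uY r(1)] r(1) by simp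
    qed
    then show "\<theta> u \<in> small.ext R R i" using luY uY unfolding small.ext_def Y_def by blast
  qed
  have t1: "E'.ty (\<lambda>x. b (g x)) U (\<lambda>x. \<psi> (\<theta> x))" using E'.ty_comp'[OF \<theta>(1) b sub] .
  have bg: "mE T (\<lambda>x. b (g x))" using t1 by (simp add: E'.ty_def)
  obtain \<delta> where \<delta>: "E'.ty (\<lambda>x. b (g x)) Y \<delta>" "\<And>x. x \<in> R \<Longrightarrow> \<delta> x = x"
  proof (rule typed_extension_id[OF U t1])
    fix x assume x: "x \<in> R"
    then have "\<theta> x \<in> R" using \<theta>(2) by blast
    then show "\<psi> (\<theta> x) = x" using \<psi>(2) i\<theta>[OF x] by simp
  qed blast
  have \<psi>RC: "E'.ty b RC \<psi>" using E'.ty_restr[OF b RC(1) RC_ext[OF mi]] .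
  have \<psi>RC': "\<psi> ` RC = RC"
    by (rule RC_image[OF E'.ty_M[OF \<psi>RC]]) (use \<psi>(2) mi(2) in \<open>force simp: image_def\<close>)
  have \<delta>RC: "E'.ty (\<lambda>x. b (g x)) RC \<delta>" using E'.ty_restr[OF \<delta>(1) RC(1,3)] .
  have \<delta>RC': "\<delta> ` RC = RC"
    by (rule RC_image[OF E'.ty_M[OF \<delta>RC]]) (use \<delta>(2) in simp)
  have inv\<psi>: "inv_into RC \<psi> (\<psi> x) = x" if "x \<in> RC" for x using small.inv_f[OF E'.ty_M[OF \<psi>RC] that] .
  have "E'.ty (inv_into T b) RC (inv_into RC \<psi>)" using E'.ty_inv[OF \<psi>RC inv\<psi>] \<psi>RC' by simp
  \<comment> \<open>\<open>\<psi>^-1 \<delta>\<close> has type \<open>b^-1 b g\<close>, that is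
    \<open>g\<close>, and it agrees with \<open>\<theta>\<close> on \<open>R\<close> because
    \<open>\<delta>\<close> is trivial there.\<close>
  then have "E'.ty (\<lambda>x. inv_into T b (b (g x))) RC (\<lambda>x. inv_into RC \<psi> (\<delta> x))"
    using E'.ty_comp[OF \<delta>RC] \<delta>RC' by simp
  then have "E'.ty g RC (\<lambda>x. inv_into RC \<psi> (\<delta> x))"
    by (rule E'.ty_cong_aut) (use E'.autT_inv(3)[OF bT(1)] E'.autT_inv(5)[OF bT(2)] in simp)
  moreover have "inv_into RC \<psi> (\<delta> x) = \<theta> x" if x: "x \<in> R" for x
  proof -
    have lx: "\<theta> x \<in> R" using \<theta>(2) x by blast
    have "\<psi> (\<theta> x) = x" using \<psi>(2)[OF lx] i\<theta>[OF x] by simp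
    then show ?thesis using inv\<psi>[of "\<theta> x"] \<delta>(2)[OF x] lx RC(2) by auto
  qed
  ultimately show ?thesis using that by blast
qed

text \<open>\<open>\<chi>\<close> is changed by an automorphism of \<open>R\<close> so that it
  extends to \<open>N_T(V)\<close>. The change does no harm, since only some identification of
  \<open>V\<close> with \<open>R\<close> is wanted.\<close>

lemma nrm_extension_to_R:
  assumes \<chi>: "mE V \<chi>" "\<chi> ` V = R"
  obtains b \<xi> where "E'.ty b (nrm T V) \<xi>" "\<xi> ` V = R"
proof -
  have sV: "subgroup V G" "V \<subseteq> T" using small.dom[OF \<chi>(1)] by auto
  obtain \<rho> where \<rho>: "small.aut R \<rho>" "carries V (\<lambda>x. \<rho> (\<chi> x)) (cj ` nrm T V) (cj ` nrm T R)"
    using small.fau_carries_aut[OF R_fau \<chi> small.nrm_family[OF sV]] small.nrm_aut sV by blast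
  have m: "mE V (\<lambda>x. \<rho> (\<chi> x))" "(\<lambda>x. \<rho> (\<chi> x)) ` V = R"
    using small.comp[OF \<chi>(1), of \<rho>] \<rho>(1) \<chi>(2) by (auto simp: small.aut_def image_image[symmetric])
  have sN: "subgroup (nrm T V) G" using nrm_subgroup[OF T] sV Tc by blast
  obtain h where h: "mE (nrm T V) h" "\<And>x. x \<in> V \<Longrightarrow> h x = \<rho> (\<chi> x)"
    using small.extend_carries[OF R_recp m \<rho>(2) sN order_refl] by blast
  obtain b where "E'.ty b (nrm T V) h" using E'_fac[OF h(1)] unfolding E'.fac_def by blast
  moreover have "h ` V = R" using h(2) m(2) by (force simp: image_def)
  ultimately show ?thesis by (rule that)
qed

text \<open>A subsystem morphism on a non-centric \<open>Q\<close> is a chain of restrictions of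
  good morphisms between conjugates of \<open>R\<close>, each identified with \<open>R\<close> by a
  map defined on its normalizer. A single link is a restriction from a centric \<open>U\<close>, so
  it is defined on \<open>N_U(Q)\<close> and, transported to \<open>R\<close>, has its type on a
  subgroup larger than \<open>R\<close>. Links are then composed on \<open>R C_T(R)\<close>.\<close>

lemma mE'_typed_centralizer:
  assumes "mE' Q f" "\<not> cen Q" "E'.ty b0 (nrm T Q) \<chi>0" "\<chi>0 ` Q = R"
    "E'.ty b1 (nrm T (f ` Q)) \<chi>1" "\<chi>1 ` f ` Q = R"
  shows "\<exists>\<mu>. E'.ty (\<lambda>x. b1 (inv_into T b0 x)) RC \<mu> \<and> (\<forall>x\<in>Q. \<mu> (\<chi>0 x) = \<chi>1 (f x))"
  using assms
proof (induction arbitrary: b0 \<chi>0 b1 \<chi>1 rule: mE'.induct)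
  case (base U f Q g)
  note U = good_cen[OF base.hyps(1)]
  note sU = cen_sub[OF U]
  \<comment> \<open>\<open>U\<close> is centric and \<open>Q\<close> is not, so the inclusion is
    proper and \<open>Q\<close> grows inside \<open>U\<close>.\<close>
  have QU: "Q \<subset> U" using base.hyps(3) U base.prems(1) by blast
  have sQ: "subgroup Q G" "Q \<subseteq> T" using base.hyps(2) QU sU by auto
  let ?N = "nrm U Q"
  have N: "subgroup ?N G" "Q \<subset> ?N" "?N \<subseteq> U" "?N \<subseteq> nrm T Q"
    using nrm_subgroup[OF sU(1)] sQ Tc nrm_grows[OF sQ(1) sU(1) QU] sU by (auto simp: nrm_def)
  have gQ: "g ` Q = f ` Q" using base.hyps(4) by (force simp: image_def)
  have mf: "mE' U f" using good_mE'[OF base.hyps(1)] .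
  have mfN: "mE' ?N f" using sub.restr[OF mf N(1,3)] .
  have fN: "f ` ?N \<subseteq> nrm T (f ` Q)"
    by (rule extension_nrm[OF mE'_mE[OF mfN]]) (use N in auto)
  have m0: "mE (nrm T Q) \<chi>0" using E'.ty_M[OF base.prems(2)] .
  have t0: "E'.ty b0 ?N \<chi>0" using E'.ty_restr[OF base.prems(2) N(1,4)] .
  have m0N: "mE ?N \<chi>0" using E'.ty_M[OF t0] .
  define i where "i = inv_into ?N \<chi>0"
  have i0: "i (\<chi>0 x) = x" if "x \<in> ?N" for x using small.inv_f[OF m0N that] by (simp add: i_def)
  have ti: "E'.ty (inv_into T b0) (\<chi>0 ` ?N) i" by (rule E'.ty_inv[OF t0]) (rule i0)
  have iN: "i ` \<chi>0 ` ?N = ?N" using i0 by (force simp: image_image)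
  have t1: "E'.ty b1 ?N (\<lambda>x. \<chi>1 (f x))"
    by (rule E'.ty_small_comp[OF mfN])
      (use E'.ty_restr[OF base.prems(4)] sub.image[OF mfN] fN gQ in simp)
  have t: "E'.ty (\<lambda>x. b1 (inv_into T b0 x)) (\<chi>0 ` ?N) (\<lambda>y. \<chi>1 (f (i y)))"
    using E'.ty_comp[OF ti, of b1 "\<lambda>x. \<chi>1 (f x)"] t1 iN by simp
  have e: "\<chi>1 (f (i (\<chi>0 x))) = \<chi>1 (g x)" if "x \<in> Q" for x
    using i0[of x] base.hyps(4)[OF that] that N(2) by auto
  obtain \<mu> where \<mu>: "E'.ty (\<lambda>x. b1 (inv_into T b0 x)) RC \<mu>" "\<And>x. x \<in> R \<Longrightarrow> \<mu> x = \<chi>1 (f (i x))"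
  proof (rule typed_centralizer_extension[OF _ _ _ t])
    show "subgroup (\<chi>0 ` ?N) G" using small.image[OF m0N] .
    show "R \<subset> \<chi>0 ` ?N"
    proof -
      have "R \<subseteq> \<chi>0 ` ?N" using base.prems(3) N(2) by blast
      moreover have "card R < card (\<chi>0 ` ?N)"
        using small.cardQ[OF m0N] small.cardQ[OF small.restr[OF m0N sQ(1)]] base.prems(3)
          psubset_card_mono[OF finS[OF N(1)] N(2)] N(2) by auto
      ultimately show ?thesis by auto
    qed
    have "\<chi>0 ` ?N \<subseteq> nrm T (\<chi>0 ` Q)" by (rule extension_nrm[OF m0N]) (use N in auto)
    then show "\<chi>0 ` ?N \<subseteq> Y" by (simp add: Y_def base.prems(3))
    have "(\<lambda>y. \<chi>1 (f (i y))) ` R = \<chi>1 ` g ` Q"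
      unfolding base.prems(3)[symmetric] using e by (force simp: image_image)
    then show "(\<lambda>y. \<chi>1 (f (i y))) ` R = R" using base.prems(5) by simp
  qed blast
  then have "\<mu> (\<chi>0 x) = \<chi>1 (g x)" if "x \<in> Q" for x using e[OF that] base.prems(3) that by auto
  then show ?case using \<mu>(1) by blast
next
  case (step Q f g h)
  have mf: "mE Q f" and mg: "mE (f ` Q) g" using mE'_mE step.hyps by blast+
  have hQ: "h ` Q = g ` f ` Q" using step.hyps(3) by (force simp: image_def)
  have ncf: "\<not> cen (f ` Q)"
  proof
    assume "cen (f ` Q)"
    then have "cen (inv_into Q f ` f ` Q)" using cen_image m_M[OF small.inverse[OF mf]] by blast
    moreover have "inv_into Q f ` f ` Q = Q" using small.inv_f[OF mf] by (force simp: image_image)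
    ultimately show False using step.prems(1) by simp
  qed
  have sQ: "subgroup Q G" "Q \<subseteq> T" using small.dom[OF mf] by auto
  have m0: "mE Q \<chi>0"
    using small.restr[OF E'.ty_M[OF step.prems(2)] sQ(1) nrm_self[OF sQ(1) finS[OF sQ(1)] sQ(2)]] .
  have "mE (f ` Q) (\<lambda>y. \<chi>0 (inv_into Q f y))" "(\<lambda>y. \<chi>0 (inv_into Q f y)) ` f ` Q = R"
    using small.comp_inv[OF mf m0, of "\<lambda>y. \<chi>0 (inv_into Q f y)"] small.inv_f[OF mf] step.prems(3)
    by (auto simp: image_image cong: image_cong)
  then obtain b \<xi> where \<xi>: "E'.ty b (nrm T (f ` Q)) \<xi>" "\<xi> ` f ` Q = R" using nrm_extension_to_R by blast
  obtain \<mu> where \<mu>: "E'.ty (\<lambda>x. b (inv_into T b0 x)) RC \<mu>" "\<And>x. x \<in> Q \<Longrightarrow> \<mu> (\<chi>0 x) = \<xi> (f x)"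
    using step.IH(1)[OF step.prems(1-3) \<xi>] by blast
  have p4: "E'.ty b1 (nrm T (g ` f ` Q)) \<chi>1" "\<chi>1 ` g ` f ` Q = R" using step.prems(4,5) hQ by simp_all
  obtain \<nu> where \<nu>: "E'.ty (\<lambda>x. b1 (inv_into T b x)) RC \<nu>" "\<And>x. x \<in> f ` Q \<Longrightarrow> \<nu> (\<xi> x) = \<chi>1 (g x)"
    using step.IH(2)[OF ncf \<xi> p4] by blast
  have \<mu>R: "\<mu> ` R = R"
  proof -
    have "\<mu> ` \<chi>0 ` Q = \<xi> ` f ` Q" using \<mu>(2) by (force simp: image_image)
    then show ?thesis using step.prems(3) \<xi>(2) by simp
  qed
  have "\<mu> ` RC = RC" by (rule RC_image[OF E'.ty_M[OF \<mu>(1)] \<mu>R])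
  then have "E'.ty (\<lambda>x. b1 (inv_into T b (b (inv_into T b0 x)))) RC (\<lambda>x. \<nu> (\<mu> x))"
    using E'.ty_comp[OF \<mu>(1)] \<nu>(1) by simp
  then have "E'.ty (\<lambda>x. b1 (inv_into T b0 x)) RC (\<lambda>x. \<nu> (\<mu> x))"
  proof (rule E'.ty_cong_aut)
    fix x assume x: "x \<in> T"
    have "mE T b" "mE T b0" using \<xi>(1) step.prems(2) by (simp_all add: E'.ty_def)
    then show "b1 (inv_into T b (b (inv_into T b0 x))) = b1 (inv_into T b0 x)"
      using E'.autT_inv(3,4) x by simp
  qed
  moreover have "\<nu> (\<mu> (\<chi>0 x)) = \<chi>1 (h x)" if "x \<in> Q" for x
    using \<mu>(2)[OF that] \<nu>(2)[of "f x"] step.hyps(3)[OF that] that by simp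
  ultimately show ?case by blast
qed

text \<open>For a non-centric \<open>R\<close> whose identity has type \<open>a\<close>, write this
  identity as \<open>a e\<close> with \<open>e\<close> in the subsystem. Identifying
  \<open>R\<close> with itself by the identity and the image of \<open>e\<close> with
  \<open>R\<close> by \<open>a\<close>, the chain argument extends it to \<open>R C_T(R)\<close>
  with type \<open>a\<close>. That group is larger than \<open>R\<close>, so the type passes on to
  \<open>N_T(R)\<close>.\<close>

lemma typed_recp_step: "typed_recp R"
proof (cases "cen R")
  case True
  then show ?thesis using typed_recp_cen R_recp by blast
next
  case nc: False
  show ?thesis
  proof (rule typed_recpI[OF R_recp])
    fix a assume a: "E'.ty a R (\<lambda>x. x)"
    obtain e where e: "mE T a" "mE' R e" "\<And>x. x \<in> R \<Longrightarrow> x = a (e x)" using E'.tyE[OF a] by blast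
    have eR: "subgroup (e ` R) G" "e ` R \<subseteq> T" using sub.image[OF e(2)] sub.img[OF e(2)] by auto
    have sN: "subgroup (nrm T (e ` R)) G" "nrm T (e ` R) \<subseteq> T"
      using nrm_subgroup[OF T] eR Tc by (auto simp: nrm_def)
    have t0: "E'.ty (\<lambda>x. x) (nrm T R) (\<lambda>x. x)"
      using E'.ty_id sub.ident Y(1,2) by (simp add: Y_def)
    have t1: "E'.ty a (nrm T (e ` R)) a" using E'.ty_aut[OF e(1) sN] .
    have "a ` e ` R = R" using e(3) by (force simp: image_image)
    then obtain \<mu> where \<mu>: "E'.ty (\<lambda>x. a (inv_into T (\<lambda>x. x) x)) RC \<mu>" "\<And>x. x \<in> R \<Longrightarrow> \<mu> x = a (e x)"
      using mE'_typed_centralizer[OF e(2) nc t0 _ t1] by auto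
    have \<mu>': "E'.ty a RC \<mu>"
      by (rule E'.ty_cong_aut[OF \<mu>(1)]) (use E'.autT_inv(3)[OF E'.autT_id] in simp)
    have "R \<subset> RC"
    proof -
      obtain t where t: "t \<in> T" "t \<notin> R" "\<And>x. x \<in> R \<Longrightarrow> t \<otimes> x = x \<otimes> t"
        using non_centric_centralizer[OF R(1,2) nc R_recp] by blast
      have "t = \<one> \<otimes> t" using t Tc by simp
      then have "t \<in> RC" unfolding RC_def using t subgroup.one_closed[OF R(1)] by blast
      then show ?thesis using RC(2) t(2) by blast
    qed
    then obtain \<delta> where "E'.ty a Y \<delta>" "\<And>x. x \<in> R \<Longrightarrow> \<delta> x = x"
      using typed_extension_id[OF RC(1) _ RC(3) \<mu>'] \<mu>(2) e(3) by metis
    then show "\<exists>h. E'.ty a (nrm T R) h \<and> (\<forall>x\<in>R. h x = x)" unfolding Y_def by blast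
  qed
qed

end

theorem typed_recp:
  assumes "subgroup R G" "R \<subseteq> T" "small.fau R" "small.recp R"
  shows "typed_recp R"
  using assms
proof (induction "card T - card R" arbitrary: R rule: less_induct)
  case less
  show ?case
  proof (cases "R = T")
    case True
    then show ?thesis using typed_recp_cen cen_T less.prems by blast
  next
    case False
    show ?thesis
    proof (rule typed_recp_step[OF less.prems(1,2) False less.prems(4,3)])
      fix U assume U: "subgroup U G" "U \<subseteq> T" "card R < card U" "small.fau U" "small.recp U"
      show "typed_recp U"
        by (rule less.hyps) (use U card_mono[OF finT U(2)] in auto)
    qed
  qed
qed

end

lemma inj_on_conjugated:
  assumes a: "inj_on a R" and X: "\<And>f. f \<in> X \<Longrightarrow> f \<in> extensional R" "\<And>f x. f \<in> X \<Longrightarrow> x \<in> R \<Longrightarrow> f x \<in> R"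
  shows "inj_on (\<lambda>f. restrict (conjugated R a f) (a ` R)) X"
proof (rule inj_onI)
  fix f g assume fg: "f \<in> X" "g \<in> X"
    "restrict (conjugated R a f) (a ` R) = restrict (conjugated R a g) (a ` R)"
  show "f = g"
  proof (rule extensionalityI[OF X(1)[OF fg(1)] X(1)[OF fg(2)]])
    fix x assume x: "x \<in> R"
    have "a (f x) = a (g x)"
      using fun_cong[OF fg(3), of "a x"] x conjugated_apply[OF a x] by simp
    then show "f x = g x" using inj_onD[OF a] X(2)[OF fg(1) x] X(2)[OF fg(2) x] by blast
  qed
qed

lemma (in fusion) ext_cong:
  assumes fg: "\<And>x. x \<in> Q \<Longrightarrow> f x = g x"
  shows "ext Q R f \<subseteq> ext Q R g"
proof
  fix u assume "u \<in> ext Q R f"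
  then obtain h where u: "u \<in> nrm S Q" "h \<in> nrm S R" "\<And>x. x \<in> Q \<Longrightarrow> f (cj u x) = cj h (f x)"
    unfolding ext_def by blast
  have "g (cj u x) = cj h (g x)" if "x \<in> Q" for x
    using u(3)[OF that] fg[OF that] fg[OF nrmD(2)[OF u(1) that]] by simp
  then show "u \<in> ext Q R g" using u(1,2) unfolding ext_def by blast
qed

context weakly_normal_pair
begin

section \<open>Saturation of the good subsystem\<close>

lemma nrm_autE:
  assumes a: "mE T a" and R: "R \<subseteq> T" and g: "g \<in> nrm T R"
  shows "a g \<in> nrm T (a ` R)"
proof -
  have gT: "g \<in> T" using g by (simp add: nrm_def)
  have "cj (a g) ` a ` R = a ` cj g ` R"
    using small.m_cj[OF a gT] R by (force simp: image_image)
  then show ?thesis using g E'.autT_inv(5)[OF a gT] by (simp add: nrm_def)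
qed

text \<open>Conjugation by \<open>a\<close> embeds both groups. Used for \<open>a\<close> and for
  its inverse, this makes full automization invariant under \<open>Aut_E(T)\<close>.\<close>

lemma fau_card_le:
  assumes a: "mE T a" and R: "subgroup R G" "R \<subseteq> T"
  shows "card (bij_set R (small.aut R)) \<le> card (bij_set (a ` R) (small.aut (a ` R)))"
    and "card ((\<lambda>a. restrict a R) ` cj ` nrm T R) \<le> card ((\<lambda>x. restrict x (a ` R)) ` cj ` nrm T (a ` R))"
proof -
  let ?\<Phi> = "\<lambda>f. restrict (conjugated R a f) (a ` R)"
  have aR: "mE R a" using small.restr[OF a R] .
  have sR: "subgroup (a ` R) G" "a ` R \<subseteq> T" using small.image[OF aR] small.img[OF aR] by auto
  note ia = small.inj[OF aR]
  have "bij_set (a ` R) (small.aut (a ` R)) \<subseteq> Bij (a ` R)"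
    using small.bij by (auto simp: bij_set_def small.aut_def Bij_def)
  then have fB: "finite (bij_set (a ` R) (small.aut (a ` R)))"
    using finite_Bij[OF finS[OF sR(1)]] finite_subset by blast
  show "card (bij_set R (small.aut R)) \<le> card (bij_set (a ` R) (small.aut (a ` R)))"
  proof (rule card_inj_on_le[OF _ _ fB])
    show "inj_on ?\<Phi> (bij_set R (small.aut R))"
      by (rule inj_on_conjugated[OF ia]) (auto simp: bij_set_def small.aut_def)
    show "?\<Phi> ` bij_set R (small.aut R) \<subseteq> bij_set (a ` R) (small.aut (a ` R))"
    proof (rule image_subsetI)
      fix f assume "f \<in> bij_set R (small.aut R)"
      then have "small.aut R f" by (simp add: bij_set_def)
      then have "small.aut (a ` R) (conjugated R a f)" using invar_conj[OF _ m_M[OF aR] R(2)] by blast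
      then have "small.aut (a ` R) (?\<Phi> f)"
        unfolding small.aut_def using small.cong[of "a ` R" "conjugated R a f" "?\<Phi> f"] by auto
      then show "?\<Phi> f \<in> bij_set (a ` R) (small.aut (a ` R))" by (simp add: bij_set_def)
    qed
  qed
  have "nrm T (a ` R) \<subseteq> T" by (auto simp: nrm_def)
  then have fJ: "finite ((\<lambda>x. restrict x (a ` R)) ` cj ` nrm T (a ` R))" using finT finite_subset by blast
  show "card ((\<lambda>a. restrict a R) ` cj ` nrm T R) \<le> card ((\<lambda>x. restrict x (a ` R)) ` cj ` nrm T (a ` R))"
  proof (rule card_inj_on_le[OF _ _ fJ])
    show "inj_on ?\<Phi> ((\<lambda>a. restrict a R) ` cj ` nrm T R)"
      by (rule inj_on_conjugated[OF ia]) (auto dest: nrmD(2))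
    show "?\<Phi> ` (\<lambda>a. restrict a R) ` cj ` nrm T R \<subseteq> (\<lambda>x. restrict x (a ` R)) ` cj ` nrm T (a ` R)"
    proof (rule image_subsetI)
      fix f assume "f \<in> (\<lambda>a. restrict a R) ` cj ` nrm T R"
      then obtain g where g: "g \<in> nrm T R" "f = restrict (cj g) R" by auto
      have gT: "g \<in> T" using g by (simp add: nrm_def)
      have "?\<Phi> f = restrict (cj (a g)) (a ` R)"
      proof (rule restrict_ext)
        fix y assume "y \<in> a ` R"
        then obtain x where x: "x \<in> R" "y = a x" by auto
        then show "conjugated R a f y = cj (a g) y"
          using conjugated_apply[OF ia x(1), of f] small.m_cj[OF a gT, of x] R g(2) by auto
      qed
      then show "?\<Phi> f \<in> (\<lambda>x. restrict x (a ` R)) ` cj ` nrm T (a ` R)"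
        using nrm_autE[OF a R(2) g(1)] by blast
    qed
  qed
qed

lemma fau_aut:
  assumes a: "mE T a" and R: "subgroup R G" "R \<subseteq> T" and nice: "small.fau (a ` R)"
  shows "small.fau R"
proof -
  have aR: "mE R a" using small.restr[OF a R] .
  have sR: "subgroup (a ` R) G" "a ` R \<subseteq> T" using small.image[OF aR] small.img[OF aR] by auto
  have b: "inv_into T a ` a ` R = R" using E'.autT_inv(3)[OF a] R(2) by (force simp: image_image)
  note le = fau_card_le[OF a R] fau_card_le[OF E'.autT_inv(1)[OF a] sR, unfolded b]
  show ?thesis using nice le unfolding small.fau_def by (metis le_antisym)
qed

lemma ext_aut:
  assumes a: "mE T a" and f: "mE Q f"
  shows "small.ext Q (f ` Q) f \<subseteq> small.ext Q (a ` f ` Q) (\<lambda>x. a (f x))"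
proof
  fix g assume "g \<in> small.ext Q (f ` Q) f"
  then obtain h where g: "g \<in> nrm T Q" and h: "h \<in> nrm T (f ` Q)" "\<And>x. x \<in> Q \<Longrightarrow> f (cj g x) = cj h (f x)"
    unfolding small.ext_def by blast
  have fT: "f x \<in> T" if "x \<in> Q" for x using small.img[OF f] that by blast
  have hT: "h \<in> T" using h(1) by (simp add: nrm_def)
  have "a (f (cj g x)) = cj (a h) (a (f x))" if "x \<in> Q" for x
    using h(2)[OF that] small.m_cj[OF a hT fT[OF that]] by simp
  then show "g \<in> small.ext Q (a ` f ` Q) (\<lambda>x. a (f x))"
    unfolding small.ext_def using g nrm_autE[OF a small.img[OF f] h(1)] by blast
qed

text \<open>Let \<open>f = a e\<close> lead to a fully automized receptive subgroup of E; the
  required conjugate of \<open>Q\<close> is the image of \<open>e\<close>. A subsystem morphism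
  \<open>\<phi>\<close> onto it gives \<open>a \<phi>\<close> of type \<open>a\<close>, which
  extends with the same type. Removing \<open>a\<close> leaves the trivial type, that is, a morphism
  of the subsystem.\<close>

theorem E'_sat: "sub.sat"
  unfolding sub.sat_def
proof (intro allI impI)
  fix Q assume Q: "subgroup Q G" "Q \<subseteq> T"
  obtain f where f: "mE Q f" "small.fau (f ` Q)" "small.recp (f ` Q)" using small.satD[OF E_sat Q] by blast
  obtain a e where e: "mE T a" "mE' Q e" "\<And>x. x \<in> Q \<Longrightarrow> f x = a (e x)"
    using E'_fac[OF f(1)] unfolding E'.fac_def E'.ty_def by blast
  define R where "R = e ` Q"
  have sR: "subgroup R G" "R \<subseteq> T" using sub.image[OF e(2)] sub.img[OF e(2)] by (auto simp: R_def)
  have fQ: "f ` Q = a ` R" using e(3) by (force simp: R_def image_image)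
  have "subgroup (f ` Q) G" "f ` Q \<subseteq> T" using small.image[OF f(1)] small.img[OF f(1)] by auto
  then have trec: "typed_recp (a ` R)" using typed_recp f(2,3) fQ by simp
  have "small.fau R" by (rule fau_aut[OF e(1) sR]) (use f(2) fQ in simp)
  then have "sub.fau R"
    unfolding sub.fau_def small.fau_def
    by (intro not_dvd_index_subgroup[OF finS[OF sR(1)] p small.aut_group[OF sR] sub.aut_group[OF sR]])
      (use small.nrm_family[OF sR] sub.nrm_aut sR mE'_mE in \<open>auto simp: sub.aut_def small.aut_def\<close>)
  moreover have "sub.recp R"
    unfolding sub.recp_def
  proof (intro allI impI)
    fix V \<phi> assume \<phi>: "mE' V \<phi>" "\<phi> ` V = R"
    have m\<phi>: "mE V \<phi>" using mE'_mE \<phi>(1) by blast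
    have t: "E'.ty a V (\<lambda>x. a (\<phi> x))"
      using E'.ty_small_comp[OF \<phi>(1)] E'.ty_aut[OF e(1) sR] \<phi>(2) by simp
    have im: "(\<lambda>x. a (\<phi> x)) ` V = a ` R" using \<phi>(2) by (metis image_image)
    have "\<exists>h. E'.ty a (small.ext V (a ` R) (\<lambda>x. a (\<phi> x))) h \<and> (\<forall>x\<in>V. h x = a (\<phi> x))"
      by (rule trec[unfolded typed_recp_def, rule_format, OF t im])
    then obtain h where h: "E'.ty a (small.ext V (a ` R) (\<lambda>x. a (\<phi> x))) h" "\<And>x. x \<in> V \<Longrightarrow> h x = a (\<phi> x)"
      by blast
    note i = E'.autT_inv[OF e(1)]
    have ext_le: "small.ext V (a ` R) (\<lambda>x. a (\<phi> x)) \<subseteq> small.ext V R \<phi>"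
    proof -
      have 1: "inv_into T a ` a ` R = R" using i(3) sR(2) by (force simp: image_image)
      have 2: "inv_into T a (a (\<phi> x)) = \<phi> x" if "x \<in> V" for x using i(3) small.img[OF m\<phi>] that by blast
      have "small.ext V (a ` R) (\<lambda>x. a (\<phi> x)) \<subseteq> small.ext V R (\<lambda>x. inv_into T a (a (\<phi> x)))"
        using ext_aut[OF i(1) E'.ty_M[OF t]] unfolding im 1 .
      also have "\<dots> \<subseteq> small.ext V R \<phi>" by (rule small.ext_cong) (rule 2)
      finally show ?thesis .
    qed
    have "small.ext V R \<phi> \<subseteq> small.ext V (a ` R) (\<lambda>x. a (\<phi> x))" using ext_aut[OF e(1) m\<phi>] \<phi>(2) by simp
    then have eq: "small.ext V (a ` R) (\<lambda>x. a (\<phi> x)) = small.ext V R \<phi>" using ext_le by blast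
    have hT: "h ` small.ext V R \<phi> \<subseteq> T" using small.img[OF E'.ty_M[OF h(1)]] eq by simp
    have "E'.ty (\<lambda>x. inv_into T a (a x)) (small.ext V R \<phi>) (\<lambda>x. inv_into T a (h x))"
      using E'.ty_comp'[OF h(1)[unfolded eq] E'.ty_aut[OF i(1) T order_refl] hT] .
    then have "E'.ty (\<lambda>x. x) (small.ext V R \<phi>) (\<lambda>x. inv_into T a (h x))"
      by (rule E'.ty_cong_aut) (use i(3) in simp)
    then have "mE' (small.ext V R \<phi>) (\<lambda>x. inv_into T a (h x))" by (rule E'.ty_idD)
    moreover have "inv_into T a (h x) = \<phi> x" if "x \<in> V" for x
      using h(2)[OF that] i(3) small.img[OF m\<phi>] that by auto
    ultimately show "\<exists>h. mE' (sub.ext V R \<phi>) h \<and> (\<forall>x\<in>V. h x = \<phi> x)" by blast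
  qed
  ultimately show "\<exists>f. mE' Q f \<and> sub.fau (f ` Q) \<and> sub.recp (f ` Q)" using e(2) unfolding R_def by blast
qed

text \<open>The extension maps \<open>C\<close> into \<open>C\<close> because it preserves
  \<open>T\<close>. So \<open>c^-1 (h c)\<close> lies in \<open>C\<close> as well as in
  \<open>T\<close>, hence in the centre of \<open>T\<close>.\<close>

lemma good_aut_normal:
  assumes "mE' T a"
  obtains h where "mF (TC T) h" "h ` TC T = TC T" "\<And>x. x \<in> T \<Longrightarrow> h x = a x"
    "\<And>c. c \<in> C \<Longrightarrow> inv c \<otimes> h c \<in> C \<inter> T"
proof -
  have g: "good T a" using mE'_good[OF assms cen_T] .
  have aT: "a ` T = T" using E'.autT[OF mE'_mE[OF assms]] .
  obtain h where h: "mF (TC T) h" "\<And>x. x \<in> T \<Longrightarrow> h x = a x" "h ` TC T = TC (a ` T)"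
    "\<And>c. c \<in> C \<Longrightarrow> \<exists>r\<in>a ` T. h c = c \<otimes> r" using goodE[OF g] by metis
  have TT: "T \<subseteq> TC T" "C \<subseteq> TC T" using Q_TC[of T] C_TC[OF T] by auto
  have "inv c \<otimes> h c \<in> C \<inter> T" if c: "c \<in> C" for c
  proof -
    obtain r where r: "r \<in> T" "h c = c \<otimes> r" using h(4)[OF c] aT by blast
    have "h c \<otimes> y = y \<otimes> h c" if y: "y \<in> T" for y
    proof -
      obtain x where x: "x \<in> T" "y = h x" using y aT h(2) by (metis imageE)
      have "h (c \<otimes> x) = h (x \<otimes> c)" using C_comm[OF c x(1)] by simp
      then show ?thesis using big.mult[OF h(1)] TT c x by (simp add: subsetD)
    qed
    moreover have "h c \<in> carrier G" using big.car(2)[OF h(1)] TT c by blast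
    ultimately have "h c \<in> C" by (simp add: C_iff)
    then have "inv c \<otimes> h c \<in> C" using subgroup.m_closed[OF C_subgroup subgroup.m_inv_closed[OF C_subgroup c]] by blast
    moreover have "inv c \<otimes> h c = r" unfolding r(2) using inv_cancel(1) Cc[OF c] Tc[OF r(1)] by simp
    ultimately show ?thesis using r(1) by simp
  qed
  then show ?thesis using that h aT by simp
qed

text \<open>\<open>T\<close> has no other conjugates, so it is fully automized and
  \<open>Inn(T)\<close> is Sylow in \<open>Aut_E(T)\<close>. It is normal there because an
  automorphism \<open>f\<close> turns conjugation by \<open>t\<close> into conjugation by
  \<open>f t\<close>.\<close>

lemma p'_complement:
  obtains H where "subgroup H (BijGroup T)" "H \<subseteq> bij_set T (small.aut T)" "coprime p (card H)"
    "\<And>a. mE T a \<Longrightarrow> \<exists>h\<in>H. \<exists>t\<in>T. \<forall>x\<in>T. a x = cj t (h x)"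
proof -
  interpret B: group "BijGroup T" by (rule group_BijGroup)
  define K where "K = BijGroup T\<lparr>carrier := bij_set T (small.aut T)\<rparr>"
  have bg: "bij_group T (small.aut T)" by (rule small.aut_group[OF T order_refl])
  have sB: "subgroup (bij_set T (small.aut T)) (BijGroup T)" by (rule bij_group_subgroup[OF finT bg])
  interpret K: group K unfolding K_def using sB by (rule B.subgroup_imp_group)
  have Bij: "bij_set T (small.aut T) \<subseteq> Bij T" using subgroup.subset[OF sB] by (simp add: BijGroup_simps)
  have finK: "finite (carrier K)" unfolding K_def using finite_subset[OF Bij finite_Bij[OF finT]] by simp
  have NT: "nrm T T = T" using nrm_self[OF T finT order_refl] by (auto simp: nrm_def)
  define N where "N = (\<lambda>a. restrict a T) ` cj ` T"
  have fam: "p_family p T (cj ` T)" using small.nrm_family[OF T order_refl] NT by simp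
  have in_aut: "\<forall>j\<in>cj ` T. small.aut T j" using small.nrm_aut[of _ T] NT T by auto
  have NsB: "N \<subseteq> bij_set T (small.aut T)" unfolding N_def by (rule bij_set_sub[OF bg in_aut])
  have mult: "f \<otimes>\<^bsub>K\<^esub> g = compose T f g" if "f \<in> carrier K" "g \<in> carrier K" for f g
    using that Bij by (simp add: K_def BijGroup_simps(3) subset_iff)
  have N: "N \<lhd> K"
  proof (rule K.normal_invI)
    show "subgroup N K" unfolding K_def
      by (rule B.subgroup_incl[OF _ sB NsB]) (use p_family_restrict(1)[OF finT fam p] in \<open>simp add: N_def\<close>)
    fix f h assume f: "f \<in> carrier K" and h: "h \<in> N"
    obtain t where t: "t \<in> T" "h = restrict (cj t) T" using h by (auto simp: N_def)
    have mf: "mE T f" "f \<in> extensional T" using f by (simp_all add: K_def bij_set_def small.aut_def)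
    have ft: "f t \<in> T" using E'.autT_inv(5)[OF mf(1) t(1)] .
    define h' where "h' = restrict (cj (f t)) T"
    have h': "h' \<in> N" using ft by (auto simp: N_def h'_def)
    have hK: "h \<in> carrier K" "h' \<in> carrier K" using h h' NsB by (auto simp: K_def)
    have "f \<otimes>\<^bsub>K\<^esub> h = h' \<otimes>\<^bsub>K\<^esub> f"
      unfolding mult[OF f hK(1)] mult[OF hK(2) f]
      using small.m_cj[OF mf(1) t(1)] E'.autT_inv(5)[OF mf(1)] T_normal[OF Tc[OF t(1)]]
      by (auto simp: compose_def t h'_def fun_eq_iff)
    then have "f \<otimes>\<^bsub>K\<^esub> h \<otimes>\<^bsub>K\<^esub> inv\<^bsub>K\<^esub> f = h'" using f hK by (simp add: K.m_assoc)
    then show "f \<otimes>\<^bsub>K\<^esub> h \<otimes>\<^bsub>K\<^esub> inv\<^bsub>K\<^esub> f \<in> N" using h' by simp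
  qed
  obtain k where k: "card N = p ^ k" using p_family_restrict(2)[OF finT fam p] by (auto simp: N_def)
  obtain e where e: "mE T e" "small.fau (e ` T)" using small.satD[OF E_sat T order_refl] by blast
  have "\<not> p dvd order K div card N"
    using e E'.autT[OF e(1)] NT by (simp add: small.fau_def order_def K_def N_def)
  then obtain H where H: "subgroup H K" "coprime p (card H)"
    "\<And>g. g \<in> carrier K \<Longrightarrow> \<exists>n\<in>N. n \<otimes>\<^bsub>K\<^esub> g \<in> H"
    using K.normal_sylow_complement[OF finK p N k] by blast
  show ?thesis
  proof (rule that[OF _ _ H(2)])
    show "subgroup H (BijGroup T)" using H(1) B.incl_subgroup[OF sB] by (simp add: K_def)
    show "H \<subseteq> bij_set T (small.aut T)" using subgroup.subset[OF H(1)] by (simp add: K_def)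
    fix a assume a: "mE T a"
    have "small.aut T (restrict a T)"
      using small.cong[OF a, of "restrict a T"] E'.autT[OF a] by (simp add: small.aut_def)
    then have rK: "restrict a T \<in> carrier K" by (simp add: K_def bij_set_def)
    obtain n where n: "n \<in> N" "n \<otimes>\<^bsub>K\<^esub> restrict a T \<in> H" using H(3)[OF rK] by blast
    obtain t where t: "t \<in> T" "n = restrict (cj t) T" using n(1) by (auto simp: N_def)
    have nK: "n \<in> carrier K" using n(1) NsB by (auto simp: K_def)
    have "a x = cj (inv t) ((n \<otimes>\<^bsub>K\<^esub> restrict a T) x)" if x: "x \<in> T" for x
    proof -
      have ax: "a x \<in> T" using E'.autT_inv(5)[OF a x] .
      show ?thesis unfolding mult[OF nK rK] using x ax t Tc cj_cancel(2) by (simp add: compose_def)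
    qed
    then show "\<exists>h\<in>H. \<exists>t\<in>T. \<forall>x\<in>T. a x = cj t (h x)"
      using n(2) subgroup.m_inv_closed[OF T t(1)] by blast
  qed
qed

end

section \<open>Hom-sets and predicates\<close>

text \<open>The target is always \<open>S\<close>. The other Hom-sets can be recovered from the
  image of a morphism, because a fusion system contains the inclusions.\<close>

definition mor :: "'a homs \<Rightarrow> 'a set \<Rightarrow> 'a set \<Rightarrow> ('a \<Rightarrow> 'a) \<Rightarrow> bool" where
  "mor F S Q f \<longleftrightarrow> restrict f Q \<in> F Q S"

definition homs_of :: "('a, 'b) monoid_scheme \<Rightarrow> 'a set \<Rightarrow> ('a set \<Rightarrow> ('a \<Rightarrow> 'a) \<Rightarrow> bool) \<Rightarrow> 'a homs" where
  "homs_of G S m Q R = {f \<in> extensional Q. m Q f \<and> f ` Q \<subseteq> R \<and> subgroup_of G S R}"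

context group
begin

lemma conj_map_cj: "conj_map G Q g = restrict (cj g) Q"
  by (rule ext) (simp add: conj_map_def cj_def restrict_def)

lemma fusion_systemD:
  assumes "fusion_system G S F"
  shows "subgroup S G"
    and "\<phi> \<in> F Q R \<Longrightarrow> subgroup_of G S Q" "\<phi> \<in> F Q R \<Longrightarrow> subgroup_of G S R"
    and "\<phi> \<in> F Q R \<Longrightarrow> \<phi> \<in> mon (G\<lparr>carrier := Q\<rparr>) (G\<lparr>carrier := R\<rparr>)" "\<phi> \<in> F Q R \<Longrightarrow> \<phi> \<in> extensional Q"
    and "\<phi> \<in> F Q R \<Longrightarrow> \<psi> \<in> F R U \<Longrightarrow> compose Q \<psi> \<phi> \<in> F Q U"
    and "g \<in> S \<Longrightarrow> subgroup_of G S Q \<Longrightarrow> subgroup_of G S R \<Longrightarrow> cj g ` Q \<subseteq> R \<Longrightarrow> restrict (cj g) Q \<in> F Q R"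
    and "\<phi> \<in> F Q R \<Longrightarrow> \<phi> \<in> F Q (\<phi> ` Q)"
    and "\<phi> \<in> F Q R \<Longrightarrow> restrict (inv_into Q \<phi>) (\<phi> ` Q) \<in> F (\<phi> ` Q) Q"
  using assms unfolding fusion_system_def conj_map_cj by (blast, blast, blast, blast, blast, blast, simp, blast, blast)

lemma fusion_incl:
  assumes F: "fusion_system G S F" and \<phi>: "\<phi> \<in> F Q R" and R': "subgroup_of G S R'" "\<phi> ` Q \<subseteq> R'"
  shows "\<phi> \<in> F Q R'"
proof -
  note D = fusion_systemD[OF F]
  have e: "\<phi> \<in> F Q (\<phi> ` Q)" using D(8)[OF \<phi>] .
  have s: "subgroup_of G S (\<phi> ` Q)" using D(3)[OF e] .
  have car: "x \<in> carrier G" if "x \<in> \<phi> ` Q" for x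
    using s that unfolding subgroup_of_def by (metis subgroup.mem_carrier)
  have "\<one> \<in> S" using D(1) subgroup.one_closed by blast
  then have "restrict (cj \<one>) (\<phi> ` Q) \<in> F (\<phi> ` Q) R'"
    by (rule D(7)[OF _ s R'(1)]) (use car R'(2) in auto)
  then have "compose Q (restrict (cj \<one>) (\<phi> ` Q)) \<phi> \<in> F Q R'" using D(6)[OF e] by blast
  moreover have "compose Q (restrict (cj \<one>) (\<phi> ` Q)) \<phi> = \<phi>"
    by (rule extensionalityI[of _ Q]) (use D(5)[OF \<phi>] car in \<open>auto simp: compose_def\<close>)
  ultimately show ?thesis by simp
qed

lemma fusion_homs_iff:
  assumes F: "fusion_system G S F"
  shows "\<phi> \<in> F Q R \<longleftrightarrow> \<phi> \<in> extensional Q \<and> mor F S Q \<phi> \<and> \<phi> ` Q \<subseteq> R \<and> subgroup_of G S R"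
proof
  note D = fusion_systemD[OF F]
  assume \<phi>: "\<phi> \<in> F Q R"
  have im: "\<phi> ` Q \<subseteq> R" using D(4)[OF \<phi>] by (auto simp: mon_def hom_def)
  have "subgroup_of G S S" using D(1) by (simp add: subgroup_of_def)
  then have "\<phi> \<in> F Q S" using fusion_incl[OF F \<phi>] im D(3)[OF \<phi>] by (auto simp: subgroup_of_def)
  then show "\<phi> \<in> extensional Q \<and> mor F S Q \<phi> \<and> \<phi> ` Q \<subseteq> R \<and> subgroup_of G S R"
    using D(5)[OF \<phi>] im D(3)[OF \<phi>] by (simp add: mor_def extensional_restrict)
next
  assume a: "\<phi> \<in> extensional Q \<and> mor F S Q \<phi> \<and> \<phi> ` Q \<subseteq> R \<and> subgroup_of G S R"
  then have "restrict \<phi> Q = \<phi>" by (simp add: extensional_restrict)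
  then have "\<phi> \<in> F Q S" using a by (simp add: mor_def)
  then show "\<phi> \<in> F Q R" using fusion_incl[OF F, of \<phi> Q S R] a by blast
qed

end

context finite_p_group
begin

lemma fusion_mor:
  assumes F: "fusion_system G S F"
  shows "fusion G p n S (mor F S)"
proof (intro fusion.intro fusion_axioms.intro finite_p_group_axioms)
  note D = fusion_systemD[OF F]
  have one: "\<one> \<in> S" using D(1) subgroup.one_closed by blast
  have SS: "subgroup_of G S S" using D(1) by (simp add: subgroup_of_def)
  have Sc: "x \<in> carrier G" if "x \<in> S" for x using that D(1) subgroup.mem_carrier by metis
  show "subgroup S G" using D(1) .
  fix Q f assume f: "mor F S Q f"
  have rf: "restrict f Q \<in> F Q S" using f by (simp add: mor_def)
  have sQ: "subgroup_of G S Q" using D(2)[OF rf] .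
  show "subgroup Q G" "Q \<subseteq> S" using sQ by (auto simp: subgroup_of_def)
  have mon: "restrict f Q \<in> mon (G\<lparr>carrier := Q\<rparr>) (G\<lparr>carrier := S\<rparr>)" using D(4)[OF rf] .
  then have "restrict f Q \<in> Q \<rightarrow> S" "inj_on (restrict f Q) Q" by (auto simp: mon_def hom_def)
  then show "f ` Q \<subseteq> S" "inj_on f Q" by (auto simp: Pi_iff)
  show "f (x \<otimes> y) = f x \<otimes> f y" if "x \<in> Q" "y \<in> Q" for x y
  proof -
    have "x \<otimes> y \<in> Q" using sQ that by (simp add: subgroup_of_def subgroup.m_closed)
    moreover have "restrict f Q (x \<otimes> y) = restrict f Q x \<otimes> restrict f Q y"
      using mon that unfolding mon_def hom_def by (simp del: restrict_apply restrict_apply')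
    ultimately show ?thesis using that by simp
  qed
  show "mor F S Q g" if "\<And>x. x \<in> Q \<Longrightarrow> f x = g x" for g
    using rf that unfolding mor_def by (metis restrict_ext)
  have e: "restrict f Q \<in> F Q (f ` Q)" using D(8)[OF rf] by simp
  show "mor F S Q (\<lambda>x. g (f x))" if "mor F S (f ` Q) g" for g
  proof -
    have "compose Q (restrict g (f ` Q)) (restrict f Q) \<in> F Q S" using D(6)[OF e] that by (simp add: mor_def)
    moreover have "compose Q (restrict g (f ` Q)) (restrict f Q) = restrict (\<lambda>x. g (f x)) Q"
      by (auto simp: compose_def)
    ultimately show ?thesis by (simp add: mor_def)
  qed
  show "mor F S U f" if U: "subgroup U G" "U \<subseteq> Q" for U
  proof -
    have car: "x \<in> carrier G" if "x \<in> U" for x using U(1) that subgroup.mem_carrier by metis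
    have sU: "subgroup_of G S U" using U sQ by (auto simp: subgroup_of_def)
    \<comment> \<open>Restrictions are not among the axioms of \<open>fusion_system\<close>; they
      arise as composites with an inclusion, which is conjugation by \<open>\<one>\<close>.\<close>
    have "restrict (cj \<one>) U \<in> F U Q" by (rule D(7)[OF one sU sQ]) (use U car in auto)
    then have "compose U (restrict f Q) (restrict (cj \<one>) U) \<in> F U S" using D(6) rf by blast
    moreover have "compose U (restrict f Q) (restrict (cj \<one>) U) = restrict f U"
      using U car by (auto simp: compose_def fun_eq_iff)
    ultimately show ?thesis by (simp add: mor_def)
  qed
  show "mor F S (f ` Q) (inv_into Q f)"
  proof -
    have "restrict (inv_into Q (restrict f Q)) (f ` Q) \<in> F (f ` Q) Q" using D(9)[OF rf] by simp
    then have "restrict (inv_into Q (restrict f Q)) (f ` Q) \<in> F (f ` Q) S"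
    proof (rule fusion_incl[OF F _ SS])
      have "inv_into Q (restrict f Q) y \<in> Q" if "y \<in> f ` Q" for y
        using inv_into_into[of y "restrict f Q" Q] that by simp
      then show "restrict (inv_into Q (restrict f Q)) (f ` Q) ` f ` Q \<subseteq> S"
        using \<open>Q \<subseteq> S\<close> by auto
    qed
    moreover have "restrict (inv_into Q (restrict f Q)) (f ` Q) = restrict (inv_into Q f) (f ` Q)"
    proof (rule restrict_ext)
      fix y assume "y \<in> f ` Q"
      then obtain x where x: "x \<in> Q" "y = f x" by blast
      have "inj_on (restrict f Q) Q" using \<open>inj_on f Q\<close> by simp
      then have "inv_into Q (restrict f Q) (restrict f Q x) = x" using x(1) by (rule inv_into_f_f)
      then show "inv_into Q (restrict f Q) y = inv_into Q f y" using x \<open>inj_on f Q\<close> by simp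
    qed
    ultimately show ?thesis by (simp add: mor_def)
  qed
next
  note D = fusion_systemD[OF F]
  have SS: "subgroup_of G S S" using D(1) by (simp add: subgroup_of_def)
  fix g assume g: "g \<in> S"
  have "cj g ` S \<subseteq> S" using g D(1) by (auto simp: cj_def subgroup.m_closed subgroup.m_inv_closed)
  then show "mor F S S (cj g)" using D(7)[OF g SS SS] by (simp add: mor_def)
qed

end

context fusion
begin

lemma fusion_system_homs_of: "fusion_system G S (homs_of G S m)"
  unfolding fusion_system_def
proof (intro conjI allI impI ballI subsetI)
  show "subgroup S G" by (rule S)
  fix Q R
  show "subgroup_of G S Q" "subgroup_of G S R" if "homs_of G S m Q R \<noteq> {}"
    using that dom unfolding homs_of_def subgroup_of_def by blast+
  show "conj_map G Q g \<in> homs_of G S m Q R"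
    if "g \<in> S" "subgroup_of G S Q \<and> subgroup_of G S R \<and> conj_map G Q g ` Q \<subseteq> R" for g
  proof -
    have "m Q (restrict (cj g) Q)"
      by (rule cong[OF conj[OF that(1)]]) (use that in \<open>auto simp: subgroup_of_def\<close>)
    then show ?thesis using that by (simp add: homs_of_def conj_map_cj)
  qed
  fix \<phi> assume "\<phi> \<in> homs_of G S m Q R"
  then have \<phi>: "\<phi> \<in> extensional Q" "m Q \<phi>" "\<phi> ` Q \<subseteq> R" "subgroup_of G S R" by (auto simp: homs_of_def)
  show "\<phi> \<in> mon (G\<lparr>carrier := Q\<rparr>) (G\<lparr>carrier := R\<rparr>) \<inter> extensional Q"
    using \<phi> inj[OF \<phi>(2)] mult[OF \<phi>(2)] by (auto simp: mon_def hom_def)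
  show "\<phi> \<in> homs_of G S m Q (\<phi> ` Q)"
    using \<phi> image[OF \<phi>(2)] img[OF \<phi>(2)] by (simp add: homs_of_def subgroup_of_def)
  have "m (\<phi> ` Q) (restrict (inv_into Q \<phi>) (\<phi> ` Q))" by (rule cong[OF inverse[OF \<phi>(2)]]) simp
  then show "restrict (inv_into Q \<phi>) (\<phi> ` Q) \<in> homs_of G S m (\<phi> ` Q) Q"
    using dom[OF \<phi>(2)] by (auto simp: homs_of_def subgroup_of_def inv_into_into)
  fix U \<psi> assume "\<psi> \<in> homs_of G S m R U"
  then have \<psi>: "m R \<psi>" "\<psi> ` R \<subseteq> U" "subgroup_of G S U" by (auto simp: homs_of_def)
  have "m Q (compose Q \<psi> \<phi>)" by (rule cong[OF comp'[OF \<phi>(2) \<psi>(1) \<phi>(3)]]) (simp add: compose_def)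
  then show "compose Q \<psi> \<phi> \<in> homs_of G S m Q U"
    using \<phi>(3) \<psi>(2,3) by (auto simp: homs_of_def compose_def)
qed

lemma mor_homs_of: "mor (homs_of G S m) S = m"
proof (intro ext iffI)
  fix Q f
  have SS: "subgroup_of G S S" using S by (simp add: subgroup_of_def)
  show "m Q f" if "mor (homs_of G S m) S Q f"
  proof -
    have "m Q (restrict f Q)" using that by (simp add: mor_def homs_of_def)
    then show ?thesis by (rule cong) simp
  qed
  show "mor (homs_of G S m) S Q f" if "m Q f"
  proof -
    have "m Q (restrict f Q)" using that by (rule cong) simp
    then show ?thesis using img[OF that] SS by (simp add: mor_def homs_of_def)
  qed
qed

text \<open>\<open>normalizer\<close> conjugates by the inverse of the element. Since normalizers
  are closed under inverses, the two conventions agree.\<close>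

lemma normalizer_nrm:
  assumes Q: "subgroup Q G"
  shows "normalizer G Q \<inter> S = nrm S Q"
proof -
  have Qc: "Q \<subseteq> carrier G" using subgroup.subset[OF Q] .
  have cs: "g <# Q #> inv g = cj (inv g) ` Q" if "g \<in> carrier G" for g
    using that Qc by (auto simp: l_coset_def r_coset_def cj_def)
  have "g <# Q #> inv g = Q \<longleftrightarrow> g \<in> nrm S Q" if g: "g \<in> S" for g
  proof -
    have gc: "g \<in> carrier G" using Sc g by blast
    have sN: "subgroup (nrm S Q) G" using nrm_subgroup[OF S Qc] .
    have "cj (inv g) ` Q = Q \<longleftrightarrow> inv g \<in> nrm S Q" using subgroup.m_inv_closed[OF S g] by (simp add: nrm_def)
    also have "\<dots> \<longleftrightarrow> g \<in> nrm S Q" using subgroup.m_inv_closed[OF sN] gc by (metis inv_inv)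
    finally show ?thesis using cs[OF gc] by simp
  qed
  moreover have "nrm S Q \<subseteq> S" by (auto simp: nrm_def)
  ultimately show ?thesis using Qc Sc unfolding normalizer_def stabilizer_def by auto
qed

lemma Aut_conj_nrm: "subgroup Q G \<Longrightarrow> Aut_conj G S Q = (\<lambda>a. restrict a Q) ` cj ` nrm S Q"
  unfolding Aut_conj_def normalizer_nrm by (simp add: image_image conj_map_cj)

context
  fixes F
  assumes F: "fusion_system G S F" and mF: "m = mor F S"
begin

lemma F_iff:
  "\<phi> \<in> F Q R \<longleftrightarrow> \<phi> \<in> extensional Q \<and> m Q \<phi> \<and> \<phi> ` Q \<subseteq> R \<and> subgroup_of G S R"
  by (simp add: fusion_homs_iff[OF F] mF)

lemma homs_self: "subgroup Q G \<Longrightarrow> Q \<subseteq> S \<Longrightarrow> F Q Q = bij_set Q (aut Q)"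
proof -
  assume Q: "subgroup Q G" "Q \<subseteq> S"
  have "\<phi> ` Q = Q" if "m Q \<phi>" "\<phi> ` Q \<subseteq> Q" for \<phi> using endo[OF that] .
  then show ?thesis
    using Q unfolding bij_set_def aut_def set_eq_iff F_iff subgroup_of_def mem_Collect_eq by blast
qed

text \<open>If the groups have orders \<open>p^k\<close> and \<open>p^k i\<close>, then
  \<open>p^k\<close> is the full \<open>p\<close>-part of the larger order exactly if
  \<open>p\<close> does not divide \<open>i\<close>.\<close>

lemma fully_automized_fau:
  assumes Q: "subgroup Q G" "Q \<subseteq> S"
  shows "fully_automized p G S F Q \<longleftrightarrow> fau Q"
proof -
  interpret B: group "BijGroup Q" by (rule group_BijGroup)
  let ?J = "(\<lambda>a. restrict a Q) ` cj ` nrm S Q" and ?B = "bij_set Q (aut Q)"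
  have bg: "bij_group Q (aut Q)" by (rule aut_group[OF Q])
  have sB: "subgroup ?B (BijGroup Q)" by (rule bij_group_subgroup[OF finS[OF Q(1)] bg])
  note fam = nrm_family[OF Q]
  have JB: "?J \<subseteq> ?B" by (rule bij_set_sub[OF bg]) (use nrm_aut Q in auto)
  have sJ: "subgroup ?J (BijGroup Q)" and "\<exists>k. card ?J = p ^ k"
    using p_family_restrict[OF finS[OF Q(1)] fam p] by auto
  then obtain k where k: "card ?J = p ^ k" by blast
  have "?B \<subseteq> Bij Q" using subgroup.subset[OF sB] by (simp add: BijGroup_simps)
  then have finB: "finite ?B" using finite_Bij[OF finS[OF Q(1)]] finite_subset by blast
  have B0: "card ?B \<noteq> 0" using finB subgroup.one_closed[OF sB] by auto
  have "card ?J dvd card ?B" by (rule B.card_subgroup_dvd[OF sJ sB JB])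
  then obtain i where i: "card ?B = p ^ k * i" unfolding k by blast
  have pk: "p ^ k \<noteq> 0" using p by (simp add: prime_gt_0_nat)
  have i0: "i \<noteq> 0" using B0 i by auto
  have div: "card ?B div card ?J = i" using i k pk by simp
  have mul: "multiplicity p (card ?B) = k + multiplicity p i"
    unfolding i using p pk i0 by (simp add: prime_elem_multiplicity_mult_distrib)
  have "fully_automized p G S F Q \<longleftrightarrow> p ^ k = p ^ multiplicity p (card ?B)"
    unfolding fully_automized_def sylow_subgroup_def Aut_homs_def homs_self[OF Q] Aut_conj_nrm[OF Q(1)]
    using B.subgroup_incl[OF sJ sB JB] k by (simp add: order_def)
  also have "\<dots> \<longleftrightarrow> multiplicity p i = 0" unfolding mul using power_inject_exp[OF prime_gt_1_nat[OF p]] by simp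
  also have "\<dots> \<longleftrightarrow> \<not> p dvd i" using i0 p by (metis multiplicity_eq_zero_iff not_prime_unit)
  finally show ?thesis unfolding fau_def div .
qed

text \<open>Applying the injective \<open>f\<close> to both sides turns the conjugated automorphism
  in \<open>extender\<close> into the intertwining condition of \<open>ext\<close>.\<close>

lemma extender_ext:
  assumes f: "m Q f" "f ` Q = R"
  shows "extender G S Q R (restrict f Q) = ext Q R f"
proof -
  have Q: "subgroup Q G" using dom[OF f(1)] by blast
  have R: "subgroup R G" using image[OF f(1)] f(2) by simp
  have inv: "inv_into Q (restrict f Q) (f x) = x" if "x \<in> Q" for x
    using inv_into_f_f[of "restrict f Q" Q x] inj[OF f(1)] that by simp
  have "restrict (cj g) Q = (\<lambda>x\<in>Q. inv_into Q (restrict f Q) (restrict (cj h) R (restrict f Q x))) \<longleftrightarrow>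
      (\<forall>x\<in>Q. f (cj g x) = cj h (f x))" if g: "g \<in> nrm S Q" and h: "h \<in> nrm S R" for g h
  proof -
    have "cj g x = inv_into Q (restrict f Q) (cj h (f x)) \<longleftrightarrow> f (cj g x) = cj h (f x)" if x: "x \<in> Q" for x
    proof -
      have gx: "cj g x \<in> Q" using nrmD(2)[OF g x] .
      have "cj h (f x) \<in> R" using nrmD(2)[OF h] f(2) x by blast
      then obtain y where y: "y \<in> Q" "cj h (f x) = f y" using f(2) by blast
      show ?thesis unfolding y(2) inv[OF y(1)] using inj_onD[OF inj[OF f(1)]] gx y(1) by blast
    qed
    moreover have "f x \<in> R" if "x \<in> Q" for x using f(2) that by blast
    ultimately show ?thesis by (auto simp: fun_eq_iff restrict_def)
  qed
  then show ?thesis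
    unfolding extender_def ext_def Aut_conj_nrm[OF Q] Aut_conj_nrm[OF R] normalizer_nrm[OF Q] conj_map_cj
    by (auto simp: image_iff)
qed

lemma receptive_recp:
  assumes R: "R \<subseteq> S"
  shows "receptive G S F R \<longleftrightarrow> recp R"
proof
  assume r: "receptive G S F R"
  show "recp R"
    unfolding recp_def
  proof (intro allI impI)
    fix Q f assume f: "m Q f" "f ` Q = R"
    have "restrict f Q \<in> iso_homs F Q R"
      using f F_iff[of "restrict f Q" Q R] image[OF f(1)] R cong[OF f(1), of "restrict f Q"]
      by (simp add: iso_homs_def subgroup_of_def)
    then obtain \<psi> where \<psi>: "\<psi> \<in> F (extender G S Q R (restrict f Q)) S" "\<And>x. x \<in> Q \<Longrightarrow> \<psi> x = restrict f Q x"
      using r unfolding receptive_def by blast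
    have "m (ext Q R f) \<psi>" using \<psi>(1) F_iff extender_ext[OF f] by simp
    then show "\<exists>h. m (ext Q R f) h \<and> (\<forall>x\<in>Q. h x = f x)" using \<psi>(2) by auto
  qed
next
  assume r: "recp R"
  show "receptive G S F R"
    unfolding receptive_def
  proof (intro allI ballI)
    fix Q \<phi> assume "\<phi> \<in> iso_homs F Q R"
    then have \<phi>: "m Q \<phi>" "\<phi> ` Q = R" "\<phi> \<in> extensional Q"
      using F_iff by (auto simp: iso_homs_def)
    obtain h where h: "m (ext Q R \<phi>) h" "\<And>x. x \<in> Q \<Longrightarrow> h x = \<phi> x" using recpD[OF r \<phi>(1,2)] by blast
    have e: "extender G S Q R \<phi> = ext Q R \<phi>" using extender_ext[OF \<phi>(1,2)] \<phi>(3) by (simp add: extensional_restrict)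
    have "restrict h (ext Q R \<phi>) \<in> F (ext Q R \<phi>) S" using h(1) by (simp add: mF mor_def)
    moreover have "restrict h (ext Q R \<phi>) x = \<phi> x" if "x \<in> Q" for x
      using h(2) ext_self[OF \<phi>(1,2)] that by auto
    ultimately show "\<exists>\<psi>\<in>F (extender G S Q R \<phi>) S. \<forall>x\<in>Q. \<psi> x = \<phi> x" unfolding e by blast
  qed
qed

lemma saturated_sat: "saturated p G S F \<longleftrightarrow> sat"
proof
  assume s: "saturated p G S F"
  show sat
    unfolding sat_def
  proof (intro allI impI)
    fix Q assume Q: "subgroup Q G" "Q \<subseteq> S"
    then obtain R \<phi> where R: "\<phi> \<in> iso_homs F Q R" "fully_automized p G S F R" "receptive G S F R"
      using s unfolding saturated_def subgroup_of_def by blast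
    have \<phi>: "m Q \<phi>" "\<phi> ` Q = R" using R(1) F_iff by (auto simp: iso_homs_def)
    have "subgroup R G" "R \<subseteq> S" using image[OF \<phi>(1)] img[OF \<phi>(1)] \<phi>(2) by auto
    then have "fau R" "recp R" using R(2,3) fully_automized_fau receptive_recp by auto
    then show "\<exists>f. m Q f \<and> fau (f ` Q) \<and> recp (f ` Q)" using \<phi> by blast
  qed
next
  assume s: sat
  show "saturated p G S F"
    unfolding saturated_def
  proof (intro allI impI)
    fix Q assume "subgroup_of G S Q"
    then obtain f where f: "m Q f" "fau (f ` Q)" "recp (f ` Q)"
      using satD[OF s] unfolding subgroup_of_def by blast
    have R: "subgroup (f ` Q) G" "f ` Q \<subseteq> S" using image[OF f(1)] img[OF f(1)] by auto
    have "restrict f Q \<in> iso_homs F Q (f ` Q)"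
      using f(1) R F_iff[of "restrict f Q" Q "f ` Q"] cong[OF f(1), of "restrict f Q"]
      by (simp add: iso_homs_def subgroup_of_def)
    then show "\<exists>R. iso_homs F Q R \<noteq> {} \<and> fully_automized p G S F R \<and> receptive G S F R"
      using f(2,3) fully_automized_fau[OF R] receptive_recp[OF R(2)] by blast
  qed
qed

end

end

section \<open>Transfer of the result from predicates to Hom-sets\<close>

lemma weakly_normal_pair_mor:
  assumes "finite_p_group G p n" and F: "fusion_system G (carrier G) F" "saturated p G (carrier G) F"
    and E: "weakly_normal p G (carrier G) F T E"
  shows "weakly_normal_pair G p n (mor F (carrier G)) T (mor E T)"
proof -
  interpret finite_p_group G p n by fact
  have E': "saturated p G T E" "fusion_system G T E" "E \<le> F" "strongly_closed G (carrier G) F T"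
    and TS: "subgroup_of G (carrier G) T"
    and inv: "\<And>Q R \<phi> \<psi>. Q \<subseteq> R \<Longrightarrow> \<phi> \<in> E Q R \<Longrightarrow> \<psi> \<in> F R T \<Longrightarrow>
      (\<lambda>y\<in>\<psi> ` Q. \<psi> (\<phi> (inv_into R \<psi> y))) \<in> E (\<psi> ` Q) (\<psi> ` R)"
    using E by (auto simp: weakly_normal_def invariant_subsystem_def subsystem_def)
  let ?S = "carrier G"
  interpret F: fusion G p n ?S "mor F ?S" by (rule fusion_mor[OF F(1)])
  interpret E: fusion G p n T "mor E T" by (rule fusion_mor[OF E'(2)])
  have T: "T \<subseteq> ?S" using TS by (simp add: subgroup_of_def)
  have closed: "f ` Q \<subseteq> T" if f: "mor F ?S Q f" and Q: "Q \<subseteq> T" for Q f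
  proof -
    have "restrict f Q \<in> F Q ?S" using f by (simp add: mor_def)
    moreover have "subgroup_of G T Q" using F.dom(1)[OF f] Q by (simp add: subgroup_of_def)
    ultimately have "restrict f Q ` Q \<subseteq> T" using E'(4) unfolding strongly_closed_def by blast
    then show ?thesis by simp
  qed
  have EF: "mor F ?S Q f" if f: "mor E T Q f" for Q f
  proof -
    have "restrict f Q \<in> F Q T" using f E'(3) unfolding mor_def le_fun_def by blast
    then show ?thesis using fusion_homs_iff[OF F(1), of "restrict f Q" Q T] F.cong[of Q "restrict f Q" f] by simp
  qed
  have invar: "mor E T (g ` Q) h"
    if f: "mor E T Q f" and g: "mor F ?S R g" and R: "R \<subseteq> T" "Q \<subseteq> R" "f ` Q \<subseteq> R"
      and h: "\<And>x. x \<in> Q \<Longrightarrow> h (g x) = g (f x)" for Q f R g h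
  proof -
    have sR: "subgroup R G" using F.dom(1)[OF g] .
    have 1: "restrict f Q \<in> E Q R"
      using fusion_homs_iff[OF E'(2), of "restrict f Q" Q R] E.cong[OF f, of "restrict f Q"] R sR
      by (simp add: subgroup_of_def)
    have 2: "restrict g R \<in> F R T"
      using fusion_homs_iff[OF F(1), of "restrict g R" R T] F.cong[OF g, of "restrict g R"] closed[OF g R(1)] TS
      by simp
    have gQ: "restrict g R ` Q = g ` Q" using R(2) by (force simp: image_def)
    have "(\<lambda>y\<in>g ` Q. restrict g R (restrict f Q (inv_into R (restrict g R) y))) \<in> E (g ` Q) (restrict g R ` R)"
      using inv[OF R(2) 1 2] unfolding gQ .
    then have "mor E T (g ` Q) (\<lambda>y\<in>g ` Q. restrict g R (restrict f Q (inv_into R (restrict g R) y)))"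
      using fusion_homs_iff[OF E'(2)] by blast
    then show ?thesis
    proof (rule E.cong)
      fix y assume y: "y \<in> g ` Q"
      then obtain x where x: "x \<in> Q" "y = g x" by blast
      have xR: "x \<in> R" "f x \<in> R" using R(2,3) x(1) by auto
      have "inv_into R (restrict g R) (restrict g R x) = x"
        by (rule inv_into_f_f) (use F.inj[OF g] xR in auto)
      then have "inv_into R (restrict g R) y = x" using x(2) xR by simp
      then show "(\<lambda>y\<in>g ` Q. restrict g R (restrict f Q (inv_into R (restrict g R) y))) y = h y"
        using y x xR h[OF x(1)] by simp
    qed
  qed
  show ?thesis
  proof (intro weakly_normal_pair.intro normal_pair.intro normal_pair_axioms.intro weakly_normal_pair_axioms.intro
      finite_p_group_axioms F.fusion_axioms E.fusion_axioms)
    show "F.sat" using F.saturated_sat[OF F(1) refl] F(2) by simp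
    show "E.sat" using E.saturated_sat[OF E'(2) refl] E'(1) by simp
    fix a Q f h assume a: "mor F ?S T a" and f: "mor E T Q f" and h: "\<And>x. x \<in> Q \<Longrightarrow> h (a x) = a (f x)"
    show "mor E T (a ` Q) h"
      by (rule invar[OF f a order_refl E.dom(2)[OF f] E.img[OF f]]) (rule h)
  next
    fix Q f assume "mor E T Q f"
    then show "mor F ?S Q f" by (rule EF)
  next
    fix Q f assume "mor F ?S Q f" "Q \<subseteq> T"
    then show "f ` Q \<subseteq> T" by (rule closed)
  next
    fix Q f R g h
    assume "mor E T Q f" "mor F ?S R g" "R \<subseteq> T" "Q \<subseteq> R" "f ` Q \<subseteq> R" "\<And>x. x \<in> Q \<Longrightarrow> h (g x) = g (f x)"
    then show "mor E T (g ` Q) h" by (rule invar)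
  qed (rule T)
qed

theorem corollaryB:
  fixes P :: "('a, 'b) monoid_scheme" (structure)
    and p n :: nat
    and F E :: "'a homs"
    and T :: "'a set"
  assumes "prime p"
    and "group P" and "finite (carrier P)" and "order P = p ^ n"
    and "fusion_system P (carrier P) F" and "saturated p P (carrier P) F"
    and "weakly_normal p P (carrier P) F T E"
  shows "\<exists>E' H. normal_subsystem p P (carrier P) F T E' \<and>
           subgroup H (Aut_homs F T) \<and> coprime p (card H) \<and>
           generated_by P T E (sup E' (\<lambda>Q R. if Q = T \<and> R = T then H else {}))"
proof -
  interpret finite_p_group P p n
    by (intro finite_p_group.intro finite_p_group_axioms.intro) (use assms in auto)
  let ?S = "carrier P"
  interpret weakly_normal_pair P p n "mor F ?S" T "mor E T"
    by (rule weakly_normal_pair_mor[OF finite_p_group_axioms assms(5-7)])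
  note F = \<open>fusion_system P (carrier P) F\<close>
  have E: "fusion_system P T E" "E \<le> F" and sc: "strongly_closed P ?S F T" and TS': "subgroup_of P ?S T"
    using assms(7) by (auto simp: weakly_normal_def invariant_subsystem_def subsystem_def)
  note F_iff = fusion_homs_iff[OF F] and E_iff = fusion_homs_iff[OF E(1)]
  define E0 where "E0 = homs_of P T mE'"
  have E0: "fusion_system P T E0" and E0m: "mor E0 T = mE'"
    unfolding E0_def by (rule sub.fusion_system_homs_of, rule sub.mor_homs_of)
  have E0_iff: "\<phi> \<in> E0 Q R \<longleftrightarrow> \<phi> \<in> extensional Q \<and> mE' Q \<phi> \<and> \<phi> ` Q \<subseteq> R \<and> subgroup_of P T R" for \<phi> Q R
    using fusion_homs_iff[OF E0] E0m by simp
  have E0E: "E0 \<le> E" using E0_iff E_iff mE'_mE by (auto simp: le_fun_def)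
  have TT: "subgroup_of P T T" using T by (simp add: subgroup_of_def)
  have wn: "weakly_normal p P ?S F T E0"
    unfolding weakly_normal_def invariant_subsystem_def subsystem_def
  proof (intro conjI allI impI ballI TS' E0 sc)
    show "saturated p P T E0" using sub.saturated_sat[OF E0 E0m[symmetric]] E'_sat by simp
    show "E0 \<le> F" using E0E E(2) by (rule order_trans)
    fix Q R \<phi> \<psi> assume QR: "Q \<subseteq> R" and \<phi>: "\<phi> \<in> E0 Q R" and \<psi>: "\<psi> \<in> F R T"
    have \<phi>': "mE' Q \<phi>" "\<phi> ` Q \<subseteq> R" "R \<subseteq> T" using \<phi> E0_iff by (auto simp: subgroup_of_def)
    have \<psi>': "mor F ?S R \<psi>" "\<psi> ` R \<subseteq> T" using \<psi> F_iff by auto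
    have inv: "inv_into R \<psi> (\<psi> x) = x" if "x \<in> Q" for x using big.inv_f[OF \<psi>'(1)] QR that by blast
    let ?h = "\<lambda>y\<in>\<psi> ` Q. \<psi> (\<phi> (inv_into R \<psi> y))"
    have "mE' (\<psi> ` Q) ?h"
      by (rule E'_invar[OF \<phi>'(1) \<psi>'(1) \<phi>'(3) QR \<phi>'(2)]) (use inv in simp)
    moreover have "?h ` \<psi> ` Q \<subseteq> \<psi> ` R" using inv \<phi>'(2) by auto
    moreover have "subgroup_of P T (\<psi> ` R)" using big.image[OF \<psi>'(1)] \<psi>'(2) by (simp add: subgroup_of_def)
    ultimately show "?h \<in> E0 (\<psi> ` Q) (\<psi> ` R)" using E0_iff by simp
  qed
  have nrml: "normal_subsystem p P ?S F T E0"
    unfolding normal_subsystem_def Let_def C_def[symmetric]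
  proof (intro conjI wn ballI)
    fix \<phi> assume "\<phi> \<in> E0 T T"
    then have "mE' T \<phi>" using E0_iff by simp
    then obtain h where h: "mor F ?S (TC T) h" "h ` TC T = TC T" "\<And>x. x \<in> T \<Longrightarrow> h x = \<phi> x"
      "\<And>c. c \<in> C \<Longrightarrow> inv c \<otimes> h c \<in> C \<inter> T" using good_aut_normal by blast
    have sTC: "subgroup (TC T) P" using big.dom(1)[OF h(1)] .
    have CT: "T \<subseteq> TC T" "C \<subseteq> TC T" using Q_TC[of T] C_TC[OF T] by auto
    let ?h = "restrict h (TC T)"
    have "?h \<in> F (TC T) (TC T)"
      using F_iff h(1,2) big.cong[OF h(1), of ?h] subgroup.subset[OF sTC] sTC by (simp add: subgroup_of_def)
    moreover have "\<forall>x\<in>T. ?h x = \<phi> x" using h(3) CT by auto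
    moreover have "generate P ((\<lambda>x. inv x \<otimes> ?h x) ` C) \<subseteq> centralizer P T T"
    proof -
      have "(\<lambda>x. inv x \<otimes> ?h x) ` C \<subseteq> C \<inter> T" using h(4) CT by auto
      then have "generate P ((\<lambda>x. inv x \<otimes> ?h x) ` C) \<subseteq> C \<inter> T"
        by (rule generate_subgroup_incl[OF _ subgroups_Inter_pair[OF C_subgroup T]])
      also have "\<dots> \<subseteq> centralizer P T T" by (auto simp: centralizer_def C_iff)
      finally show ?thesis .
    qed
    ultimately show "\<exists>\<phi>'\<in>F (T <#> C) (T <#> C). (\<forall>x\<in>T. \<phi>' x = \<phi> x) \<and>
        generate P ((\<lambda>x. inv x \<otimes> \<phi>' x) ` C) \<subseteq> centralizer P T T"
      unfolding TC_def by blast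
  qed
  obtain H where H: "subgroup H (BijGroup T)" "H \<subseteq> bij_set T (small.aut T)" "coprime p (card H)"
    "\<And>a. mor E T T a \<Longrightarrow> \<exists>h\<in>H. \<exists>t\<in>T. \<forall>x\<in>T. a x = cj t (h x)"
    using p'_complement by blast
  have HE: "H \<subseteq> E T T" using H(2) small.homs_self[OF E(1) refl T order_refl] by simp
  have "subgroup H (Aut_homs F T)"
  proof -
    interpret B: group "BijGroup T" by (rule group_BijGroup)
    have FT: "F T T = bij_set T (big.aut T)" using big.homs_self[OF F refl T TS] .
    have "subgroup (F T T) (BijGroup T)"
      unfolding FT by (rule bij_group_subgroup[OF finT big.aut_group[OF T TS]])
    then show ?thesis unfolding Aut_homs_def
      by (rule B.subgroup_incl[OF H(1)]) (use HE E(2) in \<open>auto simp: le_fun_def\<close>)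
  qed
  moreover have "generated_by P T E (sup E0 (\<lambda>Q R. if Q = T \<and> R = T then H else {}))"
    unfolding generated_by_def
  proof (intro conjI allI impI E(1))
    show "sup E0 (\<lambda>Q R. if Q = T \<and> R = T then H else {}) \<le> E"
      using E0E HE by (auto simp: le_fun_def)
    fix D assume "fusion_system P T D \<and> sup E0 (\<lambda>Q R. if Q = T \<and> R = T then H else {}) \<le> D"
    then have D: "fusion_system P T D" and E0D: "E0 \<le> D" and HD: "H \<subseteq> D T T"
      by (auto simp: le_fun_def split: if_splits)
    interpret D: fusion P p n T "mor D T" by (rule fusion_mor[OF D])
    have E0D': "mor D T Q f" if "mE' Q f" for Q f
      using that E0D unfolding E0m[symmetric] mor_def le_fun_def by blast
    show "E \<le> D"
      unfolding le_fun_def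
    proof (intro allI subsetI)
      fix Q R \<phi> assume \<phi>: "\<phi> \<in> E Q R"
      then have \<phi>': "\<phi> \<in> extensional Q" "mor E T Q \<phi>" "\<phi> ` Q \<subseteq> R" "subgroup_of P T R" using E_iff by auto
      \<comment> \<open>This leads to \<open>\<phi> = c_t h e\<close> with \<open>t\<close> in
        \<open>T\<close>, \<open>h\<close> in \<open>H\<close> and \<open>e\<close> in the
        subsystem. Each factor lies in every fusion system on \<open>T\<close> that contains the
        generators.\<close>
      obtain a e where e: "mor E T T a" "mE' Q e" "\<And>x. x \<in> Q \<Longrightarrow> \<phi> x = a (e x)"
        using E'_fac[OF \<phi>'(2)] unfolding E'.fac_def E'.ty_def by blast
      obtain h t where h: "h \<in> H" "t \<in> T" "\<And>x. x \<in> T \<Longrightarrow> a x = cj t (h x)" using H(4)[OF e(1)] by blast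
      have mh: "mor D T T h" using HD h(1) fusion_homs_iff[OF D] by blast
      have "mor D T T (\<lambda>x. cj t (h x))"
        using D.comp'[OF mh D.conj_S[OF h(2)] D.img[OF mh]] .
      then have "mor D T Q (\<lambda>x. cj t (h (e x)))"
        using D.comp'[OF E0D'[OF e(2)], of T "\<lambda>x. cj t (h x)"] sub.img[OF e(2)] by blast
      then have "mor D T Q \<phi>"
        by (rule D.cong) (use e(3) h(3) sub.img[OF e(2)] in auto)
      then show "\<phi> \<in> D Q R" using \<phi>' fusion_homs_iff[OF D] by blast
    qed
  qed
  ultimately show ?thesis using nrml H(3) by blast
qed

end
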